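(* Let $\mathcal{A}$ and $\mathcal{B}$ be abelian categories and let $F:\mathcal{A}\to\mathcal{B}$ be a faithful additive functor with left adjoint $L$ and right adjoint $R$, such that the classes of $F$-projective and $F$-injective objects of $\mathcal{A}$ coincide. Then the category $D_F^-(\mathcal{A})$ is equivalent, as a triangulated category, to the homotopy category of bounded above complexes of $F$-projective objects of $\mathcal{A}$.
   Context: An object of $\mathcal{A}$ is $F$-projective if it is a direct summand of $LY$ for some $Y\in\mathcal{B}$, and $F$-injective if it is a direct summand of $RY$ for some $Y\in\mathcal{B}$. $\mathrm{K}(\mathcal{A})$ denotes the unbounded homotopy category of cochain complexes over $\mathcal{A}$, and $\mathrm{K}^-(\mathcal{A})$ its full subcategory of complexes whose terms are zero in all sufficiently high degrees. The functor $F$ is exact and induces $F:\mathrm{K}(\mathcal{A})\to\mathrm{K}(\mathcal{B})$; let $\mathcal{L}$ be the kernel of this induced functor, i.e. the complexes $S$ such that $FS$ is split acyclic (contractible), called $F$-split acyclic complexes. $D_F^-(\mathcal{A})$ is the Verdier localization of $\mathrm{K}^-(\mathcal{A})$ at the $F$-split acyclic complexes it contains, i.e. $\mathrm{K}^-(\mathcal{A})/(\mathcal{L}\cap\mathrm{K}^-(\mathcal{A}))$. *)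

theory Defs
  imports "HOL-Algebra.Group"
begin

section \<open>Categories, functors, adjunctions\<close>

text \<open>
  Arrows determine their source and target (distinct hom-sets are disjoint), so composition
  needs no object arguments. Composition is written in the order of functions. The values of
  the operations outside the objects and hom-sets are irrelevant.
\<close>

record ('o, 'm) cat =
  Ob :: "'o set"
  Hom :: "'o \<Rightarrow> 'o \<Rightarrow> 'm set"
  Idn :: "'o \<Rightarrow> 'm"
  Comp :: "'m \<Rightarrow> 'm \<Rightarrow> 'm"  (infixl "\<cdot>\<index>" 70)

locale category =
  fixes C :: "('o, 'm, 'x) cat_scheme" (structure)
  assumes Hom_disjoint:
      "\<lbrakk>X \<in> Ob C; Y \<in> Ob C; X' \<in> Ob C; Y' \<in> Ob C; f \<in> Hom C X Y; f \<in> Hom C X' Y'\<rbrakk>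
        \<Longrightarrow> X = X' \<and> Y = Y'"
    and Idn_in_Hom: "X \<in> Ob C \<Longrightarrow> Idn C X \<in> Hom C X X"
    and Comp_in_Hom:
      "\<lbrakk>X \<in> Ob C; Y \<in> Ob C; Z \<in> Ob C; f \<in> Hom C X Y; g \<in> Hom C Y Z\<rbrakk> \<Longrightarrow> g \<cdot> f \<in> Hom C X Z"
    and Comp_Idn: "\<lbrakk>X \<in> Ob C; Y \<in> Ob C; f \<in> Hom C X Y\<rbrakk> \<Longrightarrow> f \<cdot> Idn C X = f"
    and Idn_Comp: "\<lbrakk>X \<in> Ob C; Y \<in> Ob C; f \<in> Hom C X Y\<rbrakk> \<Longrightarrow> Idn C Y \<cdot> f = f"
    and Comp_assoc:
      "\<lbrakk>W \<in> Ob C; X \<in> Ob C; Y \<in> Ob C; Z \<in> Ob C; f \<in> Hom C W X; g \<in> Hom C X Y; h \<in> Hom C Y Z\<rbrakk>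
        \<Longrightarrow> h \<cdot> (g \<cdot> f) = (h \<cdot> g) \<cdot> f"

definition iso_arrow :: "('o, 'm, 'x) cat_scheme \<Rightarrow> 'o \<Rightarrow> 'o \<Rightarrow> 'm \<Rightarrow> bool" where
  "iso_arrow C X Y f \<longleftrightarrow> X \<in> Ob C \<and> Y \<in> Ob C \<and> f \<in> Hom C X Y \<and>
     (\<exists>g\<in>Hom C Y X. g \<cdot>\<^bsub>C\<^esub> f = Idn C X \<and> f \<cdot>\<^bsub>C\<^esub> g = Idn C Y)"

record ('o, 'm, 'p, 'n) func =
  ob_map :: "'o \<Rightarrow> 'p"
  ar_map :: "'m \<Rightarrow> 'n"

definition is_functor ::
  "('o, 'm, 'x) cat_scheme \<Rightarrow> ('p, 'n, 'y) cat_scheme \<Rightarrow> ('o, 'm, 'p, 'n) func \<Rightarrow> bool" where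
  "is_functor C D F \<longleftrightarrow>
     (\<forall>X\<in>Ob C. ob_map F X \<in> Ob D \<and> ar_map F (Idn C X) = Idn D (ob_map F X)) \<and>
     (\<forall>X\<in>Ob C. \<forall>Y\<in>Ob C. \<forall>f\<in>Hom C X Y. ar_map F f \<in> Hom D (ob_map F X) (ob_map F Y)) \<and>
     (\<forall>X\<in>Ob C. \<forall>Y\<in>Ob C. \<forall>Z\<in>Ob C. \<forall>f\<in>Hom C X Y. \<forall>g\<in>Hom C Y Z.
        ar_map F (g \<cdot>\<^bsub>C\<^esub> f) = ar_map F g \<cdot>\<^bsub>D\<^esub> ar_map F f)"

definition faithful_functor ::
  "('o, 'm, 'x) cat_scheme \<Rightarrow> ('p, 'n, 'y) cat_scheme \<Rightarrow> ('o, 'm, 'p, 'n) func \<Rightarrow> bool" where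
  "faithful_functor C D F \<longleftrightarrow> is_functor C D F \<and>
     (\<forall>X\<in>Ob C. \<forall>Y\<in>Ob C. inj_on (ar_map F) (Hom C X Y))"

definition id_func :: "('o, 'm, 'o, 'm) func" where
  "id_func = \<lparr>ob_map = (\<lambda>X. X), ar_map = (\<lambda>f. f)\<rparr>"

definition comp_func ::
  "('p, 'n, 'q, 'l) func \<Rightarrow> ('o, 'm, 'p, 'n) func \<Rightarrow> ('o, 'm, 'q, 'l) func" where
  "comp_func G F = \<lparr>ob_map = ob_map G \<circ> ob_map F, ar_map = ar_map G \<circ> ar_map F\<rparr>"

definition nat_iso ::
  "('o, 'm, 'x) cat_scheme \<Rightarrow> ('p, 'n, 'y) cat_scheme \<Rightarrow>
   ('o, 'm, 'p, 'n) func \<Rightarrow> ('o, 'm, 'p, 'n) func \<Rightarrow> ('o \<Rightarrow> 'n) \<Rightarrow> bool" where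
  "nat_iso C D F G \<tau> \<longleftrightarrow>
     (\<forall>X\<in>Ob C. iso_arrow D (ob_map F X) (ob_map G X) (\<tau> X)) \<and>
     (\<forall>X\<in>Ob C. \<forall>Y\<in>Ob C. \<forall>f\<in>Hom C X Y. \<tau> Y \<cdot>\<^bsub>D\<^esub> ar_map F f = ar_map G f \<cdot>\<^bsub>D\<^esub> \<tau> X)"

text \<open>\<open>adjunction C D L R\<close>: the functor \<open>L : C \<rightarrow> D\<close> is left adjoint to \<open>R : D \<rightarrow> C\<close>.\<close>

definition adjunction ::
  "('o, 'm, 'x) cat_scheme \<Rightarrow> ('p, 'n, 'y) cat_scheme \<Rightarrow>
   ('o, 'm, 'p, 'n) func \<Rightarrow> ('p, 'n, 'o, 'm) func \<Rightarrow> bool" where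
  "adjunction C D L R \<longleftrightarrow> is_functor C D L \<and> is_functor D C R \<and>
     (\<exists>\<phi> :: 'o \<Rightarrow> 'p \<Rightarrow> 'n \<Rightarrow> 'm.
        (\<forall>X\<in>Ob C. \<forall>Y\<in>Ob D. bij_betw (\<phi> X Y) (Hom D (ob_map L X) Y) (Hom C X (ob_map R Y))) \<and>
        (\<forall>X\<in>Ob C. \<forall>X'\<in>Ob C. \<forall>Y\<in>Ob D. \<forall>Y'\<in>Ob D.
           \<forall>f\<in>Hom C X' X. \<forall>g\<in>Hom D Y Y'. \<forall>u\<in>Hom D (ob_map L X) Y.
             \<phi> X' Y' (g \<cdot>\<^bsub>D\<^esub> u \<cdot>\<^bsub>D\<^esub> ar_map L f) = ar_map R g \<cdot>\<^bsub>C\<^esub> \<phi> X Y u \<cdot>\<^bsub>C\<^esub> f))"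

section \<open>Additive and abelian categories\<close>

record ('o, 'm) ab_cat = "('o, 'm) cat" +
  Add :: "'m \<Rightarrow> 'm \<Rightarrow> 'm"  (infixl "\<boxplus>\<index>" 65)
  Zero :: "'o \<Rightarrow> 'o \<Rightarrow> 'm"

definition hom_group :: "('o, 'm, 'x) ab_cat_scheme \<Rightarrow> 'o \<Rightarrow> 'o \<Rightarrow> 'm monoid" where
  "hom_group C X Y = \<lparr>carrier = Hom C X Y, monoid.mult = Add C, one = Zero C X Y\<rparr>"

definition neg :: "('o, 'm, 'x) ab_cat_scheme \<Rightarrow> 'o \<Rightarrow> 'o \<Rightarrow> 'm \<Rightarrow> 'm" where
  "neg C X Y f = inv\<^bsub>hom_group C X Y\<^esub> f"

locale preadditive = category C for C :: "('o, 'm, 'x) ab_cat_scheme" (structure) +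
  assumes hom_comm_group: "\<lbrakk>X \<in> Ob C; Y \<in> Ob C\<rbrakk> \<Longrightarrow> comm_group (hom_group C X Y)"
    and Comp_Add_left:
      "\<lbrakk>X \<in> Ob C; Y \<in> Ob C; Z \<in> Ob C; f \<in> Hom C X Y; g \<in> Hom C Y Z; g' \<in> Hom C Y Z\<rbrakk>
        \<Longrightarrow> (g \<boxplus> g') \<cdot> f = g \<cdot> f \<boxplus> g' \<cdot> f"
    and Comp_Add_right:
      "\<lbrakk>X \<in> Ob C; Y \<in> Ob C; Z \<in> Ob C; f \<in> Hom C X Y; f' \<in> Hom C X Y; g \<in> Hom C Y Z\<rbrakk>
        \<Longrightarrow> g \<cdot> (f \<boxplus> f') = g \<cdot> f \<boxplus> g \<cdot> f'"

definition is_zero_object :: "('o, 'm, 'x) cat_scheme \<Rightarrow> 'o \<Rightarrow> bool" where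
  "is_zero_object C Z \<longleftrightarrow> Z \<in> Ob C \<and>
     (\<forall>X\<in>Ob C. (\<exists>!f. f \<in> Hom C X Z) \<and> (\<exists>!f. f \<in> Hom C Z X))"

text \<open>\<open>S = X \<oplus> Y\<close> with inclusions \<open>i\<close>, \<open>j\<close> and projections \<open>p\<close>, \<open>q\<close>.\<close>

definition biproduct ::
  "('o, 'm, 'x) ab_cat_scheme \<Rightarrow> 'o \<Rightarrow> 'o \<Rightarrow> 'o \<Rightarrow> 'm \<Rightarrow> 'm \<Rightarrow> 'm \<Rightarrow> 'm \<Rightarrow> bool" where
  "biproduct C X Y S i j p q \<longleftrightarrow> X \<in> Ob C \<and> Y \<in> Ob C \<and> S \<in> Ob C \<and>
     i \<in> Hom C X S \<and> j \<in> Hom C Y S \<and> p \<in> Hom C S X \<and> q \<in> Hom C S Y \<and>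
     p \<cdot>\<^bsub>C\<^esub> i = Idn C X \<and> q \<cdot>\<^bsub>C\<^esub> j = Idn C Y \<and>
     q \<cdot>\<^bsub>C\<^esub> i = Zero C X Y \<and> p \<cdot>\<^bsub>C\<^esub> j = Zero C Y X \<and>
     i \<cdot>\<^bsub>C\<^esub> p \<boxplus>\<^bsub>C\<^esub> j \<cdot>\<^bsub>C\<^esub> q = Idn C S"

definition direct_summand :: "('o, 'm, 'x) ab_cat_scheme \<Rightarrow> 'o \<Rightarrow> 'o \<Rightarrow> bool" where
  "direct_summand C X S \<longleftrightarrow> (\<exists>Y i j p q. biproduct C X Y S i j p q)"

definition mono_arrow :: "('o, 'm, 'x) cat_scheme \<Rightarrow> 'o \<Rightarrow> 'o \<Rightarrow> 'm \<Rightarrow> bool" where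
  "mono_arrow C X Y f \<longleftrightarrow> f \<in> Hom C X Y \<and>
     (\<forall>T\<in>Ob C. \<forall>t\<in>Hom C T X. \<forall>t'\<in>Hom C T X. f \<cdot>\<^bsub>C\<^esub> t = f \<cdot>\<^bsub>C\<^esub> t' \<longrightarrow> t = t')"

definition epi_arrow :: "('o, 'm, 'x) cat_scheme \<Rightarrow> 'o \<Rightarrow> 'o \<Rightarrow> 'm \<Rightarrow> bool" where
  "epi_arrow C X Y f \<longleftrightarrow> f \<in> Hom C X Y \<and>
     (\<forall>T\<in>Ob C. \<forall>t\<in>Hom C Y T. \<forall>t'\<in>Hom C Y T. t \<cdot>\<^bsub>C\<^esub> f = t' \<cdot>\<^bsub>C\<^esub> f \<longrightarrow> t = t')"

definition is_kernel :: "('o, 'm, 'x) ab_cat_scheme \<Rightarrow> 'o \<Rightarrow> 'o \<Rightarrow> 'm \<Rightarrow> 'o \<Rightarrow> 'm \<Rightarrow> bool" where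
  "is_kernel C X Y f K k \<longleftrightarrow> K \<in> Ob C \<and> k \<in> Hom C K X \<and> f \<cdot>\<^bsub>C\<^esub> k = Zero C K Y \<and>
     (\<forall>T\<in>Ob C. \<forall>t\<in>Hom C T X. f \<cdot>\<^bsub>C\<^esub> t = Zero C T Y \<longrightarrow>
        (\<exists>!u. u \<in> Hom C T K \<and> k \<cdot>\<^bsub>C\<^esub> u = t))"

definition is_cokernel :: "('o, 'm, 'x) ab_cat_scheme \<Rightarrow> 'o \<Rightarrow> 'o \<Rightarrow> 'm \<Rightarrow> 'o \<Rightarrow> 'm \<Rightarrow> bool" where
  "is_cokernel C X Y f Q c \<longleftrightarrow> Q \<in> Ob C \<and> c \<in> Hom C Y Q \<and> c \<cdot>\<^bsub>C\<^esub> f = Zero C X Q \<and>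
     (\<forall>T\<in>Ob C. \<forall>t\<in>Hom C Y T. t \<cdot>\<^bsub>C\<^esub> f = Zero C X T \<longrightarrow>
        (\<exists>!u. u \<in> Hom C Q T \<and> u \<cdot>\<^bsub>C\<^esub> c = t))"

locale abelian_category = preadditive C for C :: "('o, 'm, 'x) ab_cat_scheme" (structure) +
  assumes ex_zero_object: "\<exists>Z. is_zero_object C Z"
    and ex_biproduct: "\<lbrakk>X \<in> Ob C; Y \<in> Ob C\<rbrakk> \<Longrightarrow> \<exists>S i j p q. biproduct C X Y S i j p q"
    and ex_kernel: "\<lbrakk>X \<in> Ob C; Y \<in> Ob C; f \<in> Hom C X Y\<rbrakk> \<Longrightarrow> \<exists>K k. is_kernel C X Y f K k"
    and ex_cokernel: "\<lbrakk>X \<in> Ob C; Y \<in> Ob C; f \<in> Hom C X Y\<rbrakk> \<Longrightarrow> \<exists>Q c. is_cokernel C X Y f Q c"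
    and mono_is_kernel: "\<lbrakk>X \<in> Ob C; Y \<in> Ob C; mono_arrow C X Y f\<rbrakk>
        \<Longrightarrow> \<exists>Z\<in>Ob C. \<exists>g\<in>Hom C Y Z. is_kernel C Y Z g X f"
    and epi_is_cokernel: "\<lbrakk>X \<in> Ob C; Y \<in> Ob C; epi_arrow C X Y f\<rbrakk>
        \<Longrightarrow> \<exists>W\<in>Ob C. \<exists>g\<in>Hom C W X. is_cokernel C W X g Y f"

definition additive_functor ::
  "('o, 'm, 'x) ab_cat_scheme \<Rightarrow> ('p, 'n, 'y) ab_cat_scheme \<Rightarrow> ('o, 'm, 'p, 'n) func \<Rightarrow> bool" where
  "additive_functor C D F \<longleftrightarrow> is_functor C D F \<and>
     (\<forall>X\<in>Ob C. \<forall>Y\<in>Ob C. \<forall>f\<in>Hom C X Y. \<forall>g\<in>Hom C X Y.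
        ar_map F (f \<boxplus>\<^bsub>C\<^esub> g) = ar_map F f \<boxplus>\<^bsub>D\<^esub> ar_map F g)"

section \<open>Shifts, triangles and triangle functors\<close>

record ('o, 'm) shift_cat = "('o, 'm) ab_cat" +
  ShOb :: "'o \<Rightarrow> 'o"
  ShAr :: "'m \<Rightarrow> 'm"

text \<open>\<open>(X, Y, Z, u, v, w)\<close> stands for \<open>X \<rightarrow> Y \<rightarrow> Z \<rightarrow> X[1]\<close> with arrows \<open>u\<close>, \<open>v\<close>, \<open>w\<close>.\<close>

type_synonym ('o, 'm) triangle = "'o \<times> 'o \<times> 'o \<times> 'm \<times> 'm \<times> 'm"

record ('o, 'm) tri_cat = "('o, 'm) shift_cat" +
  Tri :: "('o, 'm) triangle set"

definition shift_func :: "('o, 'm, 'x) shift_cat_scheme \<Rightarrow> ('o, 'm, 'o, 'm) func" where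
  "shift_func C = \<lparr>ob_map = ShOb C, ar_map = ShAr C\<rparr>"

definition triangle_iso ::
  "('o, 'm, 'x) shift_cat_scheme \<Rightarrow> ('o, 'm) triangle \<Rightarrow> ('o, 'm) triangle \<Rightarrow> bool" where
  "triangle_iso C = (\<lambda>(X, Y, Z, u, v, w) (X', Y', Z', u', v', w').
     u \<in> Hom C X Y \<and> v \<in> Hom C Y Z \<and> w \<in> Hom C Z (ShOb C X) \<and>
     u' \<in> Hom C X' Y' \<and> v' \<in> Hom C Y' Z' \<and> w' \<in> Hom C Z' (ShOb C X') \<and>
     (\<exists>a b c. iso_arrow C X X' a \<and> iso_arrow C Y Y' b \<and> iso_arrow C Z Z' c \<and>
        b \<cdot>\<^bsub>C\<^esub> u = u' \<cdot>\<^bsub>C\<^esub> a \<and> c \<cdot>\<^bsub>C\<^esub> v = v' \<cdot>\<^bsub>C\<^esub> b \<and> ShAr C a \<cdot>\<^bsub>C\<^esub> w = w' \<cdot>\<^bsub>C\<^esub> c))"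

text \<open>
  The full subcategory on the objects in \<open>S\<close>. For \<open>S\<close> closed under shifts, cones and
  isomorphisms this is the induced triangulated structure.
\<close>

definition full_subcat :: "('o, 'm) tri_cat \<Rightarrow> 'o set \<Rightarrow> ('o, 'm) tri_cat" where
  "full_subcat T S = T\<lparr>Ob := Ob T \<inter> S,
     Tri := {(X, Y, Z, u, v, w). (X, Y, Z, u, v, w) \<in> Tri T \<and> X \<in> S \<and> Y \<in> S \<and> Z \<in> S}\<rparr>"

definition triangle_functor ::
  "('o, 'm) tri_cat \<Rightarrow> ('p, 'n) tri_cat \<Rightarrow> ('o, 'm, 'p, 'n) func \<Rightarrow> ('o \<Rightarrow> 'n) \<Rightarrow> bool" where
  "triangle_functor C D \<Phi> \<theta> \<longleftrightarrow> additive_functor C D \<Phi> \<and>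
     nat_iso C D (comp_func \<Phi> (shift_func C)) (comp_func (shift_func D) \<Phi>) \<theta> \<and>
     (\<forall>X Y Z u v w. (X, Y, Z, u, v, w) \<in> Tri C \<longrightarrow>
        (ob_map \<Phi> X, ob_map \<Phi> Y, ob_map \<Phi> Z, ar_map \<Phi> u, ar_map \<Phi> v, \<theta> X \<cdot>\<^bsub>D\<^esub> ar_map \<Phi> w) \<in> Tri D)"

definition triangle_equivalent :: "('o, 'm) tri_cat \<Rightarrow> ('p, 'n) tri_cat \<Rightarrow> bool" where
  "triangle_equivalent C D \<longleftrightarrow>
     (\<exists>\<Phi> \<theta> \<Psi> \<psi>. triangle_functor C D \<Phi> \<theta> \<and> triangle_functor D C \<Psi> \<psi> \<and>
        (\<exists>\<eta>. nat_iso C C id_func (comp_func \<Psi> \<Phi>) \<eta>) \<and>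
        (\<exists>\<epsilon>. nat_iso D D (comp_func \<Phi> \<Psi>) id_func \<epsilon>))"

section \<open>Cochain complexes and the homotopy category\<close>

record ('o, 'm) cochain_complex =
  obj :: "int \<Rightarrow> 'o"
  diff :: "int \<Rightarrow> 'm"

definition is_complex :: "('o, 'm) ab_cat \<Rightarrow> ('o, 'm) cochain_complex \<Rightarrow> bool" where
  "is_complex A X \<longleftrightarrow>
     (\<forall>n. obj X n \<in> Ob A \<and> diff X n \<in> Hom A (obj X n) (obj X (n + 1)) \<and>
          diff X (n + 1) \<cdot>\<^bsub>A\<^esub> diff X n = Zero A (obj X n) (obj X (n + 2)))"

definition chain_maps ::
  "('o, 'm) ab_cat \<Rightarrow> ('o, 'm) cochain_complex \<Rightarrow> ('o, 'm) cochain_complex \<Rightarrow> (int \<Rightarrow> 'm) set" where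
  "chain_maps A X Y = {f. \<forall>n. f n \<in> Hom A (obj X n) (obj Y n) \<and>
     f (n + 1) \<cdot>\<^bsub>A\<^esub> diff X n = diff Y n \<cdot>\<^bsub>A\<^esub> f n}"

definition homotopic ::
  "('o, 'm) ab_cat \<Rightarrow> ('o, 'm) cochain_complex \<Rightarrow> ('o, 'm) cochain_complex \<Rightarrow>
   (int \<Rightarrow> 'm) \<Rightarrow> (int \<Rightarrow> 'm) \<Rightarrow> bool" where
  "homotopic A X Y f g \<longleftrightarrow>
     (\<exists>h. (\<forall>n. h n \<in> Hom A (obj X n) (obj Y (n - 1))) \<and>
          (\<forall>n. f n = g n \<boxplus>\<^bsub>A\<^esub> (diff Y (n - 1) \<cdot>\<^bsub>A\<^esub> h n \<boxplus>\<^bsub>A\<^esub> h (n + 1) \<cdot>\<^bsub>A\<^esub> diff X n)))"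

definition homotopy_class ::
  "('o, 'm) ab_cat \<Rightarrow> ('o, 'm) cochain_complex \<Rightarrow> ('o, 'm) cochain_complex \<Rightarrow>
   (int \<Rightarrow> 'm) \<Rightarrow> (int \<Rightarrow> 'm) set" where
  "homotopy_class A X Y f = {g \<in> chain_maps A X Y. homotopic A X Y f g}"

definition contractible :: "('o, 'm) ab_cat \<Rightarrow> ('o, 'm) cochain_complex \<Rightarrow> bool" where
  "contractible A X \<longleftrightarrow>
     homotopic A X X (\<lambda>n. Idn A (obj X n)) (\<lambda>n. Zero A (obj X n) (obj X n))"

definition shift_complex :: "('o, 'm) ab_cat \<Rightarrow> ('o, 'm) cochain_complex \<Rightarrow> ('o, 'm) cochain_complex" where
  "shift_complex A X = \<lparr>obj = (\<lambda>n. obj X (n + 1)),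
     diff = (\<lambda>n. neg A (obj X (n + 1)) (obj X (n + 2)) (diff X (n + 1)))\<rparr>"

text \<open>An arrow \<open>X \<rightarrow> Y\<close> is a triple \<open>(X, \<alpha>, Y)\<close> with \<open>\<alpha>\<close> a homotopy class of chain maps.\<close>

type_synonym ('o, 'm) htpy_arrow =
  "('o, 'm) cochain_complex \<times> (int \<Rightarrow> 'm) set \<times> ('o, 'm) cochain_complex"

definition htpy_arrow ::
  "('o, 'm) ab_cat \<Rightarrow> ('o, 'm) cochain_complex \<Rightarrow> ('o, 'm) cochain_complex \<Rightarrow>
   (int \<Rightarrow> 'm) \<Rightarrow> ('o, 'm) htpy_arrow" where
  "htpy_arrow A X Y f = (X, homotopy_class A X Y f, Y)"

text \<open>
  Operations on classes are given by the set of all maps homotopic to the result of the operation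
  on some representatives; as the operations respect homotopy, this is a single homotopy class.
\<close>

definition htpy_shift_cat ::
  "('o, 'm) ab_cat \<Rightarrow> (('o, 'm) cochain_complex, ('o, 'm) htpy_arrow) shift_cat" where
  "htpy_shift_cat A = \<lparr>
     Ob = {X. is_complex A X},
     Hom = (\<lambda>X Y. htpy_arrow A X Y ` chain_maps A X Y),
     Idn = (\<lambda>X. htpy_arrow A X X (\<lambda>n. Idn A (obj X n))),
     Comp = (\<lambda>(Y', \<beta>, Z) (X, \<alpha>, Y).
       (X, \<Union>f\<in>\<alpha>. \<Union>g\<in>\<beta>. homotopy_class A X Z (\<lambda>n. g n \<cdot>\<^bsub>A\<^esub> f n), Z)),
     Add = (\<lambda>(X, \<alpha>, Y) (X', \<beta>, Y').
       (X, \<Union>f\<in>\<alpha>. \<Union>g\<in>\<beta>. homotopy_class A X Y (\<lambda>n. f n \<boxplus>\<^bsub>A\<^esub> g n), Y)),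
     Zero = (\<lambda>X Y. htpy_arrow A X Y (\<lambda>n. Zero A (obj X n) (obj Y n))),
     ShOb = shift_complex A,
     ShAr = (\<lambda>(X, \<alpha>, Y).
       (shift_complex A X,
        \<Union>f\<in>\<alpha>. homotopy_class A (shift_complex A X) (shift_complex A Y) (\<lambda>n. f (n + 1)),
        shift_complex A Y))\<rparr>"

text \<open>
  \<open>Z\<close> is the mapping cone of \<open>f : X \<rightarrow> Y\<close>: \<open>Z\<^sup>n = X\<^sup>n\<^sup>+\<^sup>1 \<oplus> Y\<^sup>n\<close>, with differential given by
  \<open>-d\<close> on \<open>X\<^sup>n\<^sup>+\<^sup>1\<close> (the differential of \<open>X[1]\<close>), by \<open>f\<close> from \<open>X\<^sup>n\<^sup>+\<^sup>1\<close> to \<open>Y\<^sup>n\<^sup>+\<^sup>1\<close> and by \<open>d\<close> on \<open>Y\<^sup>n\<close>.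
\<close>

definition is_cone ::
  "('o, 'm) ab_cat \<Rightarrow> ('o, 'm) cochain_complex \<Rightarrow> ('o, 'm) cochain_complex \<Rightarrow> (int \<Rightarrow> 'm) \<Rightarrow>
   ('o, 'm) cochain_complex \<Rightarrow> (int \<Rightarrow> 'm) \<Rightarrow> (int \<Rightarrow> 'm) \<Rightarrow> (int \<Rightarrow> 'm) \<Rightarrow> (int \<Rightarrow> 'm) \<Rightarrow> bool" where
  "is_cone A X Y f Z i j p q \<longleftrightarrow>
     (\<forall>n. biproduct A (obj X (n + 1)) (obj Y n) (obj Z n) (i n) (j n) (p n) (q n) \<and>
        diff Z n =
          i (n + 1) \<cdot>\<^bsub>A\<^esub> diff (shift_complex A X) n \<cdot>\<^bsub>A\<^esub> p n
          \<boxplus>\<^bsub>A\<^esub> j (n + 1) \<cdot>\<^bsub>A\<^esub> f (n + 1) \<cdot>\<^bsub>A\<^esub> p n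
          \<boxplus>\<^bsub>A\<^esub> j (n + 1) \<cdot>\<^bsub>A\<^esub> diff Y n \<cdot>\<^bsub>A\<^esub> q n)"

text \<open>The distinguished triangles are those isomorphic to some \<open>X \<rightarrow> Y \<rightarrow> cone f \<rightarrow> X[1]\<close>.\<close>

definition htpy_triangles ::
  "('o, 'm) ab_cat \<Rightarrow> (('o, 'm) cochain_complex, ('o, 'm) htpy_arrow) triangle set" where
  "htpy_triangles A = {T. \<exists>X Y f Z i j p q.
     is_complex A X \<and> is_complex A Y \<and> f \<in> chain_maps A X Y \<and> is_cone A X Y f Z i j p q \<and>
     triangle_iso (htpy_shift_cat A) T
       (X, Y, Z, htpy_arrow A X Y f, htpy_arrow A Y Z j, htpy_arrow A Z (shift_complex A X) p)}"

definition homotopy_category ::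
  "('o, 'm) ab_cat \<Rightarrow> (('o, 'm) cochain_complex, ('o, 'm) htpy_arrow) tri_cat" where
  "homotopy_category A =
     shift_cat.extend (htpy_shift_cat A) \<lparr>tri_cat.Tri = htpy_triangles A, \<dots> = ()\<rparr>"

definition bounded_above :: "('o, 'm) ab_cat \<Rightarrow> ('o, 'm) cochain_complex \<Rightarrow> bool" where
  "bounded_above A X \<longleftrightarrow> (\<exists>N. \<forall>n>N. is_zero_object A (obj X n))"

definition homotopy_category_minus ::
  "('o, 'm) ab_cat \<Rightarrow> (('o, 'm) cochain_complex, ('o, 'm) htpy_arrow) tri_cat" where
  "homotopy_category_minus A = full_subcat (homotopy_category A) {X. bounded_above A X}"

section \<open>Verdier localization\<close>

text \<open>
  The Verdier localization \<open>T / N\<close> by fractions: an arrow \<open>X \<rightarrow> Y\<close> is an equivalence class of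
  roofs \<open>X \<leftarrow> U \<rightarrow> Y\<close> whose left leg \<open>s\<close> has a cone in \<open>N\<close>; \<open>(U, s, f)\<close> is read as \<open>f \<circ> s\<^sup>-\<^sup>1\<close>.
\<close>

definition cone_in :: "('o, 'm) tri_cat \<Rightarrow> 'o set \<Rightarrow> 'o \<Rightarrow> 'o \<Rightarrow> 'm set" where
  "cone_in T N X Y = {s \<in> Hom T X Y. \<exists>Z\<in>N. \<exists>v w. (X, Y, Z, s, v, w) \<in> Tri T}"

type_synonym ('o, 'm) roof = "'o \<times> 'm \<times> 'm"

definition roofs :: "('o, 'm) tri_cat \<Rightarrow> 'o set \<Rightarrow> 'o \<Rightarrow> 'o \<Rightarrow> ('o, 'm) roof set" where
  "roofs T N X Y = {(U, s, f). U \<in> Ob T \<and> s \<in> cone_in T N U X \<and> f \<in> Hom T U Y}"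

definition roof_equiv ::
  "('o, 'm) tri_cat \<Rightarrow> 'o set \<Rightarrow> 'o \<Rightarrow> ('o, 'm) roof \<Rightarrow> ('o, 'm) roof \<Rightarrow> bool" where
  "roof_equiv T N X = (\<lambda>(U, s, f) (U', s', f').
     \<exists>V\<in>Ob T. \<exists>a\<in>Hom T V U. \<exists>a'\<in>Hom T V U'.
       s \<cdot>\<^bsub>T\<^esub> a = s' \<cdot>\<^bsub>T\<^esub> a' \<and> s \<cdot>\<^bsub>T\<^esub> a \<in> cone_in T N V X \<and> f \<cdot>\<^bsub>T\<^esub> a = f' \<cdot>\<^bsub>T\<^esub> a')"

definition roof_class ::
  "('o, 'm) tri_cat \<Rightarrow> 'o set \<Rightarrow> 'o \<Rightarrow> 'o \<Rightarrow> ('o, 'm) roof \<Rightarrow> ('o, 'm) roof set" where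
  "roof_class T N X Y r = {r' \<in> roofs T N X Y. roof_equiv T N X r r'}"

type_synonym ('o, 'm) frac = "'o \<times> ('o, 'm) roof set \<times> 'o"

definition loc_arrow :: "('o, 'm) tri_cat \<Rightarrow> 'o set \<Rightarrow> 'o \<Rightarrow> 'o \<Rightarrow> 'm \<Rightarrow> ('o, 'm) frac" where
  "loc_arrow T N X Y f = (X, roof_class T N X Y (X, Idn T X, f), Y)"

text \<open>
  Composition completes \<open>U \<rightarrow> Y \<leftarrow> V\<close> to a commutative square with a vertex \<open>W\<close>; addition uses
  representatives with the same left leg. As above, all choices are taken at once.
\<close>

definition verdier_shift_cat :: "('o, 'm) tri_cat \<Rightarrow> 'o set \<Rightarrow> ('o, ('o, 'm) frac) shift_cat" where
  "verdier_shift_cat T N = \<lparr>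
     Ob = Ob T,
     Hom = (\<lambda>X Y. (\<lambda>r. (X, roof_class T N X Y r, Y)) ` roofs T N X Y),
     Idn = (\<lambda>X. loc_arrow T N X X (Idn T X)),
     Comp = (\<lambda>(Y', \<beta>, Z) (X, \<alpha>, Y).
       (X, \<Union>{roof_class T N X Z (W, s \<cdot>\<^bsub>T\<^esub> t', g \<cdot>\<^bsub>T\<^esub> f') | U s f V t g W t' f'.
              (U, s, f) \<in> \<alpha> \<and> (V, t, g) \<in> \<beta> \<and> W \<in> Ob T \<and>
              t' \<in> cone_in T N W U \<and> f' \<in> Hom T W V \<and> f \<cdot>\<^bsub>T\<^esub> t' = t \<cdot>\<^bsub>T\<^esub> f'}, Z)),
     Add = (\<lambda>(X, \<alpha>, Y) (X', \<beta>, Y').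
       (X, \<Union>{roof_class T N X Y (U, s, f \<boxplus>\<^bsub>T\<^esub> g) | U s f g. (U, s, f) \<in> \<alpha> \<and> (U, s, g) \<in> \<beta>}, Y)),
     Zero = (\<lambda>X Y. loc_arrow T N X Y (Zero T X Y)),
     ShOb = ShOb T,
     ShAr = (\<lambda>(X, \<alpha>, Y).
       (ShOb T X,
        \<Union>{roof_class T N (ShOb T X) (ShOb T Y) (ShOb T U, ShAr T s, ShAr T f) | U s f. (U, s, f) \<in> \<alpha>},
        ShOb T Y))\<rparr>"

definition verdier_triangles ::
  "('o, 'm) tri_cat \<Rightarrow> 'o set \<Rightarrow> ('o, ('o, 'm) frac) triangle set" where
  "verdier_triangles T N = {D. \<exists>X Y Z u v w. (X, Y, Z, u, v, w) \<in> Tri T \<and>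
     triangle_iso (verdier_shift_cat T N) D
       (X, Y, Z, loc_arrow T N X Y u, loc_arrow T N Y Z v, loc_arrow T N Z (ShOb T X) w)}"

definition verdier_localization :: "('o, 'm) tri_cat \<Rightarrow> 'o set \<Rightarrow> ('o, ('o, 'm) frac) tri_cat" where
  "verdier_localization T N =
     shift_cat.extend (verdier_shift_cat T N) \<lparr>tri_cat.Tri = verdier_triangles T N, \<dots> = ()\<rparr>"

section \<open>Notions relative to a functor with adjoints\<close>

definition F_projective ::
  "('a, 'm) ab_cat \<Rightarrow> ('b, 'n) ab_cat \<Rightarrow> ('b, 'n, 'a, 'm) func \<Rightarrow> 'a \<Rightarrow> bool" where
  "F_projective A B L X \<longleftrightarrow> (\<exists>Y\<in>Ob B. direct_summand A X (ob_map L Y))"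

definition F_injective ::
  "('a, 'm) ab_cat \<Rightarrow> ('b, 'n) ab_cat \<Rightarrow> ('b, 'n, 'a, 'm) func \<Rightarrow> 'a \<Rightarrow> bool" where
  "F_injective A B R X \<longleftrightarrow> (\<exists>Y\<in>Ob B. direct_summand A X (ob_map R Y))"

definition map_complex ::
  "('a, 'm, 'b, 'n) func \<Rightarrow> ('a, 'm) cochain_complex \<Rightarrow> ('b, 'n) cochain_complex" where
  "map_complex F X = \<lparr>obj = (\<lambda>n. ob_map F (obj X n)), diff = (\<lambda>n. ar_map F (diff X n))\<rparr>"

definition F_split_acyclic ::
  "('a, 'm) ab_cat \<Rightarrow> ('b, 'n) ab_cat \<Rightarrow> ('a, 'm, 'b, 'n) func \<Rightarrow>
   ('a, 'm) cochain_complex set" where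
  "F_split_acyclic A B F = {S. is_complex A S \<and> contractible B (map_complex F S)}"

definition derived_F_minus ::
  "('a, 'm) ab_cat \<Rightarrow> ('b, 'n) ab_cat \<Rightarrow> ('a, 'm, 'b, 'n) func \<Rightarrow>
   (('a, 'm) cochain_complex, (('a, 'm) cochain_complex, ('a, 'm) htpy_arrow) frac) tri_cat" where
  "derived_F_minus A B F =
     verdier_localization (homotopy_category_minus A)
       (F_split_acyclic A B F \<inter> Ob (homotopy_category_minus A))"

definition homotopy_category_minus_proj ::
  "('a, 'm) ab_cat \<Rightarrow> ('b, 'n) ab_cat \<Rightarrow> ('b, 'n, 'a, 'm) func \<Rightarrow>
   (('a, 'm) cochain_complex, ('a, 'm) htpy_arrow) tri_cat" where
  "homotopy_category_minus_proj A B L =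
     full_subcat (homotopy_category A)
       {X. bounded_above A X \<and> (\<forall>n. F_projective A B L (obj X n))}"

end

theory Submission
  imports Defs
begin

text \<open>
  Every bounded above complex \<open>X\<close> receives a map from a bounded above complex \<open>p X\<close> of
  \<open>F\<close>-projectives whose cone is \<open>F\<close>-split acyclic: going down in degree, cover the cycles \<open>E\<close> of
  the cone built so far by \<open>L F E\<close>; the counit \<open>L F E \<rightarrow> E\<close> splits after applying \<open>F\<close>. Conversely,
  there are no nonzero maps in the homotopy category from such a complex to an \<open>F\<close>-split acyclic
  one. Hence a map \<open>s\<close> with \<open>F\<close>-split acyclic cone induces bijections \<open>Hom(Q, s)\<close> for all these
  complexes \<open>Q\<close>, so a roof \<open>X \<leftarrow> U \<rightarrow> Y\<close> is the same thing as a map \<open>p X \<rightarrow> Y\<close>, that is, a map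
  \<open>p X \<rightarrow> p Y\<close>; this makes \<open>p\<close> an equivalence from the localization. It preserves triangles because,
  by the five lemma, a cone of \<open>p X \<rightarrow> p Y\<close> has the universal property of \<open>p Z\<close>.
\<close>

text \<open>Both halves rest on one lifting principle. For an \<open>F\<close>-projective
  \<open>Q\<close> the counit \<open>L F Q -> Q\<close> has a section, so a lifting problem out of
  \<open>Q\<close> can be solved after applying \<open>F\<close> and carried back by
  \<open>L\<close>. After \<open>F\<close> the contraction of an \<open>F\<close>-split acyclic
  complex turns every cycle into a boundary; boundedness above supplies the zero degrees at which
  the descending construction of a null homotopy can start. In the other direction, a statement
  about the cone of a resolution in \<open>A\<close> has to become a contraction in
  \<open>B\<close>: this needs the cycles of the image complex to be the images of the cycles, which
  holds since \<open>F\<close>, being right adjoint to \<open>L\<close>, preserves kernels.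

  The operations of the localization are unions over all choices of representatives and of completed
  squares. Attaching to each roof its map \<open>res X -> res Y\<close> disposes of these choices:
  it is an invariant of the class, and each operation is computed on it. Resolutions are chosen, so
  \<open>res (X[1])\<close> is merely isomorphic to \<open>(res X)[1]\<close>, and this isomorphism
  has to be carried through every statement about triangles.\<close>

context preadditive
begin

section \<open>Hom groups and zero arrows\<close>

lemma Add_in_Hom: "\<lbrakk>X \<in> Ob C; Y \<in> Ob C; f \<in> Hom C X Y; g \<in> Hom C X Y\<rbrakk> \<Longrightarrow> f \<boxplus> g \<in> Hom C X Y"
  using comm_group.axioms(2)[OF hom_comm_group, of X Y] group.is_monoid monoid.m_closed
  by (fastforce simp: hom_group_def)

lemma Zero_in_Hom: "\<lbrakk>X \<in> Ob C; Y \<in> Ob C\<rbrakk> \<Longrightarrow> Zero C X Y \<in> Hom C X Y"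
  using comm_group.axioms(2)[OF hom_comm_group, of X Y] group.is_monoid monoid.one_closed
  by (fastforce simp: hom_group_def)

lemma neg_in_Hom: "\<lbrakk>X \<in> Ob C; Y \<in> Ob C; f \<in> Hom C X Y\<rbrakk> \<Longrightarrow> neg C X Y f \<in> Hom C X Y"
  using group.inv_closed[OF comm_group.axioms(2)[OF hom_comm_group, of X Y], of f]
  by (simp add: hom_group_def neg_def)

lemma Add_assoc:
  "\<lbrakk>X \<in> Ob C; Y \<in> Ob C; f \<in> Hom C X Y; g \<in> Hom C X Y; h \<in> Hom C X Y\<rbrakk> \<Longrightarrow> f \<boxplus> g \<boxplus> h = f \<boxplus> (g \<boxplus> h)"
  using monoid.m_assoc[OF group.is_monoid[OF comm_group.axioms(2)[OF hom_comm_group, of X Y]], of f g h]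
  by (simp add: hom_group_def)

lemma Add_commute:
  "\<lbrakk>X \<in> Ob C; Y \<in> Ob C; f \<in> Hom C X Y; g \<in> Hom C X Y\<rbrakk> \<Longrightarrow> f \<boxplus> g = g \<boxplus> f"
  using comm_monoid.m_comm[OF comm_group.axioms(1)[OF hom_comm_group, of X Y], of f g]
  by (simp add: hom_group_def)

lemma Zero_Add: "\<lbrakk>X \<in> Ob C; Y \<in> Ob C; f \<in> Hom C X Y\<rbrakk> \<Longrightarrow> Zero C X Y \<boxplus> f = f"
  using monoid.l_one[OF group.is_monoid[OF comm_group.axioms(2)[OF hom_comm_group, of X Y]], of f]
  by (simp add: hom_group_def)

lemma neg_Add: "\<lbrakk>X \<in> Ob C; Y \<in> Ob C; f \<in> Hom C X Y\<rbrakk> \<Longrightarrow> neg C X Y f \<boxplus> f = Zero C X Y"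
  using group.l_inv[OF comm_group.axioms(2)[OF hom_comm_group, of X Y], of f]
  by (simp add: hom_group_def neg_def)

text \<open>Cancelling one \<open>f\<close>. Additivity alone makes the image of zero idempotent, so
  this is how composition with zero arrows and, later, an additive functor on zero arrows are
  evaluated.\<close>

lemma Add_idem_eq_Zero:
  "\<lbrakk>X \<in> Ob C; Y \<in> Ob C; f \<in> Hom C X Y; f \<boxplus> f = f\<rbrakk> \<Longrightarrow> f = Zero C X Y"
  by (metis Add_assoc Zero_Add neg_Add neg_in_Hom)

lemma Comp_Zero_right:
  "\<lbrakk>X \<in> Ob C; Y \<in> Ob C; Z \<in> Ob C; g \<in> Hom C Y Z\<rbrakk> \<Longrightarrow> g \<cdot> Zero C X Y = Zero C X Z"
  using Comp_Add_right[of X Y Z "Zero C X Y" "Zero C X Y" g]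
  by (intro Add_idem_eq_Zero) (auto intro: Comp_in_Hom Zero_in_Hom simp: Zero_Add Zero_in_Hom)

lemma Comp_Zero_left:
  "\<lbrakk>X \<in> Ob C; Y \<in> Ob C; Z \<in> Ob C; f \<in> Hom C X Y\<rbrakk> \<Longrightarrow> Zero C Y Z \<cdot> f = Zero C X Z"
  using Comp_Add_left[of X Y Z f "Zero C Y Z" "Zero C Y Z"]
  by (intro Add_idem_eq_Zero) (auto intro: Comp_in_Hom Zero_in_Hom simp: Zero_Add Zero_in_Hom)

end

section \<open>Arrows as elements of a ring\<close>

text \<open>
  Arrows of a preadditive category act by composition on families of arrows, and so become
  elements of a ring, where equations need no typing side conditions. Since a type cannot depend
  on a category, \<open>hom_vec\<close> consists of families indexed by all preadditive categories at once (and
  by a source \<open>T\<close>, a degree and a target), and an arrow acts only on the entries of its own category.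
\<close>

definition typed_position :: "('o, 'm) ab_cat \<Rightarrow> 'o \<Rightarrow> 'o \<Rightarrow> bool" where
  "typed_position A T X \<longleftrightarrow> preadditive A \<and> T \<in> Ob A \<and> X \<in> Ob A"

text \<open>Untyped positions carry the fixed value \<open>undefined\<close>, so vectors are equal
  once their entries at typed positions agree. Since a typed position includes
  \<open>preadditive A\<close>, every hom-set there is a group, and its zero also shows that the
  type is nonempty.\<close>

typedef ('o, 'm) hom_vec =
  "{v :: ('o, 'm) ab_cat \<Rightarrow> 'o \<Rightarrow> int \<Rightarrow> 'o \<Rightarrow> 'm. \<forall>A T n X.
     (typed_position A T X \<longrightarrow> v A T n X \<in> Hom A T X) \<and>
     (\<not> typed_position A T X \<longrightarrow> v A T n X = undefined)}"
  morphisms entry Abs_hom_vec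
  by (rule exI[of _ "\<lambda>A T n X. if typed_position A T X then Zero A T X else undefined"])
     (auto simp: typed_position_def preadditive.Zero_in_Hom)

lemma entry_in_Hom: "typed_position A T X \<Longrightarrow> entry v A T n X \<in> Hom A T X"
  using entry[of v] by simp

lemma entry_undefined: "\<not> typed_position A T X \<Longrightarrow> entry v A T n X = undefined"
  using entry[of v] by simp

definition make_vec ::
  "(('o, 'm) ab_cat \<Rightarrow> 'o \<Rightarrow> int \<Rightarrow> 'o \<Rightarrow> 'm) \<Rightarrow> ('o, 'm) hom_vec" where
  "make_vec v = Abs_hom_vec (\<lambda>A T n X. if typed_position A T X then v A T n X else undefined)"

lemma entry_make_vec:
  assumes "\<And>A T n X. typed_position A T X \<Longrightarrow> v A T n X \<in> Hom A T X" and "typed_position A T X"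
  shows "entry (make_vec v) A T n X = v A T n X"
  unfolding make_vec_def using assms by (subst Abs_hom_vec_inverse) auto

lemma hom_vec_eqI:
  assumes "\<And>A T n X. typed_position A T X \<Longrightarrow> entry v A T n X = entry w A T n X"
  shows "v = w"
proof (rule iffD1[OF entry_inject], intro ext)
  fix A T n X
  show "entry v A T n X = entry w A T n X"
    using assms[of A T X n] entry_undefined[of A T X v n] entry_undefined[of A T X w n] by metis
qed

instantiation hom_vec :: (type, type) ab_group_add
begin

definition "0 = make_vec (\<lambda>A T n X. Zero A T X)"
definition "v + w = make_vec (\<lambda>A T n X. entry v A T n X \<boxplus>\<^bsub>A\<^esub> entry w A T n X)"
definition "- v = make_vec (\<lambda>A T n X. neg A T X (entry v A T n X))"
definition "v - w = v + - (w :: ('a, 'b) hom_vec)"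

lemma entry_zero: "typed_position A T X \<Longrightarrow> entry 0 A T n X = Zero A T X"
  unfolding zero_hom_vec_def by (subst entry_make_vec) (auto simp: typed_position_def preadditive.Zero_in_Hom)

lemma entry_plus:
  "typed_position A T X \<Longrightarrow> entry (v + w) A T n X = entry v A T n X \<boxplus>\<^bsub>A\<^esub> entry w A T n X"
  unfolding plus_hom_vec_def
  by (subst entry_make_vec)
     (auto simp: entry_in_Hom preadditive.Add_in_Hom typed_position_def[THEN iffD1])

lemma entry_uminus: "typed_position A T X \<Longrightarrow> entry (- v) A T n X = neg A T X (entry v A T n X)"
  unfolding uminus_hom_vec_def
  by (subst entry_make_vec)
     (auto simp: entry_in_Hom preadditive.neg_in_Hom typed_position_def[THEN iffD1])

instance
proof
  fix u v w :: "('a, 'b) hom_vec"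
  note [simp] = entry_zero entry_plus entry_uminus
  have pre: "preadditive A" "T \<in> Ob A" "X \<in> Ob A" if "typed_position A T X" for A :: "('a, 'b) ab_cat" and T X
    using that by (auto simp: typed_position_def)
  show "u + v + w = u + (v + w)"
    by (rule hom_vec_eqI) (simp add: preadditive.Add_assoc[OF pre] entry_in_Hom)
  show "u + v = v + u"
    by (rule hom_vec_eqI) (simp add: preadditive.Add_commute[OF pre] entry_in_Hom)
  show "0 + u = u"
    by (rule hom_vec_eqI) (simp add: preadditive.Zero_Add[OF pre] entry_in_Hom)
  show "- u + u = 0"
    by (rule hom_vec_eqI) (simp add: preadditive.neg_Add[OF pre] entry_in_Hom)
  show "u - v = u + - v" by (rule minus_hom_vec_def)
qed

end

text \<open>The endomorphism ring of the abelian group \<open>hom_vec\<close>; additivity of the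
  operators is what makes a left factor distribute over sums.\<close>

typedef ('o, 'm) hom_op =
  "{\<phi> :: ('o, 'm) hom_vec \<Rightarrow> ('o, 'm) hom_vec. \<forall>v w. \<phi> (v + w) = \<phi> v + \<phi> w}"
  morphisms act Abs_hom_op
  by (rule exI[of _ id]) simp

lemma act_add: "act \<phi> (v + w) = act \<phi> v + act \<phi> w"
  using act[of \<phi>] by simp

lemma act_Abs: "(\<And>v w. \<phi> (v + w) = \<phi> v + \<phi> w) \<Longrightarrow> act (Abs_hom_op \<phi>) = \<phi>"
  by (rule Abs_hom_op_inverse) simp

lemma hom_op_eqI: "(\<And>v. act \<phi> v = act \<psi> v) \<Longrightarrow> \<phi> = \<psi>"
  by (intro iffD1[OF act_inject] ext)

text \<open>No unit is singled out: the identity arrows of each family of objects act as an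
  idempotent of their own, introduced below as \<open>unit\<close>.\<close>

instantiation hom_op :: (type, type) ring
begin

definition "0 = Abs_hom_op (\<lambda>v. 0)"
definition "\<phi> + \<psi> = Abs_hom_op (\<lambda>v. act \<phi> v + act \<psi> v)"
definition "- \<phi> = Abs_hom_op (\<lambda>v. - act \<phi> v)"
definition "\<phi> - \<psi> = \<phi> + - (\<psi> :: ('a, 'b) hom_op)"
definition "\<phi> * \<psi> = Abs_hom_op (\<lambda>v. act \<phi> (act \<psi> v))"

lemma act_zero: "act 0 v = 0"
  unfolding zero_hom_op_def by (subst act_Abs) auto

lemma act_plus: "act (\<phi> + \<psi>) v = act \<phi> v + act \<psi> v"
  unfolding plus_hom_op_def by (subst act_Abs) (auto simp: act_add algebra_simps)

lemma act_uminus: "act (- \<phi>) v = - act \<phi> v"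
  unfolding uminus_hom_op_def by (subst act_Abs) (auto simp: act_add algebra_simps)

lemma act_times: "act (\<phi> * \<psi>) v = act \<phi> (act \<psi> v)"
  unfolding times_hom_op_def by (subst act_Abs) (auto simp: act_add)

instance
  by standard
     (auto intro!: hom_op_eqI simp: act_zero act_plus act_uminus act_times act_add algebra_simps
       minus_hom_op_def)

end

section \<open>Graded maps\<close>

context preadditive
begin

text \<open>Degrees are general because differentials have degree 1, homotopies degree -1, and the
  passage to the shift is expressed by maps of degree -1 and 1.\<close>

definition graded_hom :: "int \<Rightarrow> (int \<Rightarrow> 'o) \<Rightarrow> (int \<Rightarrow> 'o) \<Rightarrow> (int \<Rightarrow> 'm) set" where
  "graded_hom k X Y = {f. \<forall>n. X n \<in> Ob C \<and> Y n \<in> Ob C \<and> f n \<in> Hom C (X n) (Y (n + k))}"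

end

locale plain_preadditive = preadditive C for C :: "('o, 'm) ab_cat" (structure)
begin

definition graded_action ::
  "int \<Rightarrow> (int \<Rightarrow> 'o) \<Rightarrow> (int \<Rightarrow> 'o) \<Rightarrow> (int \<Rightarrow> 'm) \<Rightarrow> ('o, 'm) hom_vec \<Rightarrow> ('o, 'm) hom_vec" where
  "graded_action k X Y f v = make_vec (\<lambda>A T n Z.
     if A = C \<and> Z = Y n then f (n - k) \<cdot> entry v C T (n - k) (X (n - k)) else Zero A T Z)"

text \<open>The entry of the source \<open>X\<^sup>n\<^sup>-\<^sup>k\<close> is moved by \<open>f\<^sup>n\<^sup>-\<^sup>k\<close> to the target \<open>Y\<^sup>n\<close>; all other entries
  of the result are zero, so operators of noncomposable arrows multiply to \<open>0\<close>.\<close>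

lemma entry_graded_action:
  assumes "f \<in> graded_hom k X Y" and "typed_position A T Z"
  shows "entry (graded_action k X Y f v) A T n Z =
     (if A = C \<and> Z = Y n then f (n - k) \<cdot> entry v C T (n - k) (X (n - k)) else Zero A T Z)"
proof -
  have "f (n - k) \<cdot> entry v C T (n - k) (X (n - k)) \<in> Hom C T (Y n)" if "T \<in> Ob C" for T n
  proof (rule Comp_in_Hom)
    show "entry v C T (n - k) (X (n - k)) \<in> Hom C T (X (n - k))"
      using assms(1) that
      by (intro entry_in_Hom) (auto simp: typed_position_def graded_hom_def preadditive_axioms)
    show "f (n - k) \<in> Hom C (X (n - k)) (Y n)"
      using assms(1) by (auto simp: graded_hom_def dest: spec[of _ "n - k"])
  qed (use assms(1) that in \<open>auto simp: graded_hom_def\<close>)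
  then show ?thesis
    unfolding graded_action_def using assms(2)
    by (subst entry_make_vec) (auto simp: typed_position_def preadditive.Zero_in_Hom)
qed

lemma graded_action_add:
  assumes "f \<in> graded_hom k X Y"
  shows "graded_action k X Y f (v + w) = graded_action k X Y f v + graded_action k X Y f w"
proof (rule hom_vec_eqI)
  fix A :: "('o, 'm) ab_cat" and T n Z assume t: "typed_position A T Z"
  then interpret A: preadditive A by (simp add: typed_position_def)
  show "entry (graded_action k X Y f (v + w)) A T n Z =
        entry (graded_action k X Y f v + graded_action k X Y f w) A T n Z"
  proof (cases "A = C \<and> Z = Y n")
    case True
    have p: "typed_position C T (X (n - k))"
      using t assms True by (auto simp: typed_position_def graded_hom_def)
    have "f (n - k) \<in> Hom C (X (n - k)) (Y n)"
      using assms by (auto simp: graded_hom_def dest: spec[of _ "n - k"])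
    then show ?thesis
      using True t p entry_in_Hom[OF p] assms
      by (auto simp: entry_graded_action[OF assms] entry_plus typed_position_def graded_hom_def
          intro!: Comp_Add_right[of T "X (n - k)" "Y n"])
  next
    case False
    then show ?thesis
      using t by (auto simp: entry_graded_action[OF assms] entry_plus A.Zero_Add A.Zero_in_Hom typed_position_def)
  qed
qed

definition emb :: "int \<Rightarrow> (int \<Rightarrow> 'o) \<Rightarrow> (int \<Rightarrow> 'o) \<Rightarrow> (int \<Rightarrow> 'm) \<Rightarrow> ('o, 'm) hom_op" where
  "emb k X Y f = Abs_hom_op (graded_action k X Y f)"

lemma act_emb: "f \<in> graded_hom k X Y \<Longrightarrow> act (emb k X Y f) = graded_action k X Y f"
  unfolding emb_def by (rule act_Abs) (rule graded_action_add)

text \<open>The total degree is a separate variable \<open>m\<close>, so that a composite can be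
  typed in a reduced degree such as \<open>0\<close> instead of \<open>1 + (-1)\<close>.\<close>

lemma graded_hom_Comp:
  assumes "f \<in> graded_hom k X Y" "g \<in> graded_hom l Y Z" "m = k + l"
  shows "(\<lambda>n. g (n + k) \<cdot> f n) \<in> graded_hom m X Z"
  unfolding graded_hom_def
proof (intro CollectI allI conjI)
  fix n
  show "X n \<in> Ob C" "Z n \<in> Ob C" using assms by (auto simp: graded_hom_def)
  have "g (n + k) \<in> Hom C (Y (n + k)) (Z (n + k + l))" using assms by (auto simp: graded_hom_def)
  then show "g (n + k) \<cdot> f n \<in> Hom C (X n) (Z (n + m))"
    using assms by (auto simp: graded_hom_def add.assoc intro!: Comp_in_Hom[of _ "Y (n + k)"])
qed

lemma graded_hom_Add:
  "\<lbrakk>f \<in> graded_hom k X Y; g \<in> graded_hom k X Y\<rbrakk> \<Longrightarrow> (\<lambda>n. f n \<boxplus> g n) \<in> graded_hom k X Y"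
  by (auto simp: graded_hom_def intro: Add_in_Hom)

lemma graded_hom_Zero:
  "\<lbrakk>\<And>n. X n \<in> Ob C; \<And>n. Y n \<in> Ob C\<rbrakk> \<Longrightarrow> (\<lambda>n. Zero C (X n) (Y (n + k))) \<in> graded_hom k X Y"
  by (auto simp: graded_hom_def intro: Zero_in_Hom)

lemma graded_hom_neg:
  "f \<in> graded_hom k X Y \<Longrightarrow> (\<lambda>n. neg C (X n) (Y (n + k)) (f n)) \<in> graded_hom k X Y"
  by (auto simp: graded_hom_def intro: neg_in_Hom)

lemma graded_hom_Idn:
  "(\<And>n. X n \<in> Ob C) \<Longrightarrow> (\<lambda>n. Idn C (X n)) \<in> graded_hom 0 X X"
  by (auto simp: graded_hom_def intro: Idn_in_Hom)

text \<open>At the entries with target \<open>Z n\<close> this is associativity of composition; at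
  all others both sides are zero. The order of functions is kept: the right factor acts
  first.\<close>

lemma emb_Comp:
  assumes f: "f \<in> graded_hom k X Y" and g: "g \<in> graded_hom l Y Z" and m: "m = k + l"
  shows "emb m X Z (\<lambda>n. g (n + k) \<cdot> f n) = emb l Y Z g * emb k X Y f"
proof (rule hom_op_eqI, rule hom_vec_eqI)
  fix v and A :: "('o, 'm) ab_cat" and T n W assume t: "typed_position A T W"
  then interpret A: preadditive A by (simp add: typed_position_def)
  have gf: "(\<lambda>n. g (n + k) \<cdot> f n) \<in> graded_hom m X Z"
    by (rule graded_hom_Comp) fact+
  show "entry (act (emb m X Z (\<lambda>n. g (n + k) \<cdot> f n)) v) A T n W =
        entry (act (emb l Y Z g * emb k X Y f) v) A T n W"
  proof (cases "A = C \<and> W = Z n")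
    case True
    have ob: "T \<in> Ob C" "X (n - k - l) \<in> Ob C" "Y (n - l) \<in> Ob C" "Z n \<in> Ob C"
      using t f g True by (auto simp: typed_position_def graded_hom_def)
    then have p: "typed_position C T (X (n - k - l))" "typed_position C T (Y (n - l))"
      using t f g True by (auto simp: typed_position_def)
    have hg: "g (n - l) \<in> Hom C (Y (n - l)) (Z n)"
      using g by (auto simp: graded_hom_def dest: spec[of _ "n - l"])
    have hf: "f (n - k - l) \<in> Hom C (X (n - k - l)) (Y (n - l))"
      using f by (auto simp: graded_hom_def dest!: spec[of _ "n - k - l"])
    have e: "n - l - k = n - k - l" "n - (k + l) = n - k - l" "n - k - l + k = n - l" by auto
    show ?thesis
      using True t p Comp_assoc[OF ob(1,2,3,4) entry_in_Hom[OF p(1)] hf hg]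
      by (simp add: act_emb[OF f] act_emb[OF g] act_emb[OF gf[unfolded m]] act_times
          entry_graded_action[OF gf[unfolded m]] entry_graded_action[OF g]
          entry_graded_action[OF f] m e)
  next
    case False
    then show ?thesis
      using t by (auto simp: act_emb f g gf act_times entry_graded_action[OF gf] entry_graded_action[OF g])
  qed
qed

lemma emb_Add:
  assumes f: "f \<in> graded_hom k X Y" and g: "g \<in> graded_hom k X Y"
  shows "emb k X Y (\<lambda>n. f n \<boxplus> g n) = emb k X Y f + emb k X Y g"
proof (rule hom_op_eqI, rule hom_vec_eqI)
  fix v and A :: "('o, 'm) ab_cat" and T n W assume t: "typed_position A T W"
  then interpret A: preadditive A by (simp add: typed_position_def)
  note fg = graded_hom_Add[OF f g]
  show "entry (act (emb k X Y (\<lambda>n. f n \<boxplus> g n)) v) A T n W =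
        entry (act (emb k X Y f + emb k X Y g) v) A T n W"
  proof (cases "A = C \<and> W = Y n")
    case True
    have ob: "T \<in> Ob C" "X (n - k) \<in> Ob C" "Y n \<in> Ob C"
      using t f True by (auto simp: typed_position_def graded_hom_def)
    then have p: "typed_position C T (X (n - k))"
      using t True by (auto simp: typed_position_def)
    have hf: "f (n - k) \<in> Hom C (X (n - k)) (Y n)"
      using f by (auto simp: graded_hom_def dest: spec[of _ "n - k"])
    have hg: "g (n - k) \<in> Hom C (X (n - k)) (Y n)"
      using g by (auto simp: graded_hom_def dest: spec[of _ "n - k"])
    show ?thesis
      using True t Comp_Add_left[OF ob(1,2,3) entry_in_Hom[OF p] hf hg]
      by (simp add: act_emb f g fg act_plus entry_graded_action[OF fg] entry_graded_action[OF g]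
          entry_graded_action[OF f] entry_plus)
  next
    case False
    then show ?thesis
      using t by (auto simp: act_emb f g fg act_plus entry_graded_action[OF fg] entry_graded_action[OF g]
          entry_graded_action[OF f] entry_plus A.Zero_Add A.Zero_in_Hom typed_position_def)
  qed
qed

text \<open>The Yoneda argument: on a vector whose entry from \<open>X n\<close> to
  \<open>X n\<close> is the identity, the operator returns \<open>f n\<close>. The zeros elsewhere
  in \<open>v\<close> are only filler.\<close>

lemma emb_inject:
  assumes f: "f \<in> graded_hom k X Y" and g: "g \<in> graded_hom k X Y" and eq: "emb k X Y f = emb k X Y g"
  shows "f = g"
proof
  fix n
  have ob: "X n \<in> Ob C" "Y (n + k) \<in> Ob C" using f by (auto simp: graded_hom_def)
  define v where "v = make_vec (\<lambda>A T m Z. if A = C \<and> T = Z then Idn C T else Zero A T Z)"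
  have "entry v C (X n) n (X n) = Idn C (X n)"
    unfolding v_def using ob preadditive_axioms
    by (subst entry_make_vec)
       (auto simp: typed_position_def intro: preadditive.Zero_in_Hom Idn_in_Hom)
  then have *: "entry (graded_action k X Y h v) C (X n) (n + k) (Y (n + k)) = h n"
    if "h \<in> graded_hom k X Y" for h
    using that ob preadditive_axioms
    by (subst entry_graded_action) (auto simp: typed_position_def graded_hom_def intro: Comp_Idn)
  show "f n = g n"
    using *[OF f] *[OF g] eq act_emb[OF f] act_emb[OF g] by metis
qed

lemma emb_Zero:
  assumes "\<And>n. X n \<in> Ob C" "\<And>n. Y n \<in> Ob C"
  shows "emb k X Y (\<lambda>n. Zero C (X n) (Y (n + k))) = 0"
proof -
  let ?z = "\<lambda>n. Zero C (X n) (Y (n + k))"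
  have z: "?z \<in> graded_hom k X Y" using assms by (rule graded_hom_Zero)
  have "(\<lambda>n. ?z n \<boxplus> ?z n) = ?z"
    using assms by (auto simp: Zero_Add Zero_in_Hom)
  then show ?thesis using emb_Add[OF z z] by simp
qed

lemma emb_neg:
  assumes f: "f \<in> graded_hom k X Y"
  shows "emb k X Y (\<lambda>n. neg C (X n) (Y (n + k)) (f n)) = - emb k X Y f"
proof -
  have "(\<lambda>n. neg C (X n) (Y (n + k)) (f n) \<boxplus> f n) = (\<lambda>n. Zero C (X n) (Y (n + k)))"
    using f by (auto simp: neg_Add graded_hom_def)
  then have "emb k X Y (\<lambda>n. neg C (X n) (Y (n + k)) (f n)) + emb k X Y f = 0"
    using emb_Add[OF graded_hom_neg[OF f] f] emb_Zero f by (simp add: graded_hom_def)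
  then show ?thesis by (simp add: eq_neg_iff_add_eq_0)
qed

definition unit :: "(int \<Rightarrow> 'o) \<Rightarrow> ('o, 'm) hom_op" where
  "unit X = emb 0 X X (\<lambda>n. Idn C (X n))"

definition graded_map :: "int \<Rightarrow> (int \<Rightarrow> 'o) \<Rightarrow> (int \<Rightarrow> 'o) \<Rightarrow> ('o, 'm) hom_op \<Rightarrow> bool" where
  "graded_map k X Y x \<longleftrightarrow> (\<forall>n. X n \<in> Ob C \<and> Y n \<in> Ob C) \<and> x \<in> emb k X Y ` graded_hom k X Y"

definition components :: "int \<Rightarrow> (int \<Rightarrow> 'o) \<Rightarrow> (int \<Rightarrow> 'o) \<Rightarrow> ('o, 'm) hom_op \<Rightarrow> int \<Rightarrow> 'm" where
  "components k X Y x = inv_into (graded_hom k X Y) (emb k X Y) x"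

lemma graded_map_emb: "f \<in> graded_hom k X Y \<Longrightarrow> graded_map k X Y (emb k X Y f)"
  by (auto simp: graded_map_def graded_hom_def)

lemma components_in: "graded_map k X Y x \<Longrightarrow> components k X Y x \<in> graded_hom k X Y"
  by (auto simp: graded_map_def components_def intro: inv_into_into)

lemma emb_components: "graded_map k X Y x \<Longrightarrow> emb k X Y (components k X Y x) = x"
  unfolding graded_map_def components_def using f_inv_into_f[of x "emb k X Y"] by blast

lemma components_emb: "f \<in> graded_hom k X Y \<Longrightarrow> components k X Y (emb k X Y f) = f"
  by (meson components_in emb_components emb_inject graded_map_emb)

lemma graded_map_objects:
  "graded_map k X Y x \<Longrightarrow> X n \<in> Ob C" "graded_map k X Y x \<Longrightarrow> Y n \<in> Ob C"
  by (auto simp: graded_map_def)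

lemma graded_map_times:
  assumes "graded_map k X Y x" "graded_map l Y Z y" "m = k + l"
  shows "graded_map m X Z (y * x)"
proof -
  obtain f g where fg: "f \<in> graded_hom k X Y" "x = emb k X Y f" "g \<in> graded_hom l Y Z" "y = emb l Y Z g"
    using assms by (auto simp: graded_map_def)
  show ?thesis using graded_map_emb[OF graded_hom_Comp[OF fg(1,3) assms(3)]]
    by (simp add: emb_Comp[OF fg(1,3) assms(3)] fg)
qed

lemma graded_map_plus:
  assumes "graded_map k X Y x" "graded_map k X Y y"
  shows "graded_map k X Y (x + y)"
proof -
  obtain f g where fg: "f \<in> graded_hom k X Y" "x = emb k X Y f" "g \<in> graded_hom k X Y" "y = emb k X Y g"
    using assms by (auto simp: graded_map_def)
  show ?thesis using graded_map_emb[OF graded_hom_Add[OF fg(1,3)]]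
    by (simp add: emb_Add[OF fg(1,3)] fg)
qed

lemma graded_map_uminus:
  assumes "graded_map k X Y x"
  shows "graded_map k X Y (- x)"
proof -
  obtain f where f: "f \<in> graded_hom k X Y" "x = emb k X Y f"
    using assms by (auto simp: graded_map_def)
  show ?thesis using graded_map_emb[OF graded_hom_neg[OF f(1)]] by (simp add: emb_neg f)
qed

lemma graded_map_minus:
  "\<lbrakk>graded_map k X Y x; graded_map k X Y y\<rbrakk> \<Longrightarrow> graded_map k X Y (x - y)"
  using graded_map_plus[of k X Y x "- y"] graded_map_uminus[of k X Y y] by simp

lemma graded_map_0:
  assumes "\<And>n. X n \<in> Ob C" "\<And>n. Y n \<in> Ob C"
  shows "graded_map k X Y 0"
  using graded_map_emb[OF graded_hom_Zero[OF assms], of k] emb_Zero[OF assms, of k] by simp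

lemma graded_map_unit: "(\<And>n. X n \<in> Ob C) \<Longrightarrow> graded_map 0 X X (unit X)"
  unfolding unit_def by (rule graded_map_emb, rule graded_hom_Idn)

lemma unit_times:
  assumes "graded_map k X Y x" shows "unit Y * x = x"
proof -
  obtain f where f: "f \<in> graded_hom k X Y" "x = emb k X Y f"
    using assms by (auto simp: graded_map_def)
  have "(\<lambda>n. Idn C (Y (n + k)) \<cdot> f n) = f"
    using f by (auto simp: graded_hom_def intro: Idn_Comp)
  then show ?thesis
    using emb_Comp[OF f(1) graded_hom_Idn[of Y], of k] graded_map_objects[OF assms]
    by (simp add: unit_def f)
qed

lemma times_unit:
  assumes "graded_map k X Y x" shows "x * unit X = x"
proof -
  obtain f where f: "f \<in> graded_hom k X Y" "x = emb k X Y f"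
    using assms by (auto simp: graded_map_def)
  have "(\<lambda>n. f n \<cdot> Idn C (X n)) = f"
    using f by (auto simp: graded_hom_def intro: Comp_Idn)
  then show ?thesis
    using emb_Comp[OF graded_hom_Idn[of X] f(1), of k] graded_map_objects[OF assms]
    by (simp add: unit_def f)
qed

end

section \<open>Complexes and homotopy classes\<close>

context plain_preadditive
begin

abbreviation gmap ::
  "int \<Rightarrow> ('o, 'm) cochain_complex \<Rightarrow> ('o, 'm) cochain_complex \<Rightarrow> ('o, 'm) hom_op \<Rightarrow> bool" where
  "gmap k X Y \<equiv> graded_map k (obj X) (obj Y)"

definition dif :: "('o, 'm) cochain_complex \<Rightarrow> ('o, 'm) hom_op" where
  "dif X = emb 1 (obj X) (obj X) (diff X)"

text \<open>The square of the differential is an element of degree 2; by injectivity of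
  \<open>emb\<close> it vanishes in the ring exactly if it vanishes in every degree.\<close>

lemma is_complex_iff:
  "is_complex C X \<longleftrightarrow> diff X \<in> graded_hom 1 (obj X) (obj X) \<and> dif X * dif X = 0"
proof (cases "diff X \<in> graded_hom 1 (obj X) (obj X)")
  case True
  then have ob: "\<And>n. obj X n \<in> Ob C" by (auto simp: graded_hom_def)
  have dd: "emb 2 (obj X) (obj X) (\<lambda>n. diff X (n + 1) \<cdot> diff X n) = dif X * dif X"
    unfolding dif_def by (rule emb_Comp[OF True True]) simp
  have gdd: "(\<lambda>n. diff X (n + 1) \<cdot> diff X n) \<in> graded_hom 2 (obj X) (obj X)"
    by (rule graded_hom_Comp[OF True True]) simp
  note z = graded_hom_Zero[of "obj X" "obj X" 2, OF ob ob]
  have "dif X * dif X = 0 \<longleftrightarrow>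
      (\<lambda>n. diff X (n + 1) \<cdot> diff X n) = (\<lambda>n. Zero C (obj X n) (obj X (n + 2)))"
    using emb_inject[OF gdd z] emb_Zero[of "obj X" "obj X" 2, OF ob ob] dd by auto
  then show ?thesis using True by (auto simp: is_complex_def graded_hom_def fun_eq_iff)
next
  case False
  then show ?thesis by (auto simp: is_complex_def graded_hom_def)
qed

lemma complex_obj: "is_complex C X \<Longrightarrow> obj X n \<in> Ob C"
  by (simp add: is_complex_def)

lemma gmap_dif: "is_complex C X \<Longrightarrow> gmap 1 X X (dif X)"
  by (simp add: is_complex_iff dif_def graded_map_emb)

lemma dif_dif: "is_complex C X \<Longrightarrow> dif X * dif X = 0"
  by (simp add: is_complex_iff)

lemma dif_dif_times: "is_complex C X \<Longrightarrow> dif X * (dif X * z) = 0"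
  by (simp add: dif_dif flip: mult.assoc)

text \<open>Both complexes belong to the predicate, so a single typing fact discharges the side
  conditions of the ring rules.\<close>

definition cmap ::
  "('o, 'm) cochain_complex \<Rightarrow> ('o, 'm) cochain_complex \<Rightarrow> ('o, 'm) hom_op \<Rightarrow> bool" where
  "cmap X Y x \<longleftrightarrow> is_complex C X \<and> is_complex C Y \<and> gmap 0 X Y x \<and> x * dif X = dif Y * x"

text \<open>Two maps are homotopic if their difference is null. Null maps are closed under sums and
  under composition with chain maps on either side, which makes the operations on homotopy classes
  well defined.\<close>

definition null ::
  "('o, 'm) cochain_complex \<Rightarrow> ('o, 'm) cochain_complex \<Rightarrow> ('o, 'm) hom_op \<Rightarrow> bool" where
  "null X Y x \<longleftrightarrow> (\<exists>h. gmap (-1) X Y h \<and> x = dif Y * h + h * dif X)"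

lemma chain_maps_iff:
  assumes "is_complex C X" "is_complex C Y"
  shows "f \<in> chain_maps C X Y \<longleftrightarrow> f \<in> graded_hom 0 (obj X) (obj Y) \<and> cmap X Y (emb 0 (obj X) (obj Y) f)"
proof (cases "f \<in> graded_hom 0 (obj X) (obj Y)")
  case True
  have dX: "diff X \<in> graded_hom 1 (obj X) (obj X)" and dY: "diff Y \<in> graded_hom 1 (obj Y) (obj Y)"
    using assms by (auto simp: is_complex_iff)
  have "emb 0 (obj X) (obj Y) f * dif X = dif Y * emb 0 (obj X) (obj Y) f \<longleftrightarrow>
     (\<lambda>n. f (n + 1) \<cdot> diff X n) = (\<lambda>n. diff Y n \<cdot> f n)"
    using emb_inject[OF graded_hom_Comp[OF dX True, of 1] graded_hom_Comp[OF True dY, of 1]]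
      emb_Comp[OF dX True, of 1] emb_Comp[OF True dY, of 1]
    by (auto simp: dif_def)
  then show ?thesis
    using True assms by (auto simp: cmap_def graded_map_emb chain_maps_def graded_hom_def fun_eq_iff)
next
  case False
  then show ?thesis using assms by (auto simp: chain_maps_def graded_hom_def complex_obj)
qed

lemma homotopic_iff:
  assumes "is_complex C X" "is_complex C Y"
    and f: "f \<in> graded_hom 0 (obj X) (obj Y)" and g: "g \<in> graded_hom 0 (obj X) (obj Y)"
  shows "homotopic C X Y f g \<longleftrightarrow> null X Y (emb 0 (obj X) (obj Y) f - emb 0 (obj X) (obj Y) g)"
proof -
  have dX: "diff X \<in> graded_hom 1 (obj X) (obj X)" and dY: "diff Y \<in> graded_hom 1 (obj Y) (obj Y)"
    using assms by (auto simp: is_complex_iff)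
  have *: "f = (\<lambda>n. g n \<boxplus> (diff Y (n - 1) \<cdot> h n \<boxplus> h (n + 1) \<cdot> diff X n)) \<longleftrightarrow>
     emb 0 (obj X) (obj Y) f - emb 0 (obj X) (obj Y) g =
       dif Y * emb (-1) (obj X) (obj Y) h + emb (-1) (obj X) (obj Y) h * dif X"
    if h: "h \<in> graded_hom (-1) (obj X) (obj Y)" for h
  proof -
    have 1: "(\<lambda>n. diff Y (n - 1) \<cdot> h n) \<in> graded_hom 0 (obj X) (obj Y)"
      using graded_hom_Comp[OF h dY, of 0] by simp
    have 2: "(\<lambda>n. h (n + 1) \<cdot> diff X n) \<in> graded_hom 0 (obj X) (obj Y)"
      using graded_hom_Comp[OF dX h, of 0] by simp
    note 3 = graded_hom_Add[OF 1 2] note 4 = graded_hom_Add[OF g 3]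
    have "emb 0 (obj X) (obj Y) (\<lambda>n. g n \<boxplus> (diff Y (n - 1) \<cdot> h n \<boxplus> h (n + 1) \<cdot> diff X n)) =
      emb 0 (obj X) (obj Y) g +
       (dif Y * emb (-1) (obj X) (obj Y) h + emb (-1) (obj X) (obj Y) h * dif X)"
      using emb_Add[OF 1 2] emb_Add[OF g 3] emb_Comp[OF h dY, of 0] emb_Comp[OF dX h, of 0]
      by (simp add: dif_def)
    then show ?thesis using emb_inject[OF f 4] by (auto simp: algebra_simps)
  qed
  show ?thesis
  proof
    assume "homotopic C X Y f g"
    then obtain h where h: "\<And>n. h n \<in> Hom C (obj X n) (obj Y (n - 1))"
      and e: "f = (\<lambda>n. g n \<boxplus> (diff Y (n - 1) \<cdot> h n \<boxplus> h (n + 1) \<cdot> diff X n))"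
      unfolding homotopic_def by blast
    have h': "h \<in> graded_hom (-1) (obj X) (obj Y)"
      using h assms by (auto simp: graded_hom_def complex_obj)
    then show "null X Y (emb 0 (obj X) (obj Y) f - emb 0 (obj X) (obj Y) g)"
      using *[OF h'] e graded_map_emb[OF h'] unfolding null_def by auto
  next
    assume "null X Y (emb 0 (obj X) (obj Y) f - emb 0 (obj X) (obj Y) g)"
    then obtain h where "h \<in> graded_hom (-1) (obj X) (obj Y)"
      "emb 0 (obj X) (obj Y) f - emb 0 (obj X) (obj Y) g =
       dif Y * emb (-1) (obj X) (obj Y) h + emb (-1) (obj X) (obj Y) h * dif X"
      unfolding null_def graded_map_def by blast
    with * show "homotopic C X Y f g"
      unfolding homotopic_def by (intro exI[of _ h]) (auto simp: graded_hom_def fun_eq_iff)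
  qed
qed

lemma cmapI:
  "\<lbrakk>is_complex C X; is_complex C Y; gmap 0 X Y x; x * dif X = dif Y * x\<rbrakk> \<Longrightarrow> cmap X Y x"
  by (simp add: cmap_def)

lemma nullI: "\<lbrakk>gmap (-1) X Y h; x = dif Y * h + h * dif X\<rbrakk> \<Longrightarrow> null X Y x"
  by (auto simp: null_def)

lemma cmap_complex: "cmap X Y x \<Longrightarrow> is_complex C X" "cmap X Y x \<Longrightarrow> is_complex C Y"
  by (simp_all add: cmap_def)

lemma cmap_gmap: "cmap X Y x \<Longrightarrow> gmap 0 X Y x"
  by (simp add: cmap_def)

lemma cmap_dif: "cmap X Y x \<Longrightarrow> x * dif X = dif Y * x"
  by (simp add: cmap_def)

lemma cmap_dif_times: "cmap X Y x \<Longrightarrow> x * (dif X * z) = dif Y * (x * z)"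
  by (simp add: cmap_def flip: mult.assoc)

lemma cmap_times: "\<lbrakk>cmap X Y x; cmap Y Z y\<rbrakk> \<Longrightarrow> cmap X Z (y * x)"
  by (auto simp: cmap_def mult.assoc intro: graded_map_times) (simp flip: mult.assoc)

lemma cmap_plus: "\<lbrakk>cmap X Y x; cmap X Y y\<rbrakk> \<Longrightarrow> cmap X Y (x + y)"
  by (auto simp: cmap_def algebra_simps intro: graded_map_plus)

lemma cmap_uminus: "cmap X Y x \<Longrightarrow> cmap X Y (- x)"
  by (auto simp: cmap_def algebra_simps intro: graded_map_uminus)

lemma cmap_0: "\<lbrakk>is_complex C X; is_complex C Y\<rbrakk> \<Longrightarrow> cmap X Y 0"
  by (auto simp: cmap_def complex_obj intro: graded_map_0)

lemma cmap_unit: "is_complex C X \<Longrightarrow> cmap X X (unit (obj X))"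
  using unit_times[OF gmap_dif] times_unit[OF gmap_dif]
  by (auto simp: cmap_def complex_obj intro: graded_map_unit)

lemma null_0: "\<lbrakk>is_complex C X; is_complex C Y\<rbrakk> \<Longrightarrow> null X Y 0"
  by (rule nullI[of _ _ 0]) (auto simp: complex_obj intro: graded_map_0)

lemma null_plus: "\<lbrakk>null X Y x; null X Y y\<rbrakk> \<Longrightarrow> null X Y (x + y)"
  unfolding null_def
proof (elim exE conjE)
  fix h h' assume h: "gmap (- 1) X Y h" "x = dif Y * h + h * dif X"
    "gmap (- 1) X Y h'" "y = dif Y * h' + h' * dif X"
  show "\<exists>h. gmap (- 1) X Y h \<and> x + y = dif Y * h + h * dif X"
    by (rule exI[of _ "h + h'"]) (simp add: h graded_map_plus algebra_simps)
qed

lemma null_uminus: "null X Y x \<Longrightarrow> null X Y (- x)"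
  unfolding null_def
proof (elim exE conjE)
  fix h assume h: "gmap (- 1) X Y h" "x = dif Y * h + h * dif X"
  show "\<exists>h. gmap (- 1) X Y h \<and> - x = dif Y * h + h * dif X"
    by (rule exI[of _ "- h"]) (simp add: h graded_map_uminus)
qed

lemma null_times_left: "\<lbrakk>null X Y x; cmap Y Z y\<rbrakk> \<Longrightarrow> null X Z (y * x)"
proof -
  assume "null X Y x" and y: "cmap Y Z y"
  then obtain h where h: "gmap (-1) X Y h" "x = dif Y * h + h * dif X" by (auto simp: null_def)
  have "gmap (-1) X Z (y * h)" using h y by (auto simp: cmap_def intro: graded_map_times)
  then show ?thesis
    by (rule nullI) (use h y in \<open>simp add: cmap_dif_times algebra_simps\<close>)
qed

lemma null_times_right: "\<lbrakk>null Y Z y; cmap X Y x\<rbrakk> \<Longrightarrow> null X Z (y * x)"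
proof -
  assume "null Y Z y" and x: "cmap X Y x"
  then obtain h where h: "gmap (-1) Y Z h" "y = dif Z * h + h * dif Y" by (auto simp: null_def)
  have "gmap (-1) X Z (h * x)" using h x by (auto simp: cmap_def intro: graded_map_times)
  then show ?thesis
    by (rule nullI) (use h x in \<open>simp add: cmap_dif algebra_simps\<close>)
qed

lemma null_minus_swap: "null X Y (x - y) \<longleftrightarrow> null X Y (y - x)"
  using null_uminus[of X Y "x - y"] null_uminus[of X Y "y - x"] by auto

lemma null_minus_trans: "\<lbrakk>null X Y (x - y); null X Y (y - z)\<rbrakk> \<Longrightarrow> null X Y (x - z)"
  using null_plus[of X Y "x - y" "y - z"] by simp

section \<open>Homotopy classes as arrows\<close>

definition hclass ::
  "('o, 'm) cochain_complex \<Rightarrow> ('o, 'm) cochain_complex \<Rightarrow> ('o, 'm) hom_op \<Rightarrow> (int \<Rightarrow> 'm) set" where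
  "hclass X Y x = homotopy_class C X Y (components 0 (obj X) (obj Y) x)"

definition karr ::
  "('o, 'm) cochain_complex \<Rightarrow> ('o, 'm) cochain_complex \<Rightarrow> ('o, 'm) hom_op \<Rightarrow> ('o, 'm) htpy_arrow" where
  "karr X Y x = (X, hclass X Y x, Y)"

lemma hclass_eq:
  assumes "cmap X Y x"
  shows "hclass X Y x = components 0 (obj X) (obj Y) ` {y. cmap X Y y \<and> null X Y (x - y)}"
proof (intro Set.set_eqI iffI)
  note c = cmap_complex[OF assms] and g = components_in[OF cmap_gmap[OF assms]]
  fix f
  {
    assume "f \<in> hclass X Y x"
    then have f: "f \<in> chain_maps C X Y" and h: "homotopic C X Y (components 0 (obj X) (obj Y) x) f"
      by (auto simp: hclass_def homotopy_class_def)
    then have f': "f \<in> graded_hom 0 (obj X) (obj Y)" "cmap X Y (emb 0 (obj X) (obj Y) f)"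
      using chain_maps_iff[OF c] by auto
    have "null X Y (x - emb 0 (obj X) (obj Y) f)"
      using homotopic_iff[OF c g f'(1)] h by (simp add: emb_components[OF cmap_gmap[OF assms]])
    then show "f \<in> components 0 (obj X) (obj Y) ` {y. cmap X Y y \<and> null X Y (x - y)}"
      using f' components_emb[OF f'(1)] by (intro image_eqI[of _ _ "emb 0 (obj X) (obj Y) f"]) auto
  }
  assume "f \<in> components 0 (obj X) (obj Y) ` {y. cmap X Y y \<and> null X Y (x - y)}"
  then obtain y where y: "cmap X Y y" "null X Y (x - y)" "f = components 0 (obj X) (obj Y) y" by auto
  have f: "f \<in> graded_hom 0 (obj X) (obj Y)" "emb 0 (obj X) (obj Y) f = y"
    using y components_in emb_components cmap_gmap by auto
  show "f \<in> hclass X Y x"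
    using homotopic_iff[OF c g f(1)] f y chain_maps_iff[OF c]
    by (simp add: hclass_def homotopy_class_def emb_components[OF cmap_gmap[OF assms]])
qed

lemma hclass_eq_iff:
  assumes x: "cmap X Y x" and y: "cmap X Y y"
  shows "hclass X Y x = hclass X Y y \<longleftrightarrow> null X Y (x - y)"
proof
  assume "hclass X Y x = hclass X Y y"
  moreover have "components 0 (obj X) (obj Y) x \<in> hclass X Y x"
    using x null_0[OF cmap_complex[OF x]] by (auto simp: hclass_eq[OF x])
  ultimately obtain z where "cmap X Y z" "null X Y (y - z)"
    "components 0 (obj X) (obj Y) x = components 0 (obj X) (obj Y) z"
    by (auto simp: hclass_eq[OF y])
  then show "null X Y (x - y)" using x emb_components cmap_gmap null_minus_swap by metis
next
  assume "null X Y (x - y)"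
  then show "hclass X Y x = hclass X Y y"
    unfolding hclass_eq[OF x] hclass_eq[OF y]
    using null_minus_trans null_minus_swap by (intro arg_cong[where f = "image _"]) blast
qed

lemma karr_eq_iff:
  "\<lbrakk>cmap X Y x; cmap X Y y\<rbrakk> \<Longrightarrow> karr X Y x = karr X Y y \<longleftrightarrow> null X Y (x - y)"
  by (simp add: karr_def hclass_eq_iff)

lemma htpy_arrow_eq_karr:
  assumes "f \<in> graded_hom 0 (obj X) (obj Y)"
  shows "htpy_arrow C X Y f = karr X Y (emb 0 (obj X) (obj Y) f)"
  by (simp add: htpy_arrow_def karr_def hclass_def components_emb[OF assms])

abbreviation "K \<equiv> homotopy_category C"

lemma K_simps:
  "Ob K = {X. is_complex C X}" "Hom K = Hom (htpy_shift_cat C)" "Idn K = Idn (htpy_shift_cat C)"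
  "Comp K = Comp (htpy_shift_cat C)" "Add K = Add (htpy_shift_cat C)" "Zero K = Zero (htpy_shift_cat C)"
  "ShOb K = shift_complex C" "ShAr K = ShAr (htpy_shift_cat C)" "Tri K = htpy_triangles C"
  by (simp_all add: homotopy_category_def shift_cat.extend_def htpy_shift_cat_def)

lemma Hom_K:
  assumes c: "is_complex C X" "is_complex C Y"
  shows "Hom K X Y = karr X Y ` {x. cmap X Y x}"
proof -
  have "Hom K X Y = htpy_arrow C X Y ` chain_maps C X Y"
    by (simp add: K_simps) (simp add: htpy_shift_cat_def)
  also have "\<dots> = karr X Y ` {x. cmap X Y x}"
  proof (intro Set.set_eqI iffI)
    fix a assume "a \<in> htpy_arrow C X Y ` chain_maps C X Y"
    then show "a \<in> karr X Y ` {x. cmap X Y x}"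
      by (auto simp: chain_maps_iff[OF c] htpy_arrow_eq_karr)
  next
    fix a assume "a \<in> karr X Y ` {x. cmap X Y x}"
    then obtain x where x: "cmap X Y x" "a = karr X Y x" by auto
    note g = components_in[OF cmap_gmap[OF x(1)]] emb_components[OF cmap_gmap[OF x(1)]]
    show "a \<in> htpy_arrow C X Y ` chain_maps C X Y"
      using x g htpy_arrow_eq_karr[OF g(1)]
      by (intro image_eqI[of _ _ "components 0 (obj X) (obj Y) x"]) (auto simp: chain_maps_iff[OF c])
  qed
  finally show ?thesis .
qed

lemma karr_in_Hom: "cmap X Y x \<Longrightarrow> karr X Y x \<in> Hom K X Y"
  using Hom_K cmap_complex by auto

lemma Idn_K: "is_complex C X \<Longrightarrow> Idn K X = karr X X (unit (obj X))"
  using htpy_arrow_eq_karr[OF graded_hom_Idn[of "obj X"]]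
  by (simp add: K_simps unit_def complex_obj) (simp add: htpy_shift_cat_def)

lemma Zero_K: "\<lbrakk>is_complex C X; is_complex C Y\<rbrakk> \<Longrightarrow> Zero K X Y = karr X Y 0"
  using htpy_arrow_eq_karr[OF graded_hom_Zero[of "obj X" "obj Y" 0, simplified]] emb_Zero[of "obj X" "obj Y" 0]
  by (simp add: K_simps complex_obj) (simp add: htpy_shift_cat_def)

lemma components_in_hclass:
  assumes "f \<in> hclass X Y x" "cmap X Y x"
  obtains x' where "cmap X Y x'" "null X Y (x - x')" "f = components 0 (obj X) (obj Y) x'"
  using assms by (auto simp: hclass_eq)

lemma hclass_nonempty: "cmap X Y x \<Longrightarrow> hclass X Y x \<noteq> {}"
  using null_0 cmap_complex by (fastforce simp: hclass_eq)

text \<open>The union over all representatives is one class because every pair gives the same class: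
  \<open>y * x - y' * x'\<close> equals \<open>y * (x - x') + (y - y') * x'\<close>, and both
  summands are null.\<close>

lemma Comp_K:
  assumes x: "cmap X Y x" and y: "cmap Y Z y"
  shows "Comp K (karr Y Z y) (karr X Y x) = karr X Z (y * x)"
proof -
  have *: "homotopy_class C X Z (\<lambda>n. g n \<cdot> f n) = hclass X Z (y * x)"
    if f: "f \<in> hclass X Y x" and g: "g \<in> hclass Y Z y" for f g
  proof -
    obtain x' where x': "cmap X Y x'" "null X Y (x - x')" "f = components 0 (obj X) (obj Y) x'"
      using components_in_hclass[OF f x] .
    obtain y' where y': "cmap Y Z y'" "null Y Z (y - y')" "g = components 0 (obj Y) (obj Z) y'"
      using components_in_hclass[OF g y] .
    have fg: "f \<in> graded_hom 0 (obj X) (obj Y)" "g \<in> graded_hom 0 (obj Y) (obj Z)"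
      using x' y' cmap_gmap components_in by blast+
    have "emb 0 (obj X) (obj Z) (\<lambda>n. g n \<cdot> f n) = y' * x'"
      using emb_Comp[OF fg, of 0] x' y' cmap_gmap emb_components by auto
    then have "(\<lambda>n. g n \<cdot> f n) = components 0 (obj X) (obj Z) (y' * x')"
      using components_emb[OF graded_hom_Comp[OF fg, of 0]] by simp
    moreover have "null X Z (y * x - y' * x')"
      using null_plus[OF null_times_left[OF x'(2) y] null_times_right[OF y'(2) x'(1)]]
      by (simp add: algebra_simps)
    then have "hclass X Z (y * x) = hclass X Z (y' * x')"
      using x y x' y' cmap_times hclass_eq_iff by metis
    ultimately show ?thesis by (simp add: hclass_def)
  qed
  have "(\<Union>f\<in>hclass X Y x. \<Union>g\<in>hclass Y Z y. homotopy_class C X Z (\<lambda>n. g n \<cdot> f n)) = hclass X Z (y * x)"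
    using hclass_nonempty[OF x] hclass_nonempty[OF y] * by auto
  then show ?thesis by (simp add: K_simps) (simp add: htpy_shift_cat_def karr_def)
qed

lemma Add_K:
  assumes x: "cmap X Y x" and y: "cmap X Y y"
  shows "Add K (karr X Y x) (karr X Y y) = karr X Y (x + y)"
proof -
  have *: "homotopy_class C X Y (\<lambda>n. f n \<boxplus> g n) = hclass X Y (x + y)"
    if f: "f \<in> hclass X Y x" and g: "g \<in> hclass X Y y" for f g
  proof -
    obtain x' where x': "cmap X Y x'" "null X Y (x - x')" "f = components 0 (obj X) (obj Y) x'"
      using components_in_hclass[OF f x] .
    obtain y' where y': "cmap X Y y'" "null X Y (y - y')" "g = components 0 (obj X) (obj Y) y'"
      using components_in_hclass[OF g y] .
    have fg: "f \<in> graded_hom 0 (obj X) (obj Y)" "g \<in> graded_hom 0 (obj X) (obj Y)"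
      using x' y' cmap_gmap components_in by blast+
    have "emb 0 (obj X) (obj Y) (\<lambda>n. f n \<boxplus> g n) = x' + y'"
      using emb_Add[OF fg] x' y' cmap_gmap emb_components by auto
    then have "(\<lambda>n. f n \<boxplus> g n) = components 0 (obj X) (obj Y) (x' + y')"
      using components_emb[OF graded_hom_Add[OF fg]] by simp
    moreover have "null X Y (x + y - (x' + y'))"
      using null_plus[OF x'(2) y'(2)] by (simp add: algebra_simps)
    then have "hclass X Y (x + y) = hclass X Y (x' + y')"
      using x y x' y' cmap_plus hclass_eq_iff by metis
    ultimately show ?thesis by (simp add: hclass_def)
  qed
  have "(\<Union>f\<in>hclass X Y x. \<Union>g\<in>hclass X Y y. homotopy_class C X Y (\<lambda>n. f n \<boxplus> g n)) = hclass X Y (x + y)"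
    using hclass_nonempty[OF x] hclass_nonempty[OF y] * by auto
  then show ?thesis by (simp add: K_simps) (simp add: htpy_shift_cat_def karr_def)
qed

section \<open>Shifts\<close>

abbreviation "sh \<equiv> shift_complex C"

text \<open>\<open>sus X : X \<rightarrow> X[1]\<close> and \<open>des X : X[1] \<rightarrow> X\<close> are the identities, regarded as maps of
  degree \<open>-1\<close> and \<open>1\<close>.\<close>

definition sus :: "('o, 'm) cochain_complex \<Rightarrow> ('o, 'm) hom_op" where
  "sus X = emb (-1) (obj X) (obj (sh X)) (\<lambda>n. Idn C (obj X n))"

definition des :: "('o, 'm) cochain_complex \<Rightarrow> ('o, 'm) hom_op" where
  "des X = emb 1 (obj (sh X)) (obj X) (\<lambda>n. Idn C (obj X (n + 1)))"

lemma obj_sh: "obj (sh X) n = obj X (n + 1)"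
  by (simp add: shift_complex_def)

lemma sus_hom: "(\<And>n. obj X n \<in> Ob C) \<Longrightarrow> (\<lambda>n. Idn C (obj X n)) \<in> graded_hom (-1) (obj X) (obj (sh X))"
  by (auto simp: graded_hom_def obj_sh intro: Idn_in_Hom)

lemma des_hom: "(\<And>n. obj X n \<in> Ob C) \<Longrightarrow> (\<lambda>n. Idn C (obj X (n + 1))) \<in> graded_hom 1 (obj (sh X)) (obj X)"
  by (auto simp: graded_hom_def obj_sh intro: Idn_in_Hom)

lemma gmap_sus: "is_complex C X \<Longrightarrow> gmap (-1) X (sh X) (sus X)"
  unfolding sus_def by (intro graded_map_emb sus_hom complex_obj)

lemma gmap_des: "is_complex C X \<Longrightarrow> gmap 1 (sh X) X (des X)"
  unfolding des_def by (intro graded_map_emb des_hom complex_obj)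

lemma des_sus: "is_complex C X \<Longrightarrow> des X * sus X = unit (obj X)"
  using emb_Comp[OF sus_hom des_hom, of X 0]
  by (simp add: sus_def des_def unit_def complex_obj Comp_Idn[OF _ _ Idn_in_Hom])

lemma sus_des: "is_complex C X \<Longrightarrow> sus X * des X = unit (obj (sh X))"
  using emb_Comp[OF des_hom sus_hom, of X 0]
  by (simp add: sus_def des_def unit_def complex_obj obj_sh Comp_Idn[OF _ _ Idn_in_Hom])

text \<open>Reindexing by one is multiplication by the identity of degree one. In this way all
  statements about shifted complexes become products in the ring.\<close>

lemma emb_des:
  assumes "is_complex C X" and f: "f \<in> graded_hom k (obj X) Y" and l: "l = k + 1"
  shows "(\<lambda>n. f (n + 1)) \<in> graded_hom l (obj (sh X)) Y"
    and "emb l (obj (sh X)) Y (\<lambda>n. f (n + 1)) = emb k (obj X) Y f * des X"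
proof -
  have f': "f (n + 1) \<in> Hom C (obj X (n + 1)) (Y (n + 1 + k))" for n
    using f by (auto simp: graded_hom_def)
  have Y: "Y n \<in> Ob C" for n using f by (auto simp: graded_hom_def)
  have d: "(\<lambda>n. Idn C (obj X (n + 1))) \<in> graded_hom 1 (obj (sh X)) (obj X)"
    using des_hom assms complex_obj by blast
  have e: "(\<lambda>n. f (n + 1) \<cdot> Idn C (obj X (n + 1))) = (\<lambda>n. f (n + 1))"
    using f' assms complex_obj Y by (intro ext Comp_Idn) blast+
  have l': "l = 1 + k" using l by simp
  show "(\<lambda>n. f (n + 1)) \<in> graded_hom l (obj (sh X)) Y"
    using graded_hom_Comp[OF d f l'] by (simp add: e)
  show "emb l (obj (sh X)) Y (\<lambda>n. f (n + 1)) = emb k (obj X) Y f * des X"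
    using emb_Comp[OF d f l'] by (simp add: e des_def)
qed

lemma emb_shift:
  assumes "is_complex C X" "is_complex C Y" and f: "f \<in> graded_hom k (obj X) (obj Y)"
  shows "(\<lambda>n. f (n + 1)) \<in> graded_hom k (obj (sh X)) (obj (sh Y))"
    and "emb k (obj (sh X)) (obj (sh Y)) (\<lambda>n. f (n + 1)) = sus Y * emb k (obj X) (obj Y) f * des X"
proof -
  have f': "f (n + 1) \<in> Hom C (obj X (n + 1)) (obj Y (n + 1 + k))" for n
    using f by (auto simp: graded_hom_def)
  show "(\<lambda>n. f (n + 1)) \<in> graded_hom k (obj (sh X)) (obj (sh Y))"
    using f' assms(1,2) by (auto simp: graded_hom_def obj_sh complex_obj algebra_simps)
  have s: "(\<lambda>n. Idn C (obj Y n)) \<in> graded_hom (-1) (obj Y) (obj (sh Y))"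
    using sus_hom assms complex_obj by blast
  have e: "(\<lambda>n. Idn C (obj Y (n + (k + 1))) \<cdot> f (n + 1)) = (\<lambda>n. f (n + 1))"
  proof (rule ext, rule Idn_Comp)
    fix n show "f (n + 1) \<in> Hom C (obj X (n + 1)) (obj Y (n + (k + 1)))"
      using f'[of n] by (simp add: algebra_simps)
  qed (use assms complex_obj in blast)+
  note d = emb_des[OF assms(1) f refl]
  show "emb k (obj (sh X)) (obj (sh Y)) (\<lambda>n. f (n + 1)) = sus Y * emb k (obj X) (obj Y) f * des X"
    using emb_Comp[OF d(1) s, of k] by (simp only: e d(2)) (simp add: sus_def mult.assoc)
qed

lemma dif_sh:
  assumes X: "is_complex C X"
  shows "diff (sh X) \<in> graded_hom 1 (obj (sh X)) (obj (sh X))" "dif (sh X) = - (sus X * dif X * des X)"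
proof -
  have d: "diff X \<in> graded_hom 1 (obj X) (obj X)" using X by (simp add: is_complex_iff)
  note e = emb_shift[OF X X d]
  have "diff (sh X) = (\<lambda>n. neg C (obj (sh X) n) (obj (sh X) (n + 1)) (diff X (n + 1)))"
    by (simp add: shift_complex_def add.commute)
  then show "diff (sh X) \<in> graded_hom 1 (obj (sh X)) (obj (sh X))" "dif (sh X) = - (sus X * dif X * des X)"
    using graded_hom_neg[OF e(1)] emb_neg[OF e(1)] e(2) by (simp_all add: dif_def)
qed

lemma des_sus_times:
  "\<lbrakk>is_complex C X; graded_map k W (obj X) z\<rbrakk> \<Longrightarrow> des X * (sus X * z) = z"
  by (simp add: des_sus unit_times flip: mult.assoc)

lemma complex_sh: "is_complex C X \<Longrightarrow> is_complex C (sh X)"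
  using dif_sh[of X] dif_dif_times[of X "des X"] des_sus_times[of X 2 "obj (sh X)" "dif X * des X"]
    graded_map_times[OF gmap_des gmap_dif, of X 2]
  by (simp add: is_complex_iff[of "sh X"] mult.assoc)

definition shm :: "('o, 'm) cochain_complex \<Rightarrow> ('o, 'm) cochain_complex \<Rightarrow> ('o, 'm) hom_op \<Rightarrow> ('o, 'm) hom_op" where
  "shm X Y x = sus Y * x * des X"

lemma gmap_shm: "\<lbrakk>is_complex C X; is_complex C Y; gmap k X Y x\<rbrakk> \<Longrightarrow> gmap k (sh X) (sh Y) (shm X Y x)"
  unfolding shm_def
  by (rule graded_map_times[of 1 "obj (sh X)" "obj X" _ "k - 1"]) (auto intro!: gmap_des graded_map_times[OF _ gmap_sus])

text \<open>The sign in the differential of the shift makes \<open>sus\<close> and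
  \<open>des\<close>, maps of odd degree, anticommute with the differentials. All later sign
  bookkeeping is done by this rule and its variants.\<close>

lemma dif_sus: "is_complex C X \<Longrightarrow> dif (sh X) * sus X = - (sus X * dif X)"
  by (simp add: dif_sh mult.assoc des_sus times_unit[OF gmap_dif])

lemma des_dif: "is_complex C X \<Longrightarrow> des X * dif (sh X) = - (dif X * des X)"
  using des_sus_times[of X 2 "obj (sh X)" "dif X * des X"] graded_map_times[OF gmap_des gmap_dif, of X 2]
  by (simp add: dif_sh mult.assoc)

lemma dif_sus_times: "is_complex C X \<Longrightarrow> dif (sh X) * (sus X * z) = - (sus X * (dif X * z))"
  by (simp add: dif_sus flip: mult.assoc)

lemma des_dif_times: "is_complex C X \<Longrightarrow> des X * (dif (sh X) * z) = - (dif X * (des X * z))"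
  by (simp add: des_dif flip: mult.assoc)

lemma cmap_shm: "cmap X Y x \<Longrightarrow> cmap (sh X) (sh Y) (shm X Y x)"
  by (rule cmapI)
     (simp_all add: cmap_complex complex_sh cmap_gmap gmap_shm,
      simp add: cmap_complex shm_def mult.assoc des_dif dif_sus_times cmap_dif_times)

lemma null_shm:
  assumes X: "is_complex C X" and Y: "is_complex C Y" and "null X Y x"
  shows "null (sh X) (sh Y) (shm X Y x)"
proof -
  obtain h where h: "gmap (-1) X Y h" "x = dif Y * h + h * dif X"
    using assms(3) by (auto simp: null_def)
  \<comment> \<open>The shifted homotopy is negated, again because of the sign in the differential
    of the shift.\<close>
  show ?thesis
    by (rule nullI[OF graded_map_uminus[OF gmap_shm[OF X Y h(1)]]])
       (simp add: h shm_def algebra_simps des_dif[OF X] dif_sus_times[OF Y])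
qed

lemma shm_times:
  "\<lbrakk>is_complex C Y; gmap k X Y x\<rbrakk> \<Longrightarrow> shm X Z (y * x) = shm Y Z y * shm X Y x"
  by (simp add: shm_def mult.assoc) (simp add: des_sus flip: mult.assoc, simp add: unit_times mult.assoc)

lemma shm_plus: "shm X Y (x + y) = shm X Y x + shm X Y y"
  by (simp add: shm_def algebra_simps)

lemma shm_unit: "is_complex C X \<Longrightarrow> shm X X (unit (obj X)) = unit (obj (sh X))"
  by (simp add: shm_def times_unit[OF gmap_sus] sus_des)

lemma ShAr_K:
  assumes x: "cmap X Y x"
  shows "ShAr K (karr X Y x) = karr (sh X) (sh Y) (shm X Y x)"
proof -
  note c = cmap_complex[OF x]
  have *: "homotopy_class C (sh X) (sh Y) (\<lambda>n. f (n + 1)) = hclass (sh X) (sh Y) (shm X Y x)"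
    if f: "f \<in> hclass X Y x" for f
  proof -
    obtain x' where x': "cmap X Y x'" "null X Y (x - x')" "f = components 0 (obj X) (obj Y) x'"
      using components_in_hclass[OF f x] .
    have f: "f \<in> graded_hom 0 (obj X) (obj Y)" using x' cmap_gmap components_in by blast
    have "(\<lambda>n. f (n + 1)) = components 0 (obj (sh X)) (obj (sh Y)) (shm X Y x')"
      using emb_shift[OF c f] components_emb x' emb_components[OF cmap_gmap] by (metis shm_def)
    moreover have "null (sh X) (sh Y) (shm X Y x - shm X Y x')"
      using null_shm[OF c x'(2)] by (simp add: shm_def algebra_simps)
    then have "hclass (sh X) (sh Y) (shm X Y x) = hclass (sh X) (sh Y) (shm X Y x')"
      using x x' cmap_shm hclass_eq_iff by metis
    ultimately show ?thesis by (simp add: hclass_def)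
  qed
  have "(\<Union>f\<in>hclass X Y x. homotopy_class C (sh X) (sh Y) (\<lambda>n. f (n + 1))) = hclass (sh X) (sh Y) (shm X Y x)"
    using hclass_nonempty[OF x] * by auto
  then show ?thesis by (simp add: K_simps) (simp add: htpy_shift_cat_def karr_def)
qed

end

text \<open>Products are kept nested to the right, where a rule for \<open>a * b\<close> no longer
  matches if more factors follow; this form of the rule includes the tail \<open>z\<close>.\<close>

lemma times_ext: "a * b = c \<Longrightarrow> a * (b * z) = c * (z :: 'r :: semigroup_mult)"
  by (simp flip: mult.assoc)

section \<open>Sources, targets and the ring representation of arrows\<close>

context category
begin

text \<open>Since distinct hom-sets are disjoint, an arrow determines its source and target. With
  \<open>src\<close> and \<open>tgt\<close> as functions, typing conditions become equations that
  rewriting can discharge.\<close>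

definition arr :: "'m \<Rightarrow> bool" where
  "arr f \<longleftrightarrow> (\<exists>X\<in>Ob C. \<exists>Y\<in>Ob C. f \<in> Hom C X Y)"

definition src :: "'m \<Rightarrow> 'o" where
  "src f = (THE X. X \<in> Ob C \<and> (\<exists>Y\<in>Ob C. f \<in> Hom C X Y))"

definition tgt :: "'m \<Rightarrow> 'o" where
  "tgt f = (THE Y. Y \<in> Ob C \<and> (\<exists>X\<in>Ob C. f \<in> Hom C X Y))"

definition typed :: "'m \<Rightarrow> 'o \<Rightarrow> 'o \<Rightarrow> bool" where
  "typed f X Y \<longleftrightarrow> X \<in> Ob C \<and> Y \<in> Ob C \<and> f \<in> Hom C X Y"

lemma typed_arr:
  assumes "typed f X Y" shows "arr f" "src f = X" "tgt f = Y"
proof -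
  note t = assms[unfolded typed_def]
  show "arr f" using t by (auto simp: arr_def)
  show "src f = X" unfolding src_def by (rule the_equality) (use t Hom_disjoint in blast)+
  show "tgt f = Y" unfolding tgt_def by (rule the_equality) (use t Hom_disjoint in blast)+
qed

lemma arr_typed: "arr f \<Longrightarrow> typed f (src f) (tgt f)"
  using typed_arr by (metis arr_def typed_def)

lemma typed_iff: "typed f X Y \<longleftrightarrow> arr f \<and> src f = X \<and> tgt f = Y"
  using typed_arr arr_typed by blast

lemma arr_src: "arr f \<Longrightarrow> src f \<in> Ob C" and arr_tgt: "arr f \<Longrightarrow> tgt f \<in> Ob C"
  using arr_typed by (auto simp: typed_def)

lemma arr_Hom: "arr f \<Longrightarrow> f \<in> Hom C (src f) (tgt f)"
  using arr_typed by (auto simp: typed_def)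

lemma in_HomI: "\<lbrakk>arr f; src f = X; tgt f = Y\<rbrakk> \<Longrightarrow> f \<in> Hom C X Y"
  using arr_Hom by blast

lemma Hom_typed: "\<lbrakk>f \<in> Hom C X Y; X \<in> Ob C; Y \<in> Ob C\<rbrakk> \<Longrightarrow> typed f X Y"
  by (simp add: typed_def)

lemma typed_Comp: "\<lbrakk>arr f; arr g; src g = tgt f\<rbrakk> \<Longrightarrow> typed (g \<cdot> f) (src f) (tgt g)"
  by (metis arr_src arr_tgt arr_Hom typed_def Comp_in_Hom)

lemma arr_Comp [simp]:
  assumes "arr f" "arr g" "src g = tgt f"
  shows "arr (g \<cdot> f)" "src (g \<cdot> f) = src f" "tgt (g \<cdot> f) = tgt g"
  using typed_arr[OF typed_Comp[OF assms]] by auto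

lemma arr_Idn [simp]:
  assumes "X \<in> Ob C" shows "arr (Idn C X)" "src (Idn C X) = X" "tgt (Idn C X) = X"
  using typed_arr[OF Hom_typed[OF Idn_in_Hom[OF assms] assms assms]] by auto

lemma Comp_Idn_src [simp]: "\<lbrakk>arr f; src f = X\<rbrakk> \<Longrightarrow> f \<cdot> Idn C X = f"
  by (metis arr_typed typed_def Comp_Idn)

lemma Idn_tgt_Comp [simp]: "\<lbrakk>arr f; tgt f = X\<rbrakk> \<Longrightarrow> Idn C X \<cdot> f = f"
  by (metis arr_typed typed_def Idn_Comp)

lemma Comp_assoc_arr:
  "\<lbrakk>arr f; arr g; arr h; src g = tgt f; src h = tgt g\<rbrakk> \<Longrightarrow> (h \<cdot> g) \<cdot> f = h \<cdot> (g \<cdot> f)"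
  by (rule sym, rule Comp_assoc[of "src f" "tgt f" "tgt g" "tgt h"]) (auto intro: in_HomI arr_src arr_tgt)

lemma Idn_typed: "X \<in> Ob C \<Longrightarrow> typed (Idn C X) X X"
  by (simp add: typed_iff)

lemma Comp_typed: "\<lbrakk>typed f X Y; typed g Y Z\<rbrakk> \<Longrightarrow> typed (g \<cdot> f) X Z"
  by (simp add: typed_iff)

lemma iso_arrow_iff:
  "iso_arrow C X Y f \<longleftrightarrow> typed f X Y \<and> (\<exists>g. typed g Y X \<and> g \<cdot> f = Idn C X \<and> f \<cdot> g = Idn C Y)"
  by (auto simp: iso_arrow_def typed_def)

lemma iso_arrowI:
  "\<lbrakk>typed f X Y; typed g Y X; g \<cdot> f = Idn C X; f \<cdot> g = Idn C Y\<rbrakk> \<Longrightarrow> iso_arrow C X Y f"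
  by (auto simp: iso_arrow_iff)

lemma iso_arrowE:
  assumes "iso_arrow C X Y f"
  obtains g where "typed f X Y" "typed g Y X" "g \<cdot> f = Idn C X" "f \<cdot> g = Idn C Y"
  using assms by (auto simp: iso_arrow_iff)

lemma iso_arrow_Idn: "X \<in> Ob C \<Longrightarrow> iso_arrow C X X (Idn C X)"
  by (rule iso_arrowI[of _ _ _ "Idn C X"]) (auto simp: Idn_typed)

lemma iso_arrow_Comp:
  assumes "iso_arrow C X Y f" "iso_arrow C Y Z g"
  shows "iso_arrow C X Z (g \<cdot> f)"
proof -
  obtain f' where f: "typed f X Y" "typed f' Y X" "f' \<cdot> f = Idn C X" "f \<cdot> f' = Idn C Y"
    using assms(1) by (rule iso_arrowE)
  obtain g' where g: "typed g Y Z" "typed g' Z Y" "g' \<cdot> g = Idn C Y" "g \<cdot> g' = Idn C Z"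
    using assms(2) by (rule iso_arrowE)
  note t = f(1,2)[unfolded typed_iff] g(1,2)[unfolded typed_iff]
  show ?thesis
  proof (rule iso_arrowI)
    show "typed (g \<cdot> f) X Z" "typed (f' \<cdot> g') Z X" using f g by (auto intro: Comp_typed)
    have "f' \<cdot> g' \<cdot> (g \<cdot> f) = f' \<cdot> ((g' \<cdot> g) \<cdot> f)" using t by (simp add: Comp_assoc_arr)
    then show "f' \<cdot> g' \<cdot> (g \<cdot> f) = Idn C X" using f g t by (simp add: typed_iff)
    have "g \<cdot> f \<cdot> (f' \<cdot> g') = g \<cdot> ((f \<cdot> f') \<cdot> g')" using t by (simp add: Comp_assoc_arr)
    then show "g \<cdot> f \<cdot> (f' \<cdot> g') = Idn C Z" using f g t by (simp add: typed_iff)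
  qed
qed

end

context preadditive
begin

text \<open>The ring representation concerns plain \<open>ab_cat\<close> records. Categories with a
  shift or with triangles have further record fields, which are forgotten before it is
  applied.\<close>

abbreviation base :: "('o, 'm) ab_cat" where
  "base \<equiv> ab_cat.truncate C"

lemma base_simps:
  "Ob base = Ob C" "Hom base = Hom C" "Idn base = Idn C" "Comp base = Comp C" "Add base = Add C"
  "Zero base = Zero C" "hom_group base = hom_group C"
  by (simp_all add: ab_cat.truncate_def hom_group_def fun_eq_iff)

lemma plain_preadditive_base: "plain_preadditive base"
proof (intro plain_preadditive.intro preadditive.intro category.intro preadditive_axioms.intro)
  fix X Y X' Y' f
  show "\<lbrakk>X \<in> Ob base; Y \<in> Ob base; X' \<in> Ob base; Y' \<in> Ob base; f \<in> Hom base X Y;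
    f \<in> Hom base X' Y'\<rbrakk> \<Longrightarrow> X = X' \<and> Y = Y'"
    using Hom_disjoint by (auto simp: base_simps)
qed (auto simp: base_simps intro: Idn_in_Hom Comp_in_Hom Comp_Idn Idn_Comp Comp_assoc hom_comm_group
    Comp_Add_left Comp_Add_right)

text \<open>A single arrow is a constant family of degree 0. Its source and target are read off from
  the arrow, so no object arguments are needed and an equation between arrows translates
  literally.\<close>

definition rr :: "'m \<Rightarrow> ('o, 'm) hom_op" where
  "rr f = plain_preadditive.emb base 0 (\<lambda>_. src f) (\<lambda>_. tgt f) (\<lambda>_. f)"

lemma graded_hom_const: "typed f X Y \<Longrightarrow> (\<lambda>_. f) \<in> preadditive.graded_hom base k (\<lambda>_. X) (\<lambda>_. Y)"
  using plain_preadditive_base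
  by (auto simp: preadditive.graded_hom_def plain_preadditive_def base_simps typed_def)

lemma rr_Comp [simp]:
  assumes "arr f" "arr g" "src g = tgt f"
  shows "rr (g \<cdot> f) = rr g * rr f"
  using plain_preadditive.emb_Comp[OF plain_preadditive_base graded_hom_const graded_hom_const refl,
      OF arr_typed[OF assms(1)], of g "tgt g" 0 0] assms arr_typed[OF assms(2)]
  by (simp add: rr_def base_simps)

lemma typed_Add: "\<lbrakk>typed f X Y; typed g X Y\<rbrakk> \<Longrightarrow> typed (f \<boxplus> g) X Y"
  by (simp add: typed_def Add_in_Hom)

lemma arr_Add [simp]:
  assumes "arr f" "arr g" "src f = src g" "tgt f = tgt g"
  shows "arr (f \<boxplus> g)" "src (f \<boxplus> g) = src g" "tgt (f \<boxplus> g) = tgt g"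
  using typed_Add[of f "src g" "tgt g" g] arr_typed assms by (auto simp: typed_iff)

lemma rr_Add [simp]:
  assumes "arr f" "arr g" "src f = src g" "tgt f = tgt g"
  shows "rr (f \<boxplus> g) = rr f + rr g"
  using plain_preadditive.emb_Add[OF plain_preadditive_base graded_hom_const graded_hom_const,
      of f "src g" "tgt g" g 0] assms arr_typed
  by (auto simp: rr_def base_simps typed_iff)

lemma arr_Zero [simp]:
  assumes "X \<in> Ob C" "Y \<in> Ob C"
  shows "arr (Zero C X Y)" "src (Zero C X Y) = X" "tgt (Zero C X Y) = Y"
  using typed_arr[OF Hom_typed[OF Zero_in_Hom[OF assms] assms]] by auto

lemma rr_Zero [simp]: "\<lbrakk>X \<in> Ob C; Y \<in> Ob C\<rbrakk> \<Longrightarrow> rr (Zero C X Y) = 0"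
  using plain_preadditive.emb_Zero[OF plain_preadditive_base, of "\<lambda>_. X" "\<lambda>_. Y" 0]
  by (simp add: rr_def base_simps)

lemma rr_inject: "\<lbrakk>arr f; arr g; src f = src g; tgt f = tgt g; rr f = rr g\<rbrakk> \<Longrightarrow> f = g"
  using plain_preadditive.emb_inject[OF plain_preadditive_base graded_hom_const graded_hom_const,
      of f "src g" "tgt g" g 0] arr_typed
  by (auto simp: rr_def typed_iff fun_eq_iff)

lemma eqI_rr: "\<lbrakk>typed f X Y; typed g X Y; rr f = rr g\<rbrakk> \<Longrightarrow> f = g"
  by (rule rr_inject) (auto simp: typed_iff)

lemma rr_Idn_left [simp]: "\<lbrakk>arr f; tgt f = X\<rbrakk> \<Longrightarrow> rr (Idn C X) * rr f = rr f"
  by (subst rr_Comp[symmetric]) (auto simp: arr_tgt)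

lemma rr_Idn_right [simp]: "\<lbrakk>arr f; src f = X\<rbrakk> \<Longrightarrow> rr f * rr (Idn C X) = rr f"
  by (subst rr_Comp[symmetric]) (auto simp: arr_src)

lemma typed_neg: "typed f X Y \<Longrightarrow> typed (neg C X Y f) X Y"
  by (simp add: typed_def neg_in_Hom)

lemma rr_neg:
  assumes "typed f X Y" shows "rr (neg C X Y f) = - rr f"
proof -
  have o: "X \<in> Ob C" "Y \<in> Ob C" using assms by (auto simp: typed_def)
  have "neg C X Y f \<boxplus> f = Zero C X Y" using assms by (simp add: typed_def neg_Add)
  then have "rr (neg C X Y f \<boxplus> f) = 0" using o by simp
  then show ?thesis
    using typed_neg[OF assms] assms by (simp add: typed_iff eq_neg_iff_add_eq_0)
qed

definition minus :: "'m \<Rightarrow> 'm \<Rightarrow> 'm"  (infixl "\<boxminus>" 65) where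
  "f \<boxminus> g = f \<boxplus> neg C (src g) (tgt g) g"

lemma typed_minus: "\<lbrakk>typed f X Y; typed g X Y\<rbrakk> \<Longrightarrow> typed (f \<boxminus> g) X Y"
  by (simp add: minus_def typed_def Add_in_Hom neg_in_Hom typed_arr[of g X Y])

lemma arr_minus [simp]:
  assumes "arr f" "arr g" "src f = src g" "tgt f = tgt g"
  shows "arr (f \<boxminus> g)" "src (f \<boxminus> g) = src g" "tgt (f \<boxminus> g) = tgt g"
  using typed_minus[of f "src g" "tgt g" g] arr_typed assms by (auto simp: typed_iff)

lemma rr_minus [simp]:
  assumes "arr f" "arr g" "src f = src g" "tgt f = tgt g"
  shows "rr (f \<boxminus> g) = rr f - rr g"
  using typed_neg[OF arr_typed[OF assms(2)]] rr_neg[OF arr_typed[OF assms(2)]] assms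
  by (simp add: minus_def typed_iff)

end

section \<open>Categories with shift and distinguished triangles\<close>

text \<open>The shift is required to be bijective on hom-sets, so arrows can be shifted back
  whenever their ends are presented as shifts; objects need not be shifts.\<close>

locale shifted_category = preadditive C for C :: "('o, 'm, 'x) shift_cat_scheme" (structure) +
  assumes ShOb_in: "X \<in> Ob C \<Longrightarrow> ShOb C X \<in> Ob C"
    and ShAr_bij: "\<lbrakk>X \<in> Ob C; Y \<in> Ob C\<rbrakk> \<Longrightarrow>
      bij_betw (ShAr C) (Hom C X Y) (Hom C (ShOb C X) (ShOb C Y))"
    and ShAr_Idn: "X \<in> Ob C \<Longrightarrow> ShAr C (Idn C X) = Idn C (ShOb C X)"
    and ShAr_Comp: "\<lbrakk>X \<in> Ob C; Y \<in> Ob C; Z \<in> Ob C; f \<in> Hom C X Y; g \<in> Hom C Y Z\<rbrakk> \<Longrightarrow>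
      ShAr C (g \<cdot> f) = ShAr C g \<cdot> ShAr C f"
    and ShAr_Add: "\<lbrakk>X \<in> Ob C; Y \<in> Ob C; f \<in> Hom C X Y; g \<in> Hom C X Y\<rbrakk> \<Longrightarrow>
      ShAr C (f \<boxplus> g) = ShAr C f \<boxplus> ShAr C g"
begin

lemma typed_ShAr: "typed f X Y \<Longrightarrow> typed (ShAr C f) (ShOb C X) (ShOb C Y)"
  using ShAr_bij[of X Y] ShOb_in by (auto simp: typed_def bij_betw_def)

lemma arr_ShAr [simp]:
  assumes "arr f" shows "arr (ShAr C f)" "src (ShAr C f) = ShOb C (src f)" "tgt (ShAr C f) = ShOb C (tgt f)"
  using typed_ShAr[OF arr_typed[OF assms]] by (auto simp: typed_iff)

lemma ShAr_Comp_arr: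
  "\<lbrakk>arr f; arr g; src g = tgt f\<rbrakk> \<Longrightarrow> ShAr C (g \<cdot> f) = ShAr C g \<cdot> ShAr C f"
  by (rule ShAr_Comp[of "src f" "tgt f" "tgt g"]) (auto simp: arr_src arr_tgt intro: in_HomI)

lemma ShAr_surj:
  assumes "typed g (ShOb C X) (ShOb C Y)" "X \<in> Ob C" "Y \<in> Ob C"
  obtains f where "typed f X Y" "ShAr C f = g"
  using assms ShAr_bij[of X Y] by (auto simp: bij_betw_def typed_def image_iff) (metis imageE)

lemma ShAr_inj:
  "\<lbrakk>typed f X Y; typed g X Y; ShAr C f = ShAr C g\<rbrakk> \<Longrightarrow> f = g"
  using ShAr_bij[of X Y] by (auto simp: bij_betw_def typed_def dest: inj_onD)

lemma iso_arrow_ShAr: "iso_arrow C X Y f \<Longrightarrow> iso_arrow C (ShOb C X) (ShOb C Y) (ShAr C f)"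
proof (erule iso_arrowE)
  fix g assume g: "typed f X Y" "typed g Y X" "g \<cdot> f = Idn C X" "f \<cdot> g = Idn C Y"
  note t = g(1,2)[unfolded typed_iff]
  have "X \<in> Ob C" "Y \<in> Ob C" using g by (auto simp: typed_def)
  then show ?thesis
    using g t ShAr_Comp_arr[of f g] ShAr_Comp_arr[of g f]
    by (intro iso_arrowI[OF typed_ShAr typed_ShAr]) (auto simp: ShAr_Idn)
qed

definition tri_typed :: "('o, 'm) triangle \<Rightarrow> bool" where
  "tri_typed = (\<lambda>(X, Y, Z, u, v, w). typed u X Y \<and> typed v Y Z \<and> typed w Z (ShOb C X))"

lemma triangle_iso_iff:
  "triangle_iso C (X, Y, Z, u, v, w) (X', Y', Z', u', v', w') \<longleftrightarrow>
     tri_typed (X, Y, Z, u, v, w) \<and> tri_typed (X', Y', Z', u', v', w') \<and>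
     (\<exists>a b c. iso_arrow C X X' a \<and> iso_arrow C Y Y' b \<and> iso_arrow C Z Z' c \<and>
        b \<cdot> u = u' \<cdot> a \<and> c \<cdot> v = v' \<cdot> b \<and> ShAr C a \<cdot> w = w' \<cdot> c)"
  unfolding triangle_iso_def tri_typed_def typed_def iso_arrow_def by (auto simp: ShOb_in)

lemma triangle_iso_refl: "tri_typed t \<Longrightarrow> triangle_iso C t t"
proof (cases t)
  fix X Y Z u v w assume t: "tri_typed t" "t = (X, Y, Z, u, v, w)"
  then have "X \<in> Ob C" "Y \<in> Ob C" "Z \<in> Ob C" by (auto simp: tri_typed_def typed_def)
  then show ?thesis
    using t unfolding t(2) triangle_iso_iff
    by (intro conjI exI[of _ "Idn C X"] exI[of _ "Idn C Y"] exI[of _ "Idn C Z"] iso_arrow_Idn)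
       (auto simp: tri_typed_def typed_iff ShAr_Idn)
qed

lemma triangle_iso_trans:
  assumes "triangle_iso C t t'" "triangle_iso C t' t''"
  shows "triangle_iso C t t''"
proof -
  obtain X Y Z u v w where t: "t = (X, Y, Z, u, v, w)" by (cases t)
  obtain X' Y' Z' u' v' w' where t': "t' = (X', Y', Z', u', v', w')" by (cases t')
  obtain X'' Y'' Z'' u'' v'' w'' where t'': "t'' = (X'', Y'', Z'', u'', v'', w'')" by (cases t'')
  obtain a b c where abc: "iso_arrow C X X' a" "iso_arrow C Y Y' b" "iso_arrow C Z Z' c"
      "b \<cdot> u = u' \<cdot> a" "c \<cdot> v = v' \<cdot> b" "ShAr C a \<cdot> w = w' \<cdot> c"
    using assms(1) unfolding t t' triangle_iso_iff by auto
  obtain a' b' c' where abc': "iso_arrow C X' X'' a'" "iso_arrow C Y' Y'' b'" "iso_arrow C Z' Z'' c'"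
      "b' \<cdot> u' = u'' \<cdot> a'" "c' \<cdot> v' = v'' \<cdot> b'" "ShAr C a' \<cdot> w' = w'' \<cdot> c'"
    using assms(2) unfolding t' t'' triangle_iso_iff by auto
  have ty: "tri_typed t" "tri_typed t'" "tri_typed t''"
    using assms unfolding t t' t'' triangle_iso_iff by auto
  have iso: "iso_arrow C X X'' (a' \<cdot> a)" "iso_arrow C Y Y'' (b' \<cdot> b)" "iso_arrow C Z Z'' (c' \<cdot> c)"
    using abc abc' by (auto intro: iso_arrow_Comp)
  have sq: "g' \<cdot> g \<cdot> s = s'' \<cdot> (h' \<cdot> h)"
    if "typed h P P'" "typed h' P' P''" "typed g Q Q'" "typed g' Q' Q''"
      "typed s P Q" "typed s' P' Q'" "typed s'' P'' Q''" "g \<cdot> s = s' \<cdot> h" "g' \<cdot> s' = s'' \<cdot> h'"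
    for P P' P'' Q Q' Q'' h h' g g' s s' s''
  proof -
    note e = that[unfolded typed_iff]
    have "g' \<cdot> g \<cdot> s = g' \<cdot> (s' \<cdot> h)" using e by (simp add: Comp_assoc_arr)
    also have "\<dots> = g' \<cdot> s' \<cdot> h" by (rule Comp_assoc_arr[symmetric]) (use e in auto)
    also have "\<dots> = s'' \<cdot> (h' \<cdot> h)" using e by (simp add: Comp_assoc_arr)
    finally show ?thesis .
  qed
  note tt = ty[unfolded t t' t'' tri_typed_def, simplified]
  note at = abc(1-3)[unfolded iso_arrow_iff] abc'(1-3)[unfolded iso_arrow_iff]
  have "b' \<cdot> b \<cdot> u = u'' \<cdot> (a' \<cdot> a)" "c' \<cdot> c \<cdot> v = v'' \<cdot> (b' \<cdot> b)"
    using tt at abc abc' by (auto intro!: sq)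
  moreover have "ShAr C a' \<cdot> ShAr C a \<cdot> w = w'' \<cdot> (c' \<cdot> c)"
    by (rule sq[of c Z Z' c' Z'' "ShAr C a" "ShOb C X" "ShOb C X'" "ShAr C a'" "ShOb C X''" w w' w''])
       (use tt at abc abc' in \<open>auto intro: typed_ShAr\<close>)
  then have "ShAr C (a' \<cdot> a) \<cdot> w = w'' \<cdot> (c' \<cdot> c)"
    using at by (subst ShAr_Comp_arr) (auto simp: typed_iff)
  ultimately show ?thesis using iso ty unfolding t t'' triangle_iso_iff by blast
qed

lemma iso_arrow_cancel:
  assumes "iso_arrow C Y Z c" "typed f X Y" "typed g X Y" "c \<cdot> f = c \<cdot> g"
  shows "f = g"
proof -
  obtain c' where c: "typed c Y Z" "typed c' Z Y" "c' \<cdot> c = Idn C Y"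
    using assms(1) by (auto elim: iso_arrowE)
  have "c' \<cdot> c \<cdot> h = c' \<cdot> (c \<cdot> h)" if "typed h X Y" for h
    by (rule Comp_assoc_arr) (use that c in \<open>auto simp: typed_iff\<close>)
  then have "c' \<cdot> c \<cdot> f = c' \<cdot> c \<cdot> g"
    using assms(2-4) by simp
  then show ?thesis using c assms(2,3) by (simp add: typed_iff)
qed

lemma rr_0_iff: "typed f X Y \<Longrightarrow> f = Zero C X Y \<longleftrightarrow> rr f = 0"
  using rr_inject[of f "Zero C X Y"] rr_Zero[of X Y] arr_Zero[of X Y] arr_src arr_tgt
  unfolding typed_iff by metis

text \<open>\<open>Hom(Q, -)\<close> applied to \<open>X -> Y -> Z -> X[1] -> Y[1]\<close> is exact
  at the three inner terms, for every object \<open>Q\<close>.\<close>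

definition exact_triangle :: "('o, 'm) triangle \<Rightarrow> bool" where
  "exact_triangle = (\<lambda>(X, Y, Z, u, v, w). tri_typed (X, Y, Z, u, v, w) \<and>
     v \<cdot> u = Zero C X Z \<and> w \<cdot> v = Zero C Y (ShOb C X) \<and> ShAr C u \<cdot> w = Zero C Z (ShOb C Y) \<and>
     (\<forall>Q g. typed g Q Y \<and> v \<cdot> g = Zero C Q Z \<longrightarrow> (\<exists>g'. typed g' Q X \<and> u \<cdot> g' = g)) \<and>
     (\<forall>Q g. typed g Q Z \<and> w \<cdot> g = Zero C Q (ShOb C X) \<longrightarrow> (\<exists>g'. typed g' Q Y \<and> v \<cdot> g' = g)) \<and>
     (\<forall>Q g. typed g Q (ShOb C X) \<and> ShAr C u \<cdot> g = Zero C Q (ShOb C Y) \<longrightarrow>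
        (\<exists>g'. typed g' Q Z \<and> w \<cdot> g' = g)))"

text \<open>The axiom TR3 for one pair of triangles: a commutative first square extends to a
  morphism of triangles.\<close>

definition tr3 :: "('o, 'm) triangle \<Rightarrow> ('o, 'm) triangle \<Rightarrow> bool" where
  "tr3 = (\<lambda>(X, Y, Z, u, v, w) (X', Y', Z', u', v', w'). \<forall>a b. typed a X X' \<and> typed b Y Y' \<and> b \<cdot> u = u' \<cdot> a \<longrightarrow>
     (\<exists>c. typed c Z Z' \<and> c \<cdot> v = v' \<cdot> b \<and> ShAr C a \<cdot> w = w' \<cdot> c))"

text \<open>Only two consecutive arrows are considered, so that the lemma serves at each of the
  three places where a triangle has to be exact.\<close>

lemma exact_transfer:
  assumes a: "iso_arrow C X X' a" and b: "iso_arrow C Y Y' b" and c: "iso_arrow C Z Z' c"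
    and t: "typed u X Y" "typed v Y Z" "typed u' X' Y'" "typed v' Y' Z'"
    and sq: "b \<cdot> u = u' \<cdot> a" "c \<cdot> v = v' \<cdot> b"
    and ex: "v' \<cdot> u' = Zero C X' Z'"
      "\<And>Q g. \<lbrakk>typed g Q Y'; v' \<cdot> g = Zero C Q Z'\<rbrakk> \<Longrightarrow> \<exists>g'. typed g' Q X' \<and> u' \<cdot> g' = g"
  shows "v \<cdot> u = Zero C X Z"
    and "\<And>Q g. \<lbrakk>typed g Q Y; v \<cdot> g = Zero C Q Z\<rbrakk> \<Longrightarrow> \<exists>g'. typed g' Q X \<and> u \<cdot> g' = g"
proof -
  obtain a' where a': "typed a X X'" "typed a' X' X" "a' \<cdot> a = Idn C X" "a \<cdot> a' = Idn C X'"
    using a by (rule iso_arrowE)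
  have bt: "typed b Y Y'" and ct: "typed c Z Z'" using b c by (auto simp: iso_arrow_iff)
  have ob: "X \<in> Ob C" "Y \<in> Ob C" "Z \<in> Ob C" "X' \<in> Ob C" "Y' \<in> Ob C" "Z' \<in> Ob C"
    using a' bt ct by (auto simp: typed_def)
  note tt = t[unfolded typed_iff] a'(1,2)[unfolded typed_iff] bt[unfolded typed_iff] ct[unfolded typed_iff]
  have R: "rr b * rr u = rr u' * rr a" "rr c * rr v = rr v' * rr b" "rr v' * rr u' = 0"
    using arg_cong[OF sq(1), of rr] arg_cong[OF sq(2), of rr] arg_cong[OF ex(1), of rr] tt ob by simp_all
  have "rr c * (rr v * rr u) = 0"
    by (simp add: R[THEN times_ext] R mult.assoc)
  then have "c \<cdot> (v \<cdot> u) = c \<cdot> Zero C X Z"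
    using tt ob by (intro eqI_rr[of _ X Z']) (auto simp: typed_iff)
  then show "v \<cdot> u = Zero C X Z"
    using iso_arrow_cancel[OF c] tt ob by (auto simp: typed_iff)
  fix Q g assume g: "typed g Q Y" "v \<cdot> g = Zero C Q Z"
  note gt = g(1)[unfolded typed_iff]
  have Q: "Q \<in> Ob C" using g by (simp add: typed_def)
  have "rr v * rr g = 0" using arg_cong[OF g(2), of rr] gt tt ob Q by simp
  then have "rr v' * (rr b * rr g) = 0" by (simp add: R(2)[symmetric, THEN times_ext] mult.assoc)
  then have "v' \<cdot> (b \<cdot> g) = Zero C Q Z'"
    using tt gt ob Q by (intro eqI_rr[of _ Q Z']) (auto simp: typed_iff)
  then obtain k where k: "typed k Q X'" "u' \<cdot> k = b \<cdot> g"
    using ex(2)[OF Comp_typed[OF g(1) bt]] by blast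
  note kt = k(1)[unfolded typed_iff]
  have aa: "rr a * rr a' = rr (Idn C X')" using arg_cong[OF a'(4), of rr] tt by simp
  have "rr b * (rr u * (rr a' * rr k)) = rr u' * (rr (Idn C X') * rr k)"
    by (simp add: R(1)[THEN times_ext] mult.assoc aa[THEN times_ext])
  also have "\<dots> = rr b * rr g"
    using arg_cong[OF k(2), of rr] kt gt tt by simp
  finally have "b \<cdot> (u \<cdot> (a' \<cdot> k)) = b \<cdot> g"
    using tt gt kt by (intro eqI_rr[of _ Q Y']) (auto simp: typed_iff)
  then have "u \<cdot> (a' \<cdot> k) = g"
    using iso_arrow_cancel[OF b] tt gt kt by (auto simp: typed_iff)
  then show "\<exists>g'. typed g' Q X \<and> u \<cdot> g' = g"
    using tt kt by (intro exI[of _ "a' \<cdot> k"]) (auto simp: typed_iff)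
qed

lemma exact_triangle_iso:
  assumes iso: "triangle_iso C t t'" and ex: "exact_triangle t'"
  shows "exact_triangle t"
proof -
  obtain X Y Z u v w where t: "t = (X, Y, Z, u, v, w)" by (cases t)
  obtain X' Y' Z' u' v' w' where t': "t' = (X', Y', Z', u', v', w')" by (cases t')
  obtain a b c where abc: "iso_arrow C X X' a" "iso_arrow C Y Y' b" "iso_arrow C Z Z' c"
      "b \<cdot> u = u' \<cdot> a" "c \<cdot> v = v' \<cdot> b" "ShAr C a \<cdot> w = w' \<cdot> c"
    using iso unfolding t t' triangle_iso_iff by auto
  have ty: "typed u X Y" "typed v Y Z" "typed w Z (ShOb C X)"
    "typed u' X' Y'" "typed v' Y' Z'" "typed w' Z' (ShOb C X')"
    using iso unfolding t t' triangle_iso_iff by (auto simp: tri_typed_def)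
  have su: "ShAr C b \<cdot> ShAr C u = ShAr C u' \<cdot> ShAr C a"
    using abc ty ShAr_Comp_arr[of u b] ShAr_Comp_arr[of a u'] by (auto simp: iso_arrow_iff typed_iff)
  note ex = ex[unfolded t' exact_triangle_def, simplified]
  note 1 = exact_transfer[OF abc(1,2,3) ty(1,2,4,5) abc(4,5)]
  note 2 = exact_transfer[OF abc(2,3) iso_arrow_ShAr[OF abc(1)] ty(2,3,5,6) abc(5,6)]
  note 3 = exact_transfer[OF abc(3) iso_arrow_ShAr[OF abc(1)] iso_arrow_ShAr[OF abc(2)]
      ty(3) typed_ShAr[OF ty(1)] ty(6) typed_ShAr[OF ty(4)] abc(6) su]
  show ?thesis
    unfolding t exact_triangle_def using ty 1 2 3 ex
    by (auto simp: tri_typed_def)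
qed

text \<open>Conjugate the given pair with the isomorphisms to a pair between the primed triangles,
  complete it there by some \<open>z\<close>, and conjugate back: the completion is \<open>z\<close>
  preceded by \<open>c\<close> and followed by the inverse of \<open>f\<close>.\<close>

lemma tr3_iso:
  assumes iso: "triangle_iso C t1 t1'" "triangle_iso C t2 t2'" and tr: "tr3 t1' t2'"
  shows "tr3 t1 t2"
proof -
  obtain X Y Z u v w where t: "t1 = (X, Y, Z, u, v, w)" by (cases t1)
  obtain X' Y' Z' u' v' w' where t': "t1' = (X', Y', Z', u', v', w')" by (cases t1')
  obtain P Q R k l m where s: "t2 = (P, Q, R, k, l, m)" by (cases t2)
  obtain P' Q' R' k' l' m' where s': "t2' = (P', Q', R', k', l', m')" by (cases t2')
  obtain a b c where abc: "iso_arrow C X X' a" "iso_arrow C Y Y' b" "iso_arrow C Z Z' c"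
      "b \<cdot> u = u' \<cdot> a" "c \<cdot> v = v' \<cdot> b" "ShAr C a \<cdot> w = w' \<cdot> c"
    using iso(1) unfolding t t' triangle_iso_iff by auto
  obtain d e f where de: "iso_arrow C P P' d" "iso_arrow C Q Q' e" "iso_arrow C R R' f"
      "e \<cdot> k = k' \<cdot> d" "f \<cdot> l = l' \<cdot> e" "ShAr C d \<cdot> m = m' \<cdot> f"
    using iso(2) unfolding s s' triangle_iso_iff by auto
  have ty: "typed u X Y" "typed v Y Z" "typed w Z (ShOb C X)"
    "typed u' X' Y'" "typed v' Y' Z'" "typed w' Z' (ShOb C X')"
    "typed k P Q" "typed l Q R" "typed m R (ShOb C P)"
    "typed k' P' Q'" "typed l' Q' R'" "typed m' R' (ShOb C P')"
    using iso unfolding t t' s s' triangle_iso_iff by (auto simp: tri_typed_def)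
  obtain ai where ai: "typed a X X'" "typed ai X' X" "ai \<cdot> a = Idn C X" "a \<cdot> ai = Idn C X'"
    using abc(1) by (rule iso_arrowE)
  obtain bi where bi: "typed b Y Y'" "typed bi Y' Y" "bi \<cdot> b = Idn C Y" "b \<cdot> bi = Idn C Y'"
    using abc(2) by (rule iso_arrowE)
  obtain fi where fi: "typed f R R'" "typed fi R' R" "fi \<cdot> f = Idn C R" "f \<cdot> fi = Idn C R'"
    using de(3) by (rule iso_arrowE)
  have ct: "typed c Z Z'" and dt: "typed d P P'" and et: "typed e Q Q'"
    using abc de by (auto simp: iso_arrow_iff)
  note tt = ty[unfolded typed_iff] ai(1,2)[unfolded typed_iff] bi(1,2)[unfolded typed_iff]
    fi(1,2)[unfolded typed_iff] ct[unfolded typed_iff] dt[unfolded typed_iff] et[unfolded typed_iff]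
  have ob: "X \<in> Ob C" "Y \<in> Ob C" "X' \<in> Ob C" "Y' \<in> Ob C" "R \<in> Ob C" "R' \<in> Ob C"
    using ai bi fi by (auto simp: typed_def)
  show ?thesis
    unfolding t s tr3_def
  proof (clarsimp)
    fix x y assume xy: "typed x X P" "typed y Y Q" "y \<cdot> u = k \<cdot> x"
    note xt = xy(1,2)[unfolded typed_iff]
    have R1: "rr y * rr u = rr k * rr x" "rr b * rr u = rr u' * rr a" "rr e * rr k = rr k' * rr d"
      "rr c * rr v = rr v' * rr b" "rr f * rr l = rr l' * rr e"
      "rr (ShAr C a) * rr w = rr w' * rr c" "rr (ShAr C d) * rr m = rr m' * rr f"
      "rr ai * rr a = rr (Idn C X)" "rr a * rr ai = rr (Idn C X')"
      "rr bi * rr b = rr (Idn C Y)" "rr b * rr bi = rr (Idn C Y')"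
      "rr fi * rr f = rr (Idn C R)" "rr f * rr fi = rr (Idn C R')"
      using arg_cong[OF xy(3), of rr] arg_cong[OF abc(4), of rr] arg_cong[OF abc(5), of rr]
        arg_cong[OF abc(6), of rr] arg_cong[OF de(4), of rr] arg_cong[OF de(5), of rr]
        arg_cong[OF de(6), of rr] arg_cong[OF ai(3), of rr] arg_cong[OF ai(4), of rr]
        arg_cong[OF bi(3), of rr] arg_cong[OF bi(4), of rr] arg_cong[OF fi(3), of rr]
        arg_cong[OF fi(4), of rr] tt xt
      by simp_all
    have "rr bi * (rr u' * rr a) = rr bi * rr b * rr u" using R1(2) by (simp add: mult.assoc)
    then have "rr bi * (rr u' * rr a) = rr u" using R1(10) tt by simp
    then have "rr bi * (rr u' * (rr a * rr ai)) = rr u * rr ai" by (simp flip: mult.assoc)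
    then have bu: "rr bi * rr u' = rr u * rr ai" using R1(9) tt by simp
    have "rr e * (rr y * (rr bi * rr u')) = rr k' * (rr d * (rr x * rr ai))"
      by (simp add: bu R1(1,3)[THEN times_ext] mult.assoc)
    then have "(e \<cdot> (y \<cdot> bi)) \<cdot> u' = k' \<cdot> (d \<cdot> (x \<cdot> ai))"
      using tt xt by (intro eqI_rr[of _ X' Q']) (auto simp: typed_iff mult.assoc)
    moreover have "typed (d \<cdot> (x \<cdot> ai)) X' P'" "typed (e \<cdot> (y \<cdot> bi)) Y' Q'"
      using tt xt by (auto simp: typed_iff)
    ultimately obtain z where z: "typed z Z' R'" "z \<cdot> v' = l' \<cdot> (e \<cdot> (y \<cdot> bi))"
      "ShAr C (d \<cdot> (x \<cdot> ai)) \<cdot> w' = m' \<cdot> z"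
      using tr[unfolded t' s' tr3_def] by auto
    note zt = z(1)[unfolded typed_iff]
    have Z1: "rr z * rr v' = rr l' * (rr e * (rr y * rr bi))"
      using arg_cong[OF z(2), of rr] tt xt zt by simp
    have "ShAr C (d \<cdot> (x \<cdot> ai)) = ShAr C d \<cdot> (ShAr C x \<cdot> ShAr C ai)"
      using tt xt by (simp add: ShAr_Comp_arr)
    then have Z2: "rr (ShAr C d) * (rr (ShAr C x) * (rr (ShAr C ai) * rr w')) = rr m' * rr z"
      using arg_cong[OF z(3), of rr] tt xt zt by (simp add: mult.assoc)
    have "ShAr C ai \<cdot> ShAr C a = Idn C (ShOb C X)"
      using ai(3) ShAr_Comp_arr[of a ai] ShAr_Idn[of X] tt ob by simp
    then have sai: "rr (ShAr C ai) * rr (ShAr C a) = rr (Idn C (ShOb C X))"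
      using tt rr_Comp[of "ShAr C a" "ShAr C ai"] by simp
    have zv: "rr z * (rr c * rr v) = rr f * (rr l * rr y)"
    proof -
      have "rr z * (rr c * rr v) = rr l' * (rr e * (rr y * (rr bi * rr b)))"
        by (simp add: R1(4) Z1[THEN times_ext] mult.assoc)
      also have "\<dots> = rr f * (rr l * rr y)"
        using xt by (simp add: R1(5)[symmetric, THEN times_ext] R1(10) mult.assoc)
      finally show ?thesis .
    qed
    have fg: "rr fi * (rr f * (rr l * rr y)) = rr l * rr y"
      using tt xt by (simp add: R1(12)[THEN times_ext]) (simp flip: mult.assoc)
    have "(fi \<cdot> (z \<cdot> c)) \<cdot> v = l \<cdot> y"
      using tt xt zt zv fg by (intro eqI_rr[of _ Y R]) (auto simp: typed_iff mult.assoc)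
    moreover have "ShAr C x \<cdot> w = m \<cdot> (fi \<cdot> (z \<cdot> c))"
    proof -
      have "rr (ShAr C d) * (rr m * (rr fi * (rr z * rr c))) = rr m' * (rr f * rr fi * (rr z * rr c))"
        by (simp add: R1(7)[THEN times_ext] mult.assoc)
      also have "\<dots> = rr m' * (rr z * rr c)"
        using zt by (simp add: R1(13)) (simp flip: mult.assoc)
      also have "\<dots> = rr (ShAr C d) * (rr (ShAr C x) * (rr (ShAr C ai) * (rr w' * rr c)))"
        using times_ext[OF Z2[symmetric], of "rr c"] by (simp add: mult.assoc)
      also have "\<dots> = rr (ShAr C d) * (rr (ShAr C x) * (rr (ShAr C ai) * (rr (ShAr C a) * rr w)))"
        using R1(6) by simp
      also have "\<dots> = rr (ShAr C d) * (rr (ShAr C x) * (rr (Idn C (ShOb C X)) * rr w))"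
        by (simp add: sai[THEN times_ext])
      also have "\<dots> = rr (ShAr C d) * (rr (ShAr C x) * rr w)" using tt by simp
      finally have "ShAr C d \<cdot> (m \<cdot> (fi \<cdot> (z \<cdot> c))) = ShAr C d \<cdot> (ShAr C x \<cdot> w)"
        using tt xt zt by (intro eqI_rr[of _ Z "ShOb C P'"]) (auto simp: typed_iff)
      then show ?thesis
        using tt xt zt
        by (intro iso_arrow_cancel[OF iso_arrow_ShAr[OF de(1)], of "ShAr C x \<cdot> w" Z]) (simp_all add: typed_iff)
    qed
    moreover have "typed (fi \<cdot> (z \<cdot> c)) Z R" using tt zt by (auto simp: typed_iff)
    ultimately show "\<exists>c. typed c Z R \<and> c \<cdot> v = l \<cdot> y \<and> ShAr C x \<cdot> w = m \<cdot> c" by blast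
  qed
qed

end

text \<open>Exactness at \<open>X[1]\<close> takes the place of rotating triangles: together with
  bijectivity of the shift it controls the kernel of \<open>Hom(Q, u)\<close>.\<close>

locale pretriangulated = shifted_category C for C :: "('o, 'm) tri_cat" (structure) +
  assumes Tri_exact: "t \<in> Tri C \<Longrightarrow> exact_triangle t"
    and Tri_tr3: "\<lbrakk>t \<in> Tri C; t' \<in> Tri C\<rbrakk> \<Longrightarrow> tr3 t t'"
    and Tri_iso: "\<lbrakk>t' \<in> Tri C; triangle_iso C t t'\<rbrakk> \<Longrightarrow> t \<in> Tri C"

section \<open>The homotopy category as a category with triangles\<close>

context plain_preadditive
begin

lemma category_K: "category K"
proof
  fix X Y X' Y' f
  assume "X \<in> Ob K" "Y \<in> Ob K" "X' \<in> Ob K" "Y' \<in> Ob K" "f \<in> Hom K X Y" "f \<in> Hom K X' Y'"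
  then show "X = X' \<and> Y = Y'" by (auto simp: Hom_K K_simps(1) karr_def)
next
  fix X assume "X \<in> Ob K"
  then show "Idn K X \<in> Hom K X X" by (simp add: K_simps(1) Idn_K cmap_unit karr_in_Hom)
next
  fix X Y Z f g assume "X \<in> Ob K" "Y \<in> Ob K" "Z \<in> Ob K" "f \<in> Hom K X Y" "g \<in> Hom K Y Z"
  then show "Comp K g f \<in> Hom K X Z" by (auto simp: K_simps(1) Hom_K Comp_K intro!: cmap_times)
next
  fix X Y f assume "X \<in> Ob K" "Y \<in> Ob K" "f \<in> Hom K X Y"
  then show "Comp K f (Idn K X) = f" "Comp K (Idn K Y) f = f"
    by (auto simp: K_simps(1) Hom_K Comp_K Idn_K cmap_unit times_unit[OF cmap_gmap] unit_times[OF cmap_gmap])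
next
  fix W X Y Z f g h
  assume "W \<in> Ob K" "X \<in> Ob K" "Y \<in> Ob K" "Z \<in> Ob K" "f \<in> Hom K W X" "g \<in> Hom K X Y" "h \<in> Hom K Y Z"
  then show "Comp K h (Comp K g f) = Comp K (Comp K h g) f"
    by (auto simp: K_simps(1) Hom_K Comp_K cmap_times mult.assoc)
qed

lemma preadditive_K: "preadditive K"
proof (intro preadditive.intro category_K preadditive_axioms.intro)
  fix X Y assume XY: "X \<in> Ob K" "Y \<in> Ob K"
  then have c: "is_complex C X" "is_complex C Y" by (auto simp: K_simps(1))
  show "comm_group (hom_group K X Y)"
  proof (rule comm_groupI)
    fix x assume "x \<in> carrier (hom_group K X Y)"
    then obtain z where z: "cmap X Y z" "x = karr X Y z" using c by (auto simp: hom_group_def Hom_K)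
    then show "\<exists>y\<in>carrier (hom_group K X Y). y \<otimes>\<^bsub>hom_group K X Y\<^esub> x = \<one>\<^bsub>hom_group K X Y\<^esub>"
      using c by (intro bexI[of _ "karr X Y (- z)"])
        (auto simp: hom_group_def Add_K Zero_K cmap_uminus intro!: karr_in_Hom)
  qed (use c in \<open>auto simp: hom_group_def Hom_K Add_K Zero_K cmap_0 cmap_plus add_ac\<close>)
next
  fix X Y Z f g g'
  assume "X \<in> Ob K" "Y \<in> Ob K" "Z \<in> Ob K" "f \<in> Hom K X Y" "g \<in> Hom K Y Z" "g' \<in> Hom K Y Z"
  then show "Comp K (Add K g g') f = Add K (Comp K g f) (Comp K g' f)"
    by (auto simp: K_simps(1) Hom_K Comp_K Add_K cmap_times cmap_plus algebra_simps)
next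
  fix X Y Z f f' g
  assume "X \<in> Ob K" "Y \<in> Ob K" "Z \<in> Ob K" "f \<in> Hom K X Y" "f' \<in> Hom K X Y" "g \<in> Hom K Y Z"
  then show "Comp K g (Add K f f') = Add K (Comp K g f) (Comp K g f')"
    by (auto simp: K_simps(1) Hom_K Comp_K Add_K cmap_times cmap_plus algebra_simps)
qed

section \<open>Bijectivity of the shift on homotopy classes\<close>

definition unshm :: "('o, 'm) cochain_complex \<Rightarrow> ('o, 'm) cochain_complex \<Rightarrow> ('o, 'm) hom_op \<Rightarrow> ('o, 'm) hom_op" where
  "unshm X Y x = des Y * x * sus X"

lemma gmap_unshm: "\<lbrakk>is_complex C X; is_complex C Y; gmap k (sh X) (sh Y) x\<rbrakk> \<Longrightarrow> gmap k X Y (unshm X Y x)"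
  unfolding unshm_def
  by (rule graded_map_times[of "-1" "obj X" "obj (sh X)" _ "k + 1"])
     (auto intro!: gmap_sus graded_map_times[OF _ gmap_des])

lemma shm_unshm:
  "\<lbrakk>is_complex C X; is_complex C Y; gmap k (sh X) (sh Y) x\<rbrakk> \<Longrightarrow> shm X Y (unshm X Y x) = x"
  by (simp add: shm_def unshm_def mult.assoc sus_des times_unit)
     (simp add: sus_des unit_times flip: mult.assoc)

lemma unshm_shm:
  "\<lbrakk>is_complex C X; is_complex C Y; gmap k X Y x\<rbrakk> \<Longrightarrow> unshm X Y (shm X Y x) = x"
  by (simp add: shm_def unshm_def mult.assoc des_sus times_unit)
     (simp add: des_sus unit_times flip: mult.assoc)

lemma cmap_unshm:
  assumes X: "is_complex C X" and Y: "is_complex C Y" and x: "cmap (sh X) (sh Y) x"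
  shows "cmap X Y (unshm X Y x)"
proof (rule cmapI)
  have "des Y * (x * (dif (sh X) * sus X)) = des Y * (dif (sh Y) * (x * sus X))"
    using cmap_dif_times[OF x] by simp
  then show "unshm X Y x * dif X = dif Y * unshm X Y x"
    by (simp add: unshm_def mult.assoc dif_sus[OF X] des_dif_times[OF Y])
qed (use X Y x in \<open>auto intro: gmap_unshm cmap_gmap\<close>)

lemma null_unshm:
  assumes X: "is_complex C X" and Y: "is_complex C Y" and "null (sh X) (sh Y) x"
  shows "null X Y (unshm X Y x)"
proof -
  obtain h where h: "gmap (-1) (sh X) (sh Y) h" "x = dif (sh Y) * h + h * dif (sh X)"
    using assms(3) by (auto simp: null_def)
  show ?thesis
    by (rule nullI[OF graded_map_uminus[OF gmap_unshm[OF X Y h(1)]]])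
       (simp add: h unshm_def algebra_simps dif_sus[OF X] des_dif_times[OF Y])
qed

lemma shifted_category_K: "shifted_category K"
proof (intro shifted_category.intro preadditive_K shifted_category_axioms.intro)
  fix X Y assume "X \<in> Ob K" "Y \<in> Ob K"
  then have c: "is_complex C X" "is_complex C Y" by (auto simp: K_simps(1))
  note s = complex_sh[OF c(1)] complex_sh[OF c(2)]
  show "bij_betw (ShAr K) (Hom K X Y) (Hom K (ShOb K X) (ShOb K Y))"
    unfolding bij_betw_def
  proof
    show "inj_on (ShAr K) (Hom K X Y)"
    proof (rule inj_onI)
      fix f g assume fg: "f \<in> Hom K X Y" "g \<in> Hom K X Y" "ShAr K f = ShAr K g"
      then obtain x y where xy: "cmap X Y x" "f = karr X Y x" "cmap X Y y" "g = karr X Y y"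
        using c by (auto simp: Hom_K)
      have "null (sh X) (sh Y) (shm X Y x - shm X Y y)"
        using fg xy by (simp add: ShAr_K karr_eq_iff cmap_shm)
      then have "null X Y (unshm X Y (shm X Y x - shm X Y y))" by (rule null_unshm[OF c])
      moreover have "unshm X Y (shm X Y x - shm X Y y) = unshm X Y (shm X Y x) - unshm X Y (shm X Y y)"
        by (simp add: unshm_def algebra_simps)
      ultimately have "null X Y (x - y)"
        using unshm_shm[OF c cmap_gmap[OF xy(1)]] unshm_shm[OF c cmap_gmap[OF xy(3)]] by simp
      then show "f = g" using xy by (simp add: karr_eq_iff)
    qed
    show "ShAr K ` Hom K X Y = Hom K (ShOb K X) (ShOb K Y)"
    proof (intro Set.set_eqI iffI)
      fix f assume "f \<in> ShAr K ` Hom K X Y"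
      then show "f \<in> Hom K (ShOb K X) (ShOb K Y)"
        using c by (auto simp: Hom_K ShAr_K K_simps(7) intro!: karr_in_Hom cmap_shm)
    next
      fix f assume "f \<in> Hom K (ShOb K X) (ShOb K Y)"
      then obtain x where x: "cmap (sh X) (sh Y) x" "f = karr (sh X) (sh Y) x"
        using s by (auto simp: Hom_K K_simps(7))
      then show "f \<in> ShAr K ` Hom K X Y"
        using c shm_unshm[OF c cmap_gmap[OF x(1)]]
        by (intro image_eqI[of _ _ "karr X Y (unshm X Y x)"]) (auto simp: ShAr_K cmap_unshm karr_in_Hom)
    qed
  qed
next
  fix X Y Z f g assume "X \<in> Ob K" "Y \<in> Ob K" "Z \<in> Ob K" "f \<in> Hom K X Y" "g \<in> Hom K Y Z"
  then show "ShAr K (Comp K g f) = Comp K (ShAr K g) (ShAr K f)"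
    by (auto simp: K_simps(1) Hom_K Comp_K ShAr_K cmap_shm cmap_times shm_times[OF _ cmap_gmap])
qed (auto simp: K_simps(1,7) complex_sh Hom_K Idn_K ShAr_K Add_K cmap_shm cmap_unit cmap_plus shm_unit shm_plus)

lemma typed_K: "category.typed K a X Y \<longleftrightarrow> (\<exists>x. cmap X Y x \<and> a = karr X Y x)"
  using category.typed_def[OF category_K] Hom_K cmap_complex karr_in_Hom
  by (auto simp: K_simps(1))

section \<open>Mapping cones\<close>

text \<open>The ring form of \<open>is_cone\<close>. The maps \<open>i\<close> and \<open>q\<close>
  are in general maps of graded objects only. The factor \<open>des X\<close> regards the component
  in \<open>X[1]\<close> as one in \<open>X\<close> a degree higher, where \<open>f\<close>
  applies.\<close>

definition cone where
  "cone X Y f Z i j p q \<longleftrightarrow> cmap X Y f \<and> is_complex C Z \<and>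
     gmap 0 (sh X) Z i \<and> gmap 0 Y Z j \<and> gmap 0 Z (sh X) p \<and> gmap 0 Z Y q \<and>
     p * i = unit (obj (sh X)) \<and> q * j = unit (obj Y) \<and> q * i = 0 \<and> p * j = 0 \<and>
     i * p + j * q = unit (obj Z) \<and>
     dif Z = i * dif (sh X) * p + j * f * des X * p + j * dif Y * q"

text \<open>The columns and rows of the matrix of \<open>dif Z\<close>. They show that
  \<open>j\<close> and \<open>p\<close> commute with the differentials, while the failure of
  \<open>i\<close> and \<open>q\<close> to do so is measured by \<open>f * des X\<close>.\<close>

lemma cone_rules:
  assumes "cone X Y f Z i j p q"
  shows "dif Z * i = i * dif (sh X) + j * (f * des X)" "dif Z * j = j * dif Y"
    "p * dif Z = dif (sh X) * p" "q * dif Z = f * (des X * p) + dif Y * q"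
proof -
  note c = assms[unfolded cone_def]
  have X: "is_complex C X" and Y: "is_complex C Y" using c cmap_complex by auto
  note d = gmap_dif[OF X] gmap_dif[OF Y] gmap_dif[OF complex_sh[OF X]] gmap_des[OF X]
  have fd: "gmap 1 (sh X) Y (f * des X)" using graded_map_times[OF d(4) cmap_gmap[of X Y f], of 1] c by simp
  have r: "p * i = unit (obj (sh X))" "q * j = unit (obj Y)" "q * i = 0" "p * j = 0"
    and dZ: "dif Z = i * (dif (sh X) * p) + (j * (f * (des X * p)) + j * (dif Y * q))"
    using c by (auto simp: mult.assoc add.assoc)
  have fdp: "gmap 1 Z Y (f * (des X * p))" using c fd graded_map_times[of 0 "obj Z" "obj (sh X)" p 1 "obj Y" "f * des X" 1] by (simp add: mult.assoc)
  have dp: "gmap 1 Z (sh X) (dif (sh X) * p)" and dq: "gmap 1 Z Y (dif Y * q)"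
    using c d by (auto intro: graded_map_times)
  show "dif Z * i = i * dif (sh X) + j * (f * des X)" "dif Z * j = j * dif Y"
    using d fd by (simp_all add: dZ algebra_simps r times_unit)
  show "p * dif Z = dif (sh X) * p" "q * dif Z = f * (des X * p) + dif Y * q"
    by (simp_all add: dZ distrib_left r[THEN times_ext] unit_times[OF dp] unit_times[OF fdp] unit_times[OF dq])
qed

lemma cone_cmaps:
  assumes c: "cone X Y f Z i j p q"
  shows "cmap X Y f" "is_complex C X" "is_complex C Y" "is_complex C Z" "cmap Y Z j" "cmap Z (sh X) p"
  using c cone_rules[OF c] cmap_complex[of X Y f] complex_sh[of X]
  by (auto simp: cone_def intro!: cmapI)

lemma cone_of_is_cone:
  assumes X: "is_complex C X" and Y: "is_complex C Y" and f: "f \<in> chain_maps C X Y"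
    and c: "is_cone C X Y f Z i j p q"
  shows "cone X Y (emb 0 (obj X) (obj Y) f) Z (emb 0 (obj (sh X)) (obj Z) i) (emb 0 (obj Y) (obj Z) j)
           (emb 0 (obj Z) (obj (sh X)) p) (emb 0 (obj Z) (obj Y) q)"
    and "i \<in> graded_hom 0 (obj (sh X)) (obj Z)" "j \<in> graded_hom 0 (obj Y) (obj Z)"
    and "p \<in> graded_hom 0 (obj Z) (obj (sh X))" "q \<in> graded_hom 0 (obj Z) (obj Y)"
proof -
  have bp: "biproduct C (obj (sh X) n) (obj Y n) (obj Z n) (i n) (j n) (p n) (q n)" for n
    using c by (simp add: is_cone_def obj_sh)
  have ob: "\<And>n. obj (sh X) n \<in> Ob C" "\<And>n. obj Y n \<in> Ob C" "\<And>n. obj Z n \<in> Ob C"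
    using bp by (auto simp: biproduct_def)
  show i: "i \<in> graded_hom 0 (obj (sh X)) (obj Z)" and j: "j \<in> graded_hom 0 (obj Y) (obj Z)"
    and p: "p \<in> graded_hom 0 (obj Z) (obj (sh X))" and q: "q \<in> graded_hom 0 (obj Z) (obj Y)"
    using bp by (auto simp: biproduct_def graded_hom_def)
  have f': "f \<in> graded_hom 0 (obj X) (obj Y)" "cmap X Y (emb 0 (obj X) (obj Y) f)"
    using f chain_maps_iff[OF X Y] by auto
  let ?i = "emb 0 (obj (sh X)) (obj Z) i" and ?j = "emb 0 (obj Y) (obj Z) j"
    and ?p = "emb 0 (obj Z) (obj (sh X)) p" and ?q = "emb 0 (obj Z) (obj Y) q"
    and ?f = "emb 0 (obj X) (obj Y) f"
  have r: "?p * ?i = unit (obj (sh X))" "?q * ?j = unit (obj Y)" "?q * ?i = 0" "?p * ?j = 0"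
    "?i * ?p + ?j * ?q = unit (obj Z)"
  proof -
    have "(\<lambda>n. p n \<cdot> i n) = (\<lambda>n. Idn C (obj (sh X) n))" using bp by (simp add: biproduct_def)
    then show "?p * ?i = unit (obj (sh X))" using emb_Comp[OF i p, of 0] by (simp add: unit_def)
    have "(\<lambda>n. q n \<cdot> j n) = (\<lambda>n. Idn C (obj Y n))" using bp by (simp add: biproduct_def)
    then show "?q * ?j = unit (obj Y)" using emb_Comp[OF j q, of 0] by (simp add: unit_def)
    have "(\<lambda>n. q n \<cdot> i n) = (\<lambda>n. Zero C (obj (sh X) n) (obj Y n))" using bp by (simp add: biproduct_def)
    then show "?q * ?i = 0" using emb_Comp[OF i q, of 0] emb_Zero[OF ob(1,2), of 0] by simp
    have "(\<lambda>n. p n \<cdot> j n) = (\<lambda>n. Zero C (obj Y n) (obj (sh X) n))" using bp by (simp add: biproduct_def)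
    then show "?p * ?j = 0" using emb_Comp[OF j p, of 0] emb_Zero[OF ob(2,1), of 0] by simp
    have "(\<lambda>n. i n \<cdot> p n \<boxplus> j n \<cdot> q n) = (\<lambda>n. Idn C (obj Z n))" using bp by (simp add: biproduct_def)
    then show "?i * ?p + ?j * ?q = unit (obj Z)"
      using emb_Comp[OF p i, of 0] emb_Comp[OF q j, of 0]
        emb_Add[OF graded_hom_Comp[OF p i, of 0] graded_hom_Comp[OF q j, of 0]]
      by (simp add: unit_def)
  qed
  have dX: "diff (sh X) \<in> graded_hom 1 (obj (sh X)) (obj (sh X))" by (rule dif_sh(1)[OF X])
  have dY: "diff Y \<in> graded_hom 1 (obj Y) (obj Y)" using Y by (simp add: is_complex_iff)
  note fd = emb_des[OF X f'(1), of 1, simplified]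
  have 1: "(\<lambda>n. i (n + 1) \<cdot> diff (sh X) n) \<in> graded_hom 1 (obj (sh X)) (obj Z)"
    "emb 1 (obj (sh X)) (obj Z) (\<lambda>n. i (n + 1) \<cdot> diff (sh X) n) = ?i * dif (sh X)"
    using graded_hom_Comp[OF dX i, of 1] emb_Comp[OF dX i, of 1] by (simp_all add: dif_def)
  have 2: "(\<lambda>n. i (n + 1) \<cdot> diff (sh X) n \<cdot> p n) \<in> graded_hom 1 (obj Z) (obj Z)"
    "emb 1 (obj Z) (obj Z) (\<lambda>n. i (n + 1) \<cdot> diff (sh X) n \<cdot> p n) = ?i * dif (sh X) * ?p"
    using graded_hom_Comp[OF p 1(1), of 1] emb_Comp[OF p 1(1), of 1] 1(2) by simp_all
  have 3: "(\<lambda>n. j (n + 1) \<cdot> f (n + 1)) \<in> graded_hom 1 (obj (sh X)) (obj Z)"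
    "emb 1 (obj (sh X)) (obj Z) (\<lambda>n. j (n + 1) \<cdot> f (n + 1)) = ?j * ?f * des X"
    using graded_hom_Comp[OF fd(1) j, of 1] emb_Comp[OF fd(1) j, of 1] fd(2) by (simp_all add: mult.assoc)
  have 4: "(\<lambda>n. j (n + 1) \<cdot> f (n + 1) \<cdot> p n) \<in> graded_hom 1 (obj Z) (obj Z)"
    "emb 1 (obj Z) (obj Z) (\<lambda>n. j (n + 1) \<cdot> f (n + 1) \<cdot> p n) = ?j * ?f * des X * ?p"
    using graded_hom_Comp[OF p 3(1), of 1] emb_Comp[OF p 3(1), of 1] 3(2) by simp_all
  have 5: "(\<lambda>n. j (n + 1) \<cdot> diff Y n) \<in> graded_hom 1 (obj Y) (obj Z)"
    "emb 1 (obj Y) (obj Z) (\<lambda>n. j (n + 1) \<cdot> diff Y n) = ?j * dif Y"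
    using graded_hom_Comp[OF dY j, of 1] emb_Comp[OF dY j, of 1] by (simp_all add: dif_def)
  have 6: "(\<lambda>n. j (n + 1) \<cdot> diff Y n \<cdot> q n) \<in> graded_hom 1 (obj Z) (obj Z)"
    "emb 1 (obj Z) (obj Z) (\<lambda>n. j (n + 1) \<cdot> diff Y n \<cdot> q n) = ?j * dif Y * ?q"
    using graded_hom_Comp[OF q 5(1), of 1] emb_Comp[OF q 5(1), of 1] 5(2) by simp_all
  have dZn: "diff Z = (\<lambda>n. i (n + 1) \<cdot> diff (sh X) n \<cdot> p n \<boxplus> j (n + 1) \<cdot> f (n + 1) \<cdot> p n
          \<boxplus> j (n + 1) \<cdot> diff Y n \<cdot> q n)"
    using c by (simp add: is_cone_def fun_eq_iff)
  note dZ1 = graded_hom_Add[OF graded_hom_Add[OF 2(1) 4(1)] 6(1), folded dZn]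
  have dZ2: "dif Z = ?i * dif (sh X) * ?p + ?j * ?f * des X * ?p + ?j * dif Y * ?q"
    unfolding dif_def[of Z] dZn emb_Add[OF graded_hom_Add[OF 2(1) 4(1)] 6(1)] emb_Add[OF 2(1) 4(1)]
    by (simp add: 2 4 6)
  \<comment> \<open>\<open>is_cone\<close> prescribes the differential without asserting that its
    square is zero. The diagonal terms vanish since the differentials of \<open>X[1]\<close> and
    \<open>Y\<close> square to zero; the two mixed terms cancel because \<open>des X\<close>
    anticommutes with the differentials.\<close>
  have "dif Z * dif Z = 0"
  proof -
    have u: "?p * (?i * z) = unit (obj (sh X)) * z" "?q * (?j * z) = unit (obj Y) * z"
      "?q * (?i * z) = 0" "?p * (?j * z) = 0" for z
      using r(1-4)[THEN times_ext] by simp_all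
    have m: "gmap 1 Z (sh X) (dif (sh X) * ?p)" "gmap 1 Z Y (dif Y * ?q)" "gmap 1 Z Y (?f * (des X * ?p))"
      using graded_map_times[OF graded_map_emb[OF p] gmap_dif[OF complex_sh[OF X]], of 1]
        graded_map_times[OF graded_map_emb[OF q] gmap_dif[OF Y], of 1]
        graded_map_times[OF graded_map_times[OF graded_map_emb[OF p] gmap_des[OF X], of 1] cmap_gmap[OF f'(2)], of 1]
      by simp_all
    show ?thesis
      unfolding dZ2
      by (simp add: algebra_simps u unit_times[OF m(1)] unit_times[OF m(2)] unit_times[OF m(3)]
          dif_dif_times[OF complex_sh[OF X]] dif_dif_times[OF Y] des_dif_times[OF X]
          cmap_dif_times[OF f'(2)])
  qed
  then have "is_complex C Z" using dZ1 by (simp add: is_complex_iff)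
  then show "cone X Y ?f Z ?i ?j ?p ?q"
    unfolding cone_def using f' r dZ2 graded_map_emb[OF i] graded_map_emb[OF j] graded_map_emb[OF p] graded_map_emb[OF q]
    by simp
qed

lemma triangle_iso_K: "triangle_iso (htpy_shift_cat C) = triangle_iso K"
  unfolding triangle_iso_def iso_arrow_def K_simps(2-8)
  by (simp add: K_simps(1) htpy_shift_cat_def)

lemma Tri_K_E:
  assumes "t \<in> Tri K"
  obtains X Y f Z i j p q where "cone X Y f Z i j p q"
    "triangle_iso K t (X, Y, Z, karr X Y f, karr Y Z j, karr Z (sh X) p)"
proof -
  obtain X Y f Z i j p q where c: "is_complex C X" "is_complex C Y" "f \<in> chain_maps C X Y"
      "is_cone C X Y f Z i j p q"
    and t: "triangle_iso (htpy_shift_cat C) t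
       (X, Y, Z, htpy_arrow C X Y f, htpy_arrow C Y Z j, htpy_arrow C Z (shift_complex C X) p)"
    using assms unfolding K_simps htpy_triangles_def by auto
  note k = cone_of_is_cone[OF c]
  have "f \<in> graded_hom 0 (obj X) (obj Y)" using c chain_maps_iff by blast
  with k t show ?thesis
    by (intro that[OF k(1)]) (simp add: htpy_arrow_eq_karr triangle_iso_K)
qed

lemma Tri_K_of_is_cone:
  assumes c: "is_complex C X" "is_complex C Y" "f \<in> chain_maps C X Y" "is_cone C X Y f Z i j p q"
  shows "(X, Y, Z, htpy_arrow C X Y f, htpy_arrow C Y Z j, htpy_arrow C Z (sh X) p) \<in> Tri K"
proof -
  note k = cone_of_is_cone[OF c]
  have f: "f \<in> graded_hom 0 (obj X) (obj Y)" using c chain_maps_iff by blast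
  have "shifted_category.tri_typed K (X, Y, Z, htpy_arrow C X Y f, htpy_arrow C Y Z j, htpy_arrow C Z (sh X) p)"
    using cone_cmaps[OF k(1)] f k
    by (auto simp: shifted_category.tri_typed_def[OF shifted_category_K] typed_K htpy_arrow_eq_karr K_simps(7))
  then have "triangle_iso K (X, Y, Z, htpy_arrow C X Y f, htpy_arrow C Y Z j, htpy_arrow C Z (sh X) p)
     (X, Y, Z, htpy_arrow C X Y f, htpy_arrow C Y Z j, htpy_arrow C Z (sh X) p)"
    by (rule shifted_category.triangle_iso_refl[OF shifted_category_K])
  then show ?thesis
    using c unfolding K_simps(9) htpy_triangles_def triangle_iso_K by blast
qed

lemma is_cone_exists:
  assumes bp: "\<And>X Y. \<lbrakk>X \<in> Ob C; Y \<in> Ob C\<rbrakk> \<Longrightarrow> \<exists>S i j p q. biproduct C X Y S i j p q"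
    and c: "is_complex C X" "is_complex C Y"
  obtains Z i j p q where "is_cone C X Y f Z i j p q"
proof -
  have "\<exists>S i j p q. biproduct C (obj X (n + 1)) (obj Y n) S i j p q" for n
    using bp c by (simp add: complex_obj)
  then obtain S i j p q where b: "\<And>n. biproduct C (obj X (n + 1)) (obj Y n) (S n) (i n) (j n) (p n) (q n)"
    by metis
  let ?Z = "\<lparr>obj = S, diff = \<lambda>n. i (n + 1) \<cdot> diff (sh X) n \<cdot> p n \<boxplus> j (n + 1) \<cdot> f (n + 1) \<cdot> p n
          \<boxplus> j (n + 1) \<cdot> diff Y n \<cdot> q n\<rparr>"
  have "is_cone C X Y f ?Z i j p q" using b by (simp add: is_cone_def)
  then show ?thesis by (rule that)
qed

lemma cone_ext:
  assumes c: "cone X Y f Z i j p q"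
  shows "graded_map k W (obj (sh X)) z \<Longrightarrow> p * (i * z) = z"
    "graded_map k W (obj Y) z \<Longrightarrow> q * (j * z) = z" "q * (i * z) = 0" "p * (j * z) = 0"
    "graded_map k W (obj Z) z \<Longrightarrow> i * (p * z) + j * (q * z) = z"
proof -
  have r: "p * i = unit (obj (sh X))" "q * j = unit (obj Y)" "q * i = 0" "p * j = 0"
     "i * p + j * q = unit (obj Z)" using c by (auto simp: cone_def)
  show "graded_map k W (obj (sh X)) z \<Longrightarrow> p * (i * z) = z" "graded_map k W (obj Y) z \<Longrightarrow> q * (j * z) = z"
     "q * (i * z) = 0" "p * (j * z) = 0"
    using r(1-4)[THEN times_ext] by (simp_all add: unit_times)
  show "graded_map k W (obj Z) z \<Longrightarrow> i * (p * z) + j * (q * z) = z"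
    using arg_cong[OF r(5), of "\<lambda>u. u * z"] by (simp add: distrib_right mult.assoc unit_times)
qed

lemma null_iff_Zero:
  assumes "cmap X Y x" shows "karr X Y x = Zero K X Y \<longleftrightarrow> null X Y x"
  using karr_eq_iff[OF assms cmap_0] cmap_complex[OF assms] by (simp add: Zero_K)

text \<open>Everything is read off from components: a null homotopy with values in one vertex of the
  triangle supplies, after \<open>des\<close>, the correction or the map required at the
  neighbouring vertex. The vanishing of the composites comes from the homotopies
  \<open>i * sus X\<close> and \<open>sus Y * q\<close>, and from \<open>p * j = 0\<close>.\<close>

lemma exact_triangle_cone:
  assumes c: "cone X Y f Z i j p q"
  shows "shifted_category.exact_triangle K (X, Y, Z, karr X Y f, karr Y Z j, karr Z (sh X) p)"
proof -
  note cm = cone_cmaps[OF c] and cr = cone_rules[OF c]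
  note X = cm(2) and Y = cm(3) and Z = cm(4)
  note crx = cr(1,2)[THEN times_ext] cr(3,4)[THEN times_ext]
  note sX = complex_sh[OF X] and sY = complex_sh[OF Y]
  have g: "gmap 0 (sh X) Z i" "gmap 0 Y Z j" "gmap 0 Z (sh X) p" "gmap 0 Z Y q" "gmap 0 X Y f"
    using c cmap_gmap by (auto simp: cone_def)
  have pj: "p * j = 0" using c by (simp add: cone_def)
  have z1: "null X Z (j * f)"
  proof (rule nullI)
    show "gmap (-1) X Z (i * sus X)" using g gmap_sus[OF X] by (auto intro: graded_map_times)
    show "j * f = dif Z * (i * sus X) + i * sus X * dif X"
      by (simp add: crx distrib_right mult.assoc dif_sus[OF X] des_sus[OF X] times_unit[OF g(5)])
  qed
  have z3: "null Z (sh Y) (shm X Y f * p)"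
  proof (rule nullI)
    show "gmap (-1) Z (sh Y) (sus Y * q)" using g gmap_sus[OF Y] by (auto intro: graded_map_times)
    show "shm X Y f * p = dif (sh Y) * (sus Y * q) + sus Y * q * dif Z"
      by (simp add: shm_def cr distrib_left mult.assoc dif_sus_times[OF Y])
  qed
  have e1: "\<exists>k. cmap Q X k \<and> null Q Y (f * k - y)"
    if Q: "cmap Q Y y" and n: "null Q Z (j * y)" for Q y
  proof -
    obtain h where h: "gmap (-1) Q Z h" "j * y = dif Z * h + h * dif Q" using n by (auto simp: null_def)
    note qc = cmap_complex(1)[OF Q]
    \<comment> \<open>Since \<open>p * j = 0\<close>, the component \<open>p * h\<close>
      anticommutes with the differentials; so does \<open>des X\<close>, hence the product is a
      chain map. The component \<open>q * h\<close> becomes, up to sign, the homotopy between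
      \<open>f * k\<close> and \<open>y\<close>.\<close>
    let ?k = "des X * (p * h)"
    have ph: "gmap (-1) Q (sh X) (p * h)" and qh: "gmap (-1) Q Y (q * h)"
      using g h by (auto intro: graded_map_times)
    have gk: "gmap 0 Q X ?k" using ph gmap_des[OF X] by (auto intro: graded_map_times)
    have "p * (j * y) = dif (sh X) * (p * h) + p * (h * dif Q)"
      unfolding h(2) by (simp add: distrib_left crx mult.assoc)
    then have "des X * (dif (sh X) * (p * h) + p * (h * dif Q)) = 0"
      by (simp add: pj flip: mult.assoc)
    then have kc: "?k * dif Q = dif X * ?k"
      by (simp add: distrib_left des_dif_times[OF X] mult.assoc)
    have "q * (j * y) = f * ?k + dif Y * (q * h) + q * (h * dif Q)"
      unfolding h(2) by (simp add: distrib_left distrib_right crx mult.assoc)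
    then have y: "y = f * ?k + (dif Y * (q * h) + q * h * dif Q)"
      using cone_ext(2)[OF c cmap_gmap[OF Q]] by (simp add: mult.assoc add.assoc)
    have "null Q Y (f * ?k - y)"
      by (rule nullI[OF graded_map_uminus[OF qh]]) (subst y, simp add: algebra_simps)
    moreover have "cmap Q X ?k" by (rule cmapI[OF qc X gk kc])
    ultimately show ?thesis by blast
  qed
  have e2: "\<exists>b. cmap Q Y b \<and> null Q Z (j * b - z)"
    if Q: "cmap Q Z z" and n: "null Q (sh X) (p * z)" for Q z
  proof -
    obtain h where h: "gmap (-1) Q (sh X) h" "p * z = dif (sh X) * h + h * dif Q" using n by (auto simp: null_def)
    note qc = cmap_complex(1)[OF Q] and zg = cmap_gmap[OF Q]
    \<comment> \<open>\<open>q * z\<close> fails to be a chain map by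
      \<open>f * des X * p * z\<close>. As \<open>p * z\<close> is the boundary of \<open>h\<close>,
      subtracting \<open>f * des X * h\<close> repairs this.\<close>
    let ?b = "q * z - f * (des X * h)"
    have dh: "gmap 0 Q X (des X * h)" using h gmap_des[OF X] by (auto intro: graded_map_times)
    have gb: "gmap 0 Q Y ?b" using g zg dh by (auto intro!: graded_map_minus intro: graded_map_times)
    have "q * (z * dif Q) = q * (dif Z * z)" by (simp add: cmap_dif[OF Q])
    also have "\<dots> = f * (des X * (p * z)) + dif Y * (q * z)"
      by (simp add: crx distrib_right mult.assoc)
    also have "f * (des X * (p * z)) = f * (des X * (h * dif Q)) - dif Y * (f * (des X * h))"
      by (simp add: h algebra_simps des_dif_times[OF X] cmap_dif_times[OF cm(1)])
    finally have bc: "?b * dif Q = dif Y * ?b" by (simp add: algebra_simps)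
    have ih: "gmap (-1) Q Z (i * h)" using g h by (auto intro: graded_map_times)
    have "j * ?b - z = - (i * (p * z)) - j * (f * (des X * h))"
      using cone_ext(5)[OF c zg] by (simp add: algebra_simps)
    also have "\<dots> = dif Z * (- (i * h)) + - (i * h) * dif Q"
      by (simp add: h(2) algebra_simps crx)
    finally have "null Q Z (j * ?b - z)" by (rule nullI[OF graded_map_uminus[OF ih]])
    moreover have "cmap Q Y ?b" by (rule cmapI[OF qc Y gb bc])
    ultimately show ?thesis by blast
  qed
  have e3: "\<exists>z. cmap Q Z z \<and> null Q (sh X) (p * z - y)"
    if Q: "cmap Q (sh X) y" and n: "null Q (sh Y) (shm X Y f * y)" for Q y
  proof -
    obtain h where h: "gmap (-1) Q (sh Y) h" "shm X Y f * y = dif (sh Y) * h + h * dif Q"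
      using n by (auto simp: null_def)
    note qc = cmap_complex(1)[OF Q] and yg = cmap_gmap[OF Q]
    \<comment> \<open>\<open>i * y\<close> fails to be a chain map by
      \<open>j * f * des X * y\<close>; the null homotopy of the shifted \<open>f\<close> after
      \<open>y\<close>, brought back to \<open>Y\<close> by \<open>des Y\<close>, compensates for
      it.\<close>
    let ?z = "i * y + j * (des Y * h)"
    have dh: "gmap 0 Q Y (des Y * h)" using h gmap_des[OF Y] by (auto intro: graded_map_times)
    have gz: "gmap 0 Q Z ?z" using g yg dh by (auto intro!: graded_map_plus intro: graded_map_times)
    have fy: "gmap 1 Q Y (f * (des X * y))"
      using graded_map_times[OF graded_map_times[OF yg gmap_des[OF X], of 1] g(5), of 1] by simp
    have "f * (des X * y) = des Y * (shm X Y f * y)"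
      using des_sus_times[OF Y fy] by (simp add: shm_def mult.assoc)
    also have "\<dots> = des Y * (h * dif Q) - dif Y * (des Y * h)"
      by (simp add: h(2) distrib_left des_dif_times[OF Y])
    finally have fdx: "f * (des X * y) = des Y * (h * dif Q) - dif Y * (des Y * h)" .
    have zc: "?z * dif Q = dif Z * ?z"
      by (simp add: algebra_simps crx cmap_dif[OF Q] fdx)
    have "p * ?z - y = 0"
      using cone_ext(1)[OF c yg] cone_ext(4)[OF c] by (simp add: distrib_left)
    then have "null Q (sh X) (p * ?z - y)" using null_0[OF qc sX] by simp
    moreover have "cmap Q Z ?z" by (rule cmapI[OF qc Z gz zc])
    ultimately show ?thesis by blast
  qed
  have t: "shifted_category.tri_typed K (X, Y, Z, karr X Y f, karr Y Z j, karr Z (sh X) p)"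
    using cm by (auto simp: shifted_category.tri_typed_def[OF shifted_category_K] typed_K K_simps(7))
  have a: "Comp K (karr Y Z j) (karr X Y f) = Zero K X Z"
    using z1 cm null_iff_Zero cmap_times by (simp add: Comp_K)
  have b: "Comp K (karr Z (sh X) p) (karr Y Z j) = Zero K Y (sh X)"
    using cm Y sX by (simp add: Comp_K pj Zero_K)
  have d: "Comp K (ShAr K (karr X Y f)) (karr Z (sh X) p) = Zero K Z (sh Y)"
    using z3 cm null_iff_Zero cmap_times[OF cm(6) cmap_shm[OF cm(1)]] by (simp add: Comp_K ShAr_K cmap_shm)
  have ker: "\<exists>k. category.typed K k Q V \<and> Comp K (karr V U r) k = y"
    if y: "category.typed K y Q U" "Comp K (karr U W s) y = Zero K Q W" and r: "cmap V U r" and s: "cmap U W s"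
      and ex: "\<And>y. \<lbrakk>cmap Q U y; null Q W (s * y)\<rbrakk> \<Longrightarrow> \<exists>k. cmap Q V k \<and> null Q U (r * k - y)"
    for y Q U V W r s
  proof -
    obtain y' where y': "cmap Q U y'" "y = karr Q U y'" using y(1) by (auto simp: typed_K)
    have "null Q W (s * y')" using y y' s null_iff_Zero cmap_times by (simp add: Comp_K)
    then obtain k where k: "cmap Q V k" "null Q U (r * k - y')" using ex y' by blast
    then have "Comp K (karr V U r) (karr Q V k) = y"
      using y' r by (simp add: Comp_K karr_eq_iff cmap_times)
    then show ?thesis using k typed_K by blast
  qed
  show ?thesis
    unfolding shifted_category.exact_triangle_def[OF shifted_category_K]
    using t a b d ker[OF _ _ cm(1) cm(5) e1] ker[OF _ _ cm(5) cm(6) e2]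
      ker[OF _ _ cm(6) cmap_shm[OF cm(1)] e3]
    by (auto simp: K_simps(7) ShAr_K[OF cm(1)])
qed

lemma tr3_cone:
  assumes c: "cone X Y f Z i j p q" and c': "cone X' Y' f' Z' i' j' p' q'"
  shows "shifted_category.tr3 K (X, Y, Z, karr X Y f, karr Y Z j, karr Z (sh X) p)
    (X', Y', Z', karr X' Y' f', karr Y' Z' j', karr Z' (sh X') p')"
proof -
  note cm = cone_cmaps[OF c] and cr = cone_rules[OF c]
  note cm' = cone_cmaps[OF c'] and cr' = cone_rules[OF c']
  note crx = cr(1,2)[THEN times_ext] cr(3,4)[THEN times_ext]
    cr'(1,2)[THEN times_ext] cr'(3,4)[THEN times_ext]
  have g: "gmap 0 (sh X) Z i" "gmap 0 Y Z j" "gmap 0 Z (sh X) p" "gmap 0 Z Y q" "gmap 0 X Y f"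
    "gmap 0 (sh X') Z' i'" "gmap 0 Y' Z' j'" "gmap 0 Z' (sh X') p'" "gmap 0 Z' Y' q'"
    using c c' cmap_gmap by (auto simp: cone_def)
  have pj: "p * j = 0" "q * j = unit (obj Y)" using c by (auto simp: cone_def)
  note X = cm(2) and Y = cm(3) and Z = cm(4) and X' = cm'(2) and Y' = cm'(3) and Z' = cm'(4)
  have "\<exists>z. category.typed K z Z Z' \<and> Comp K z (karr Y Z j) = Comp K (karr Y' Z' j') b \<and>
      Comp K (ShAr K a) (karr Z (sh X) p) = Comp K (karr Z' (sh X') p') z"
    if ab: "category.typed K a X X'" "category.typed K b Y Y'"
      "Comp K b (karr X Y f) = Comp K (karr X' Y' f') a" for a b
  proof -
    obtain x y where x: "cmap X X' x" "a = karr X X' x" and y: "cmap Y Y' y" "b = karr Y Y' y"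
      using ab by (auto simp: typed_K)
    have "null X Y' (y * f - f' * x)"
      using ab(3) x y cm(1) cm'(1) by (simp add: Comp_K karr_eq_iff cmap_times)
    then obtain h where h: "gmap (-1) X Y' h" "y * f - f' * x = dif Y' * h + h * dif X"
      by (auto simp: null_def)
    have yf: "y * f = f' * x + dif Y' * h + h * dif X" using h(2) by (simp add: algebra_simps)
    let ?s = "shm X X' x"
    \<comment> \<open>The diagonal entries are the shift of \<open>x\<close> and \<open>y\<close>.
      The first square commutes only up to the homotopy \<open>h\<close>, which therefore enters as
      the off-diagonal entry.\<close>
    let ?z = "i' * (?s * p) + j' * (y * q) + j' * (h * (des X * p))"
    have dp: "gmap 1 Z X (des X * p)" using g(3) gmap_des[OF X] by (auto intro: graded_map_times)
    have hdp: "gmap 0 Z Y' (h * (des X * p))" using dp h(1) by (auto intro: graded_map_times)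
    have gz: "gmap 0 Z Z' ?z"
      using g hdp cmap_gmap[OF y(1)] cmap_gmap[OF cmap_shm[OF x(1)]]
      by (auto intro!: graded_map_plus intro: graded_map_times)
    have xg: "gmap 1 Z X' (x * (des X * p))" using dp cmap_gmap[OF x(1)] by (auto intro: graded_map_times)
    have zc: "?z * dif Z = dif Z' * ?z"
      by (simp add: algebra_simps crx cr cmap_dif_times[OF cmap_shm[OF x(1)]] cmap_dif_times[OF y(1)]
          des_dif_times[OF X])
         (simp add: yf[THEN times_ext] shm_def algebra_simps des_sus_times[OF X' xg])
    have zcm: "cmap Z Z' ?z" by (rule cmapI[OF Z Z' gz zc])
    have "?z * j = j' * y"
      by (simp add: distrib_right mult.assoc pj times_unit[OF cmap_gmap[OF y(1)]])
    moreover have "p' * ?z = ?s * p"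
      using cone_ext(1)[OF c', of 0 "obj Z" "?s * p"] cone_ext(4)[OF c'] g(3) cmap_gmap[OF cmap_shm[OF x(1)]]
      by (simp add: distrib_left graded_map_times[of 0 _ _ _ 0])
    ultimately show ?thesis
      using zcm x y cm cm' typed_K[of "karr Z Z' ?z"]
      by (intro exI[of _ "karr Z Z' ?z"]) (auto simp: Comp_K ShAr_K cmap_shm)
  qed
  then show ?thesis
    unfolding shifted_category.tr3_def[OF shifted_category_K] by simp
qed

lemma pretriangulated_K: "pretriangulated K"
proof (intro pretriangulated.intro shifted_category_K pretriangulated_axioms.intro)
  fix t assume "t \<in> Tri K"
  then show "shifted_category.exact_triangle K t"
    by (elim Tri_K_E)
       (rule shifted_category.exact_triangle_iso[OF shifted_category_K], assumption, rule exact_triangle_cone)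
next
  fix t t' assume "t \<in> Tri K" "t' \<in> Tri K"
  then show "shifted_category.tr3 K t t'"
    by (elim Tri_K_E)
       (rule shifted_category.tr3_iso[OF shifted_category_K], assumption, assumption, rule tr3_cone)
next
  fix t t' assume "t' \<in> Tri K" and "triangle_iso K t t'"
  then show "t \<in> Tri K"
    using shifted_category.triangle_iso_trans[OF shifted_category_K \<open>triangle_iso K t t'\<close>]
    unfolding K_simps(9) htpy_triangles_def triangle_iso_K by fast
qed

end

section \<open>Verdier localization at a class with enough colocal objects\<close>

text \<open>The abstract comparison, with \<open>P\<close> in the role of the complexes of relative
  projectives and \<open>N\<close> in that of the split acyclic ones. \<open>P_unshift\<close> asks
  for an equality of objects; it allows a map from an object of \<open>P\<close> into
  \<open>X[1]\<close> to be written as a shift.\<close>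

locale colocalization = pretriangulated C for C :: "('o, 'm) tri_cat" (structure) +
  fixes N P :: "'o set"
  assumes P_Ob: "P \<subseteq> Ob C"
    and P_N: "\<lbrakk>Q \<in> P; S \<in> N; g \<in> Hom C Q S\<rbrakk> \<Longrightarrow> g = Zero C Q S"
    and P_shift: "Q \<in> P \<Longrightarrow> ShOb C Q \<in> P"
    and P_unshift: "Q \<in> P \<Longrightarrow> \<exists>Q'\<in>P. ShOb C Q' = Q"
    and P_cone: "\<lbrakk>Q \<in> P; Q' \<in> P; u \<in> Hom C Q Q'\<rbrakk> \<Longrightarrow> \<exists>Z\<in>P. \<exists>v w. (Q, Q', Z, u, v, w) \<in> Tri C"
    and P_resolution: "X \<in> Ob C \<Longrightarrow> \<exists>Q\<in>P. \<exists>s. s \<in> cone_in C N Q X"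
begin

lemma rr_compD: "\<lbrakk>g \<cdot> f = h; arr f; arr g; src g = tgt f\<rbrakk> \<Longrightarrow> rr g * rr f = rr h"
  using rr_Comp by metis

lemma P_in_Ob: "Q \<in> P \<Longrightarrow> Q \<in> Ob C"
  using P_Ob by blast

section \<open>Maps inverted by all \<open>Hom(Q, -)\<close> with \<open>Q\<close> in
  \<open>P\<close>\<close>

definition colocal :: "'m \<Rightarrow> bool" where
  "colocal s \<longleftrightarrow> arr s \<and> (\<forall>Q\<in>P. \<forall>x. typed x Q (tgt s) \<longrightarrow> (\<exists>!g. typed g Q (src s) \<and> s \<cdot> g = x))"

definition lift :: "'m \<Rightarrow> 'm \<Rightarrow> 'm" where
  "lift s x = (THE g. typed g (src x) (src s) \<and> s \<cdot> g = x)"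

lemma colocal_arr [simp]: "colocal s \<Longrightarrow> arr s"
  by (simp add: colocal_def)

lemma lift:
  assumes "colocal s" "arr x" "src x \<in> P" "tgt x = tgt s"
  shows "arr (lift s x)" "src (lift s x) = src x" "tgt (lift s x) = src s" "s \<cdot> lift s x = x"
proof -
  have "typed x (src x) (tgt s)" using assms by (simp add: typed_iff)
  then have "\<exists>!g. typed g (src x) (src s) \<and> s \<cdot> g = x"
    using assms by (simp add: colocal_def)
  then have "typed (lift s x) (src x) (src s) \<and> s \<cdot> lift s x = x"
    unfolding lift_def by (rule theI')
  then show "arr (lift s x)" "src (lift s x) = src x" "tgt (lift s x) = src s" "s \<cdot> lift s x = x"
    by (auto simp: typed_iff)
qed

lemma colocal_cancel:
  assumes "colocal s" "src g \<in> P" "arr g" "arr g'" "src g' = src g" "tgt g = src s" "tgt g' = src s"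
    "s \<cdot> g = s \<cdot> g'"
  shows "g = g'"
proof -
  have "typed (s \<cdot> g) (src g) (tgt s)" using assms by (simp add: typed_iff)
  then have "\<exists>!k. typed k (src g) (src s) \<and> s \<cdot> k = s \<cdot> g"
    using assms by (simp add: colocal_def)
  moreover have "typed g (src g) (src s)" "typed g' (src g) (src s)" using assms by (auto simp: typed_iff)
  ultimately show ?thesis using assms by metis
qed

lemma colocal_cancel_rr:
  assumes "colocal s" "src g \<in> P" "arr g" "arr g'" "src g' = src g" "tgt g = src s" "tgt g' = src s"
    "rr s * rr g = rr s * rr g'"
  shows "g = g'"
  by (rule colocal_cancel[OF assms(1-7)], rule rr_inject) (use assms in auto)

lemma colocalI:
  assumes "arr s"
    and ex: "\<And>Q x. \<lbrakk>Q \<in> P; typed x Q (tgt s)\<rbrakk> \<Longrightarrow> \<exists>g. typed g Q (src s) \<and> s \<cdot> g = x"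
    and un: "\<And>Q g. \<lbrakk>Q \<in> P; typed g Q (src s); rr s * rr g = 0\<rbrakk> \<Longrightarrow> rr g = 0"
  shows "colocal s"
  unfolding colocal_def
proof (intro conjI ballI allI impI ex_ex1I)
  fix Q x assume Q: "Q \<in> P" "typed x Q (tgt s)"
  show "\<exists>g. typed g Q (src s) \<and> s \<cdot> g = x" by (rule ex) fact+
  fix g g' assume g: "typed g Q (src s) \<and> s \<cdot> g = x" "typed g' Q (src s) \<and> s \<cdot> g' = x"
  have "rr s * rr g = rr s * rr g'"
    using g assms(1) rr_Comp[of g s] rr_Comp[of g' s] by (simp add: typed_iff)
  then have "rr (g \<boxminus> g') = 0"
    using g Q by (intro un[OF Q(1)] typed_minus) (auto simp: typed_iff algebra_simps)
  then show "g = g'" using g by (intro rr_inject) (auto simp: typed_iff)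
qed (rule assms(1))

text \<open>The Yoneda lemma inside \<open>P\<close>: lifting the identity of the target gives a
  right inverse, and cancelling \<open>s\<close> shows that it is also a left inverse.\<close>

lemma iso_of_colocal:
  assumes s: "colocal s" "src s \<in> P" "tgt s \<in> P"
  shows "lift s (Idn C (tgt s)) \<cdot> s = Idn C (src s)" "s \<cdot> lift s (Idn C (tgt s)) = Idn C (tgt s)"
    "iso_arrow C (src s) (tgt s) s" "iso_arrow C (tgt s) (src s) (lift s (Idn C (tgt s)))"
proof -
  have ob: "src s \<in> Ob C" "tgt s \<in> Ob C" using s by (auto simp: arr_src arr_tgt)
  note l = lift[OF s(1), of "Idn C (tgt s)", simplified ob arr_Idn, OF TrueI s(3) refl]
  show 1: "s \<cdot> lift s (Idn C (tgt s)) = Idn C (tgt s)" by (rule l)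
  show 2: "lift s (Idn C (tgt s)) \<cdot> s = Idn C (src s)"
  proof (rule colocal_cancel[OF s(1)])
    show "s \<cdot> (lift s (Idn C (tgt s)) \<cdot> s) = s \<cdot> Idn C (src s)"
      using l s by (simp add: Comp_assoc_arr[symmetric])
  qed (use l s ob in auto)
  show "iso_arrow C (src s) (tgt s) s" "iso_arrow C (tgt s) (src s) (lift s (Idn C (tgt s)))"
    using 1 2 l s by (auto simp: typed_iff intro!: iso_arrowI)
qed

lemma TriD:
  assumes "(X, Y, Z, u, v, w) \<in> Tri C"
  shows "typed u X Y" "typed v Y Z" "typed w Z (ShOb C X)"
    "rr v * rr u = 0" "rr w * rr v = 0" "rr (ShAr C u) * rr w = 0"
    "\<And>Q g. \<lbrakk>typed g Q Y; rr v * rr g = 0\<rbrakk> \<Longrightarrow> \<exists>g'. typed g' Q X \<and> u \<cdot> g' = g"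
    "\<And>Q g. \<lbrakk>typed g Q Z; rr w * rr g = 0\<rbrakk> \<Longrightarrow> \<exists>g'. typed g' Q Y \<and> v \<cdot> g' = g"
    "\<And>Q g. \<lbrakk>typed g Q (ShOb C X); rr (ShAr C u) * rr g = 0\<rbrakk> \<Longrightarrow> \<exists>g'. typed g' Q Z \<and> w \<cdot> g' = g"
proof -
  note e = Tri_exact[OF assms, unfolded exact_triangle_def tri_typed_def, simplified]
  then show t: "typed u X Y" "typed v Y Z" "typed w Z (ShOb C X)" by auto
  note tt = t[unfolded typed_iff]
  have z: "g \<cdot> f = Zero C (src f) (tgt g) \<longleftrightarrow> rr g * rr f = 0" if "arr f" "arr g" "src g = tgt f" for f g
    using that rr_0_iff[of "g \<cdot> f" "src f" "tgt g"] by (simp add: typed_iff)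
  show "rr v * rr u = 0" "rr w * rr v = 0" "rr (ShAr C u) * rr w = 0"
    using e tt z[of u v] z[of v w] z[of w "ShAr C u"] by simp_all
  fix Q g
  show "\<lbrakk>typed g Q Y; rr v * rr g = 0\<rbrakk> \<Longrightarrow> \<exists>g'. typed g' Q X \<and> u \<cdot> g' = g"
    using e tt z[of g v] by (auto simp: typed_iff)
  show "\<lbrakk>typed g Q Z; rr w * rr g = 0\<rbrakk> \<Longrightarrow> \<exists>g'. typed g' Q Y \<and> v \<cdot> g' = g"
    using e tt z[of g w] by (auto simp: typed_iff)
  show "\<lbrakk>typed g Q (ShOb C X); rr (ShAr C u) * rr g = 0\<rbrakk> \<Longrightarrow> \<exists>g'. typed g' Q Z \<and> w \<cdot> g' = g"
    using e tt z[of g "ShAr C u"] by (auto simp: typed_iff)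
qed

text \<open>Additivity shows that the shift of zero is zero; injectivity on hom-sets gives the
  converse.\<close>

lemma rr_ShAr_eq_0: "arr f \<Longrightarrow> rr (ShAr C f) = 0 \<longleftrightarrow> rr f = 0"
proof
  assume f: "arr f"
  let ?z = "Zero C (src f) (tgt f)"
  have z: "arr ?z" "src ?z = src f" "tgt ?z = tgt f" "rr ?z = 0" using f by (auto simp: arr_src arr_tgt)
  have "?z \<boxplus> ?z = ?z" using f by (simp add: Zero_Add Zero_in_Hom arr_src arr_tgt)
  then have "ShAr C ?z \<boxplus> ShAr C ?z = ShAr C ?z"
    using ShAr_Add[of "src f" "tgt f" ?z ?z] f by (simp add: Zero_in_Hom arr_src arr_tgt)
  then have sz: "rr (ShAr C ?z) = 0"
    using rr_Add[of "ShAr C ?z" "ShAr C ?z"] z by simp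
  show "rr f = 0" if "rr (ShAr C f) = 0"
  proof -
    have "ShAr C f = ShAr C ?z" using f z sz that by (intro rr_inject) auto
    then have "f = ?z" using f z by (intro ShAr_inj[of f "src f" "tgt f"]) (auto simp: typed_iff)
    then show ?thesis using z by metis
  qed
  show "rr (ShAr C f) = 0" if "rr f = 0"
  proof -
    have "f = ?z" using f z that by (intro rr_inject) auto
    then show ?thesis using sz by metis
  qed
qed

lemma cone_in_typed: "\<lbrakk>s \<in> cone_in C N U X\<rbrakk> \<Longrightarrow> typed s U X"
  using TriD by (auto simp: cone_in_def)

text \<open>The exact sequence of \<open>Hom(Q, -)\<close>: the third vertex \<open>Z\<close> lies
  in \<open>N\<close>, so \<open>Hom(Q, Z)\<close> vanishes, which gives surjectivity. The shift of
  \<open>Q\<close> is again in \<open>P\<close>, so \<open>Hom(Q[1], Z)\<close> vanishes as well,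
  which gives injectivity.\<close>

lemma cone_in_colocal:
  assumes "s \<in> cone_in C N U X" shows "colocal s"
proof -
  obtain Z v w where Z: "Z \<in> N" and t: "(U, X, Z, s, v, w) \<in> Tri C"
    using assms by (auto simp: cone_in_def)
  note t = TriD[OF t]
  note tt = t(1-3)[unfolded typed_iff]
  have PN: "rr g = 0" if "typed g Q Z" "Q \<in> P" for g Q
    using that Z P_N[of Q Z g] rr_Zero[of Q Z] by (auto simp: typed_def)
  show ?thesis
  proof (rule colocalI)
    show "arr s" using tt by simp
    fix Q assume Q: "Q \<in> P"
    show "\<exists>g. typed g Q (src s) \<and> s \<cdot> g = x" if "typed x Q (tgt s)" for x
    proof -
      have "rr (v \<cdot> x) = 0" using that tt Q by (intro PN[of _ Q]) (auto simp: typed_iff)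
      then show ?thesis using t(7)[of x Q] that tt by (auto simp: typed_iff)
    qed
    fix g assume g: "typed g Q (src s)" "rr s * rr g = 0"
    note gt = g(1)[unfolded typed_iff]
    \<comment> \<open>Exactness to the left of \<open>U\<close> is obtained by shifting: the shift
      of \<open>g\<close> is killed by the shift of \<open>s\<close>, so it factors through
      \<open>w\<close> and a map \<open>Q[1] -> Z\<close>.\<close>
    have "rr (ShAr C (s \<cdot> g)) = 0" using rr_ShAr_eq_0[of "s \<cdot> g"] g(2) gt tt by simp
    then have "rr (ShAr C s) * rr (ShAr C g) = 0"
      using gt tt by (simp add: ShAr_Comp_arr)
    then obtain k where k: "typed k (ShOb C Q) Z" "w \<cdot> k = ShAr C g"
      using t(9)[of "ShAr C g" "ShOb C Q"] gt tt by (auto simp: typed_iff)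
    have "rr k = 0" using k Q P_shift PN by blast
    then have "rr (ShAr C g) = 0" using k tt rr_Comp[of k w] by (simp add: typed_iff)
    then show "rr g = 0" using rr_ShAr_eq_0 gt by blast
  qed
qed

text \<open>A test object is written as \<open>ShOb C Q'\<close> with \<open>Q'\<close> in
  \<open>P\<close>. Maps from it into a shift are then shifts of maps from \<open>Q'\<close>, where
  \<open>s\<close> is known to be colocal.\<close>

lemma colocal_ShAr:
  assumes s: "colocal s" shows "colocal (ShAr C s)"
proof (rule colocalI)
  show a: "arr (ShAr C s)" using s by simp
  have ob: "src s \<in> Ob C" "tgt s \<in> Ob C" using s by (auto simp: arr_src arr_tgt)
  fix Q assume "Q \<in> P"
  then obtain Q' where Q: "Q' \<in> P" "Q = ShOb C Q'" using P_unshift by blast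
  note Qo = P_in_Ob[OF Q(1)]
  show "\<exists>g. typed g Q (src (ShAr C s)) \<and> ShAr C s \<cdot> g = x" if x: "typed x Q (tgt (ShAr C s))" for x
  proof -
    obtain x' where x': "typed x' Q' (tgt s)" "ShAr C x' = x"
      using ShAr_surj[of x Q' "tgt s"] x Q Qo ob s by auto
    note l = lift[OF s, of x'] x'(1)[unfolded typed_iff]
    have "ShAr C s \<cdot> ShAr C (lift s x') = x"
      using l Q s x' ShAr_Comp_arr[of "lift s x'" s] by simp
    then show ?thesis using l Q s by (intro exI[of _ "ShAr C (lift s x')"]) (auto simp: typed_iff)
  qed
  fix g assume g: "typed g Q (src (ShAr C s))" "rr (ShAr C s) * rr g = 0"
  obtain g' where g': "typed g' Q' (src s)" "ShAr C g' = g"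
    using ShAr_surj[of g Q' "src s"] g Q Qo ob s by auto
  note gt = g'(1)[unfolded typed_iff]
  have "arr g" "tgt g = src (ShAr C s)" using g by (auto simp: typed_iff)
  then have "rr (ShAr C (s \<cdot> g')) = 0" using g g' gt s by (simp add: ShAr_Comp_arr)
  then have "rr s * rr g' = 0" using rr_ShAr_eq_0[of "s \<cdot> g'"] gt s by simp
  then have "g' = Zero C Q' (src s)"
    using gt s Qo ob Q(1) by (intro colocal_cancel_rr[OF s]) auto
  then have "rr g' = 0" using Qo ob by simp
  then show "rr g = 0" using rr_ShAr_eq_0 gt g'(2) by blast
qed

subsection \<open>Resolutions\<close>

definition res :: "'o \<Rightarrow> 'o" where
  "res X = (SOME Q. Q \<in> P \<and> (\<exists>s. s \<in> cone_in C N Q X))"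

definition aug :: "'o \<Rightarrow> 'm" where
  "aug X = (SOME s. s \<in> cone_in C N (res X) X)"

lemma aug_cone_in:
  assumes "X \<in> Ob C" shows "res X \<in> P" "aug X \<in> cone_in C N (res X) X"
proof -
  have "\<exists>Q. Q \<in> P \<and> (\<exists>s. s \<in> cone_in C N Q X)" using P_resolution[OF assms] by blast
  from someI_ex[OF this] have r: "res X \<in> P" "\<exists>s. s \<in> cone_in C N (res X) X"
    unfolding res_def by auto
  then show "res X \<in> P" "aug X \<in> cone_in C N (res X) X"
    unfolding aug_def by (auto intro: someI_ex)
qed

lemma aug [simp]:
  assumes "X \<in> Ob C"
  shows "arr (aug X)" "src (aug X) = res X" "tgt (aug X) = X" "colocal (aug X)" "res X \<in> P" "res X \<in> Ob C"
  using aug_cone_in[OF assms] cone_in_typed cone_in_colocal P_in_Ob by (auto simp: typed_iff)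

definition resm :: "'m \<Rightarrow> 'm" where
  "resm f = lift (aug (tgt f)) (f \<cdot> aug (src f))"

lemma resm:
  assumes "arr f"
  shows "arr (resm f)" "src (resm f) = res (src f)" "tgt (resm f) = res (tgt f)"
    "rr (aug (tgt f)) * rr (resm f) = rr f * rr (aug (src f))"
proof -
  have ob: "src f \<in> Ob C" "tgt f \<in> Ob C" using assms by (auto simp: arr_src arr_tgt)
  note l = lift[of "aug (tgt f)" "f \<cdot> aug (src f)", folded resm_def]
  show 1: "arr (resm f)" "src (resm f) = res (src f)" "tgt (resm f) = res (tgt f)"
    using l ob assms by simp_all
  have "aug (tgt f) \<cdot> resm f = f \<cdot> aug (src f)" using l ob assms by simp
  from arg_cong[OF this, of rr] show "rr (aug (tgt f)) * rr (resm f) = rr f * rr (aug (src f))"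
    using 1 ob assms by simp
qed

text \<open>Uniqueness of lifts along \<open>aug\<close>. Functoriality, additivity and
  compatibility of \<open>resm\<close> with the shift reduce to checking one square.\<close>

lemma resm_eqI:
  assumes "arr f" "arr g" "src g = res (src f)" "tgt g = res (tgt f)"
    "rr (aug (tgt f)) * rr g = rr f * rr (aug (src f))"
  shows "resm f = g"
  using resm[OF assms(1)] assms
  by (intro colocal_cancel_rr[of "aug (tgt f)"]) (auto simp: arr_tgt arr_src)

lemma resm_Idn: "X \<in> Ob C \<Longrightarrow> resm (Idn C X) = Idn C (res X)"
  by (rule resm_eqI) auto

lemma resm_Comp:
  assumes "arr f" "arr g" "src g = tgt f" shows "resm (g \<cdot> f) = resm g \<cdot> resm f"
  using assms resm[of f] resm[of g]
  by (intro resm_eqI) (auto simp: mult.assoc resm(4)[OF assms(2), THEN times_ext])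

lemma resm_Add:
  assumes "arr f" "arr g" "src g = src f" "tgt g = tgt f"
  shows "resm (f \<boxplus> g) = resm f \<boxplus> resm g"
  using assms resm[of f] resm[of g] by (intro resm_eqI) (auto simp: algebra_simps)

text \<open>The canonical isomorphism \<open>res (X[1]) \<rightarrow> (res X)[1]\<close> and its inverse.\<close>

definition shc :: "'o \<Rightarrow> 'm" where
  "shc X = lift (ShAr C (aug X)) (aug (ShOb C X))"

definition shc' :: "'o \<Rightarrow> 'm" where
  "shc' X = lift (aug (ShOb C X)) (ShAr C (aug X))"

text \<open>Both \<open>ShAr C (aug X)\<close> and \<open>aug (ShOb C X)\<close> are colocal maps to
  \<open>X[1]\<close> with sources in \<open>P\<close>, so each lifts along the other; by
  cancellation the lifts are mutually inverse.\<close>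

lemma shc:
  assumes X: "X \<in> Ob C"
  shows "arr (shc X)" "src (shc X) = res (ShOb C X)" "tgt (shc X) = ShOb C (res X)"
    "arr (shc' X)" "src (shc' X) = ShOb C (res X)" "tgt (shc' X) = res (ShOb C X)"
    "rr (ShAr C (aug X)) * rr (shc X) = rr (aug (ShOb C X))"
    "rr (aug (ShOb C X)) * rr (shc' X) = rr (ShAr C (aug X))"
    "shc X \<cdot> shc' X = Idn C (ShOb C (res X))" "shc' X \<cdot> shc X = Idn C (res (ShOb C X))"
proof -
  have c: "colocal (ShAr C (aug X))" using X by (simp add: colocal_ShAr)
  have o: "ShOb C X \<in> Ob C" "ShOb C (res X) \<in> P" "ShOb C (res X) \<in> Ob C"
    using X ShOb_in P_shift P_in_Ob by auto
  note l = lift[OF c, of "aug (ShOb C X)", folded shc_def]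
    lift[of "aug (ShOb C X)" "ShAr C (aug X)", folded shc'_def]
  show t: "arr (shc X)" "src (shc X) = res (ShOb C X)" "tgt (shc X) = ShOb C (res X)"
    "arr (shc' X)" "src (shc' X) = ShOb C (res X)" "tgt (shc' X) = res (ShOb C X)"
    using l X o by simp_all
  have e: "ShAr C (aug X) \<cdot> shc X = aug (ShOb C X)" "aug (ShOb C X) \<cdot> shc' X = ShAr C (aug X)"
    using l X o by simp_all
  show r: "rr (ShAr C (aug X)) * rr (shc X) = rr (aug (ShOb C X))"
    "rr (aug (ShOb C X)) * rr (shc' X) = rr (ShAr C (aug X))"
    using arg_cong[OF e(1), of rr] arg_cong[OF e(2), of rr] t X o by simp_all
  show "shc X \<cdot> shc' X = Idn C (ShOb C (res X))"
    by (rule colocal_cancel_rr[OF c]) (use t X o r in \<open>auto simp: r(1)[THEN times_ext]\<close>)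
  show "shc' X \<cdot> shc X = Idn C (res (ShOb C X))"
    by (rule colocal_cancel_rr[of "aug (ShOb C X)"]) (use t X o r in \<open>auto simp: r(2)[THEN times_ext]\<close>)
qed

lemma rr_shc_inv:
  assumes X: "X \<in> Ob C" and z: "arr z"
  shows "tgt z = ShOb C (res X) \<Longrightarrow> rr (shc X) * (rr (shc' X) * rr z) = rr z"
    "tgt z = res (ShOb C X) \<Longrightarrow> rr (shc' X) * (rr (shc X) * rr z) = rr z"
proof -
  note s = shc[OF X]
  have "rr (shc X) * rr (shc' X) = rr (Idn C (ShOb C (res X)))"
    "rr (shc' X) * rr (shc X) = rr (Idn C (res (ShOb C X)))"
    using rr_compD[OF s(9)] rr_compD[OF s(10)] s(1-6) by auto
  then show "tgt z = ShOb C (res X) \<Longrightarrow> rr (shc X) * (rr (shc' X) * rr z) = rr z"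
    "tgt z = res (ShOb C X) \<Longrightarrow> rr (shc' X) * (rr (shc X) * rr z) = rr z"
    using z by (simp_all add: times_ext)
qed

lemma iso_shc: "X \<in> Ob C \<Longrightarrow> iso_arrow C (res (ShOb C X)) (ShOb C (res X)) (shc X)"
  using shc[of X] by (intro iso_arrowI[of _ _ _ "shc' X"]) (auto simp: typed_iff)

subsection \<open>Fractions\<close>

definition groof :: "'o \<Rightarrow> 'o \<Rightarrow> ('o, 'm) roof \<Rightarrow> bool" where
  "groof X Y = (\<lambda>(U, s, f). colocal s \<and> src s = U \<and> tgt s = X \<and> arr f \<and> src f = U \<and> tgt f = Y)"

text \<open>\<open>rep X Y r g\<close>: the roof \<open>r\<close> becomes \<open>g\<close> after resolving \<open>X\<close> and \<open>Y\<close>. The leg \<open>s\<close> of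
  a generalized roof need only be colocal, which makes closure of \<open>cone_in\<close> under composition
  superfluous.\<close>

definition rep :: "'o \<Rightarrow> 'o \<Rightarrow> ('o, 'm) roof \<Rightarrow> 'm \<Rightarrow> bool" where
  "rep X Y = (\<lambda>(U, s, f) g. typed g (res X) (res Y) \<and>
     (\<exists>t. typed t (res X) U \<and> s \<cdot> t = aug X \<and> aug Y \<cdot> g = f \<cdot> t))"

lemma roofs_groof: "\<lbrakk>r \<in> roofs C N X Y; Y \<in> Ob C\<rbrakk> \<Longrightarrow> groof X Y r"
  using cone_in_typed cone_in_colocal Hom_typed
  by (fastforce simp: roofs_def groof_def typed_iff)

lemma groof_Ob: "groof X Y r \<Longrightarrow> X \<in> Ob C" "groof X Y r \<Longrightarrow> Y \<in> Ob C"
  by (auto simp: groof_def arr_src arr_tgt split: prod.splits)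

lemma repE:
  assumes "rep X Y (U, s, f) g" "groof X Y (U, s, f)"
  obtains t where "arr t" "src t = res X" "tgt t = U" "s \<cdot> t = aug X" "rr s * rr t = rr (aug X)"
    "arr g" "src g = res X" "tgt g = res Y" "rr (aug Y) * rr g = rr f * rr t"
proof -
  note ob = groof_Ob[OF assms(2)]
  obtain t where t: "typed g (res X) (res Y)" "typed t (res X) U" "s \<cdot> t = aug X" "aug Y \<cdot> g = f \<cdot> t"
    using assms(1) by (auto simp: rep_def)
  show ?thesis
    using t assms(2) ob rr_compD[OF t(3)] rr_compD[OF t(4)]
    by (intro that[of t]) (auto simp: groof_def typed_iff)
qed

lemma repI:
  assumes "groof X Y (U, s, f)" "arr t" "src t = res X" "tgt t = U" "rr s * rr t = rr (aug X)"
    "arr g" "src g = res X" "tgt g = res Y" "rr (aug Y) * rr g = rr f * rr t"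
  shows "rep X Y (U, s, f) g"
  unfolding rep_def using assms groof_Ob[OF assms(1)]
  by (auto simp: groof_def typed_iff intro!: exI[of _ t] rr_inject)

text \<open>First \<open>aug X\<close> is lifted along \<open>s\<close>, which replaces the roof by
  one with apex \<open>res X\<close>; then its right leg is lifted along
  \<open>aug Y\<close>.\<close>

lemma rep_exists:
  assumes "groof X Y r" shows "\<exists>g. rep X Y r g"
proof -
  obtain U s f where r: "r = (U, s, f)" by (cases r)
  note a = assms[unfolded r]
  note ob = groof_Ob[OF assms]
  have a': "colocal s" "src s = U" "tgt s = X" "arr f" "src f = U" "tgt f = Y"
    using a by (auto simp: groof_def)
  note t = lift[OF a'(1), of "aug X"]
  have tt: "arr (lift s (aug X))" "src (lift s (aug X)) = res X" "tgt (lift s (aug X)) = U"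
    "s \<cdot> lift s (aug X) = aug X"
    using t a' ob by simp_all
  note g = lift[of "aug Y" "f \<cdot> lift s (aug X)"]
  show ?thesis
    unfolding r rep_def using g tt a' ob
    by (intro exI[of _ "lift (aug Y) (f \<cdot> lift s (aug X))"]) (auto simp: typed_iff intro!: exI[of _ "lift s (aug X)"])
qed

lemma rep_unique:
  assumes "groof X Y r" "rep X Y r g" "rep X Y r g'" shows "g = g'"
proof -
  obtain U s f where r: "r = (U, s, f)" by (cases r)
  note a = assms[unfolded r]
  note ob = groof_Ob[OF assms(1)]
  obtain t where t: "arr t" "src t = res X" "tgt t = U" "s \<cdot> t = aug X" "rr s * rr t = rr (aug X)"
    "arr g" "src g = res X" "tgt g = res Y" "rr (aug Y) * rr g = rr f * rr t"
    using repE[OF a(2,1)] .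
  obtain t' where t': "arr t'" "src t' = res X" "tgt t' = U" "s \<cdot> t' = aug X" "rr s * rr t' = rr (aug X)"
    "arr g'" "src g' = res X" "tgt g' = res Y" "rr (aug Y) * rr g' = rr f * rr t'"
    using repE[OF a(3,1)] .
  have "t = t'" using a(1) t t' ob by (intro colocal_cancel_rr[of s]) (auto simp: groof_def)
  then show ?thesis using t t' ob by (intro colocal_cancel_rr[of "aug Y"]) auto
qed

text \<open>Equivalence of roofs is equality of an invariant, so hom-sets of the localization are
  hom-sets between resolutions.\<close>

lemma roof_equiv_iff:
  assumes r: "groof X Y r" "rep X Y r g" and r': "groof X Y r'" "rep X Y r' g'"
  shows "roof_equiv C N X r r' \<longleftrightarrow> g = g'"
proof -
  note ob = groof_Ob[OF r(1)]
  obtain U s f where u: "r = (U, s, f)" by (cases r)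
  obtain U' s' f' where u': "r' = (U', s', f')" by (cases r')
  note gr = r(1)[unfolded u groof_def, simplified] r'(1)[unfolded u' groof_def, simplified]
  obtain t where t: "arr t" "src t = res X" "tgt t = U" "s \<cdot> t = aug X" "rr s * rr t = rr (aug X)"
    "arr g" "src g = res X" "tgt g = res Y" "rr (aug Y) * rr g = rr f * rr t"
    using repE r unfolding u by blast
  obtain t' where t': "arr t'" "src t' = res X" "tgt t' = U'" "s' \<cdot> t' = aug X" "rr s' * rr t' = rr (aug X)"
    "arr g'" "src g' = res X" "tgt g' = res Y" "rr (aug Y) * rr g' = rr f' * rr t'"
    using repE r' unfolding u' by blast
  show ?thesis
  proof
    assume "roof_equiv C N X r r'"
    then obtain V a a' where V: "V \<in> Ob C" "a \<in> Hom C V U" "a' \<in> Hom C V U'"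
      "s \<cdot> a = s' \<cdot> a'" "s \<cdot> a \<in> cone_in C N V X" "f \<cdot> a = f' \<cdot> a'"
      by (auto simp: roof_equiv_def u u')
    have a: "arr a" "src a = V" "tgt a = U" "arr a'" "src a' = V" "tgt a' = U'"
      using V Hom_typed gr by (auto simp: typed_iff arr_src)
    have sa: "rr s * rr a = rr s' * rr a'" "rr f * rr a = rr f' * rr a'"
      using arg_cong[OF V(4), of rr] arg_cong[OF V(6), of rr] a gr by simp_all
    \<comment> \<open>The map \<open>res X -> V\<close> lifting \<open>aug X\<close> along
      \<open>s \<cdot> a\<close> gives \<open>t\<close> and \<open>t'\<close> when followed by
      \<open>a\<close> and \<open>a'\<close>, since both are determined by their composites with
      \<open>s\<close> and \<open>s'\<close>.\<close>
    note l = lift[OF cone_in_colocal[OF V(5)], of "aug X"]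
    obtain k where k: "arr k" "src k = res X" "tgt k = V" "s \<cdot> a \<cdot> k = aug X"
      using l ob a gr by simp
    have rk: "rr s * (rr a * rr k) = rr (aug X)"
      using rr_compD[OF k(4)] k(1-3) a gr by (simp add: mult.assoc)
    have 1: "a \<cdot> k = t"
      using k a gr t ob rk by (intro colocal_cancel_rr[of s]) auto
    have 2: "a' \<cdot> k = t'"
      using k a gr t' ob rk sa(1)[THEN times_ext, symmetric]
      by (intro colocal_cancel_rr[of s']) (auto simp: mult.assoc)
    have "rr f * rr t = rr f' * rr t'"
      using rr_compD[OF 1] rr_compD[OF 2] a k times_ext[OF sa(2), of "rr k"] by (simp add: mult.assoc)
    then show "g = g'" using t t' ob by (intro colocal_cancel_rr[of "aug Y"]) auto
  next
    \<comment> \<open>The resolution \<open>res X\<close> itself is the common refinement: it maps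
      to both apexes by \<open>t\<close> and \<open>t'\<close>, and \<open>aug X\<close> has its
      cone in \<open>N\<close>.\<close>
    assume "g = g'"
    then have "f \<cdot> t = f' \<cdot> t'"
      using t t' gr by (intro rr_inject) auto
    then show "roof_equiv C N X r r'"
      unfolding roof_equiv_def u u' prod.case using t t' ob aug_cone_in[OF ob(1)]
      by (intro bexI[of _ "res X"] bexI[of _ t] bexI[of _ t'] conjI) (auto intro: in_HomI)
  qed
qed

text \<open>The arrow of the localization corresponding to \<open>g : res X \<rightarrow> res Y\<close>.\<close>

definition cls :: "'o \<Rightarrow> 'o \<Rightarrow> 'm \<Rightarrow> ('o, 'm) frac" where
  "cls X Y g = (X, {r \<in> roofs C N X Y. rep X Y r g}, Y)"

lemma roof_class_eq:
  assumes "groof X Y r" "rep X Y r g"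
  shows "roof_class C N X Y r = {r' \<in> roofs C N X Y. rep X Y r' g}"
proof -
  have "roof_equiv C N X r r' \<longleftrightarrow> rep X Y r' g" if r': "r' \<in> roofs C N X Y" for r'
  proof -
    have gr: "groof X Y r'" using roofs_groof[OF r' groof_Ob(2)[OF assms(1)]] .
    obtain g' where "rep X Y r' g'" using rep_exists[OF gr] by blast
    then show ?thesis using roof_equiv_iff[OF assms gr] rep_unique[OF gr] by blast
  qed
  then show ?thesis unfolding roof_class_def by blast
qed

text \<open>The standard roof \<open>X <- res X -> Y\<close> belonging to \<open>g\<close>. It shows
  that every \<open>g\<close> is attained and that the classes \<open>cls X Y g\<close> are
  nonempty.\<close>

lemma base_roof:
  assumes "X \<in> Ob C" "Y \<in> Ob C" "typed g (res X) (res Y)"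
  shows "(res X, aug X, aug Y \<cdot> g) \<in> roofs C N X Y" "rep X Y (res X, aug X, aug Y \<cdot> g) g"
    "groof X Y (res X, aug X, aug Y \<cdot> g)"
  using assms aug_cone_in[OF assms(1)]
  by (auto simp: roofs_def rep_def groof_def typed_iff intro!: in_HomI exI[of _ "Idn C (res X)"])

lemma cls_inject:
  assumes "X \<in> Ob C" "Y \<in> Ob C" "typed g (res X) (res Y)" "cls X Y g = cls X Y g'"
  shows "g = g'"
proof -
  note b = base_roof[OF assms(1-3)]
  have "rep X Y (res X, aug X, aug Y \<cdot> g) g'" using b assms(4) by (auto simp: cls_def)
  then show ?thesis using rep_unique b by blast
qed

abbreviation V :: "('o, ('o, 'm) frac) tri_cat" where
  "V \<equiv> verdier_localization C N"

lemma V_simps: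
  "Ob V = Ob C" "Hom V = Hom (verdier_shift_cat C N)" "Idn V = Idn (verdier_shift_cat C N)"
  "Comp V = Comp (verdier_shift_cat C N)" "Add V = Add (verdier_shift_cat C N)"
  "ShOb V = ShOb C" "ShAr V = ShAr (verdier_shift_cat C N)" "Tri V = verdier_triangles C N"
  by (simp_all add: verdier_localization_def shift_cat.extend_def verdier_shift_cat_def)

lemma Hom_V:
  assumes "X \<in> Ob C" "Y \<in> Ob C"
  shows "Hom V X Y = cls X Y ` {g. typed g (res X) (res Y)}"
proof -
  have "Hom V X Y = (\<lambda>r. (X, roof_class C N X Y r, Y)) ` roofs C N X Y"
    by (simp add: V_simps) (simp add: verdier_shift_cat_def)
  also have "\<dots> = cls X Y ` {g. typed g (res X) (res Y)}"
  proof (intro Set.set_eqI iffI)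
    fix a assume "a \<in> (\<lambda>r. (X, roof_class C N X Y r, Y)) ` roofs C N X Y"
    then obtain r where r: "r \<in> roofs C N X Y" "a = (X, roof_class C N X Y r, Y)" by auto
    note g = roofs_groof[OF r(1) assms(2)]
    then obtain g where g': "rep X Y r g" using rep_exists by blast
    then have "typed g (res X) (res Y)" by (auto simp: rep_def split: prod.splits)
    then show "a \<in> cls X Y ` {g. typed g (res X) (res Y)}"
      using r roof_class_eq[OF g g'] by (auto simp: cls_def)
  next
    fix a assume "a \<in> cls X Y ` {g. typed g (res X) (res Y)}"
    then obtain g where g: "typed g (res X) (res Y)" "a = cls X Y g" by auto
    note b = base_roof[OF assms g(1)]
    show "a \<in> (\<lambda>r. (X, roof_class C N X Y r, Y)) ` roofs C N X Y"
      using b(1) g(2) roof_class_eq[OF b(3,2)] by (intro image_eqI[OF _ b(1)]) (simp add: cls_def)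
  qed
  finally show ?thesis .
qed

lemma cls_in_Hom: "\<lbrakk>X \<in> Ob C; Y \<in> Ob C; typed g (res X) (res Y)\<rbrakk> \<Longrightarrow> cls X Y g \<in> Hom V X Y"
  by (simp add: Hom_V)

text \<open>The roof of \<open>loc_arrow\<close> has an identity as its left leg. Identities are
  evidently colocal, so it is a generalized roof, and it is represented by \<open>resm f\<close> by
  the defining square of \<open>resm\<close>.\<close>

lemma loc_arrow_cls:
  assumes "typed f X Y" shows "loc_arrow C N X Y f = cls X Y (resm f)"
proof -
  have f: "arr f" "src f = X" "tgt f = Y" and ob: "X \<in> Ob C" "Y \<in> Ob C"
    using assms by (auto simp: typed_iff arr_src arr_tgt)
  have "colocal (Idn C X)"
    using ob by (intro colocalI) (auto simp: typed_iff)
  then have g: "groof X Y (X, Idn C X, f)" using f ob by (auto simp: groof_def)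
  have "rep X Y (X, Idn C X, f) (resm f)"
    using f ob resm[OF f(1)] by (intro repI[OF g, of "aug X"]) auto
  from roof_class_eq[OF g this] show ?thesis by (simp add: loc_arrow_def cls_def)
qed

lemma Idn_V: "X \<in> Ob C \<Longrightarrow> Idn V X = cls X X (Idn C (res X))"
  using loc_arrow_cls[OF Idn_typed, of X] by (simp add: V_simps resm_Idn) (simp add: verdier_shift_cat_def)

text \<open>The pattern for all operations of the localization: every choice yields the same class,
  and at least one choice exists.\<close>

lemma Union_eqI: "\<lbrakk>\<And>S. S \<in> F \<Longrightarrow> S = T; F \<noteq> {}\<rbrakk> \<Longrightarrow> \<Union>F = T"
  by auto

text \<open>Whatever square completes the two roofs, lifting \<open>aug X\<close> to its vertex
  shows that the composite roof is represented by \<open>h \<cdot> g\<close>.\<close>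

lemma Comp_V:
  assumes ob: "X \<in> Ob C" "Y \<in> Ob C" "Z \<in> Ob C"
    and g: "typed g (res X) (res Y)" and h: "typed h (res Y) (res Z)"
  shows "Comp V (cls Y Z h) (cls X Y g) = cls X Z (h \<cdot> g)"
proof -
  let ?\<alpha> = "{r \<in> roofs C N X Y. rep X Y r g}" and ?\<beta> = "{r \<in> roofs C N Y Z. rep Y Z r h}"
  let ?F = "{roof_class C N X Z (W, s \<cdot> t', k \<cdot> f') | U s f V t k W t' f'.
    (U, s, f) \<in> ?\<alpha> \<and> (V, t, k) \<in> ?\<beta> \<and> W \<in> Ob C \<and>
    t' \<in> cone_in C N W U \<and> f' \<in> Hom C W V \<and> f \<cdot> t' = t \<cdot> f'}"
  have "\<Union>?F = {r \<in> roofs C N X Z. rep X Z r (h \<cdot> g)}"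
  proof (rule Union_eqI)
    fix S assume "S \<in> ?F"
    then obtain U s f V t k W t' f' where S: "S = roof_class C N X Z (W, s \<cdot> t', k \<cdot> f')"
      and 1: "(U, s, f) \<in> roofs C N X Y" "rep X Y (U, s, f) g"
      and 2: "(V, t, k) \<in> roofs C N Y Z" "rep Y Z (V, t, k) h"
      and W: "W \<in> Ob C" "t' \<in> cone_in C N W U" "f' \<in> Hom C W V" "f \<cdot> t' = t \<cdot> f'"
      by auto
    note g1 = roofs_groof[OF 1(1) ob(2)] and g2 = roofs_groof[OF 2(1) ob(3)]
    note gg = g1[unfolded groof_def, simplified] g2[unfolded groof_def, simplified]
    have t': "arr t'" "src t' = W" "tgt t' = U" "colocal t'"
      using W cone_in_typed cone_in_colocal by (auto simp: typed_iff)
    have f': "arr f'" "src f' = W" "tgt f' = V"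
      using W(1,3) Hom_typed[OF W(3)] gg by (auto simp: typed_iff arr_src)
    obtain a where a: "arr a" "src a = res X" "tgt a = U" "s \<cdot> a = aug X" "rr s * rr a = rr (aug X)"
      "arr g" "src g = res X" "tgt g = res Y" "rr (aug Y) * rr g = rr f * rr a"
      using repE[OF 1(2) g1] .
    obtain b where b: "arr b" "src b = res Y" "tgt b = V" "t \<cdot> b = aug Y" "rr t * rr b = rr (aug Y)"
      "arr h" "src h = res Y" "tgt h = res Z" "rr (aug Z) * rr h = rr k * rr b"
      using repE[OF 2(2) g2] .
    note l = lift[OF t'(4), of a]
    obtain a' where a': "arr a'" "src a' = res X" "tgt a' = W" "t' \<cdot> a' = a"
      using l a t' ob by simp
    have ra': "rr t' * rr a' = rr a" using rr_compD[OF a'(4)] a' t' by simp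
    have rW: "rr f * rr t' = rr t * rr f'" using arg_cong[OF W(4), of rr] t' f' gg by simp
    have cs: "colocal (s \<cdot> t')"
      using gg t'
    proof (intro colocalI)
      fix Q x assume Q: "Q \<in> P" "typed x Q (tgt (s \<cdot> t'))"
      note l1 = lift[of s x] and l2 = lift[OF t'(4), of "lift s x"]
      show "\<exists>g. typed g Q (src (s \<cdot> t')) \<and> s \<cdot> t' \<cdot> g = x"
        using l1 l2 Q t' gg
        by (intro exI[of _ "lift t' (lift s x)"]) (auto simp: typed_iff Comp_assoc_arr)
    next
      fix Q y assume Q: "Q \<in> P" "typed y Q (src (s \<cdot> t'))" "rr (s \<cdot> t') * rr y = 0"
      have y: "arr y" "src y = Q" "tgt y = W" using Q t' gg by (auto simp: typed_iff)
      have o: "Q \<in> Ob C" "W \<in> Ob C" "U \<in> Ob C" using Q P_in_Ob t' arr_src arr_tgt by auto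
      have "rr s * rr (t' \<cdot> y) = 0" using Q t' gg y by (simp add: mult.assoc)
      then have "t' \<cdot> y = Zero C Q U"
        using Q t' gg y o by (intro colocal_cancel_rr[of s]) auto
      then have "rr t' * rr y = 0" using rr_compD[of t' y] t' y o by simp
      then have "y = Zero C Q W"
        using Q t' gg y o by (intro colocal_cancel_rr[of t']) auto
      then show "rr y = 0" using o by simp
    qed (auto)
    have gr: "groof X Z (W, s \<cdot> t', k \<cdot> f')"
      unfolding groof_def using cs t' f' gg by simp
    \<comment> \<open>The map \<open>a'\<close> lifts \<open>a\<close> to the vertex
      \<open>W\<close>. Both sides become \<open>aug Y \<cdot> g\<close> after composition with the
      colocal \<open>t\<close>.\<close>
    have fa: "f' \<cdot> a' = b \<cdot> g"
    proof (rule colocal_cancel_rr[of t])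
      have "rr t * (rr f' * rr a') = rr f * rr a"
        by (simp add: rW[symmetric, THEN times_ext] ra' mult.assoc)
      then show "rr t * rr (f' \<cdot> a') = rr t * rr (b \<cdot> g)"
        using a a' b f' by (simp add: b(5)[THEN times_ext])
    qed (use a a' b f' gg ob in auto)
    have "rep X Z (W, s \<cdot> t', k \<cdot> f') (h \<cdot> g)"
    proof (rule repI[OF gr])
      show "rr (s \<cdot> t') * rr a' = rr (aug X)" using t' gg a' ra' a by (simp add: mult.assoc)
      show "rr (aug Z) * rr (h \<cdot> g) = rr (k \<cdot> f') * rr a'"
        using a b f' gg a' arg_cong[OF fa, of rr] by (simp add: mult.assoc b(9)[THEN times_ext])
    qed (use a a' b in auto)
    from roof_class_eq[OF gr this] show "S = {r \<in> roofs C N X Z. rep X Z r (h \<cdot> g)}" by (simp add: S)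
  next
    \<comment> \<open>For one completed square, take the standard roofs and the vertex
      \<open>res (res X)\<close>. It lies in \<open>P\<close>, so the map into \<open>Y\<close>
      lifts along \<open>aug Y\<close>.\<close>
    note b1 = base_roof[OF ob(1,2) g] and b2 = base_roof[OF ob(2,3) h]
    note gt = g[unfolded typed_iff]
    let ?U = "res X" and ?f = "aug Y \<cdot> g"
    let ?x = "?f \<cdot> aug ?U"
    note l = lift[of "aug Y" ?x]
    have "(?U, aug X, ?f) \<in> ?\<alpha>" "(res Y, aug Y, aug Z \<cdot> h) \<in> ?\<beta>" using b1 b2 by auto
    moreover have "res ?U \<in> Ob C" "aug ?U \<in> cone_in C N (res ?U) ?U" "lift (aug Y) ?x \<in> Hom C (res ?U) (res Y)"
      "?f \<cdot> aug ?U = aug Y \<cdot> lift (aug Y) ?x"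
      using ob aug_cone_in[of ?U] l gt by (auto intro!: in_HomI)
    ultimately have "roof_class C N X Z (res ?U, aug X \<cdot> aug ?U, aug Z \<cdot> h \<cdot> lift (aug Y) ?x) \<in> ?F"
      by blast
    then show "?F \<noteq> {}" by blast
  qed
  then show ?thesis
    by (simp add: V_simps) (simp add: verdier_shift_cat_def cls_def)
qed

lemma Add_V:
  assumes ob: "X \<in> Ob C" "Y \<in> Ob C"
    and g: "typed g (res X) (res Y)" and h: "typed h (res X) (res Y)"
  shows "Add V (cls X Y g) (cls X Y h) = cls X Y (g \<boxplus> h)"
proof -
  let ?\<alpha> = "{r \<in> roofs C N X Y. rep X Y r g}" and ?\<beta> = "{r \<in> roofs C N X Y. rep X Y r h}"
  let ?F = "{roof_class C N X Y (U, s, f \<boxplus> k) | U s f k. (U, s, f) \<in> ?\<alpha> \<and> (U, s, k) \<in> ?\<beta>}"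
  have "\<Union>?F = {r \<in> roofs C N X Y. rep X Y r (g \<boxplus> h)}"
  proof (rule Union_eqI)
    fix S assume "S \<in> ?F"
    then obtain U s f k where S: "S = roof_class C N X Y (U, s, f \<boxplus> k)"
      and 1: "(U, s, f) \<in> roofs C N X Y" "rep X Y (U, s, f) g"
      and 2: "(U, s, k) \<in> roofs C N X Y" "rep X Y (U, s, k) h" by auto
    note g1 = roofs_groof[OF 1(1) ob(2)] and g2 = roofs_groof[OF 2(1) ob(2)]
    note gg = g1[unfolded groof_def, simplified] g2[unfolded groof_def, simplified]
    obtain a where a: "arr a" "src a = res X" "tgt a = U" "s \<cdot> a = aug X" "rr s * rr a = rr (aug X)"
      "arr g" "src g = res X" "tgt g = res Y" "rr (aug Y) * rr g = rr f * rr a"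
      using repE[OF 1(2) g1] .
    obtain b where b: "arr b" "src b = res X" "tgt b = U" "s \<cdot> b = aug X" "rr s * rr b = rr (aug X)"
      "arr h" "src h = res X" "tgt h = res Y" "rr (aug Y) * rr h = rr k * rr b"
      using repE[OF 2(2) g2] .
    have ab: "a = b" using a b gg ob by (intro colocal_cancel_rr[of s]) auto
    have gr: "groof X Y (U, s, f \<boxplus> k)" using gg by (simp add: groof_def)
    have "rep X Y (U, s, f \<boxplus> k) (g \<boxplus> h)"
      using a b gg ab by (intro repI[OF gr, of a]) (auto simp: algebra_simps)
    from roof_class_eq[OF gr this] show "S = {r \<in> roofs C N X Y. rep X Y r (g \<boxplus> h)}" by (simp add: S)
  next
    show "?F \<noteq> {}" using base_roof[OF ob g] base_roof[OF ob h] by blast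
  qed
  then show ?thesis
    by (simp add: V_simps) (simp add: verdier_shift_cat_def cls_def)
qed

text \<open>The shifted roof is represented by the shift of \<open>g\<close>, but only as a map
  between the shifted resolutions; \<open>shc\<close> and \<open>shc'\<close> convert it to a map
  between the resolutions of the shifts.\<close>

lemma ShAr_V:
  assumes ob: "X \<in> Ob C" "Y \<in> Ob C" and g: "typed g (res X) (res Y)"
  shows "ShAr V (cls X Y g) = cls (ShOb C X) (ShOb C Y) (shc' Y \<cdot> (ShAr C g \<cdot> shc X))"
proof -
  let ?\<alpha> = "{r \<in> roofs C N X Y. rep X Y r g}" and ?g = "shc' Y \<cdot> (ShAr C g \<cdot> shc X)"
  let ?F = "{roof_class C N (ShOb C X) (ShOb C Y) (ShOb C U, ShAr C s, ShAr C f) | U s f. (U, s, f) \<in> ?\<alpha>}"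
  note so = ShOb_in[OF ob(1)] ShOb_in[OF ob(2)]
  note sX = shc[OF ob(1)] and sY = shc[OF ob(2)]
  have "\<Union>?F = {r \<in> roofs C N (ShOb C X) (ShOb C Y). rep (ShOb C X) (ShOb C Y) r ?g}"
  proof (rule Union_eqI)
    fix S assume "S \<in> ?F"
    then obtain U s f where S: "S = roof_class C N (ShOb C X) (ShOb C Y) (ShOb C U, ShAr C s, ShAr C f)"
      and 1: "(U, s, f) \<in> roofs C N X Y" "rep X Y (U, s, f) g" by auto
    note g1 = roofs_groof[OF 1(1) ob(2)]
    note gg = g1[unfolded groof_def, simplified]
    obtain a where a: "arr a" "src a = res X" "tgt a = U" "s \<cdot> a = aug X" "rr s * rr a = rr (aug X)"
      "arr g" "src g = res X" "tgt g = res Y" "rr (aug Y) * rr g = rr f * rr a"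
      using repE[OF 1(2) g1] .
    have gr: "groof (ShOb C X) (ShOb C Y) (ShOb C U, ShAr C s, ShAr C f)"
      using gg by (simp add: groof_def colocal_ShAr)
    have "ShAr C s \<cdot> ShAr C a = ShAr C (aug X)"
      using gg a by (simp add: ShAr_Comp_arr[symmetric])
    from arg_cong[OF this, of rr] have sa: "rr (ShAr C s) * rr (ShAr C a) = rr (ShAr C (aug X))"
      using gg a by simp
    have "aug Y \<cdot> g = f \<cdot> a" using a gg ob by (intro rr_inject) auto
    then have "ShAr C (aug Y) \<cdot> ShAr C g = ShAr C f \<cdot> ShAr C a"
      using gg a ob by (simp add: ShAr_Comp_arr[symmetric])
    from arg_cong[OF this, of rr] have sg: "rr (ShAr C (aug Y)) * rr (ShAr C g) = rr (ShAr C f) * rr (ShAr C a)"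
      using gg a ob by simp
    have "rep (ShOb C X) (ShOb C Y) (ShOb C U, ShAr C s, ShAr C f) ?g"
      using gg a sX sY ob
      by (intro repI[OF gr, of "ShAr C a \<cdot> shc X"])
         (auto simp: sa[THEN times_ext] sY(8)[THEN times_ext] sg[THEN times_ext] mult.assoc)
    from roof_class_eq[OF gr this]
    show "S = {r \<in> roofs C N (ShOb C X) (ShOb C Y). rep (ShOb C X) (ShOb C Y) r ?g}" by (simp add: S)
  next
    show "?F \<noteq> {}" using base_roof[OF ob g] by blast
  qed
  then show ?thesis
    by (simp add: V_simps) (simp add: verdier_shift_cat_def cls_def)
qed

lemma iso_arrow_V:
  assumes ob: "X \<in> Ob C" "Y \<in> Ob C" and g: "typed g (res X) (res Y)"
  shows "iso_arrow V X Y (cls X Y g) \<longleftrightarrow> iso_arrow C (res X) (res Y) g"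
proof
  assume "iso_arrow V X Y (cls X Y g)"
  then obtain h where h: "typed h (res Y) (res X)"
    "Comp V (cls Y X h) (cls X Y g) = Idn V X" "Comp V (cls X Y g) (cls Y X h) = Idn V Y"
    using ob by (auto simp: iso_arrow_def Hom_V)
  then have "cls X X (h \<cdot> g) = cls X X (Idn C (res X))" "cls Y Y (g \<cdot> h) = cls Y Y (Idn C (res Y))"
    using ob g by (simp_all add: Comp_V Idn_V)
  then have "h \<cdot> g = Idn C (res X)" "g \<cdot> h = Idn C (res Y)"
    using ob g h cls_inject Comp_typed by blast+
  then show "iso_arrow C (res X) (res Y) g" using g h by (auto intro: iso_arrowI)
next
  assume "iso_arrow C (res X) (res Y) g"
  then obtain h where h: "typed h (res Y) (res X)" "h \<cdot> g = Idn C (res X)" "g \<cdot> h = Idn C (res Y)"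
    by (auto elim: iso_arrowE)
  then show "iso_arrow V X Y (cls X Y g)"
    using ob g unfolding iso_arrow_def
    by (auto simp: V_simps(1) cls_in_Hom Comp_V Idn_V intro!: bexI[of _ "cls Y X h"])
qed

subsection \<open>The equivalence\<close>

text \<open>A cone \<open>Q\<close> of \<open>resm u\<close> can be taken in \<open>P\<close>, and
  TR3 maps its triangle to the given one; the resulting \<open>c : Q -> Z\<close> is compared with
  \<open>aug Z\<close>. The arrow \<open>shc X\<close> corrects the end of the triangle from
  \<open>res (X[1])\<close> to \<open>(res X)[1]\<close>.\<close>

lemma resolved_triangle:
  assumes t: "(X, Y, Z, u, v, w) \<in> Tri C"
  shows "(res X, res Y, res Z, resm u, resm v, shc X \<cdot> resm w) \<in> Tri C"
proof -
  note d = TriD[OF t]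
  note ty = d(1-3)[unfolded typed_iff]
  have ob: "X \<in> Ob C" "Y \<in> Ob C" "Z \<in> Ob C" "ShOb C X \<in> Ob C" "ShOb C Y \<in> Ob C"
    using d by (auto simp: typed_def ShOb_in)
  note ru = resm[of u] and rv = resm[of v] and rw = resm[of w] and sX = shc[OF ob(1)]
  have "resm u \<in> Hom C (res X) (res Y)" using ty ru by (auto intro: in_HomI)
  then obtain Q j q where Q: "Q \<in> P" and t': "(res X, res Y, Q, resm u, j, q) \<in> Tri C"
    using P_cone[of "res X" "res Y" "resm u"] ob by auto
  note d' = TriD[OF t']
  note ty' = d'(1-3)[unfolded typed_iff]
  have "aug Y \<cdot> resm u = u \<cdot> aug X"
    using ty ru ob by (intro rr_inject) auto
  then obtain c where c: "typed c Q Z" "c \<cdot> j = v \<cdot> aug Y" "ShAr C (aug X) \<cdot> q = w \<cdot> c"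
    using Tri_tr3[OF t' t, unfolded tr3_def prod.case, rule_format, of "aug X" "aug Y"] ob
    by (auto simp: typed_iff)
  note ct = c(1)[unfolded typed_iff]
  have cj: "rr c * rr j = rr v * rr (aug Y)" and wc: "rr w * rr c = rr (ShAr C (aug X)) * rr q"
    using arg_cong[OF c(2), of rr] arg_cong[OF c(3), of rr] ct ty ty' ob by simp_all
  have au: "rr (aug Y) * rr (resm u) = rr u * rr (aug X)" using ru ty by simp
  have "ShAr C (aug Y) \<cdot> ShAr C (resm u) = ShAr C u \<cdot> ShAr C (aug X)"
    using \<open>aug Y \<cdot> resm u = u \<cdot> aug X\<close> ty ru ob by (simp add: ShAr_Comp_arr[symmetric])
  from arg_cong[OF this, of rr]
  have sau: "rr (ShAr C (aug Y)) * rr (ShAr C (resm u)) = rr (ShAr C u) * rr (ShAr C (aug X))"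
    using ty ru ob by simp
  have cX: "colocal (ShAr C (aug X))" and cY: "colocal (ShAr C (aug Y))" using ob by (auto intro: colocal_ShAr)
  have so: "ShOb C (res X) \<in> Ob C" "ShOb C (res Y) \<in> Ob C" using ob ShOb_in by auto
  txt \<open>The five lemma for \<open>Hom(R, -)\<close> with \<open>R\<close> in \<open>P\<close>.\<close>
  have colc: "colocal c"
  proof (rule colocalI)
    show "arr c" using ct by simp
  next
    fix R z assume R: "R \<in> P" "typed z R (tgt c)"
    have z: "arr z" "src z = R" "tgt z = Z" using R ct by (auto simp: typed_iff)
    note Ro = P_in_Ob[OF R(1)]
    \<comment> \<open>Surjectivity: \<open>w \<cdot> z\<close> is lifted to
      \<open>(res X)[1]\<close>. The lift is killed by the shift of \<open>resm u\<close>, because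
      this holds after the colocal shift of \<open>aug Y\<close>; hence it comes from
      \<open>Q\<close>.\<close>
    note l = lift[OF cX, of "w \<cdot> z"]
    obtain y where y: "arr y" "src y = R" "tgt y = ShOb C (res X)" "ShAr C (aug X) \<cdot> y = w \<cdot> z"
      using l z ty ob R by simp
    have ry: "rr (ShAr C (aug X)) * rr y = rr w * rr z"
      using rr_compD[OF y(4)] y(1-3) z ty ob by simp
    have "ShAr C (resm u) \<cdot> y = Zero C R (ShOb C (res Y))"
    proof (rule colocal_cancel_rr[OF cY])
      have "rr (ShAr C (aug Y)) * (rr (ShAr C (resm u)) * rr y) = 0"
        by (simp add: sau[THEN times_ext] ry mult.assoc) (simp add: d(6)[THEN times_ext])
      then show "rr (ShAr C (aug Y)) * rr (ShAr C (resm u) \<cdot> y) = rr (ShAr C (aug Y)) * rr (Zero C R (ShOb C (res Y)))"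
        using ru ty y Ro so by simp
    qed (use ru ty y ob Ro so R in auto)
    from arg_cong[OF this, of rr] have "rr (ShAr C (resm u)) * rr y = 0"
      using ru ty y Ro so by simp
    then obtain g where g: "typed g R Q" "q \<cdot> g = y"
      using d'(9)[of y R] y by (auto simp: typed_iff)
    note gt = g(1)[unfolded typed_iff]
    have qg: "rr q * rr g = rr y" using arg_cong[OF g(2), of rr] gt ty' by simp
    \<comment> \<open>The error of the first approximation \<open>g\<close> comes from
      \<open>Y\<close>, hence from \<open>res Y\<close>, and is removed by adding
      \<open>j \<cdot> b'\<close>.\<close>
    have "rr w * rr (z \<boxminus> (c \<cdot> g)) = 0"
      using z ct gt by (simp add: algebra_simps wc[THEN times_ext] qg ry mult.assoc)
    then obtain b where b: "typed b R Y" "v \<cdot> b = z \<boxminus> (c \<cdot> g)"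
      using d(8)[of "z \<boxminus> (c \<cdot> g)" R] z ct gt by (auto simp: typed_iff)
    note bt = b(1)[unfolded typed_iff]
    note l' = lift[of "aug Y" b]
    obtain b' where b': "arr b'" "src b' = R" "tgt b' = res Y" "aug Y \<cdot> b' = b"
      using l' bt ob R by simp
    have "rr (aug Y) * rr b' = rr b" using rr_compD[OF b'(4)] b'(1-3) ob by simp
    then have "rr c * (rr j * rr b') = rr v * rr b" by (simp add: cj[THEN times_ext] mult.assoc)
    also have "\<dots> = rr z - rr c * rr g"
      using arg_cong[OF b(2), of rr] bt ty z ct gt by simp
    finally have "c \<cdot> (g \<boxplus> (j \<cdot> b')) = z"
      using z ct gt b' ty' by (intro rr_inject) (auto simp: algebra_simps)
    then show "\<exists>g. typed g R (src c) \<and> c \<cdot> g = z"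
      using ct gt b' ty' by (intro exI[of _ "g \<boxplus> (j \<cdot> b')"]) (auto simp: typed_iff)
  next
    fix R g assume R: "R \<in> P" "typed g R (src c)" "rr c * rr g = 0"
    have g: "arr g" "src g = R" "tgt g = Q" using R ct by (auto simp: typed_iff)
    note Ro = P_in_Ob[OF R(1)]
    \<comment> \<open>Injectivity: \<open>q \<cdot> g\<close> vanishes, so \<open>g\<close> comes
      from a map into \<open>res Y\<close>. That map factors through \<open>resm u\<close>, as seen
      after \<open>aug Y\<close>, and \<open>j\<close> kills \<open>resm u\<close>.\<close>
    have "rr (ShAr C (aug X)) * (rr q * rr g) = 0"
      by (simp add: wc[symmetric, THEN times_ext] R(3) mult.assoc)
    then have "q \<cdot> g = Zero C R (ShOb C (res X))"
      using g ty' Ro so ob R by (intro colocal_cancel_rr[OF cX]) auto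
    from arg_cong[OF this, of rr] have "rr q * rr g = 0" using g ty' Ro so by simp
    then obtain k where k: "typed k R (res Y)" "j \<cdot> k = g"
      using d'(8)[of g R] g by (auto simp: typed_iff)
    note kt = k(1)[unfolded typed_iff]
    have jk: "rr j * rr k = rr g" using arg_cong[OF k(2), of rr] kt ty' by simp
    have "rr v * (rr (aug Y) * rr k) = 0"
      by (simp add: cj[symmetric, THEN times_ext] jk R(3) mult.assoc)
    then have "rr v * rr (aug Y \<cdot> k) = 0" using kt ob by simp
    then obtain x where x: "typed x R X" "u \<cdot> x = aug Y \<cdot> k"
      using d(7)[of "aug Y \<cdot> k" R] kt ob by (auto simp: typed_iff)
    note xt = x(1)[unfolded typed_iff]
    note l = lift[of "aug X" x]
    obtain x' where x': "arr x'" "src x' = R" "tgt x' = res X" "aug X \<cdot> x' = x"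
      using l xt ob R by simp
    have "rr (aug X) * rr x' = rr x" using rr_compD[OF x'(4)] x'(1-3) ob by simp
    moreover have "rr u * rr x = rr (aug Y) * rr k"
      using arg_cong[OF x(2), of rr] xt ty kt ob by simp
    ultimately have "resm u \<cdot> x' = k"
      using x' ru ty kt ob R
      by (intro colocal_cancel_rr[of "aug Y"]) (auto simp: au[THEN times_ext] mult.assoc)
    from arg_cong[OF this, of rr] have "rr (resm u) * rr x' = rr k" using x' ru ty by simp
    then have "rr g = rr j * (rr (resm u) * rr x')" using jk by simp
    then show "rr g = 0" by (simp add: d'(4)[THEN times_ext])
  qed
  txt \<open>Both \<open>Q \<rightarrow> Z\<close> and \<open>res Z \<rightarrow> Z\<close> are colocal with source in \<open>P\<close>, so \<open>Q \<cong> res Z\<close>.\<close>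
  let ?m = "lift c (aug Z)"
  note m = lift[OF colc, of "aug Z"]
  have mt: "arr ?m" "src ?m = res Z" "tgt ?m = Q" and cm: "c \<cdot> ?m = aug Z" using m ct ob by simp_all
  have rcm: "rr c * rr ?m = rr (aug Z)" using arg_cong[OF cm, of rr] mt ct by simp
  have "colocal ?m"
  proof (rule colocalI)
    fix R x assume R: "R \<in> P" "typed x R (tgt ?m)"
    have x: "arr x" "src x = R" "tgt x = Q" using R mt by (auto simp: typed_iff)
    note l = lift[of "aug Z" "c \<cdot> x"]
    obtain k where k: "arr k" "src k = R" "tgt k = res Z" "aug Z \<cdot> k = c \<cdot> x"
      using l x ct ob R by simp
    have "?m \<cdot> k = x"
      using k x mt ct R ob rr_compD[OF k(4)]
      by (intro colocal_cancel_rr[OF colc]) (auto simp: rcm[THEN times_ext])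
    then show "\<exists>g. typed g R (src ?m) \<and> ?m \<cdot> g = x" using k mt by (auto simp: typed_iff)
  next
    fix R g assume R: "R \<in> P" "typed g R (src ?m)" "rr ?m * rr g = 0"
    have g: "arr g" "src g = R" "tgt g = res Z" using R mt by (auto simp: typed_iff)
    note Ro = P_in_Ob[OF R(1)]
    have "rr (aug Z) * rr g = 0" by (simp add: rcm[symmetric] R(3) mult.assoc)
    then have "g = Zero C R (res Z)" using g R Ro ob by (intro colocal_cancel_rr[of "aug Z"]) auto
    then show "rr g = 0" using Ro ob by simp
  qed (rule mt)
  then have iso: "iso_arrow C (res Z) Q ?m"
    using iso_of_colocal(3)[of ?m] mt Q ob by simp
  have "triangle_iso C (res X, res Y, res Z, resm u, resm v, shc X \<cdot> resm w) (res X, res Y, Q, resm u, j, q)"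
    unfolding triangle_iso_iff
  proof (intro conjI exI)
    show "tri_typed (res X, res Y, res Z, resm u, resm v, shc X \<cdot> resm w)"
      using ty ru rv rw sX by (auto simp: tri_typed_def typed_iff)
    show "tri_typed (res X, res Y, Q, resm u, j, q)" using d' by (simp add: tri_typed_def)
    show "iso_arrow C (res X) (res X) (Idn C (res X))" "iso_arrow C (res Y) (res Y) (Idn C (res Y))"
      using ob by (simp_all add: iso_arrow_Idn)
    show "iso_arrow C (res Z) Q ?m" by (rule iso)
    show "Idn C (res Y) \<cdot> resm u = resm u \<cdot> Idn C (res X)" using ru ty by simp
    have av: "rr (aug Z) * rr (resm v) = rr v * rr (aug Y)" using rv ty by simp
    have "?m \<cdot> resm v = j"
      using mt rv ty ty' ob ct
      by (intro colocal_cancel_rr[OF colc]) (auto simp: rcm[THEN times_ext] av cj)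
    then show "?m \<cdot> resm v = j \<cdot> Idn C (res Y)" using ty' by simp
    have aw: "rr (aug (ShOb C X)) * rr (resm w) = rr w * rr (aug Z)" using rw ty by simp
    have "shc X \<cdot> resm w = q \<cdot> ?m"
      using mt rw ty ty' ob ct sX
      by (intro colocal_cancel_rr[OF cX])
         (auto simp: sX(7)[THEN times_ext] aw wc[symmetric, THEN times_ext] rcm mult.assoc)
    then show "ShAr C (Idn C (res X)) \<cdot> (shc X \<cdot> resm w) = q \<cdot> ?m"
      using ob sX rw ty ty' mt by (simp add: ShAr_Idn)
  qed
  then show ?thesis using Tri_iso t' by blast
qed

abbreviation D :: "('o, 'm) tri_cat" where
  "D \<equiv> full_subcat C P"

lemma D_simps:
  "Ob D = P" "Hom D = Hom C" "Idn D = Idn C" "Comp D = Comp C" "Add D = Add C"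
  "ShOb D = ShOb C" "ShAr D = ShAr C"
  "Tri D = {(X, Y, Z, u, v, w). (X, Y, Z, u, v, w) \<in> Tri C \<and> X \<in> P \<and> Y \<in> P \<and> Z \<in> P}"
  using P_Ob by (auto simp: full_subcat_def)

text \<open>Arrows of the localization are triples that carry their ends; \<open>THE\<close>
  recovers the unique map between the resolutions.\<close>

definition resolve :: "('o, ('o, 'm) frac, 'o, 'm) func" where
  "resolve = \<lparr>ob_map = res, ar_map = (\<lambda>a. THE g. typed g (res (fst a)) (res (snd (snd a))) \<and>
      a = cls (fst a) (snd (snd a)) g)\<rparr>"

definition embed :: "('o, 'm, 'o, ('o, 'm) frac) func" where
  "embed = \<lparr>ob_map = (\<lambda>X. X), ar_map = (\<lambda>f. loc_arrow C N (src f) (tgt f) f)\<rparr>"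

lemma resolve_cls:
  assumes "X \<in> Ob C" "Y \<in> Ob C" "typed g (res X) (res Y)"
  shows "ar_map resolve (cls X Y g) = g"
  unfolding resolve_def func.simps
  by (rule the_equality) (use assms cls_inject in \<open>auto simp: cls_def\<close>)

lemma resolve_ob: "ob_map resolve = res"
  by (simp add: resolve_def)

lemma embed_arr: "typed f X Y \<Longrightarrow> ar_map embed f = cls X Y (resm f)"
  by (simp add: embed_def loc_arrow_cls typed_iff)

lemma embed_ob: "ob_map embed X = X"
  by (simp add: embed_def)

lemma typed_D: "\<lbrakk>f \<in> Hom D X Y; X \<in> Ob D; Y \<in> Ob D\<rbrakk> \<Longrightarrow> typed f X Y"
  by (simp add: typed_def D_simps P_in_Ob)

lemma resm_typed: "typed f X Y \<Longrightarrow> typed (resm f) (res X) (res Y)"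
  using resm[of f] by (simp add: typed_iff)

lemma iso_arrow_D: "\<lbrakk>iso_arrow C X Y f; X \<in> P; Y \<in> P\<rbrakk> \<Longrightarrow> iso_arrow D X Y f"
  by (auto simp: iso_arrow_def D_simps)

lemma shm_typed:
  assumes "X \<in> Ob C" "Y \<in> Ob C" "typed g (res X) (res Y)"
  shows "typed (shc' Y \<cdot> (ShAr C g \<cdot> shc X)) (res (ShOb C X)) (res (ShOb C Y))"
  using shc[OF assms(1)] shc[OF assms(2)] assms(3) by (simp add: typed_iff)

lemma resm_ShAr:
  assumes "typed f X Y"
  shows "resm (ShAr C f) = shc' Y \<cdot> (ShAr C (resm f) \<cdot> shc X)"
proof (rule resm_eqI)
  have f: "arr f" "src f = X" "tgt f = Y" and ob: "X \<in> Ob C" "Y \<in> Ob C"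
    using assms by (auto simp: typed_iff arr_src arr_tgt)
  note sX = shc[OF ob(1)] and sY = shc[OF ob(2)]
  note r = resm[OF f(1)]
  show "arr (ShAr C f)" using f by simp
  show "arr (shc' Y \<cdot> (ShAr C (resm f) \<cdot> shc X))"
    "src (shc' Y \<cdot> (ShAr C (resm f) \<cdot> shc X)) = res (src (ShAr C f))"
    "tgt (shc' Y \<cdot> (ShAr C (resm f) \<cdot> shc X)) = res (tgt (ShAr C f))"
    using sX sY r f by simp_all
  have "aug Y \<cdot> resm f = f \<cdot> aug X" using r f ob by (intro rr_inject) auto
  then have "ShAr C (aug Y) \<cdot> ShAr C (resm f) = ShAr C f \<cdot> ShAr C (aug X)"
    using r f ob by (simp add: ShAr_Comp_arr[symmetric])
  from arg_cong[OF this, of rr]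
  have "rr (ShAr C (aug Y)) * rr (ShAr C (resm f)) = rr (ShAr C f) * rr (ShAr C (aug X))"
    using r f ob by simp
  note e = this[THEN times_ext]
  show "rr (aug (tgt (ShAr C f))) * rr (shc' Y \<cdot> (ShAr C (resm f) \<cdot> shc X)) =
    rr (ShAr C f) * rr (aug (src (ShAr C f)))"
    using f ob sX sY r by (simp add: sY(8)[THEN times_ext] e mult.assoc)
qed

text \<open>On objects \<open>embed\<close> commutes with the shift strictly, so identities serve as
  the comparison. Their naturality is \<open>resm_ShAr\<close>: the \<open>shc\<close> arrows in
  \<open>ShAr_V\<close> are exactly those relating \<open>resm\<close> to the shift.\<close>

lemma triangle_functor_embed:
  "triangle_functor D V embed (\<lambda>X. Idn V (ShOb C X))"
  unfolding triangle_functor_def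
proof (intro conjI allI impI)
  show "additive_functor D V embed"
    unfolding additive_functor_def is_functor_def
  proof (intro conjI ballI)
    fix X assume X: "X \<in> Ob D"
    then have o: "X \<in> Ob C" by (simp add: D_simps P_in_Ob)
    show "ob_map embed X \<in> Ob V" using o by (simp add: embed_ob V_simps)
    show "ar_map embed (Idn D X) = Idn V (ob_map embed X)"
      using o embed_arr[OF Idn_typed[OF o]] by (simp add: D_simps embed_ob Idn_V resm_Idn)
    fix Y assume Y: "Y \<in> Ob D"
    then have o': "Y \<in> Ob C" by (simp add: D_simps P_in_Ob)
    fix f assume f: "f \<in> Hom D X Y"
    note ft = typed_D[OF f X Y]
    show "ar_map embed f \<in> Hom V (ob_map embed X) (ob_map embed Y)"
      using embed_arr[OF ft] o o' ft by (simp add: embed_ob cls_in_Hom resm_typed)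
    {
      fix g assume "g \<in> Hom D X Y"
      then have gt: "typed g X Y" using typed_D X Y by blast
      show "ar_map embed (Add D f g) = Add V (ar_map embed f) (ar_map embed g)"
        using embed_arr[OF ft] embed_arr[OF gt] embed_arr[OF typed_Add[OF ft gt]] o o' ft gt
        by (simp add: Add_V resm_typed D_simps) (simp add: typed_iff resm_Add)
    }
    fix Z g assume Z: "Z \<in> Ob D" and g: "g \<in> Hom D Y Z"
    note gt = typed_D[OF g Y Z]
    have o'': "Z \<in> Ob C" using Z by (simp add: D_simps P_in_Ob)
    show "ar_map embed (Comp D g f) = Comp V (ar_map embed g) (ar_map embed f)"
      using embed_arr[OF ft] embed_arr[OF gt] embed_arr[OF Comp_typed[OF ft gt]] o o' o'' ft gt
      by (simp add: Comp_V resm_typed D_simps) (simp add: typed_iff resm_Comp)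
  qed
  show "nat_iso D V (comp_func embed (shift_func D)) (comp_func (shift_func V) embed) (\<lambda>X. Idn V (ShOb C X))"
    unfolding nat_iso_def
  proof (intro conjI ballI)
    fix X assume X: "X \<in> Ob D"
    then have o: "X \<in> Ob C" "ShOb C X \<in> Ob C" by (auto simp: D_simps P_in_Ob ShOb_in)
    show "iso_arrow V (ob_map (comp_func embed (shift_func D)) X) (ob_map (comp_func (shift_func V) embed) X)
       (Idn V (ShOb C X))"
      using o by (simp add: comp_func_def shift_func_def embed_ob D_simps V_simps(6) Idn_V iso_arrow_V
          Idn_typed iso_arrow_Idn)
    fix Y f assume Y: "Y \<in> Ob D" and f: "f \<in> Hom D X Y"
    note ft = typed_D[OF f X Y]
    have o': "Y \<in> Ob C" "ShOb C Y \<in> Ob C" using Y by (auto simp: D_simps P_in_Ob ShOb_in)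
    note s = shm_typed[OF o(1) o'(1) resm_typed[OF ft]]
    show "Idn V (ShOb C Y) \<cdot>\<^bsub>V\<^esub> ar_map (comp_func embed (shift_func D)) f =
          ar_map (comp_func (shift_func V) embed) f \<cdot>\<^bsub>V\<^esub> Idn V (ShOb C X)"
      using o o' s embed_arr[OF ft] embed_arr[OF typed_ShAr[OF ft]]
      by (simp add: comp_func_def shift_func_def D_simps Idn_V ShAr_V[OF o(1) o'(1) resm_typed[OF ft]]
          resm_ShAr[OF ft] Comp_V[OF o(2) o'(2) o'(2)] Comp_V[OF o(2) o(2) o'(2)] Idn_typed)
         (simp add: typed_iff)
  qed
  fix X Y Z u v w assume "(X, Y, Z, u, v, w) \<in> Tri D"
  then have t: "(X, Y, Z, u, v, w) \<in> Tri C" by (simp add: D_simps)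
  note ty = TriD(1-3)[OF t]
  have o: "X \<in> Ob C" "Y \<in> Ob C" "Z \<in> Ob C" "ShOb C X \<in> Ob C"
    using ty by (auto simp: typed_def)
  let ?u = "loc_arrow C N X Y u" and ?v = "loc_arrow C N Y Z v" and ?w = "loc_arrow C N Z (ShOb C X) w"
  have e: "ar_map embed u = ?u" "ar_map embed v = ?v" "Idn V (ShOb C X) \<cdot>\<^bsub>V\<^esub> ar_map embed w = ?w"
    using embed_arr[OF ty(1)] embed_arr[OF ty(2)] embed_arr[OF ty(3)] loc_arrow_cls[OF ty(1)]
      loc_arrow_cls[OF ty(2)] loc_arrow_cls[OF ty(3)] resm_typed[OF ty(3)] o
    by (simp_all add: Idn_V Comp_V[OF o(3,4,4)] Idn_typed) (simp add: typed_iff)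
  have "triangle_iso (verdier_shift_cat C N) (X, Y, Z, ?u, ?v, ?w) (X, Y, Z, ?u, ?v, ?w)"
  proof -
    have h: "?u \<in> Hom V X Y" "?v \<in> Hom V Y Z" "?w \<in> Hom V Z (ShOb V X)"
      using ty o by (simp_all add: loc_arrow_cls cls_in_Hom resm_typed V_simps(6))
    have i: "iso_arrow V W W (Idn V W)" if "W \<in> Ob C" for W
      using that by (simp add: Idn_V iso_arrow_V Idn_typed iso_arrow_Idn)
    have c: "Idn V W' \<cdot>\<^bsub>V\<^esub> cls W W' g = cls W W' g" "cls W W' g \<cdot>\<^bsub>V\<^esub> Idn V W = cls W W' g"
      if "W \<in> Ob C" "W' \<in> Ob C" "typed g (res W) (res W')" for W W' g
      using that by (simp_all add: Idn_V Comp_V Idn_typed) (simp_all add: typed_iff)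
    have sI: "ShAr V (Idn V X) = Idn V (ShOb C X)"
      using o shc[OF o(1)] by (simp add: Idn_V ShAr_V Idn_typed ShAr_Idn P_in_Ob)
    have "triangle_iso V (X, Y, Z, ?u, ?v, ?w) (X, Y, Z, ?u, ?v, ?w)"
      unfolding triangle_iso_def prod.case
      using h i o ty
      by (intro conjI exI[of _ "Idn V X"] exI[of _ "Idn V Y"] exI[of _ "Idn V Z"])
         (simp_all add: sI loc_arrow_cls c resm_typed)
    then show ?thesis
      unfolding triangle_iso_def iso_arrow_def V_simps by (simp add: verdier_shift_cat_def)
  qed
  then show "(ob_map embed X, ob_map embed Y, ob_map embed Z, ar_map embed u, ar_map embed v,
        Idn V (ShOb C X) \<cdot>\<^bsub>V\<^esub> ar_map embed w) \<in> Tri V"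
    using t unfolding e embed_ob V_simps(8) verdier_triangles_def by blast
qed

text \<open>A distinguished triangle of the localization is isomorphic to the image of one in
  \<open>C\<close>. Passing to maps between resolutions turns this isomorphism into one onto the
  triangle of \<open>resolved_triangle\<close>, and closure under isomorphism concludes.\<close>

lemma triangle_functor_resolve: "triangle_functor V D resolve shc"
  unfolding triangle_functor_def
proof (intro conjI allI impI)
  show "additive_functor V D resolve"
    unfolding additive_functor_def is_functor_def
  proof (intro conjI ballI)
    fix X assume "X \<in> Ob V"
    then have o: "X \<in> Ob C" by (simp add: V_simps)
    show "ob_map resolve X \<in> Ob D" using o by (simp add: resolve_ob D_simps)
    show "ar_map resolve (Idn V X) = Idn D (ob_map resolve X)"
      using o by (simp add: Idn_V resolve_cls Idn_typed D_simps resolve_ob)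
    fix Y assume "Y \<in> Ob V"
    then have o': "Y \<in> Ob C" by (simp add: V_simps)
    fix f assume "f \<in> Hom V X Y"
    then obtain f' where f: "typed f' (res X) (res Y)" "f = cls X Y f'" using o o' by (auto simp: Hom_V)
    show "ar_map resolve f \<in> Hom D (ob_map resolve X) (ob_map resolve Y)"
      using f o o' by (simp add: resolve_cls D_simps resolve_ob) (simp add: typed_def)
    {
      fix g assume "g \<in> Hom V X Y"
      then obtain g' where g: "typed g' (res X) (res Y)" "g = cls X Y g'" using o o' by (auto simp: Hom_V)
      show "ar_map resolve (Add V f g) = Add D (ar_map resolve f) (ar_map resolve g)"
        using f g o o' by (simp add: Add_V resolve_cls typed_Add D_simps)
    }
    fix Z g assume "Z \<in> Ob V" and "g \<in> Hom V Y Z"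
    then obtain g' where o'': "Z \<in> Ob C" and g: "typed g' (res Y) (res Z)" "g = cls Y Z g'"
      using o' by (auto simp: Hom_V V_simps(1))
    show "ar_map resolve (Comp V g f) = Comp D (ar_map resolve g) (ar_map resolve f)"
      using f g o o' o'' by (simp add: Comp_V resolve_cls Comp_typed[of f' "res X" "res Y"] D_simps)
  qed
  show "nat_iso V D (comp_func resolve (shift_func V)) (comp_func (shift_func D) resolve) shc"
    unfolding nat_iso_def
  proof (intro conjI ballI)
    fix X assume "X \<in> Ob V"
    then have o: "X \<in> Ob C" "ShOb C X \<in> Ob C" by (auto simp: V_simps ShOb_in)
    show "iso_arrow D (ob_map (comp_func resolve (shift_func V)) X) (ob_map (comp_func (shift_func D) resolve) X)
       (shc X)"
      using o iso_shc by (simp add: comp_func_def shift_func_def resolve_ob D_simps V_simps(6) iso_arrow_D P_shift)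
    fix Y f assume "Y \<in> Ob V" and "f \<in> Hom V X Y"
    then obtain g where o': "Y \<in> Ob C" "ShOb C Y \<in> Ob C" and g: "typed g (res X) (res Y)" "f = cls X Y g"
      using o by (auto simp: Hom_V V_simps(1) ShOb_in)
    note sX = shc[OF o(1)] and sY = shc[OF o'(1)]
    have "shc Y \<cdot> (shc' Y \<cdot> (ShAr C g \<cdot> shc X)) = ShAr C g \<cdot> shc X"
      using sX sY g(1)[unfolded typed_iff] rr_shc_inv(1)[OF o'(1), of "ShAr C g \<cdot> shc X"]
      by (intro rr_inject) auto
    then show "shc Y \<cdot>\<^bsub>D\<^esub> ar_map (comp_func resolve (shift_func V)) f =
          ar_map (comp_func (shift_func D) resolve) f \<cdot>\<^bsub>D\<^esub> shc X"
      using g o o' by (simp add: comp_func_def shift_func_def D_simps ShAr_V resolve_cls shm_typed)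
  qed
  fix X Y Z a b c assume "(X, Y, Z, a, b, c) \<in> Tri V"
  then obtain X' Y' Z' u v w where t: "(X', Y', Z', u, v, w) \<in> Tri C"
    and i: "triangle_iso (verdier_shift_cat C N) (X, Y, Z, a, b, c)
       (X', Y', Z', loc_arrow C N X' Y' u, loc_arrow C N Y' Z' v, loc_arrow C N Z' (ShOb C X') w)"
    by (auto simp: V_simps verdier_triangles_def)
  have "triangle_iso V (X, Y, Z, a, b, c)
       (X', Y', Z', loc_arrow C N X' Y' u, loc_arrow C N Y' Z' v, loc_arrow C N Z' (ShOb C X') w)"
    using i unfolding triangle_iso_def iso_arrow_def V_simps by (simp add: verdier_shift_cat_def)
  then obtain \<alpha> \<beta> \<gamma> where iso: "iso_arrow V X X' \<alpha>" "iso_arrow V Y Y' \<beta>" "iso_arrow V Z Z' \<gamma>"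
    and abc: "a \<in> Hom V X Y" "b \<in> Hom V Y Z" "c \<in> Hom V Z (ShOb C X)"
    and sq: "\<beta> \<cdot>\<^bsub>V\<^esub> a = loc_arrow C N X' Y' u \<cdot>\<^bsub>V\<^esub> \<alpha>" "\<gamma> \<cdot>\<^bsub>V\<^esub> b = loc_arrow C N Y' Z' v \<cdot>\<^bsub>V\<^esub> \<beta>"
      "ShAr V \<alpha> \<cdot>\<^bsub>V\<^esub> c = loc_arrow C N Z' (ShOb C X') w \<cdot>\<^bsub>V\<^esub> \<gamma>"
    unfolding triangle_iso_def by (auto simp: V_simps(6))
  note ty = TriD(1-3)[OF t]
  have o: "X \<in> Ob C" "Y \<in> Ob C" "Z \<in> Ob C" "X' \<in> Ob C" "Y' \<in> Ob C" "Z' \<in> Ob C"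
    using iso by (auto simp: iso_arrow_def V_simps(1))
  note so = ShOb_in[OF o(1)] ShOb_in[OF o(4)]
  obtain a0 b0 c0 where a0: "typed a0 (res X) (res Y)" "a = cls X Y a0"
    and b0: "typed b0 (res Y) (res Z)" "b = cls Y Z b0"
    and c0: "typed c0 (res Z) (res (ShOb C X))" "c = cls Z (ShOb C X) c0"
    using abc o so by (auto simp: Hom_V)
  obtain \<alpha>0 \<beta>0 \<gamma>0 where \<alpha>0: "typed \<alpha>0 (res X) (res X')" "\<alpha> = cls X X' \<alpha>0"
    and \<beta>0: "typed \<beta>0 (res Y) (res Y')" "\<beta> = cls Y Y' \<beta>0"
    and \<gamma>0: "typed \<gamma>0 (res Z) (res Z')" "\<gamma> = cls Z Z' \<gamma>0"
    using iso o by (auto simp: iso_arrow_def Hom_V)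
  note ru = resm_typed[OF ty(1)] and rv = resm_typed[OF ty(2)] and rw = resm_typed[OF ty(3)]
  note s\<alpha> = shm_typed[OF o(1,4) \<alpha>0(1)]
  have "cls X Y' (\<beta>0 \<cdot> a0) = cls X Y' (resm u \<cdot> \<alpha>0)"
    using sq(1) a0 \<alpha>0 \<beta>0 o ru by (simp add: loc_arrow_cls[OF ty(1)] Comp_V)
  then have e1: "\<beta>0 \<cdot> a0 = resm u \<cdot> \<alpha>0"
    using cls_inject[OF o(1,5) Comp_typed[OF a0(1) \<beta>0(1)]] by simp
  have "cls Y Z' (\<gamma>0 \<cdot> b0) = cls Y Z' (resm v \<cdot> \<beta>0)"
    using sq(2) b0 \<gamma>0 \<beta>0 o rv by (simp add: loc_arrow_cls[OF ty(2)] Comp_V)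
  then have e2: "\<gamma>0 \<cdot> b0 = resm v \<cdot> \<beta>0"
    using cls_inject[OF o(2,6) Comp_typed[OF b0(1) \<gamma>0(1)]] by simp
  have "cls Z (ShOb C X') ((shc' X' \<cdot> (ShAr C \<alpha>0 \<cdot> shc X)) \<cdot> c0) = cls Z (ShOb C X') (resm w \<cdot> \<gamma>0)"
    using sq(3) c0 \<gamma>0 \<alpha>0 o so rw s\<alpha>
    by (simp add: loc_arrow_cls[OF ty(3)] ShAr_V Comp_V)
  then have e3: "(shc' X' \<cdot> (ShAr C \<alpha>0 \<cdot> shc X)) \<cdot> c0 = resm w \<cdot> \<gamma>0"
    using cls_inject[OF o(3) so(2) Comp_typed[OF c0(1) s\<alpha>]] by simp
  note at = a0(1)[unfolded typed_iff] b0(1)[unfolded typed_iff] c0(1)[unfolded typed_iff]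
    \<alpha>0(1)[unfolded typed_iff] \<beta>0(1)[unfolded typed_iff] \<gamma>0(1)[unfolded typed_iff]
    ru[unfolded typed_iff] rv[unfolded typed_iff] rw[unfolded typed_iff]
  note sX = shc[OF o(1)] and sX' = shc[OF o(4)]
  \<comment> \<open>Composing \<open>e3\<close> with \<open>shc X'\<close> cancels the
    \<open>shc' X'\<close> contributed by the shift of the localization.\<close>
  have e4: "ShAr C \<alpha>0 \<cdot> (shc X \<cdot> c0) = shc X' \<cdot> resm w \<cdot> \<gamma>0"
  proof (rule rr_inject)
    have "rr (shc X') * (rr (shc' X') * (rr (ShAr C \<alpha>0) * (rr (shc X) * rr c0))) =
        rr (shc X') * (rr (resm w) * rr \<gamma>0)"
      using arg_cong[OF e3, of rr] at sX sX' by (simp add: mult.assoc)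
    then show "rr (ShAr C \<alpha>0 \<cdot> (shc X \<cdot> c0)) = rr (shc X' \<cdot> resm w \<cdot> \<gamma>0)"
      using at sX sX' rr_shc_inv(1)[OF o(4), of "ShAr C \<alpha>0 \<cdot> (shc X \<cdot> c0)"]
      by (simp add: mult.assoc)
  qed (use at sX sX' in auto)
  have "triangle_iso C (res X, res Y, res Z, a0, b0, shc X \<cdot> c0)
      (res X', res Y', res Z', resm u, resm v, shc X' \<cdot> resm w)"
    unfolding triangle_iso_iff tri_typed_def
    using e1 e2 e4 at sX sX' iso \<alpha>0 \<beta>0 \<gamma>0 o
    by (auto simp: typed_iff iso_arrow_V)
  then have "(res X, res Y, res Z, a0, b0, shc X \<cdot> c0) \<in> Tri C"
    using Tri_iso resolved_triangle[OF t] by blast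
  then show "(ob_map resolve X, ob_map resolve Y, ob_map resolve Z, ar_map resolve a, ar_map resolve b,
        shc X \<cdot>\<^bsub>D\<^esub> ar_map resolve c) \<in> Tri D"
    using o so a0 b0 c0 by (simp add: resolve_ob resolve_cls D_simps)
qed

theorem triangle_equivalent_colocal: "triangle_equivalent V D"
proof -
  \<comment> \<open>An arrow \<open>X -> res X\<close> of the localization is a map
    \<open>res X -> res (res X)\<close>; the inverse of \<open>aug (res X)\<close> is taken. In the
    other direction \<open>aug X\<close> itself is invertible for \<open>X\<close> in
    \<open>P\<close>.\<close>
  let ?e = "\<lambda>X. lift (aug (res X)) (Idn C (res X))"
  have e: "iso_arrow C (res X) (res (res X)) (?e X)" "rr (aug (res X)) * rr (?e X) = rr (Idn C (res X))"
    if "X \<in> Ob C" for X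
  proof -
    have o: "res X \<in> Ob C" "res X \<in> P" using that by auto
    note i = iso_of_colocal[of "aug (res X)"]
    show 1: "iso_arrow C (res X) (res (res X)) (?e X)" using i o by simp
    have "aug (res X) \<cdot> ?e X = Idn C (res X)" using i o by simp
    from arg_cong[OF this, of rr] show "rr (aug (res X)) * rr (?e X) = rr (Idn C (res X))"
      using o 1 by (simp add: iso_arrow_iff typed_iff)
  qed
  have et: "typed (?e X) (res X) (res (res X))" if "X \<in> Ob C" for X
    using e[OF that] by (simp add: iso_arrow_iff)
  have "nat_iso V V id_func (comp_func embed resolve) (\<lambda>X. cls X (res X) (?e X))"
    unfolding nat_iso_def
  proof (intro conjI ballI)
    fix X assume "X \<in> Ob V"
    then have o: "X \<in> Ob C" "res X \<in> Ob C" by (auto simp: V_simps)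
    show "iso_arrow V (ob_map id_func X) (ob_map (comp_func embed resolve) X) (cls X (res X) (?e X))"
      using o e[OF o(1)] et[OF o(1)] by (simp add: id_func_def comp_func_def embed_ob resolve_ob iso_arrow_V)
    fix Y f assume "Y \<in> Ob V" and "f \<in> Hom V X Y"
    then obtain g where o': "Y \<in> Ob C" "res Y \<in> Ob C" and g: "typed g (res X) (res Y)" "f = cls X Y g"
      using o by (auto simp: Hom_V V_simps(1))
    note rg = resm_typed[OF g(1)]
    note tt = g(1)[unfolded typed_iff] rg[unfolded typed_iff] et[OF o(1), unfolded typed_iff]
      et[OF o'(1), unfolded typed_iff]
    have rrg: "rr (aug (res Y)) * rr (resm g) = rr g * rr (aug (res X))"
      using resm(4)[of g] tt by simp
    have "?e Y \<cdot> g = resm g \<cdot> ?e X"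
      using tt o o' e(2)[OF o(1)]
      by (intro colocal_cancel_rr[of "aug (res Y)"])
         (auto simp: e(2)[OF o'(1), THEN times_ext] rrg[THEN times_ext] mult.assoc)
    then show "cls Y (res Y) (?e Y) \<cdot>\<^bsub>V\<^esub> ar_map id_func f =
        ar_map (comp_func embed resolve) f \<cdot>\<^bsub>V\<^esub> cls X (res X) (?e X)"
      using g o o' rg et[OF o(1)] et[OF o'(1)]
      by (simp add: id_func_def comp_func_def resolve_cls embed_arr[OF g(1)] Comp_V[OF o(1) o'(1,2)] Comp_V[OF o o'(2)])
  qed
  moreover have "nat_iso D D (comp_func resolve embed) id_func aug"
    unfolding nat_iso_def
  proof (intro conjI ballI)
    fix X assume X: "X \<in> Ob D"
    then have o: "X \<in> P" "X \<in> Ob C" by (auto simp: D_simps P_in_Ob)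
    show "iso_arrow D (ob_map (comp_func resolve embed) X) (ob_map id_func X) (aug X)"
      using o iso_of_colocal(3)[of "aug X"]
      by (simp add: comp_func_def id_func_def resolve_ob embed_ob iso_arrow_D)
    fix Y f assume Y: "Y \<in> Ob D" and f: "f \<in> Hom D X Y"
    note ft = typed_D[OF f X Y]
    have o': "Y \<in> P" "Y \<in> Ob C" using Y by (auto simp: D_simps P_in_Ob)
    note tt = ft[unfolded typed_iff] resm_typed[OF ft, unfolded typed_iff]
    have "aug Y \<cdot> resm f = f \<cdot> aug X"
      using tt o o' resm(4)[of f] by (intro rr_inject) auto
    then show "aug Y \<cdot>\<^bsub>D\<^esub> ar_map (comp_func resolve embed) f = ar_map id_func f \<cdot>\<^bsub>D\<^esub> aug X"
      using o o' by (simp add: comp_func_def id_func_def D_simps embed_arr[OF ft] resolve_cls resm_typed[OF ft])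
  qed
  ultimately show ?thesis
    unfolding triangle_equivalent_def
    using triangle_functor_embed triangle_functor_resolve by blast
qed

end

section \<open>Full triangulated subcategories\<close>

lemma full_subcat_simps:
  "Ob (full_subcat T S) = Ob T \<inter> S" "Hom (full_subcat T S) = Hom T" "Idn (full_subcat T S) = Idn T"
  "Comp (full_subcat T S) = Comp T" "Add (full_subcat T S) = Add T" "Zero (full_subcat T S) = Zero T"
  "ShOb (full_subcat T S) = ShOb T" "ShAr (full_subcat T S) = ShAr T"
  "Tri (full_subcat T S) = {(X, Y, Z, u, v, w). (X, Y, Z, u, v, w) \<in> Tri T \<and> X \<in> S \<and> Y \<in> S \<and> Z \<in> S}"
  by (simp_all add: full_subcat_def)

lemma full_subcat_full_subcat: "S' \<subseteq> S \<Longrightarrow> full_subcat (full_subcat T S) S' = full_subcat T S'"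
  by (auto simp: full_subcat_def intro!: tri_cat.equality)

text \<open>Exactness is inherited because there are fewer test objects and the factorizations have
  the same ends as before. Closure under the shift keeps the end of each triangle inside the
  subcategory.\<close>

lemma (in pretriangulated) pretriangulated_full_subcat:
  assumes S: "\<And>X. X \<in> Ob C \<Longrightarrow> X \<in> S \<Longrightarrow> ShOb C X \<in> S"
  shows "pretriangulated (full_subcat C S)"
proof -
  let ?T = "full_subcat C S"
  note fs = full_subcat_simps
  have hg: "hom_group ?T = hom_group C" by (simp add: hom_group_def fs fun_eq_iff)
  have cat: "category ?T"
  proof
    fix X Y X' Y' f
    show "\<lbrakk>X \<in> Ob ?T; Y \<in> Ob ?T; X' \<in> Ob ?T; Y' \<in> Ob ?T; f \<in> Hom ?T X Y; f \<in> Hom ?T X' Y'\<rbrakk> \<Longrightarrow> X = X' \<and> Y = Y'"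
      using Hom_disjoint by (auto simp: fs)
  qed (auto simp: fs intro: Idn_in_Hom Comp_in_Hom Comp_Idn Idn_Comp Comp_assoc)
  have pre: "preadditive ?T"
    by (intro preadditive.intro cat preadditive_axioms.intro)
       (auto simp: fs hg intro: hom_comm_group Comp_Add_left Comp_Add_right)
  have sh: "shifted_category ?T"
    by (intro shifted_category.intro pre shifted_category_axioms.intro)
       (auto simp: fs S intro: ShOb_in ShAr_bij ShAr_Idn ShAr_Comp ShAr_Add)
  have ty: "category.typed ?T f X Y \<longleftrightarrow> typed f X Y \<and> X \<in> S \<and> Y \<in> S" for f X Y
    by (auto simp: category.typed_def[OF cat] typed_def fs)
  show ?thesis
  proof (intro pretriangulated.intro sh pretriangulated_axioms.intro)
    fix t assume t: "t \<in> Tri ?T"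
    obtain X Y Z u v w where e: "t = (X, Y, Z, u, v, w)" by (cases t)
    have t': "(X, Y, Z, u, v, w) \<in> Tri C" "X \<in> S" "Y \<in> S" "Z \<in> S" using t by (auto simp: fs e)
    note ex = Tri_exact[OF t'(1), unfolded exact_triangle_def tri_typed_def]
    have "X \<in> Ob C" using ex by (auto simp: typed_def)
    then have "ShOb C X \<in> S" using S t' by blast
    then show "shifted_category.exact_triangle ?T t"
      using ex t'(2-4) unfolding e shifted_category.exact_triangle_def[OF sh] shifted_category.tri_typed_def[OF sh]
      by (auto simp: ty fs)
  next
    fix t t' assume tt: "t \<in> Tri ?T" "t' \<in> Tri ?T"
    obtain X Y Z u v w where e: "t = (X, Y, Z, u, v, w)" by (cases t)
    obtain X' Y' Z' u' v' w' where e': "t' = (X', Y', Z', u', v', w')" by (cases t')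
    have m: "(X, Y, Z, u, v, w) \<in> Tri C" "(X', Y', Z', u', v', w') \<in> Tri C" "Z \<in> S" "Z' \<in> S"
      using tt by (auto simp: fs e e')
    show "shifted_category.tr3 ?T t t'"
      using Tri_tr3[OF m(1,2)] m(3,4) unfolding tr3_def shifted_category.tr3_def[OF sh] e e'
      by (auto simp: ty fs)
  next
    fix t t' assume t: "t' \<in> Tri ?T" "triangle_iso ?T t t'"
    obtain X Y Z u v w where e: "t = (X, Y, Z, u, v, w)" by (cases t)
    obtain X' Y' Z' u' v' w' where e': "t' = (X', Y', Z', u', v', w')" by (cases t')
    have "triangle_iso C t t'" "X \<in> S" "Y \<in> S" "Z \<in> S"
      using t(2) unfolding e e' triangle_iso_def iso_arrow_def by (auto simp: fs)
    moreover have "t' \<in> Tri C" using t(1) by (auto simp: fs)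
    ultimately show "t \<in> Tri ?T" using Tri_iso by (auto simp: fs e)
  qed
qed

section \<open>Zero objects, joint kernels and contractions\<close>

context preadditive
begin

text \<open>The equational form of being zero: every arrow into or out of \<open>Z\<close> factors
  through its identity.\<close>

lemma zero_object_iff: "is_zero_object C Z \<longleftrightarrow> Z \<in> Ob C \<and> Idn C Z = Zero C Z Z"
proof
  assume "is_zero_object C Z"
  then show "Z \<in> Ob C \<and> Idn C Z = Zero C Z Z"
    unfolding is_zero_object_def using Idn_in_Hom Zero_in_Hom by blast
next
  assume z: "Z \<in> Ob C \<and> Idn C Z = Zero C Z Z"
  have "f = Zero C X Z" if "X \<in> Ob C" "f \<in> Hom C X Z" for X f
    using z that Idn_Comp[of X Z f] Comp_Zero_left[of X Z Z f] by simp
  moreover have "f = Zero C Z X" if "X \<in> Ob C" "f \<in> Hom C Z X" for X f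
    using z that Comp_Idn[of Z X f] Comp_Zero_right[of Z Z X f] by simp
  ultimately show "is_zero_object C Z"
    unfolding is_zero_object_def using z Zero_in_Hom by metis
qed

lemma zero_object_Hom:
  assumes "is_zero_object C Z" "X \<in> Ob C"
  shows "f \<in> Hom C X Z \<Longrightarrow> f = Zero C X Z" "f \<in> Hom C Z X \<Longrightarrow> f = Zero C Z X"
  using assms Zero_in_Hom unfolding is_zero_object_def by blast+

lemma rr_zero_object:
  assumes "is_zero_object C Z"
  shows "typed f X Z \<Longrightarrow> rr f = 0" "typed f Z X \<Longrightarrow> rr f = 0"
  using zero_object_Hom[OF assms, of X f] rr_Zero[of X Z] rr_Zero[of Z X] by (auto simp: typed_def)

lemma biproduct_zero_object:
  assumes "biproduct C X Y S i j p q" "is_zero_object C X" "is_zero_object C Y"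
  shows "is_zero_object C S"
proof -
  note b = assms(1)[unfolded biproduct_def]
  have "p = Zero C S X" "q = Zero C S Y" using b assms zero_object_Hom by blast+
  then have "Idn C S = Zero C S S \<boxplus> Zero C S S"
    using b Comp_Zero_right[of S X S i] Comp_Zero_right[of S Y S j] by metis
  then show ?thesis using b by (simp add: zero_object_iff Zero_Add Zero_in_Hom)
qed

lemma biproduct_rr:
  assumes "biproduct C X Y S i j p q"
  shows "typed i X S" "typed j Y S" "typed p S X" "typed q S Y"
    "rr p * rr i = rr (Idn C X)" "rr q * rr j = rr (Idn C Y)" "rr q * rr i = 0" "rr p * rr j = 0"
    "rr i * rr p + rr j * rr q = rr (Idn C S)"
proof -
  note b = assms[unfolded biproduct_def]
  show t: "typed i X S" "typed j Y S" "typed p S X" "typed q S Y" using b by (auto simp: typed_def)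
  note tt = t[unfolded typed_iff]
  have o: "X \<in> Ob C" "Y \<in> Ob C" "S \<in> Ob C" using b by auto
  have e: "p \<cdot> i = Idn C X" "q \<cdot> j = Idn C Y" "q \<cdot> i = Zero C X Y" "p \<cdot> j = Zero C Y X"
    "i \<cdot> p \<boxplus> j \<cdot> q = Idn C S" using b by auto
  show "rr p * rr i = rr (Idn C X)" "rr q * rr j = rr (Idn C Y)" "rr q * rr i = 0" "rr p * rr j = 0"
    "rr i * rr p + rr j * rr q = rr (Idn C S)"
    using arg_cong[OF e(1), of rr] arg_cong[OF e(2), of rr] arg_cong[OF e(3), of rr]
      arg_cong[OF e(4), of rr] arg_cong[OF e(5), of rr] tt o by simp_all
qed

lemma is_kernel_rr:
  assumes "is_kernel C X Y f K k" "typed f X Y"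
  shows "typed k K X" "rr f * rr k = 0"
    "\<And>T t. \<lbrakk>typed t T X; rr f * rr t = 0\<rbrakk> \<Longrightarrow> \<exists>u. typed u T K \<and> rr k * rr u = rr t"
    "\<And>T u u'. \<lbrakk>typed u T K; typed u' T K; rr k * rr u = rr k * rr u'\<rbrakk> \<Longrightarrow> u = u'"
proof -
  note b = assms(1)[unfolded is_kernel_def]
  note ft = assms(2)[unfolded typed_iff]
  have o: "X \<in> Ob C" "Y \<in> Ob C" "K \<in> Ob C" using assms b by (auto simp: typed_def)
  show k: "typed k K X" using b o by (auto simp: typed_def)
  note kt = k[unfolded typed_iff]
  have "f \<cdot> k = Zero C K Y" using b by blast
  from arg_cong[OF this, of rr] show fk: "rr f * rr k = 0" using kt ft o by simp
  fix T
  {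
    fix t assume t: "typed t T X" "rr f * rr t = 0"
    note tt = t(1)[unfolded typed_iff]
    have T: "T \<in> Ob C" using t by (simp add: typed_def)
    have "f \<cdot> t = Zero C T Y" using tt ft t T o by (intro eqI_rr[of _ T Y]) (auto simp: typed_iff)
    then obtain u where u: "u \<in> Hom C T K" "k \<cdot> u = t" using b T t[unfolded typed_def] by blast
    then have "typed u T K" using T o by (simp add: typed_def)
    then show "\<exists>u. typed u T K \<and> rr k * rr u = rr t"
      using u kt arg_cong[OF u(2), of rr] rr_Comp[of u k] by (auto simp: typed_iff)
  }
  fix u u' assume u: "typed u T K" "typed u' T K" "rr k * rr u = rr k * rr u'"
  have T: "T \<in> Ob C" using u by (simp add: typed_def)
  have "k \<cdot> u = k \<cdot> u'" using u kt by (intro eqI_rr[of _ T X]) (auto simp: typed_iff)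
  moreover have "f \<cdot> (k \<cdot> u) = Zero C T Y"
    using u kt ft o T times_ext[OF fk] by (intro eqI_rr[of _ T Y]) (auto simp: typed_iff)
  moreover have "k \<cdot> u \<in> Hom C T X" using u kt by (auto simp: typed_iff intro: in_HomI)
  ultimately show "u = u'" using b T u unfolding typed_def by metis
qed

lemma is_kernelI_rr:
  assumes f: "typed f X Y" and k: "typed k K X" "rr f * rr k = 0"
    and ex: "\<And>T t. \<lbrakk>typed t T X; rr f * rr t = 0\<rbrakk> \<Longrightarrow> \<exists>u. typed u T K \<and> rr k * rr u = rr t"
    and un: "\<And>T u u'. \<lbrakk>typed u T K; typed u' T K; rr k * rr u = rr k * rr u'\<rbrakk> \<Longrightarrow> u = u'"
  shows "is_kernel C X Y f K k"
  unfolding is_kernel_def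
proof (intro conjI ballI impI)
  note ft = f[unfolded typed_iff] k(1)[unfolded typed_iff]
  have o: "X \<in> Ob C" "Y \<in> Ob C" "K \<in> Ob C" using f k by (auto simp: typed_def)
  show "K \<in> Ob C" "k \<in> Hom C K X" using k by (auto simp: typed_def)
  show "f \<cdot> k = Zero C K Y" using ft k(2) o by (intro eqI_rr[of _ K Y]) (auto simp: typed_iff)
  fix T t assume T: "T \<in> Ob C" "t \<in> Hom C T X" "f \<cdot> t = Zero C T Y"
  have t: "typed t T X" using T o by (simp add: typed_def)
  note tt = t[unfolded typed_iff]
  have "rr f * rr t = 0" using arg_cong[OF T(3), of rr] tt ft T(1) o by simp
  then obtain u where u: "typed u T K" "rr k * rr u = rr t" using ex t by blast
  show "\<exists>!u. u \<in> Hom C T K \<and> k \<cdot> u = t"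
  proof (rule ex1I[of _ u])
    show "u \<in> Hom C T K \<and> k \<cdot> u = t"
      using u tt ft by (auto simp: typed_iff intro: in_HomI rr_inject)
    fix u' assume u': "u' \<in> Hom C T K \<and> k \<cdot> u' = t"
    then have "typed u' T K" using T o by (simp add: typed_def)
    moreover from this have "rr k * rr u' = rr t" using u' ft rr_Comp[of u' k] by (simp add: typed_iff)
    ultimately show "u' = u" using u un by metis
  qed
qed

end

context abelian_category
begin

text \<open>The complement is the kernel of \<open>p\<close>: since \<open>p\<close> kills
  \<open>1 - i \<cdot> p\<close>, this endomorphism factors through the kernel, which yields the
  second projection.\<close>

lemma retract_direct_summand:
  assumes i: "typed i Q S" and p: "typed p S Q" and pi: "p \<cdot> i = Idn C Q"
  shows "direct_summand C Q S"
proof -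
  have o: "Q \<in> Ob C" "S \<in> Ob C" using i by (auto simp: typed_def)
  note tt = i[unfolded typed_iff] p[unfolded typed_iff]
  obtain K k where "is_kernel C S Q p K k" using ex_kernel[of S Q p] p[unfolded typed_def] by blast
  note k = is_kernel_rr[OF this p]
  note kt = k(1)[unfolded typed_iff]
  have K: "K \<in> Ob C" using k by (auto simp: typed_def)
  have rpi: "rr p * rr i = rr (Idn C Q)" using arg_cong[OF pi, of rr] tt by simp
  have "rr p * rr (Idn C S \<boxminus> (i \<cdot> p)) = 0"
    using tt o by (simp add: algebra_simps rpi[THEN times_ext])
  then obtain r where r: "typed r S K" "rr k * rr r = rr (Idn C S \<boxminus> (i \<cdot> p))"
    using k(3)[of "Idn C S \<boxminus> (i \<cdot> p)" S] tt o by (auto simp: typed_iff)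
  note rt = r(1)[unfolded typed_iff]
  have kr: "rr k * rr r = rr (Idn C S) - rr i * rr p" using r tt o by simp
  have kid: "rr (Idn C S) * rr k = rr k" using kt o by simp
  have "r \<cdot> k = Idn C K"
  proof (rule k(4))
    show "rr k * rr (r \<cdot> k) = rr k * rr (Idn C K)"
      using kt rt o K by (simp add: kr[THEN times_ext] algebra_simps kid k(2))
  qed (use kt rt K in \<open>auto simp: typed_iff\<close>)
  moreover have "r \<cdot> i = Zero C Q K"
  proof (rule k(4))
    show "rr k * rr (r \<cdot> i) = rr k * rr (Zero C Q K)"
      using kt rt tt o K by (simp add: kr[THEN times_ext] algebra_simps rpi)
  qed (use kt rt tt o K in \<open>auto simp: typed_iff\<close>)
  moreover have "p \<cdot> k = Zero C K Q" using kt tt o K k(2) by (intro rr_inject) auto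
  moreover have "i \<cdot> p \<boxplus> k \<cdot> r = Idn C S" using kt tt rt o kr by (intro rr_inject) auto
  ultimately have "biproduct C Q K S i k p r"
    using i p pi k(1) r(1) by (simp add: biproduct_def typed_def)
  then show ?thesis unfolding direct_summand_def by blast
qed

text \<open>The object of pairs \<open>(s, t)\<close> with \<open>d s = 0\<close> and
  \<open>f s = g t\<close>; in the construction of resolutions these are, up to sign, cycles of a
  cone.\<close>

lemma joint_kernel:
  assumes d: "typed d P P'" and f: "typed f P X'" and g: "typed g X X'"
  obtains E a b where "typed a E P" "typed b E X" "rr d * rr a = 0" "rr f * rr a = rr g * rr b"
    "\<And>T s t. \<lbrakk>typed s T P; typed t T X; rr d * rr s = 0; rr f * rr s = rr g * rr t\<rbrakk> \<Longrightarrow>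
       \<exists>u. typed u T E \<and> rr a * rr u = rr s \<and> rr b * rr u = rr t"
    "\<And>T u u'. \<lbrakk>typed u T E; typed u' T E; rr a * rr u = rr a * rr u'; rr b * rr u = rr b * rr u'\<rbrakk> \<Longrightarrow> u = u'"
proof -
  have o: "P \<in> Ob C" "P' \<in> Ob C" "X \<in> Ob C" "X' \<in> Ob C" using d f g by (auto simp: typed_def)
  obtain S i j p q where "biproduct C P X S i j p q" using ex_biproduct o by blast
  note b = biproduct_rr[OF this]
  obtain S' i' j' p' q' where "biproduct C P' X' S' i' j' p' q'" using ex_biproduct o by blast
  note b' = biproduct_rr[OF this]
  note tt = b(1-4)[unfolded typed_iff] b'(1-4)[unfolded typed_iff] d[unfolded typed_iff]
    f[unfolded typed_iff] g[unfolded typed_iff]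
  have oS: "S \<in> Ob C" "S' \<in> Ob C" using b(1) b'(1) by (auto simp: typed_def)
  \<comment> \<open>The matrix with rows \<open>(d, 0)\<close> and \<open>(f, -g)\<close>; the pairs
    in question form its kernel.\<close>
  define m where "m = (i' \<cdot> (d \<cdot> p)) \<boxplus> (j' \<cdot> ((f \<cdot> p) \<boxminus> (g \<cdot> q)))"
  have m: "typed m S S'" "rr m = rr i' * (rr d * rr p) + rr j' * (rr f * rr p - rr g * rr q)"
    using tt by (auto simp: m_def typed_iff)
  obtain E k where "is_kernel C S S' m E k" using ex_kernel[of S S' m] m(1)[unfolded typed_def] by blast
  note k = is_kernel_rr[OF this m(1)]
  note kt = k(1)[unfolded typed_iff]
  have oE: "E \<in> Ob C" using k by (auto simp: typed_def)
  have sp: "rr i * (rr p * rr t) + rr j * (rr q * rr t) = rr t" if "typed t T S" for t T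
    using arg_cong[OF b(9), of "\<lambda>z. z * rr t"] that by (simp add: distrib_right mult.assoc typed_iff)
  have pm: "rr d * (rr p * z) = 0 \<and> rr f * (rr p * z) - rr g * (rr q * z) = 0" if "rr m * z = 0" for z
  proof -
    have 1: "rr p' * (rr i' * (rr d * w)) = rr d * w" "rr q' * (rr j' * (rr f * w)) = rr f * w"
      "rr q' * (rr j' * (rr g * w)) = rr g * w" for w
      using tt by (simp_all add: b'(5,6)[THEN times_ext]) (simp_all flip: mult.assoc)
    have "rr p' * (rr m * z) = rr d * (rr p * z)"
      unfolding m(2) using b'(8)[THEN times_ext] by (simp add: algebra_simps 1)
    moreover have "rr q' * (rr m * z) = rr f * (rr p * z) - rr g * (rr q * z)"
      unfolding m(2) using b'(7)[THEN times_ext] by (simp add: algebra_simps 1)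
    ultimately show ?thesis using that by simp
  qed
  show thesis
  proof (rule that[of "p \<cdot> k" E "q \<cdot> k"])
    show "typed (p \<cdot> k) E P" "typed (q \<cdot> k) E X" using tt kt by (auto simp: typed_iff)
    show "rr d * rr (p \<cdot> k) = 0" "rr f * rr (p \<cdot> k) = rr g * rr (q \<cdot> k)"
      using pm[OF k(2)] tt kt by simp_all
  next
    fix T s t assume st: "typed s T P" "typed t T X" "rr d * rr s = 0" "rr f * rr s = rr g * rr t"
    note st' = st(1,2)[unfolded typed_iff]
    have ps: "rr p * (rr i * rr s) = rr s" "rr q * (rr j * rr t) = rr t"
      using st' by (simp_all add: b(5,6)[THEN times_ext])
    let ?t = "(i \<cdot> s) \<boxplus> (j \<cdot> t)"
    have "rr m * rr ?t = 0"
      unfolding m(2) using st' tt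
      by (simp add: algebra_simps ps b(7,8)[THEN times_ext] st(3,4))
    then obtain u where u: "typed u T E" "rr k * rr u = rr ?t"
      using k(3)[of ?t T] st' tt by (auto simp: typed_iff)
    note ut = u(1)[unfolded typed_iff]
    have "rr (p \<cdot> k) * rr u = rr s" "rr (q \<cdot> k) * rr u = rr t"
      using ut kt tt st' by (simp_all add: mult.assoc u(2) distrib_left ps b(7,8)[THEN times_ext])
    then show "\<exists>u. typed u T E \<and> rr (p \<cdot> k) * rr u = rr s \<and> rr (q \<cdot> k) * rr u = rr t"
      using u by blast
  next
    fix T u u' assume u: "typed u T E" "typed u' T E" "rr (p \<cdot> k) * rr u = rr (p \<cdot> k) * rr u'"
      "rr (q \<cdot> k) * rr u = rr (q \<cdot> k) * rr u'"
    have e: "rr p * (rr k * rr u) = rr p * (rr k * rr u')" "rr q * (rr k * rr u) = rr q * (rr k * rr u')"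
      using u(3,4) tt kt by (simp_all add: mult.assoc)
    have "rr k * rr u = rr k * rr u'"
      using sp[of "k \<cdot> u" T] sp[of "k \<cdot> u'" T] u(1,2) kt e by (simp add: typed_iff)
    then show "u = u'" using k(4) u by blast
  qed
qed

end

text \<open>A complex whose cycles \<open>E\<close> are split quotients of the preceding terms is contractible:
  the contraction projects onto the cycles and lifts them back along \<open>s\<close>.\<close>

lemma (in plain_preadditive) contractibleI:
  assumes D: "is_complex C D"
    and k: "\<And>n. typed (k n) (E n) (obj D n)" and \<pi>: "\<And>n. typed (\<pi> n) (obj D n) (E (n + 1))"
    and s: "\<And>n. typed (s n) (E n) (obj D (n - 1))"
    and dk: "\<And>n. rr (diff D n) = rr (k (n + 1)) * rr (\<pi> n)"
    and ps: "\<And>n. rr (\<pi> (n - 1)) * rr (s n) = rr (Idn C (E n))"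
    and dk0: "\<And>n. rr (diff D n) * rr (k n) = 0"
    and mono: "\<And>n T t t'. \<lbrakk>typed t T (E n); typed t' T (E n); rr (k n) * rr t = rr (k n) * rr t'\<rbrakk> \<Longrightarrow> t = t'"
    and factor: "\<And>n T t. \<lbrakk>typed t T (obj D n); rr (diff D n) * rr t = 0\<rbrakk> \<Longrightarrow>
       \<exists>u. typed u T (E n) \<and> rr (k n) * rr u = rr t"
  shows "contractible C D"
proof -
  have o: "obj D n \<in> Ob C" "E n \<in> Ob C" for n using k by (auto simp: typed_def)
  have dt: "typed (diff D n) (obj D n) (obj D (n + 1))" for n
    using D by (auto simp: is_complex_def typed_def)
  note kt = k[unfolded typed_iff] \<pi>[unfolded typed_iff] s[unfolded typed_iff] dt[unfolded typed_iff]
  have st: "arr (s (n + 1))" "src (s (n + 1)) = E (n + 1)" "tgt (s (n + 1)) = obj D n" for n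
    using s[of "n + 1"] by (auto simp: typed_iff)
  have ps1: "rr (\<pi> n) * rr (s (n + 1)) = rr (Idn C (E (n + 1)))" for n
    using ps[of "n + 1"] by simp
  \<comment> \<open>Because \<open>\<pi>\<close> splits along \<open>s\<close>, the differential
    kills \<open>1 - s \<pi>\<close>. This endomorphism therefore factors through the cycles, and
    \<open>r\<close> is the resulting projection.\<close>
  have "\<exists>r. typed r (obj D n) (E n) \<and> rr (k n) * rr r = rr (Idn C (obj D n)) - rr (s (n + 1)) * rr (\<pi> n)" for n
  proof -
    let ?t = "Idn C (obj D n) \<boxminus> (s (n + 1) \<cdot> \<pi> n)"
    have t: "typed ?t (obj D n) (obj D n)" "rr ?t = rr (Idn C (obj D n)) - rr (s (n + 1)) * rr (\<pi> n)"
      using kt st o by (simp_all add: typed_iff)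
    have "rr (k (n + 1)) * (rr (\<pi> n) * (rr (s (n + 1)) * rr (\<pi> n))) = rr (k (n + 1)) * rr (\<pi> n)"
      using kt by (simp add: ps1[THEN times_ext])
    then have "rr (diff D n) * rr ?t = 0"
      using kt o rr_Idn_right[of "diff D n"]
      by (simp only: t(2) right_diff_distrib) (simp add: dk mult.assoc)
    then show ?thesis using factor[OF t(1)] t(2) by metis
  qed
  then obtain r where r: "\<And>n. typed (r n) (obj D n) (E n)"
    "\<And>n. rr (k n) * rr (r n) = rr (Idn C (obj D n)) - rr (s (n + 1)) * rr (\<pi> n)" by metis
  note rt = r(1)[unfolded typed_iff]
  have pk: "rr (\<pi> n) * rr (k n) = 0" for n
  proof -
    have "\<pi> n \<cdot> k n = Zero C (E n) (E (n + 1))"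
    proof (rule mono)
      show "typed (\<pi> n \<cdot> k n) (E n) (E (n + 1))" "typed (Zero C (E n) (E (n + 1))) (E n) (E (n + 1))"
        using kt o by (auto simp: typed_iff)
      show "rr (k (n + 1)) * rr (\<pi> n \<cdot> k n) = rr (k (n + 1)) * rr (Zero C (E n) (E (n + 1)))"
        using kt o dk0[of n] by (simp add: dk mult.assoc)
    qed
    from arg_cong[OF this, of rr] show ?thesis using kt o by simp
  qed
  have rk: "rr (r n) * rr (k n) = rr (Idn C (E n))" for n
  proof -
    have "r n \<cdot> k n = Idn C (E n)"
    proof (rule mono)
      show "typed (r n \<cdot> k n) (E n) (E n)" "typed (Idn C (E n)) (E n) (E n)"
        using kt rt o by (auto simp: typed_iff)
      show "rr (k n) * rr (r n \<cdot> k n) = rr (k n) * rr (Idn C (E n))"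
        using kt rt o by (simp add: r(2)[THEN times_ext] algebra_simps pk)
    qed
    from arg_cong[OF this, of rr] show ?thesis using kt rt o by simp
  qed
  have "homotopic C D D (\<lambda>n. Idn C (obj D n)) (\<lambda>n. Zero C (obj D n) (obj D n))"
    unfolding homotopic_def
  proof (intro exI[of _ "\<lambda>n. s n \<cdot> r n"] conjI allI)
    fix n
    show "s n \<cdot> r n \<in> Hom C (obj D n) (obj D (n - 1))" using kt rt by (auto intro: in_HomI)
    have d1: "arr (diff D (n - 1))" "src (diff D (n - 1)) = obj D (n - 1)" "tgt (diff D (n - 1)) = obj D n"
      using dt[of "n - 1"] by (auto simp: typed_iff)
    have "rr (diff D (n - 1)) * (rr (s n) * rr (r n)) = rr (k n) * (rr (\<pi> (n - 1)) * (rr (s n) * rr (r n)))"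
      using dk[of "n - 1"] by (simp add: mult.assoc)
    also have "\<dots> = rr (k n) * rr (r n)" using rt by (simp add: ps[THEN times_ext])
    finally have 1: "rr (diff D (n - 1)) * (rr (s n) * rr (r n)) = rr (k n) * rr (r n)" .
    have 2: "rr (s (n + 1)) * (rr (r (n + 1)) * rr (diff D n)) = rr (s (n + 1)) * rr (\<pi> n)"
      using kt by (simp add: dk rk[THEN times_ext])
    show "Idn C (obj D n) = Zero C (obj D n) (obj D n) \<boxplus>
       (diff D (n - 1) \<cdot> (s n \<cdot> r n) \<boxplus> s (n + 1) \<cdot> r (n + 1) \<cdot> diff D n)"
      using kt rt st d1 o 1 2 by (intro rr_inject) (auto simp: mult.assoc r(2))
  qed
  then show ?thesis by (simp add: contractible_def)
qed

text \<open>Recursion on the integers from above: \<open>k = M - n\<close> turns it into dependent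
  choice on the naturals. In the applications \<open>b\<close> consists of zeros, available since
  the complexes are bounded above.\<close>

lemma int_down_choice:
  fixes OK :: "int \<Rightarrow> 's \<Rightarrow> bool"
  assumes base: "\<And>n. n \<ge> M \<Longrightarrow> OK n (b n)" "\<And>n. n \<ge> M \<Longrightarrow> R n (b (n + 1)) (b n)"
    and step: "\<And>n x. \<lbrakk>n < M; OK (n + 1) x\<rbrakk> \<Longrightarrow> \<exists>y. OK n y \<and> R n x y"
  obtains x where "\<And>n. OK n (x n)" "\<And>n. R n (x (n + 1)) (x n)" "\<And>n. n \<ge> M \<Longrightarrow> x n = b n"
proof -
  \<comment> \<open>The value at \<open>k = 0\<close> is fixed as \<open>b M\<close> so that the
    chosen sequence fits the prescribed one at degree \<open>M\<close>.\<close>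
  have "\<exists>f. \<forall>k. (OK (M - int k) (f k) \<and> (k = 0 \<longrightarrow> f k = b M)) \<and> R (M - int (Suc k)) (f k) (f (Suc k))"
  proof (rule dependent_nat_choice)
    show "\<exists>x. OK (M - int 0) x \<and> (0 = 0 \<longrightarrow> x = b M)" using base(1)[of M] by simp
    fix x k assume "OK (M - int k) x \<and> (k = 0 \<longrightarrow> x = b M)"
    then show "\<exists>y. (OK (M - int (Suc k)) y \<and> (Suc k = 0 \<longrightarrow> y = b M)) \<and> R (M - int (Suc k)) x y"
      using step[of "M - int (Suc k)" x] by simp
  qed
  then obtain f where f: "\<And>k. OK (M - int k) (f k)" "f 0 = b M" "\<And>k. R (M - int (Suc k)) (f k) (f (Suc k))"
    by blast
  define x where "x n = (if n \<ge> M then b n else f (nat (M - n)))" for n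
  have lt: "\<exists>k. n = M - int (Suc k)" if "n < M" for n
    using that by (intro exI[of _ "nat (M - n - 1)"]) simp
  show thesis
  proof (rule that[of x])
    fix n
    show "OK n (x n)" using base(1)[of n] f(1)[of "nat (M - n)"] by (cases "n \<ge> M") (simp_all add: x_def)
    show "R n (x (n + 1)) (x n)"
    proof (cases "n \<ge> M")
      case True then show ?thesis using base(2) by (simp add: x_def)
    next
      case False
      then have "n < M" by simp
      then obtain k where k: "n = M - int (Suc k)" using lt by blast
      have "x n = f (Suc k)" by (simp add: x_def k nat_add_distrib)
      moreover have "x (n + 1) = f k" using f(2) by (cases "k = 0") (auto simp: x_def k)
      ultimately show ?thesis using f(3)[of k] k by simp
    qed
    show "n \<ge> M \<Longrightarrow> x n = b n" by (simp add: x_def)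
  qed
qed

section \<open>Resolutions by relatively projective objects\<close>

locale relative_setting = A: abelian_category A + B: abelian_category B
  for A :: "('a, 'm) ab_cat" and B :: "('b, 'n) ab_cat" +
  fixes F :: "('a, 'm, 'b, 'n) func" and L :: "('b, 'n, 'a, 'm) func"
  assumes F_additive: "additive_functor A B F" and LF: "adjunction B A L F"
begin

sublocale A: plain_preadditive A ..
sublocale B: plain_preadditive B ..

abbreviation "Fo \<equiv> ob_map F"
abbreviation "Fa \<equiv> ar_map F"
abbreviation "Lo \<equiv> ob_map L"
abbreviation "La \<equiv> ar_map L"

lemma F_ob [simp]: "X \<in> Ob A \<Longrightarrow> Fo X \<in> Ob B"
  using F_additive by (auto simp: additive_functor_def is_functor_def)

lemma L_ob [simp]: "Y \<in> Ob B \<Longrightarrow> Lo Y \<in> Ob A"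
  using LF by (auto simp: adjunction_def is_functor_def)

lemma F_typed: "A.typed f X Y \<Longrightarrow> B.typed (Fa f) (Fo X) (Fo Y)"
  using F_additive by (auto simp: additive_functor_def is_functor_def A.typed_def B.typed_def)

lemma L_typed: "B.typed f X Y \<Longrightarrow> A.typed (La f) (Lo X) (Lo Y)"
  using LF by (auto simp: adjunction_def is_functor_def A.typed_def B.typed_def)

lemma F_arr [simp]:
  assumes "A.arr f" shows "B.arr (Fa f)" "B.src (Fa f) = Fo (A.src f)" "B.tgt (Fa f) = Fo (A.tgt f)"
  using F_typed[OF A.arr_typed[OF assms]] by (auto simp: B.typed_iff)

lemma L_arr [simp]:
  assumes "B.arr f" shows "A.arr (La f)" "A.src (La f) = Lo (B.src f)" "A.tgt (La f) = Lo (B.tgt f)"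
  using L_typed[OF B.arr_typed[OF assms]] by (auto simp: A.typed_iff)

lemma F_Idn: "X \<in> Ob A \<Longrightarrow> Fa (Idn A X) = Idn B (Fo X)"
  using F_additive by (auto simp: additive_functor_def is_functor_def)

lemma L_Idn: "Y \<in> Ob B \<Longrightarrow> La (Idn B Y) = Idn A (Lo Y)"
  using LF by (auto simp: adjunction_def is_functor_def)

lemma F_Comp:
  assumes "A.arr f" "A.arr g" "A.src g = A.tgt f" shows "Fa (g \<cdot>\<^bsub>A\<^esub> f) = Fa g \<cdot>\<^bsub>B\<^esub> Fa f"
  using F_additive assms A.arr_src A.arr_tgt A.arr_Hom
  unfolding additive_functor_def is_functor_def by metis

lemma L_Comp:
  assumes "B.arr f" "B.arr g" "B.src g = B.tgt f" shows "La (g \<cdot>\<^bsub>B\<^esub> f) = La g \<cdot>\<^bsub>A\<^esub> La f"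
  using LF assms B.arr_src B.arr_tgt B.arr_Hom
  unfolding adjunction_def is_functor_def by metis

lemma F_Add:
  assumes "A.typed f X Y" "A.typed g X Y" shows "Fa (f \<boxplus>\<^bsub>A\<^esub> g) = Fa f \<boxplus>\<^bsub>B\<^esub> Fa g"
  using F_additive assms by (auto simp: additive_functor_def A.typed_def)

lemma F_Zero:
  assumes "X \<in> Ob A" "Y \<in> Ob A" shows "Fa (Zero A X Y) = Zero B (Fo X) (Fo Y)"
proof (rule B.Add_idem_eq_Zero)
  have z: "A.typed (Zero A X Y) X Y" using assms by (simp add: A.typed_iff)
  show "Fa (Zero A X Y) \<in> Hom B (Fo X) (Fo Y)" using F_typed[OF z] by (simp add: B.typed_def)
  show "Fa (Zero A X Y) \<boxplus>\<^bsub>B\<^esub> Fa (Zero A X Y) = Fa (Zero A X Y)"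
    using F_Add[OF z z] assms by (simp add: A.Zero_Add A.Zero_in_Hom)
qed (use assms in auto)

section \<open>Unit and counit of the adjunction\<close>

lemma adjunction_bijection:
  obtains \<phi> where "\<And>X Y. \<lbrakk>X \<in> Ob B; Y \<in> Ob A\<rbrakk> \<Longrightarrow> bij_betw (\<phi> X Y) (Hom A (Lo X) Y) (Hom B X (Fo Y))"
    "\<And>X X' Y Y' f g u. \<lbrakk>B.typed f X' X; A.typed g Y Y'; A.typed u (Lo X) Y\<rbrakk> \<Longrightarrow>
       \<phi> X' Y' (g \<cdot>\<^bsub>A\<^esub> u \<cdot>\<^bsub>A\<^esub> La f) = Fa g \<cdot>\<^bsub>B\<^esub> \<phi> X Y u \<cdot>\<^bsub>B\<^esub> f"
proof -
  obtain \<phi> where p: "\<forall>X\<in>Ob B. \<forall>Y\<in>Ob A. bij_betw (\<phi> X Y) (Hom A (Lo X) Y) (Hom B X (Fo Y))"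
    "\<forall>X\<in>Ob B. \<forall>X'\<in>Ob B. \<forall>Y\<in>Ob A. \<forall>Y'\<in>Ob A. \<forall>f\<in>Hom B X' X. \<forall>g\<in>Hom A Y Y'. \<forall>u\<in>Hom A (Lo X) Y.
       \<phi> X' Y' (g \<cdot>\<^bsub>A\<^esub> u \<cdot>\<^bsub>A\<^esub> La f) = Fa g \<cdot>\<^bsub>B\<^esub> \<phi> X Y u \<cdot>\<^bsub>B\<^esub> f"
    using LF unfolding adjunction_def by blast
  show thesis by (rule that[of \<phi>]) (use p in \<open>auto simp: A.typed_def B.typed_def\<close>)
qed

text \<open>Naturality is split into the two variables by inserting an identity in the other
  one.\<close>

lemma transpose:
  obtains \<phi> where
    "\<And>X Y u. \<lbrakk>X \<in> Ob B; A.typed u (Lo X) Y\<rbrakk> \<Longrightarrow> B.typed (\<phi> X Y u) X (Fo Y)"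
    "\<And>X Y v. \<lbrakk>Y \<in> Ob A; B.typed v X (Fo Y)\<rbrakk> \<Longrightarrow> \<exists>u. A.typed u (Lo X) Y \<and> \<phi> X Y u = v"
    "\<And>X Y u u'. \<lbrakk>X \<in> Ob B; A.typed u (Lo X) Y; A.typed u' (Lo X) Y; \<phi> X Y u = \<phi> X Y u'\<rbrakk> \<Longrightarrow> u = u'"
    "\<And>X Y Y' g u. \<lbrakk>X \<in> Ob B; A.typed g Y Y'; A.typed u (Lo X) Y\<rbrakk> \<Longrightarrow>
       \<phi> X Y' (g \<cdot>\<^bsub>A\<^esub> u) = Fa g \<cdot>\<^bsub>B\<^esub> \<phi> X Y u"
    "\<And>X X' Y f u. \<lbrakk>B.typed f X' X; A.typed u (Lo X) Y\<rbrakk> \<Longrightarrow>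
       \<phi> X' Y (u \<cdot>\<^bsub>A\<^esub> La f) = \<phi> X Y u \<cdot>\<^bsub>B\<^esub> f"
proof -
  obtain \<phi> where p: "\<And>X Y. \<lbrakk>X \<in> Ob B; Y \<in> Ob A\<rbrakk> \<Longrightarrow> bij_betw (\<phi> X Y) (Hom A (Lo X) Y) (Hom B X (Fo Y))"
    "\<And>X X' Y Y' f g u. \<lbrakk>B.typed f X' X; A.typed g Y Y'; A.typed u (Lo X) Y\<rbrakk> \<Longrightarrow>
       \<phi> X' Y' (g \<cdot>\<^bsub>A\<^esub> u \<cdot>\<^bsub>A\<^esub> La f) = Fa g \<cdot>\<^bsub>B\<^esub> \<phi> X Y u \<cdot>\<^bsub>B\<^esub> f"
    using adjunction_bijection by blast
  have t: "B.typed (\<phi> X Y u) X (Fo Y)" if "X \<in> Ob B" "A.typed u (Lo X) Y" for X Y u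
    using p(1)[of X Y] that by (auto simp: A.typed_def B.typed_def bij_betw_def)
  show thesis
  proof (rule that[of \<phi>])
    show "B.typed (\<phi> X Y u) X (Fo Y)" if "X \<in> Ob B" "A.typed u (Lo X) Y" for X Y u
      using t that .
    show "\<exists>u. A.typed u (Lo X) Y \<and> \<phi> X Y u = v" if "Y \<in> Ob A" "B.typed v X (Fo Y)" for X Y v
    proof -
      have "X \<in> Ob B" "v \<in> \<phi> X Y ` Hom A (Lo X) Y"
        using p(1)[of X Y] that by (auto simp: B.typed_def bij_betw_def)
      then show ?thesis using that L_ob by (auto simp: A.typed_def)
    qed
    show "u = u'" if "X \<in> Ob B" "A.typed u (Lo X) Y" "A.typed u' (Lo X) Y" "\<phi> X Y u = \<phi> X Y u'" for X Y u u'
      using p(1)[of X Y] that by (auto simp: A.typed_def bij_betw_def dest: inj_onD)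
    show "\<phi> X Y' (g \<cdot>\<^bsub>A\<^esub> u) = Fa g \<cdot>\<^bsub>B\<^esub> \<phi> X Y u"
      if "X \<in> Ob B" "A.typed g Y Y'" "A.typed u (Lo X) Y" for X Y Y' g u
      using p(2)[OF B.Idn_typed[OF that(1)] that(2,3)] that t[OF that(1,3)] L_Idn[OF that(1)]
      by (simp add: A.typed_iff B.typed_iff)
    show "\<phi> X' Y (u \<cdot>\<^bsub>A\<^esub> La f) = \<phi> X Y u \<cdot>\<^bsub>B\<^esub> f"
      if "B.typed f X' X" "A.typed u (Lo X) Y" for X X' Y f u
    proof -
      have o: "Y \<in> Ob A" "X \<in> Ob B" using that by (auto simp: A.typed_def B.typed_def)
      show ?thesis
        using p(2)[OF that(1) A.Idn_typed[OF o(1)] that(2)] that t[OF o(2) that(2)] F_Idn[OF o(1)] o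
        by (simp add: A.typed_iff B.typed_iff)
    qed
  qed
qed

text \<open>The counit at \<open>X\<close> is the map with transpose the identity of
  \<open>F X\<close>; the unit at \<open>Y\<close> is the transpose of the identity of
  \<open>L Y\<close>. Naturality of transposition gives the triangle identities.\<close>

lemma counit:
  obtains \<epsilon> \<eta> where
    "\<And>X. X \<in> Ob A \<Longrightarrow> A.typed (\<epsilon> X) (Lo (Fo X)) X"
    "\<And>Y. Y \<in> Ob B \<Longrightarrow> B.typed (\<eta> Y) Y (Fo (Lo Y))"
    "\<And>X Y g. A.typed g X Y \<Longrightarrow> g \<cdot>\<^bsub>A\<^esub> \<epsilon> X = \<epsilon> Y \<cdot>\<^bsub>A\<^esub> La (Fa g)"
    "\<And>X. X \<in> Ob A \<Longrightarrow> Fa (\<epsilon> X) \<cdot>\<^bsub>B\<^esub> \<eta> (Fo X) = Idn B (Fo X)"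
    "\<And>Y. Y \<in> Ob B \<Longrightarrow> \<epsilon> (Lo Y) \<cdot>\<^bsub>A\<^esub> La (\<eta> Y) = Idn A (Lo Y)"
proof -
  obtain \<phi> where p:
    "\<And>X Y u. \<lbrakk>X \<in> Ob B; A.typed u (Lo X) Y\<rbrakk> \<Longrightarrow> B.typed (\<phi> X Y u) X (Fo Y)"
    "\<And>X Y v. \<lbrakk>Y \<in> Ob A; B.typed v X (Fo Y)\<rbrakk> \<Longrightarrow> \<exists>u. A.typed u (Lo X) Y \<and> \<phi> X Y u = v"
    "\<And>X Y u u'. \<lbrakk>X \<in> Ob B; A.typed u (Lo X) Y; A.typed u' (Lo X) Y; \<phi> X Y u = \<phi> X Y u'\<rbrakk> \<Longrightarrow> u = u'"
    "\<And>X Y Y' g u. \<lbrakk>X \<in> Ob B; A.typed g Y Y'; A.typed u (Lo X) Y\<rbrakk> \<Longrightarrow>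
       \<phi> X Y' (g \<cdot>\<^bsub>A\<^esub> u) = Fa g \<cdot>\<^bsub>B\<^esub> \<phi> X Y u"
    "\<And>X X' Y f u. \<lbrakk>B.typed f X' X; A.typed u (Lo X) Y\<rbrakk> \<Longrightarrow>
       \<phi> X' Y (u \<cdot>\<^bsub>A\<^esub> La f) = \<phi> X Y u \<cdot>\<^bsub>B\<^esub> f"
    using transpose by blast
  have "\<exists>e. A.typed e (Lo (Fo X)) X \<and> \<phi> (Fo X) X e = Idn B (Fo X)" if "X \<in> Ob A" for X
    using p(2)[OF that B.Idn_typed] that by simp
  then obtain \<epsilon> where e: "\<And>X. X \<in> Ob A \<Longrightarrow> A.typed (\<epsilon> X) (Lo (Fo X)) X"
    "\<And>X. X \<in> Ob A \<Longrightarrow> \<phi> (Fo X) X (\<epsilon> X) = Idn B (Fo X)" by metis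
  define \<eta> where "\<eta> Y = \<phi> Y (Lo Y) (Idn A (Lo Y))" for Y
  have h: "B.typed (\<eta> Y) Y (Fo (Lo Y))" if "Y \<in> Ob B" for Y
    unfolding \<eta>_def using that by (intro p(1) A.Idn_typed) auto
  have 1: "g \<cdot>\<^bsub>A\<^esub> \<epsilon> X = \<epsilon> Y \<cdot>\<^bsub>A\<^esub> La (Fa g)" if g: "A.typed g X Y" for X Y g
  proof -
    have o: "X \<in> Ob A" "Y \<in> Ob A" using g by (auto simp: A.typed_def)
    note t = e(1)[OF o(1)] e(1)[OF o(2)] L_typed[OF F_typed[OF g]]
    show ?thesis
    proof (rule p(3)[of "Fo X"])
      show "\<phi> (Fo X) Y (g \<cdot>\<^bsub>A\<^esub> \<epsilon> X) = \<phi> (Fo X) Y (\<epsilon> Y \<cdot>\<^bsub>A\<^esub> La (Fa g))"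
        using p(4)[OF _ g t(1)] p(5)[OF F_typed[OF g] t(2)] o e(2) g F_typed[OF g]
        by (simp add: A.typed_iff B.typed_iff)
    qed (use o g t in \<open>auto intro: A.Comp_typed\<close>)
  qed
  have 2: "Fa (\<epsilon> X) \<cdot>\<^bsub>B\<^esub> \<eta> (Fo X) = Idn B (Fo X)" if "X \<in> Ob A" for X
    using p(4)[of "Fo X" "\<epsilon> X" _ X "Idn A (Lo (Fo X))"] e[OF that] that A.Idn_typed[of "Lo (Fo X)"]
    by (simp add: \<eta>_def A.typed_iff)
  have 3: "\<epsilon> (Lo Y) \<cdot>\<^bsub>A\<^esub> La (\<eta> Y) = Idn A (Lo Y)" if Y: "Y \<in> Ob B" for Y
  proof (rule p(3)[OF Y])
    have "\<phi> Y (Lo Y) (\<epsilon> (Lo Y) \<cdot>\<^bsub>A\<^esub> La (\<eta> Y)) = \<phi> (Fo (Lo Y)) (Lo Y) (\<epsilon> (Lo Y)) \<cdot>\<^bsub>B\<^esub> \<eta> Y"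
      using p(5)[OF h[OF Y] e(1)] Y by simp
    also have "\<dots> = \<eta> Y" using e(2)[of "Lo Y"] Y h[OF Y] by (simp add: B.typed_iff)
    finally show "\<phi> Y (Lo Y) (\<epsilon> (Lo Y) \<cdot>\<^bsub>A\<^esub> La (\<eta> Y)) = \<phi> Y (Lo Y) (Idn A (Lo Y))" by (simp add: \<eta>_def)
    show "A.typed (\<epsilon> (Lo Y) \<cdot>\<^bsub>A\<^esub> La (\<eta> Y)) (Lo Y) (Lo Y)"
      using e(1)[of "Lo Y"] L_typed[OF h[OF Y]] Y by (auto intro: A.Comp_typed)
  qed (use Y in \<open>auto intro: A.Idn_typed\<close>)
  show thesis by (rule that[OF e(1) h 1 2 3])
qed

definition "\<epsilon> = (SOME \<epsilon>. \<exists>\<eta>. (\<forall>X\<in>Ob A. A.typed (\<epsilon> X) (Lo (Fo X)) X) \<and>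
    (\<forall>Y\<in>Ob B. B.typed (\<eta> Y) Y (Fo (Lo Y))) \<and>
    (\<forall>X Y g. A.typed g X Y \<longrightarrow> g \<cdot>\<^bsub>A\<^esub> \<epsilon> X = \<epsilon> Y \<cdot>\<^bsub>A\<^esub> La (Fa g)) \<and>
    (\<forall>X\<in>Ob A. Fa (\<epsilon> X) \<cdot>\<^bsub>B\<^esub> \<eta> (Fo X) = Idn B (Fo X)) \<and>
    (\<forall>Y\<in>Ob B. \<epsilon> (Lo Y) \<cdot>\<^bsub>A\<^esub> La (\<eta> Y) = Idn A (Lo Y)))"

text \<open>The unit is chosen after the counit, so that both triangle identities hold for the same
  pair.\<close>

definition "\<eta> = (SOME \<eta>. (\<forall>Y\<in>Ob B. B.typed (\<eta> Y) Y (Fo (Lo Y))) \<and>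
    (\<forall>X\<in>Ob A. Fa (\<epsilon> X) \<cdot>\<^bsub>B\<^esub> \<eta> (Fo X) = Idn B (Fo X)) \<and>
    (\<forall>Y\<in>Ob B. \<epsilon> (Lo Y) \<cdot>\<^bsub>A\<^esub> La (\<eta> Y) = Idn A (Lo Y)))"

lemma eps_eta:
  shows eps_typed: "X \<in> Ob A \<Longrightarrow> A.typed (\<epsilon> X) (Lo (Fo X)) X"
    and eta_typed: "Y \<in> Ob B \<Longrightarrow> B.typed (\<eta> Y) Y (Fo (Lo Y))"
    and eps_natural: "A.typed g X X' \<Longrightarrow> g \<cdot>\<^bsub>A\<^esub> \<epsilon> X = \<epsilon> X' \<cdot>\<^bsub>A\<^esub> La (Fa g)"
    and F_eps_eta: "X \<in> Ob A \<Longrightarrow> Fa (\<epsilon> X) \<cdot>\<^bsub>B\<^esub> \<eta> (Fo X) = Idn B (Fo X)"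
    and eps_L_eta: "Y \<in> Ob B \<Longrightarrow> \<epsilon> (Lo Y) \<cdot>\<^bsub>A\<^esub> La (\<eta> Y) = Idn A (Lo Y)"
proof -
  let ?P = "\<lambda>\<epsilon> \<eta>. (\<forall>X\<in>Ob A. A.typed (\<epsilon> X) (Lo (Fo X)) X) \<and>
    (\<forall>Y\<in>Ob B. B.typed (\<eta> Y) Y (Fo (Lo Y))) \<and>
    (\<forall>X Y g. A.typed g X Y \<longrightarrow> g \<cdot>\<^bsub>A\<^esub> \<epsilon> X = \<epsilon> Y \<cdot>\<^bsub>A\<^esub> La (Fa g)) \<and>
    (\<forall>X\<in>Ob A. Fa (\<epsilon> X) \<cdot>\<^bsub>B\<^esub> \<eta> (Fo X) = Idn B (Fo X)) \<and>
    (\<forall>Y\<in>Ob B. \<epsilon> (Lo Y) \<cdot>\<^bsub>A\<^esub> La (\<eta> Y) = Idn A (Lo Y))"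
  have "\<exists>\<epsilon>. \<exists>\<eta>. ?P \<epsilon> \<eta>"
  proof (rule counit)
    fix e h
    assume "\<And>X. X \<in> Ob A \<Longrightarrow> A.typed (e X) (Lo (Fo X)) X"
      "\<And>Y. Y \<in> Ob B \<Longrightarrow> B.typed (h Y) Y (Fo (Lo Y))"
      "\<And>X Y g. A.typed g X Y \<Longrightarrow> g \<cdot>\<^bsub>A\<^esub> e X = e Y \<cdot>\<^bsub>A\<^esub> La (Fa g)"
      "\<And>X. X \<in> Ob A \<Longrightarrow> Fa (e X) \<cdot>\<^bsub>B\<^esub> h (Fo X) = Idn B (Fo X)"
      "\<And>Y. Y \<in> Ob B \<Longrightarrow> e (Lo Y) \<cdot>\<^bsub>A\<^esub> La (h Y) = Idn A (Lo Y)"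
    then show "\<exists>\<epsilon> \<eta>. ?P \<epsilon> \<eta>" by (intro exI[of _ e] exI[of _ h]) simp
  qed
  then have 1: "\<exists>\<eta>. ?P \<epsilon> \<eta>" unfolding \<epsilon>_def by (rule someI_ex)
  then have "\<exists>\<eta>. (\<forall>Y\<in>Ob B. B.typed (\<eta> Y) Y (Fo (Lo Y))) \<and>
    (\<forall>X\<in>Ob A. Fa (\<epsilon> X) \<cdot>\<^bsub>B\<^esub> \<eta> (Fo X) = Idn B (Fo X)) \<and>
    (\<forall>Y\<in>Ob B. \<epsilon> (Lo Y) \<cdot>\<^bsub>A\<^esub> La (\<eta> Y) = Idn A (Lo Y))" by blast
  from someI_ex[OF this, folded \<eta>_def] 1
  show "X \<in> Ob A \<Longrightarrow> A.typed (\<epsilon> X) (Lo (Fo X)) X"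
    "Y \<in> Ob B \<Longrightarrow> B.typed (\<eta> Y) Y (Fo (Lo Y))"
    "A.typed g X X' \<Longrightarrow> g \<cdot>\<^bsub>A\<^esub> \<epsilon> X = \<epsilon> X' \<cdot>\<^bsub>A\<^esub> La (Fa g)"
    "X \<in> Ob A \<Longrightarrow> Fa (\<epsilon> X) \<cdot>\<^bsub>B\<^esub> \<eta> (Fo X) = Idn B (Fo X)"
    "Y \<in> Ob B \<Longrightarrow> \<epsilon> (Lo Y) \<cdot>\<^bsub>A\<^esub> La (\<eta> Y) = Idn A (Lo Y)" by blast+
qed

lemma eps_arr [simp]:
  assumes "X \<in> Ob A" shows "A.arr (\<epsilon> X)" "A.src (\<epsilon> X) = Lo (Fo X)" "A.tgt (\<epsilon> X) = X"
  using eps_typed[OF assms] by (auto simp: A.typed_iff)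

lemma eta_arr [simp]:
  assumes "Y \<in> Ob B" shows "B.arr (\<eta> Y)" "B.src (\<eta> Y) = Y" "B.tgt (\<eta> Y) = Fo (Lo Y)"
  using eta_typed[OF assms] by (auto simp: B.typed_iff)

lemma rr_eps_natural:
  assumes "A.typed g X Y" shows "A.rr g * A.rr (\<epsilon> X) = A.rr (\<epsilon> Y) * A.rr (La (Fa g))"
proof -
  have "X \<in> Ob A" "Y \<in> Ob A" using assms by (auto simp: A.typed_def)
  then show ?thesis
    using arg_cong[OF eps_natural[OF assms], of A.rr] assms by (simp add: A.typed_iff)
qed

lemma L_rr: "\<lbrakk>B.arr f; B.arr g; B.src g = B.tgt f\<rbrakk> \<Longrightarrow> A.rr (La (g \<cdot>\<^bsub>B\<^esub> f)) = A.rr (La g) * A.rr (La f)"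
  by (simp add: L_Comp)

lemma F_rr: "\<lbrakk>A.arr f; A.arr g; A.src g = A.tgt f\<rbrakk> \<Longrightarrow> B.rr (Fa (g \<cdot>\<^bsub>A\<^esub> f)) = B.rr (Fa g) * B.rr (Fa f)"
  by (simp add: F_Comp)

lemma F_rr_0:
  assumes "A.arr f" "A.rr f = 0" shows "B.rr (Fa f) = 0"
proof -
  have o: "A.src f \<in> Ob A" "A.tgt f \<in> Ob A" using assms by (auto simp: A.arr_src A.arr_tgt)
  have "f = Zero A (A.src f) (A.tgt f)" using assms o by (intro A.rr_inject) auto
  then have "Fa f = Zero B (Fo (A.src f)) (Fo (A.tgt f))" using F_Zero[OF o] by simp
  then show ?thesis using o by simp
qed

text \<open>\<open>F\<close> preserves kernels because it has the left adjoint \<open>L\<close>: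
  test maps \<open>T -> F X\<close> are transposed to \<open>L T -> X\<close>, factored there and
  transposed back.\<close>

lemma F_kernel:
  assumes k: "is_kernel A X Y d K k" and d: "A.typed d X Y"
  shows "is_kernel B (Fo X) (Fo Y) (Fa d) (Fo K) (Fa k)"
proof -
  note kr = A.is_kernel_rr[OF k d]
  note kt = kr(1)[unfolded A.typed_iff] d[unfolded A.typed_iff]
  obtain \<phi> where p:
    "\<And>X Y u. \<lbrakk>X \<in> Ob B; A.typed u (Lo X) Y\<rbrakk> \<Longrightarrow> B.typed (\<phi> X Y u) X (Fo Y)"
    "\<And>X Y v. \<lbrakk>Y \<in> Ob A; B.typed v X (Fo Y)\<rbrakk> \<Longrightarrow> \<exists>u. A.typed u (Lo X) Y \<and> \<phi> X Y u = v"
    "\<And>X Y u u'. \<lbrakk>X \<in> Ob B; A.typed u (Lo X) Y; A.typed u' (Lo X) Y; \<phi> X Y u = \<phi> X Y u'\<rbrakk> \<Longrightarrow> u = u'"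
    "\<And>X Y Y' g u. \<lbrakk>X \<in> Ob B; A.typed g Y Y'; A.typed u (Lo X) Y\<rbrakk> \<Longrightarrow>
       \<phi> X Y' (g \<cdot>\<^bsub>A\<^esub> u) = Fa g \<cdot>\<^bsub>B\<^esub> \<phi> X Y u"
    by (rule transpose) blast
  have o: "X \<in> Ob A" "Y \<in> Ob A" "K \<in> Ob A" using d kr(1) by (auto simp: A.typed_def)
  show ?thesis
  proof (rule B.is_kernelI_rr)
    show "B.typed (Fa d) (Fo X) (Fo Y)" "B.typed (Fa k) (Fo K) (Fo X)" using F_typed d kr(1) by auto
    show "B.rr (Fa d) * B.rr (Fa k) = 0"
      using F_rr_0[of "d \<cdot>\<^bsub>A\<^esub> k"] kt kr(2) by (simp add: F_Comp)
  next
    fix T t assume t: "B.typed t T (Fo X)" "B.rr (Fa d) * B.rr t = 0"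
    have T: "T \<in> Ob B" using t by (simp add: B.typed_def)
    obtain u where u: "A.typed u (Lo T) X" "\<phi> T X u = t" using p(2)[OF o(1) t(1)] by blast
    have z: "A.typed (Zero A (Lo T) Y) (Lo T) Y" "A.typed (Zero A Y Y) Y Y"
      using T o by (auto simp: A.typed_iff)
    \<comment> \<open>\<open>\<phi>\<close> is only known to be a natural bijection. That it sends
      zero to zero follows from naturality, applied to zero as a composite with the zero
      endomorphism of \<open>Y\<close>.\<close>
    have zz: "Zero A Y Y \<cdot>\<^bsub>A\<^esub> Zero A (Lo T) Y = Zero A (Lo T) Y"
      using T o by (intro A.rr_inject) auto
    have pz: "B.typed (\<phi> T Y (Zero A (Lo T) Y)) T (Fo Y)" using p(1)[OF T z(1)] .
    have "\<phi> T Y (Zero A (Lo T) Y) = Zero B (Fo Y) (Fo Y) \<cdot>\<^bsub>B\<^esub> \<phi> T Y (Zero A (Lo T) Y)"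
      using p(4)[OF T z(2,1)] o by (simp add: zz F_Zero)
    then have "B.rr (\<phi> T Y (Zero A (Lo T) Y)) = 0"
      using pz o by (metis B.arr_Zero(1,2) B.rr_Comp B.rr_Zero B.typed_iff F_ob mult_zero_left)
    moreover have "\<phi> T Y (d \<cdot>\<^bsub>A\<^esub> u) = Fa d \<cdot>\<^bsub>B\<^esub> t" using p(4)[OF T d u(1)] u(2) by simp
    then have "B.rr (\<phi> T Y (d \<cdot>\<^bsub>A\<^esub> u)) = 0" using t kt by (simp add: B.typed_iff)
    ultimately have "\<phi> T Y (d \<cdot>\<^bsub>A\<^esub> u) = \<phi> T Y (Zero A (Lo T) Y)"
      using p(1)[OF T A.Comp_typed[OF u(1) d]] pz by (intro B.eqI_rr) auto
    then have "d \<cdot>\<^bsub>A\<^esub> u = Zero A (Lo T) Y"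
      using p(3)[OF T A.Comp_typed[OF u(1) d] z(1)] by simp
    from arg_cong[OF this, of A.rr] have "A.rr d * A.rr u = 0"
      using u(1) kt T o by (simp add: A.typed_iff)
    then obtain w where w: "A.typed w (Lo T) K" "A.rr k * A.rr w = A.rr u" using kr(3) u(1) by blast
    then have "k \<cdot>\<^bsub>A\<^esub> w = u" using u(1) kt by (intro A.rr_inject) (auto simp: A.typed_iff)
    then have "Fa k \<cdot>\<^bsub>B\<^esub> \<phi> T K w = t" using p(4)[OF T kr(1) w(1)] u(2) by simp
    from arg_cong[OF this, of B.rr] show "\<exists>u. B.typed u T (Fo K) \<and> B.rr (Fa k) * B.rr u = B.rr t"
      using p(1)[OF T w(1)] kt by (intro exI[of _ "\<phi> T K w"]) (simp add: B.typed_iff)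
  next
    fix T u u' assume u: "B.typed u T (Fo K)" "B.typed u' T (Fo K)" "B.rr (Fa k) * B.rr u = B.rr (Fa k) * B.rr u'"
    have T: "T \<in> Ob B" using u by (simp add: B.typed_def)
    obtain v where v: "A.typed v (Lo T) K" "\<phi> T K v = u" using p(2)[OF o(3) u(1)] by blast
    obtain v' where v': "A.typed v' (Lo T) K" "\<phi> T K v' = u'" using p(2)[OF o(3) u(2)] by blast
    have "Fa k \<cdot>\<^bsub>B\<^esub> u = Fa k \<cdot>\<^bsub>B\<^esub> u'"
      using u kt by (intro B.rr_inject) (auto simp: B.typed_iff)
    then have "k \<cdot>\<^bsub>A\<^esub> v = k \<cdot>\<^bsub>A\<^esub> v'"
      using p(4)[OF T kr(1) v(1)] p(4)[OF T kr(1) v'(1)] v v' p(3)[OF T]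
        A.Comp_typed[OF v(1) kr(1)] A.Comp_typed[OF v'(1) kr(1)] by metis
    from arg_cong[OF this, of A.rr] have "A.rr k * A.rr v = A.rr k * A.rr v'"
      using v v' kt by (simp add: A.typed_iff)
    then show "u = u'" using kr(4) v v' by metis
  qed
qed

section \<open>Relative projectives and sections of the counit\<close>

abbreviation "proj \<equiv> F_projective A B L"

text \<open>For \<open>L Y\<close> a section of the counit is \<open>L \<eta>\<close>, by a triangle
  identity. For a summand it is conjugated by the inclusion \<open>i\<close> and by
  \<open>L F p\<close>, using naturality of the counit.\<close>

lemma proj_section:
  assumes "proj Q"
  obtains s where "A.typed s Q (Lo (Fo Q))" "A.rr (\<epsilon> Q) * A.rr s = A.rr (Idn A Q)"
proof -
  obtain Y K i j p q where Y: "Y \<in> Ob B" and b: "biproduct A Q K (Lo Y) i j p q"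
    using assms by (auto simp: F_projective_def direct_summand_def)
  note b = A.biproduct_rr[OF b]
  note t = b(1,3)[unfolded A.typed_iff]
  let ?s = "La (Fa p) \<cdot>\<^bsub>A\<^esub> (La (\<eta> Y) \<cdot>\<^bsub>A\<^esub> i)"
  have "A.typed ?s Q (Lo (Fo Q))" using t Y by (auto simp: A.typed_iff)
  moreover have el: "A.rr (\<epsilon> (Lo Y)) * A.rr (La (\<eta> Y)) = A.rr (Idn A (Lo Y))"
    using arg_cong[OF eps_L_eta[OF Y], of A.rr] Y by simp
  have "A.rr (\<epsilon> Q) * A.rr ?s = A.rr (Idn A Q)"
    using t Y b(5) by (simp add: rr_eps_natural[OF b(3), symmetric, THEN times_ext] el[THEN times_ext] mult.assoc)
  ultimately show thesis by (rule that)
qed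

lemma projI:
  assumes "Y \<in> Ob B" "A.typed i Q (Lo Y)" "A.typed p (Lo Y) Q" "A.rr p * A.rr i = A.rr (Idn A Q)"
  shows "proj Q"
proof -
  have "Q \<in> Ob A" using assms by (simp add: A.typed_def)
  then have "p \<cdot>\<^bsub>A\<^esub> i = Idn A Q" using assms by (intro A.rr_inject) (auto simp: A.typed_iff)
  then show ?thesis
    using A.retract_direct_summand[OF assms(2,3)] assms(1) unfolding F_projective_def by blast
qed

lemma proj_L: "Y \<in> Ob B \<Longrightarrow> proj (Lo Y)"
  by (rule projI[of Y "Idn A (Lo Y)" _ "Idn A (Lo Y)"]) (auto intro: A.Idn_typed)

text \<open>Zero maps exhibit \<open>Z\<close> as a retract of \<open>L F Z\<close>.\<close>

lemma proj_zero:
  assumes "is_zero_object A Z" shows "proj Z"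
proof -
  have Z: "Z \<in> Ob A" "Idn A Z = Zero A Z Z" using assms A.zero_object_iff by auto
  have "A.rr (Idn A Z) = 0" using Z by simp
  then show ?thesis
    using Z(1) by (intro projI[of "Fo Z" "Zero A Z (Lo (Fo Z))" _ "Zero A (Lo (Fo Z)) Z"]) (auto simp: A.typed_iff)
qed

text \<open>By naturality the sections of the counit at \<open>X\<close> and \<open>Y\<close>
  combine to one at \<open>S\<close>, so \<open>S\<close> is a retract of
  \<open>L F S\<close>.\<close>

lemma proj_biproduct:
  assumes b: "biproduct A X Y S i j p q" and X: "proj X" and Y: "proj Y"
  shows "proj S"
proof -
  note b = A.biproduct_rr[OF b]
  note t = b(1-4)[unfolded A.typed_iff]
  have o: "X \<in> Ob A" "Y \<in> Ob A" "S \<in> Ob A" using b(1,2) by (auto simp: A.typed_def)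
  obtain s where s: "A.typed s X (Lo (Fo X))" "A.rr (\<epsilon> X) * A.rr s = A.rr (Idn A X)"
    using proj_section[OF X] .
  obtain s' where s': "A.typed s' Y (Lo (Fo Y))" "A.rr (\<epsilon> Y) * A.rr s' = A.rr (Idn A Y)"
    using proj_section[OF Y] .
  note st = s(1)[unfolded A.typed_iff] s'(1)[unfolded A.typed_iff]
  let ?s = "(La (Fa i) \<cdot>\<^bsub>A\<^esub> (s \<cdot>\<^bsub>A\<^esub> p)) \<boxplus>\<^bsub>A\<^esub> (La (Fa j) \<cdot>\<^bsub>A\<^esub> (s' \<cdot>\<^bsub>A\<^esub> q))"
  show ?thesis
  proof (rule projI[of "Fo S" ?s _ "\<epsilon> S"])
    show "A.typed ?s S (Lo (Fo S))" using t st o by (auto simp: A.typed_iff)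
    show "A.typed (\<epsilon> S) (Lo (Fo S)) S" using o by (simp add: eps_typed)
    show "A.rr (\<epsilon> S) * A.rr ?s = A.rr (Idn A S)"
      using t st o
      by (simp add: distrib_left rr_eps_natural[OF b(1), symmetric, THEN times_ext]
          rr_eps_natural[OF b(2), symmetric, THEN times_ext] s(2)[THEN times_ext] s'(2)[THEN times_ext]
          mult.assoc b(9))
  qed (use o in simp)
qed

subsection \<open>Maps into split acyclic complexes\<close>

text \<open>In \<open>B\<close> the contraction solves the problem by \<open>h n\<close> after
  \<open>F u\<close>. Applying \<open>L\<close>, then composing with the counit of \<open>S\<close>
  in degree \<open>n - 1\<close> and the section of the counit at \<open>Q\<close>, brings the
  solution back; naturality of the counit turns \<open>L F u\<close> into \<open>u\<close>.\<close>

lemma lift_cycle: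
  assumes S: "is_complex A S" "contractible B (map_complex F S)" and Q: "proj Q"
    and u: "A.typed u Q (obj S n)" "A.rr (diff S n) * A.rr u = 0"
  obtains v where "A.typed v Q (obj S (n - 1))" "A.rr (diff S (n - 1)) * A.rr v = A.rr u"
proof -
  have o: "obj S m \<in> Ob A" for m using S by (simp add: is_complex_def)
  have dt: "A.typed (diff S m) (obj S m) (obj S (m + 1))" for m
    using S by (auto simp: is_complex_def A.typed_def)
  obtain h where h: "\<And>m. h m \<in> Hom B (Fo (obj S m)) (Fo (obj S (m - 1)))"
    and e: "\<And>m. Idn B (Fo (obj S m)) = Zero B (Fo (obj S m)) (Fo (obj S m)) \<boxplus>\<^bsub>B\<^esub>
       (Fa (diff S (m - 1)) \<cdot>\<^bsub>B\<^esub> h m \<boxplus>\<^bsub>B\<^esub> h (m + 1) \<cdot>\<^bsub>B\<^esub> Fa (diff S m))"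
    using S(2) unfolding contractible_def homotopic_def map_complex_def by auto
  have ht: "B.typed (h m) (Fo (obj S m)) (Fo (obj S (m - 1)))" for m using h o by (simp add: B.typed_def)
  have d1: "A.typed (diff S (n - 1)) (obj S (n - 1)) (obj S n)" using dt[of "n - 1"] by simp
  note dd = d1[unfolded A.typed_iff] dt[of n, unfolded A.typed_iff] ht[of n, unfolded B.typed_iff]
    ht[of "n + 1", unfolded B.typed_iff] u(1)[unfolded A.typed_iff]
  have rh: "B.rr (Idn B (Fo (obj S n))) = B.rr (Fa (diff S (n - 1))) * B.rr (h n) + B.rr (h (n + 1)) * B.rr (Fa (diff S n))"
    using arg_cong[OF e[of n], of B.rr] dd o by simp
  have Fdu: "B.rr (Fa (diff S n)) * B.rr (Fa u) = 0"
    using F_rr_0[of "diff S n \<cdot>\<^bsub>A\<^esub> u"] dd u(2) by (simp add: F_Comp)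
  obtain s where s: "A.typed s Q (Lo (Fo Q))" "A.rr (\<epsilon> Q) * A.rr s = A.rr (Idn A Q)"
    using proj_section[OF Q] .
  note st = s(1)[unfolded A.typed_iff]
  let ?w = "h n \<cdot>\<^bsub>B\<^esub> Fa u"
  have "Fa (diff S (n - 1)) \<cdot>\<^bsub>B\<^esub> ?w = Fa u"
  proof (rule B.rr_inject)
    have "B.rr (Idn B (Fo (obj S n))) * B.rr (Fa u) = B.rr (Fa (diff S (n - 1))) * (B.rr (h n) * B.rr (Fa u))"
      unfolding rh by (simp add: distrib_right mult.assoc Fdu)
    then show "B.rr (Fa (diff S (n - 1)) \<cdot>\<^bsub>B\<^esub> ?w) = B.rr (Fa u)" using dd o by simp
  qed (use dd o in auto)
  then have Lw: "A.rr (La (Fa (diff S (n - 1)))) * A.rr (La ?w) = A.rr (La (Fa u))"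
    using L_rr[of ?w "Fa (diff S (n - 1))"] dd by simp
  show thesis
  proof (rule that[of "\<epsilon> (obj S (n - 1)) \<cdot>\<^bsub>A\<^esub> (La ?w \<cdot>\<^bsub>A\<^esub> s)"])
    show "A.typed (\<epsilon> (obj S (n - 1)) \<cdot>\<^bsub>A\<^esub> (La ?w \<cdot>\<^bsub>A\<^esub> s)) Q (obj S (n - 1))"
      using dd o st by (auto simp: A.typed_iff)
    have "A.rr (diff S (n - 1)) * (A.rr (\<epsilon> (obj S (n - 1))) * (A.rr (La ?w) * A.rr s)) =
        A.rr (\<epsilon> (obj S n)) * (A.rr (La (Fa u)) * A.rr s)"
      by (simp add: rr_eps_natural[OF d1, THEN times_ext] Lw[THEN times_ext] mult.assoc)
    also have "\<dots> = A.rr u * A.rr (Idn A Q)"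
      by (simp add: rr_eps_natural[OF u(1), symmetric, THEN times_ext] s(2) mult.assoc)
    finally show "A.rr (diff S (n - 1)) * A.rr (\<epsilon> (obj S (n - 1)) \<cdot>\<^bsub>A\<^esub> (La ?w \<cdot>\<^bsub>A\<^esub> s)) = A.rr u"
      using dd o st by simp
  qed
qed

lemma homotopic_zero:
  assumes Q: "is_complex A Q" "bounded_above A Q" "\<And>n. proj (obj Q n)"
    and S: "is_complex A S" "contractible B (map_complex F S)" and g: "g \<in> chain_maps A Q S"
  shows "homotopic A Q S g (\<lambda>n. Zero A (obj Q n) (obj S n))"
proof -
  have o: "obj Q m \<in> Ob A" "obj S m \<in> Ob A" for m using Q S by (auto simp: is_complex_def)
  have dQ: "A.typed (diff Q m) (obj Q m) (obj Q (m + 1))" and dS: "A.typed (diff S m) (obj S m) (obj S (m + 1))" for m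
    using Q S by (auto simp: is_complex_def A.typed_def)
  have gt: "A.typed (g m) (obj Q m) (obj S m)" for m using g o by (auto simp: chain_maps_def A.typed_def)
  have dS1: "A.typed (diff S (m - 1)) (obj S (m - 1)) (obj S m)" for m using dS[of "m - 1"] by simp
  have dQ1: "A.typed (diff Q (m - 1)) (obj Q (m - 1)) (obj Q m)" for m using dQ[of "m - 1"] by simp
  have gd: "A.rr (g (m + 1)) * A.rr (diff Q m) = A.rr (diff S m) * A.rr (g m)" for m
  proof -
    have "g (m + 1) \<cdot>\<^bsub>A\<^esub> diff Q m = diff S m \<cdot>\<^bsub>A\<^esub> g m" using g by (simp add: chain_maps_def)
    from arg_cong[OF this, of A.rr] show ?thesis
      using gt[of m] gt[of "m + 1"] dQ[of m] dS[of m] by (simp add: A.typed_iff)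
  qed
  have dd: "A.rr (diff Q (m + 1)) * A.rr (diff Q m) = 0" for m
  proof -
    have "diff Q (m + 1) \<cdot>\<^bsub>A\<^esub> diff Q m = Zero A (obj Q m) (obj Q (m + 2))" using Q by (simp add: is_complex_def)
    from arg_cong[OF this, of A.rr] show ?thesis
      using dQ[of m] dQ[of "m + 1"] o by (simp add: A.typed_iff)
  qed
  obtain N where N: "\<And>n. n > N \<Longrightarrow> is_zero_object A (obj Q n)" using Q(2) by (auto simp: bounded_above_def)
  \<comment> \<open>The invariant is what the step one degree lower needs: by it,
    \<open>g (n - 1)\<close> minus \<open>h\<close> after the differential of \<open>Q\<close> is a
    cycle of \<open>S\<close>. Lifting that cycle gives the next component, and
    \<open>d d = 0\<close> in \<open>Q\<close> restores the invariant.\<close>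
  define OK where "OK n h \<longleftrightarrow> A.typed h (obj Q n) (obj S (n - 1)) \<and>
    A.rr (diff S (n - 1)) * (A.rr h * A.rr (diff Q (n - 1))) = A.rr (g n) * A.rr (diff Q (n - 1))" for n h
  define R where "R n h' h \<longleftrightarrow> A.rr (g n) = A.rr (diff S (n - 1)) * A.rr h + A.rr h' * A.rr (diff Q n)" for n h' h
  define b where "b n = Zero A (obj Q n) (obj S (n - 1))" for n
  have zg: "A.rr (g n) = 0" if "n \<ge> N + 1" for n
    using A.rr_zero_object(2)[OF N gt[of n]] that by simp
  obtain h where h: "\<And>n. OK n (h n)" "\<And>n. R n (h (n + 1)) (h n)"
  proof (rule int_down_choice[of "N + 1" OK b R])
    fix n assume n: "n \<ge> N + 1"
    show "OK n (b n)" "R n (b (n + 1)) (b n)"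
      unfolding OK_def R_def b_def using o zg[OF n] by (simp_all add: A.typed_iff)
  next
    fix n h' assume h': "OK (n + 1) h'"
    have h't: "A.typed h' (obj Q (n + 1)) (obj S n)" using h' by (simp add: OK_def)
    let ?u = "A.minus (g n) (h' \<cdot>\<^bsub>A\<^esub> diff Q n)"
    note tt = h't[unfolded A.typed_iff] dQ[of n, unfolded A.typed_iff] gt[of n, unfolded A.typed_iff]
    have u: "A.typed ?u (obj Q n) (obj S n)" "A.rr ?u = A.rr (g n) - A.rr h' * A.rr (diff Q n)"
      using tt by (simp_all add: A.typed_iff)
    have "A.rr (diff S n) * A.rr ?u = 0"
      using h' by (simp add: u(2) right_diff_distrib OK_def gd)
    from lift_cycle[OF S Q(3) u(1) this] obtain v where v: "A.typed v (obj Q n) (obj S (n - 1))"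
      "A.rr (diff S (n - 1)) * A.rr v = A.rr ?u" .
    have "OK n v"
      using v dd[of "n - 1"]
      by (simp add: OK_def u(2) v(2)[THEN times_ext] left_diff_distrib mult.assoc)
    moreover have "R n h' v" using v u by (simp add: R_def)
    ultimately show "\<exists>y. OK n y \<and> R n h' y" by blast
  qed (rule that, assumption+)
  have ht: "A.typed (h n) (obj Q n) (obj S (n - 1))" for n using h(1) by (simp add: OK_def)
  show ?thesis
    unfolding homotopic_def
  proof (intro exI[of _ h] conjI allI)
    fix n
    show "h n \<in> Hom A (obj Q n) (obj S (n - 1))" using ht by (simp add: A.typed_def)
    have h1: "A.typed (h (n + 1)) (obj Q (n + 1)) (obj S n)" using ht[of "n + 1"] by simp
    note tt = ht[of n, unfolded A.typed_iff] h1[unfolded A.typed_iff] dQ[of n, unfolded A.typed_iff]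
      dS1[of n, unfolded A.typed_iff] gt[of n, unfolded A.typed_iff]
    show "g n = Zero A (obj Q n) (obj S n) \<boxplus>\<^bsub>A\<^esub>
        (diff S (n - 1) \<cdot>\<^bsub>A\<^esub> h n \<boxplus>\<^bsub>A\<^esub> h (n + 1) \<cdot>\<^bsub>A\<^esub> diff Q n)"
      using tt o h(2)[of n] by (intro A.rr_inject) (auto simp: R_def)
  qed
qed

subsection \<open>Existence of resolutions\<close>

text \<open>
  One step of the construction of \<open>f : P \<rightarrow> X\<close>, with \<open>(P', P'', d', f')\<close> the data in degree \<open>n + 1\<close> and
  \<open>(P, P', d, f)\<close> those in degree \<open>n\<close>: the pair \<open>(a, b)\<close> identifies \<open>E\<close> with the pairs \<open>(x, y)\<close> in
  \<open>P' \<oplus> X\<^sup>n\<close> with \<open>d' x = 0\<close> and \<open>f' x = d y\<close>, i.e. up to a sign with the cycles of the cone, and \<open>e : P \<rightarrow> E\<close>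
  is split by \<open>s\<close> after applying \<open>F\<close>.
\<close>

definition covers ::
  "int \<Rightarrow> ('a, 'm) cochain_complex \<Rightarrow> 'a \<times> 'a \<times> 'm \<times> 'm \<Rightarrow> 'a \<times> 'a \<times> 'm \<times> 'm \<Rightarrow>
   'a \<Rightarrow> 'm \<Rightarrow> 'm \<Rightarrow> 'm \<Rightarrow> 'n \<Rightarrow> bool" where
  "covers n X = (\<lambda>(P', P'', d', f') (P, Q, d, f) E a b e s. Q = P' \<and>
     A.typed a E P' \<and> A.typed b E (obj X n) \<and> A.typed e P E \<and> B.typed s (Fo E) (Fo P) \<and>
     A.rr d = A.rr a * A.rr e \<and> A.rr f = A.rr b * A.rr e \<and> B.rr (Fa e) * B.rr s = B.rr (Idn B (Fo E)) \<and>
     A.rr d' * A.rr a = 0 \<and> A.rr f' * A.rr a = A.rr (diff X n) * A.rr b \<and>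
     (\<forall>T x y. A.typed x T P' \<and> A.typed y T (obj X n) \<and> A.rr d' * A.rr x = 0 \<and>
        A.rr f' * A.rr x = A.rr (diff X n) * A.rr y \<longrightarrow>
        (\<exists>u. A.typed u T E \<and> A.rr a * A.rr u = A.rr x \<and> A.rr b * A.rr u = A.rr y)) \<and>
     (\<forall>T u u'. A.typed u T E \<and> A.typed u' T E \<and> A.rr a * A.rr u = A.rr a * A.rr u' \<and>
        A.rr b * A.rr u = A.rr b * A.rr u' \<longrightarrow> u = u'))"

text \<open>A state also records the target of its differential, since the step at \<open>n\<close>
  uses the differential out of degree \<open>n + 1\<close>. The equation \<open>Q = P'\<close>
  inside \<open>covers\<close> identifies this target with the object of the neighbouring
  state.\<close>

lemma covering_sequence:
  assumes X: "is_complex A X" and N: "\<And>n. n > N \<Longrightarrow> is_zero_object A (obj X n)"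
  obtains P d f E a b e s where
    "\<And>n. proj (P n)" "\<And>n. n > N \<Longrightarrow> is_zero_object A (P n)"
    "\<And>n. A.typed (d n) (P n) (P (n + 1))" "\<And>n. A.typed (f n) (P n) (obj X n)"
    "\<And>n. covers n X (P (n + 1), P (n + 2), d (n + 1), f (n + 1)) (P n, P (n + 1), d n, f n) (E n) (a n) (b n) (e n) (s n)"
proof -
  obtain Z where Z: "is_zero_object A Z" using A.ex_zero_object by blast
  have oZ: "Z \<in> Ob A" using Z by (simp add: is_zero_object_def)
  have o: "obj X m \<in> Ob A" for m using X by (simp add: is_complex_def)
  have dX: "A.typed (diff X m) (obj X m) (obj X (m + 1))" for m
    using X by (auto simp: is_complex_def A.typed_def)
  define OK where "OK n = (\<lambda>(P, P', d, f). proj P \<and> A.typed d P P' \<and> A.typed f P (obj X n))" for n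
  define R where "R n s' s \<longleftrightarrow> (\<exists>E a b e \<sigma>. covers n X s' s E a b e \<sigma>)" for n s' s
  define z where "z n = (Z, Z, Zero A Z Z, Zero A Z (obj X n))" for n
  obtain x where x: "\<And>n. OK n (x n)" "\<And>n. R n (x (n + 1)) (x n)" "\<And>n. n \<ge> N + 1 \<Longrightarrow> x n = z n"
  proof (rule int_down_choice[of "N + 1" OK z R])
    fix n assume n: "n \<ge> N + 1"
    show "OK n (z n)" using oZ o by (simp add: OK_def z_def proj_zero[OF Z] A.typed_iff)
    have zX: "is_zero_object A (obj X n)" using N n by simp
    have iZ: "A.rr (Idn A Z) = 0"
      using A.rr_zero_object(1)[OF Z A.Idn_typed[OF oZ]] .
    have 0: "A.rr u = 0" if "A.typed u T Z \<or> A.typed u T (obj X n)" for u T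
      using that A.rr_zero_object(1)[OF Z] A.rr_zero_object(1)[OF zX] by blast
    \<comment> \<open>Above \<open>N\<close> the zero object serves as term of the resolution, as
      cycles and as its own cover; all universal properties hold since all maps into it or into
      \<open>obj X n\<close> are zero.\<close>
    have "covers n X (z (n + 1)) (z n) Z (Idn A Z) (Zero A Z (obj X n)) (Idn A Z) (Idn B (Fo Z))"
      unfolding covers_def z_def prod.case
    proof (intro conjI allI impI)
      show "B.rr (Fa (Idn A Z)) * B.rr (Idn B (Fo Z)) = B.rr (Idn B (Fo Z))"
        using oZ by (simp add: F_Idn)
      fix T x y assume xy: "A.typed x T Z \<and> A.typed y T (obj X n) \<and> A.rr (Zero A Z Z) * A.rr x = 0 \<and>
         A.rr (Zero A Z (obj X (n + 1))) * A.rr x = A.rr (diff X n) * A.rr y"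
      then have "T \<in> Ob A" by (auto simp: A.typed_def)
      then show "\<exists>u. A.typed u T Z \<and> A.rr (Idn A Z) * A.rr u = A.rr x \<and> A.rr (Zero A Z (obj X n)) * A.rr u = A.rr y"
        using xy 0[of x T] 0[of y T] oZ o by (intro exI[of _ x]) simp
    next
      fix T u u' assume "A.typed u T Z \<and> A.typed u' T Z \<and> A.rr (Idn A Z) * A.rr u = A.rr (Idn A Z) * A.rr u' \<and>
         A.rr (Zero A Z (obj X n)) * A.rr u = A.rr (Zero A Z (obj X n)) * A.rr u'"
      then show "u = u'" using 0[of u T] 0[of u' T] by (intro A.eqI_rr[of u T Z]) auto
    qed (use oZ o iZ in \<open>auto simp: A.typed_iff B.typed_iff\<close>)
    then show "R n (z (n + 1)) (z n)" unfolding R_def by blast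
  next
    fix n s' assume "OK (n + 1) s'"
    then obtain P' P'' d' f' where s': "s' = (P', P'', d', f')" and ok: "proj P'" "A.typed d' P' P''"
      "A.typed f' P' (obj X (n + 1))"
      by (cases s') (auto simp: OK_def)
    obtain E a b where E: "A.typed a E P'" "A.typed b E (obj X n)" "A.rr d' * A.rr a = 0"
      "A.rr f' * A.rr a = A.rr (diff X n) * A.rr b"
      "\<And>T s t. \<lbrakk>A.typed s T P'; A.typed t T (obj X n); A.rr d' * A.rr s = 0; A.rr f' * A.rr s = A.rr (diff X n) * A.rr t\<rbrakk> \<Longrightarrow>
       \<exists>u. A.typed u T E \<and> A.rr a * A.rr u = A.rr s \<and> A.rr b * A.rr u = A.rr t"
      "\<And>T u u'. \<lbrakk>A.typed u T E; A.typed u' T E; A.rr a * A.rr u = A.rr a * A.rr u'; A.rr b * A.rr u = A.rr b * A.rr u'\<rbrakk> \<Longrightarrow> u = u'"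
      by (rule A.joint_kernel[OF ok(2,3) dX]) blast
    have oE: "E \<in> Ob A" using E by (simp add: A.typed_def)
    note tt = E(1,2)[unfolded A.typed_iff]
    let ?s = "(Lo (Fo E), P', a \<cdot>\<^bsub>A\<^esub> \<epsilon> E, b \<cdot>\<^bsub>A\<^esub> \<epsilon> E)"
    have "OK n ?s" using oE tt by (auto simp: OK_def proj_L A.typed_iff)
    moreover have "B.rr (Fa (\<epsilon> E)) * B.rr (\<eta> (Fo E)) = B.rr (Idn B (Fo E))"
      using arg_cong[OF F_eps_eta[OF oE], of B.rr] oE by simp
    then have "covers n X s' ?s E a b (\<epsilon> E) (\<eta> (Fo E))"
      unfolding covers_def s' prod.case using oE tt E by (auto simp: eps_typed eta_typed)
    ultimately show "\<exists>y. OK n y \<and> R n s' y" unfolding R_def by blast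
  qed (rule that, assumption+)
  define P where "P n = fst (x n)" for n
  define d where "d n = fst (snd (snd (x n)))" for n
  define f where "f n = snd (snd (snd (x n)))" for n
  define Q where "Q n = fst (snd (x n))" for n
  have xn: "x n = (P n, Q n, d n, f n)" for n by (simp add: P_def d_def f_def Q_def)
  obtain E a b e s where c: "\<And>n. covers n X (x (n + 1)) (x n) (E n) (a n) (b n) (e n) (s n)"
    using x(2) unfolding R_def by metis
  have Q: "Q n = P (n + 1)" for n using c[of n] unfolding xn covers_def by simp
  show thesis
  proof (rule that[of P d f E a b e s])
    fix n
    show "proj (P n)" "A.typed (d n) (P n) (P (n + 1))" "A.typed (f n) (P n) (obj X n)"
      using x(1)[of n] unfolding xn OK_def Q by auto
    show "is_zero_object A (P n)" if "n > N" using x(3)[of n] that Z by (simp add: P_def z_def)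
    show "covers n X (P (n + 1), P (n + 2), d (n + 1), f (n + 1)) (P n, P (n + 1), d n, f n) (E n) (a n) (b n) (e n) (s n)"
      using c[of n] unfolding xn Q by (simp add: add.commute)
  qed
qed

text \<open>The last conclusion concerns every cone of \<open>g\<close>, so that it can be applied
  to whichever cone occurs in a triangle. The objects \<open>E n\<close> turn out to be the cycles
  of the cone, and the sections carried by \<open>covers\<close> split the differential onto them
  after \<open>F\<close>.\<close>

lemma resolution:
  assumes X: "is_complex A X" "bounded_above A X"
  obtains Q g where "is_complex A Q" "bounded_above A Q" "\<And>n. proj (obj Q n)" "g \<in> chain_maps A Q X"
    "\<And>Z i j p q. is_cone A Q X g Z i j p q \<Longrightarrow> is_complex A Z \<Longrightarrow> contractible B (map_complex F Z)"
proof -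
  obtain N where N: "\<And>n. n > N \<Longrightarrow> is_zero_object A (obj X n)" using X(2) by (auto simp: bounded_above_def)
  obtain P d f E a b e s where c: "\<And>n. proj (P n)" "\<And>n. n > N \<Longrightarrow> is_zero_object A (P n)"
    "\<And>n. A.typed (d n) (P n) (P (n + 1))" "\<And>n. A.typed (f n) (P n) (obj X n)"
    "\<And>n. covers n X (P (n + 1), P (n + 2), d (n + 1), f (n + 1)) (P n, P (n + 1), d n, f n) (E n) (a n) (b n) (e n) (s n)"
    by (rule covering_sequence[OF X(1) N]) (assumption, rule that, assumption+)
  note cv = c(5)[unfolded covers_def prod.case]
  have t: "A.typed (a n) (E n) (P (n + 1))" "A.typed (b n) (E n) (obj X n)" "A.typed (e n) (P n) (E n)"
    "B.typed (s n) (Fo (E n)) (Fo (P n))" for n using cv[of n] by auto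
  have r: "A.rr (d n) = A.rr (a n) * A.rr (e n)" "A.rr (f n) = A.rr (b n) * A.rr (e n)"
    "B.rr (Fa (e n)) * B.rr (s n) = B.rr (Idn B (Fo (E n)))" "A.rr (d (n + 1)) * A.rr (a n) = 0"
    "A.rr (f (n + 1)) * A.rr (a n) = A.rr (diff X n) * A.rr (b n)" for n using cv[of n] by auto
  have univ: "\<exists>u. A.typed u T (E n) \<and> A.rr (a n) * A.rr u = A.rr x \<and> A.rr (b n) * A.rr u = A.rr y"
    if "A.typed x T (P (n + 1))" "A.typed y T (obj X n)" "A.rr (d (n + 1)) * A.rr x = 0"
      "A.rr (f (n + 1)) * A.rr x = A.rr (diff X n) * A.rr y" for n T x y
    using cv[of n] that by blast
  have uniq: "u = u'" if "A.typed u T (E n)" "A.typed u' T (E n)" "A.rr (a n) * A.rr u = A.rr (a n) * A.rr u'"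
    "A.rr (b n) * A.rr u = A.rr (b n) * A.rr u'" for n T u u'
    using cv[of n] that by blast
  have o: "P n \<in> Ob A" "E n \<in> Ob A" "obj X n \<in> Ob A" for n
    using t(1,2)[of n] c(3)[of n] by (auto simp: A.typed_def)
  have dX: "A.typed (diff X m) (obj X m) (obj X (m + 1))" for m
    using X by (auto simp: is_complex_def A.typed_def)
  define Q where "Q = \<lparr>obj = P, diff = d\<rparr>"
  have Qs: "obj Q = P" "diff Q = d" by (simp_all add: Q_def)
  note tt = t[unfolded A.typed_iff B.typed_iff] c(3,4)[unfolded A.typed_iff] dX[unfolded A.typed_iff]
  have cQ: "is_complex A Q"
    unfolding is_complex_def Qs
  proof (intro allI conjI)
    fix n
    show "P n \<in> Ob A" by (rule o)
    show "d n \<in> Hom A (P n) (P (n + 1))" using c(3) by (simp add: A.typed_def)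
    have "A.rr (d (n + 1)) * A.rr (d n) = 0" by (simp add: r(1)[of n] r(4)[THEN times_ext])
    then show "d (n + 1) \<cdot>\<^bsub>A\<^esub> d n = Zero A (P n) (P (n + 2))"
      using tt o by (intro A.rr_inject) (auto simp: add.commute)
  qed
  have g: "f \<in> chain_maps A Q X"
    unfolding chain_maps_def Qs mem_Collect_eq
  proof (intro allI conjI)
    fix n
    show "f n \<in> Hom A (P n) (obj X n)" using c(4) by (simp add: A.typed_def)
    have "A.rr (f (n + 1)) * A.rr (d n) = A.rr (diff X n) * A.rr (f n)"
      by (simp add: r(1)[of n] r(2)[of n] r(5)[THEN times_ext] mult.assoc)
    then show "f (n + 1) \<cdot>\<^bsub>A\<^esub> d n = diff X n \<cdot>\<^bsub>A\<^esub> f n"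
      using tt o by (intro A.rr_inject) auto
  qed
  show thesis
  proof (rule that[OF cQ _ _ g])
    show "bounded_above A Q" using c(2) by (auto simp: bounded_above_def Qs)
    show "proj (obj Q n)" for n using c(1) by (simp add: Qs)
  next
    fix Z i j p q assume Z: "is_cone A Q X f Z i j p q" and cZ: "is_complex A Z"
    have "biproduct A (P (n + 1)) (obj X n) (obj Z n) (i n) (j n) (p n) (q n)" for n
      using Z by (simp add: is_cone_def Qs)
    note b = A.biproduct_rr[OF this]
    note bt = b(1-4)[unfolded A.typed_iff]
    have oZ: "obj Z n \<in> Ob A" for n using cZ by (simp add: is_complex_def)
    have dZ: "A.typed (diff Z n) (obj Z n) (obj Z (n + 1))" for n
      using cZ by (auto simp: is_complex_def A.typed_def)
    note dZt = dZ[unfolded A.typed_iff]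
    have b1: "A.arr (i (n + 1))" "A.src (i (n + 1)) = P (n + 2)" "A.tgt (i (n + 1)) = obj Z (n + 1)"
      "A.arr (j (n + 1))" "A.src (j (n + 1)) = obj X (n + 1)" "A.tgt (j (n + 1)) = obj Z (n + 1)"
      "A.arr (p (n + 1))" "A.src (p (n + 1)) = obj Z (n + 1)" "A.tgt (p (n + 1)) = P (n + 2)" for n
      using bt[of "n + 1"] by (auto simp: add.assoc)
    have d1: "A.arr (d (n + 1))" "A.src (d (n + 1)) = P (n + 1)" "A.tgt (d (n + 1)) = P (n + 2)" for n
      using tt(5)[of "n + 1"] by (auto simp: add.assoc)
    have rdZ: "A.rr (diff Z n) = A.rr (j (n + 1)) * (A.rr (f (n + 1)) * A.rr (p n)) +
        A.rr (j (n + 1)) * (A.rr (diff X n) * A.rr (q n)) - A.rr (i (n + 1)) * (A.rr (d (n + 1)) * A.rr (p n))" for n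
    proof -
      have dt: "A.typed (d (n + 1)) (P (n + 1)) (P (n + 2))" using d1[of n] by (simp add: A.typed_iff)
      note nt = A.typed_neg[OF dt, unfolded A.typed_iff] and rn = A.rr_neg[OF dt]
      have "diff Z n = i (n + 1) \<cdot>\<^bsub>A\<^esub> neg A (P (n + 1)) (P (n + 2)) (d (n + 1)) \<cdot>\<^bsub>A\<^esub> p n \<boxplus>\<^bsub>A\<^esub>
          j (n + 1) \<cdot>\<^bsub>A\<^esub> f (n + 1) \<cdot>\<^bsub>A\<^esub> p n \<boxplus>\<^bsub>A\<^esub> j (n + 1) \<cdot>\<^bsub>A\<^esub> diff X n \<cdot>\<^bsub>A\<^esub> q n"
        using Z by (simp add: is_cone_def Qs shift_complex_def)
      from arg_cong[OF this, of A.rr]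
      have "A.rr (diff Z n) = - (A.rr (i (n + 1)) * (A.rr (d (n + 1)) * A.rr (p n))) +
          A.rr (j (n + 1)) * (A.rr (f (n + 1)) * A.rr (p n)) + A.rr (j (n + 1)) * (A.rr (diff X n) * A.rr (q n))"
        using nt b1[of n] bt[of n] tt(6)[of "n + 1"] tt(7)[of n] by (simp add: rn mult.assoc)
      then show ?thesis by simp
    qed
    have pi: "A.rr (p n) * (A.rr (i n) * z) = A.rr (Idn A (P (n + 1))) * z" "A.rr (q n) * (A.rr (j n) * z) = A.rr (Idn A (obj X n)) * z"
      "A.rr (q n) * (A.rr (i n) * z) = 0" "A.rr (p n) * (A.rr (j n) * z) = 0" for n z
      using b(5-8)[of n, THEN times_ext] by simp_all
    have Ia: "A.rr (Idn A (P (n + 1))) * A.rr (a n) = A.rr (a n)" "A.rr (Idn A (obj X n)) * A.rr (b n) = A.rr (b n)" for n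
      using tt by auto
    \<comment> \<open>A cycle \<open>(x, y)\<close> of the cone satisfies \<open>d x = 0\<close> and
      \<open>f x + d y = 0\<close>, whereas \<open>E\<close> consists of pairs with
      \<open>f x = d y\<close>. Hence the first component is embedded with a minus sign.\<close>
    define k where "k n = A.minus (j n \<cdot>\<^bsub>A\<^esub> b n) (i n \<cdot>\<^bsub>A\<^esub> a n)" for n
    have k: "A.typed (k n) (E n) (obj Z n)" "A.rr (k n) = A.rr (j n) * A.rr (b n) - A.rr (i n) * A.rr (a n)" for n
      using bt[of n] tt(1,2)[of n] by (simp_all add: k_def A.typed_iff)
    have pk: "A.rr (p n) * A.rr (k n) = - A.rr (a n)" "A.rr (q n) * A.rr (k n) = A.rr (b n)" for n
      by (simp_all add: k(2) right_diff_distrib pi Ia)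
    have dk: "A.rr (diff Z n) * A.rr (k n) = 0" for n
      by (simp add: rdZ distrib_right left_diff_distrib mult.assoc pk r(4,5))
    have sum: "A.rr (i n) * (A.rr (p n) * A.rr t) + A.rr (j n) * (A.rr (q n) * A.rr t) = A.rr t"
      if "A.typed t T (obj Z n)" for n t T
      using arg_cong[OF b(9)[of n], of "\<lambda>z. z * A.rr t"] that by (simp add: distrib_right mult.assoc A.typed_iff)
    have ker: "is_kernel A (obj Z n) (obj Z (n + 1)) (diff Z n) (E n) (k n)" for n
    proof (rule A.is_kernelI_rr[OF dZ k(1) dk])
      fix T x assume x: "A.typed x T (obj Z n)" "A.rr (diff Z n) * A.rr x = 0"
      note xt = x(1)[unfolded A.typed_iff]
      have T: "T \<in> Ob A" using x by (simp add: A.typed_def)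
      have w: "A.rr (Idn A (P (n + 1 + 1))) * (A.rr (d (n + 1)) * z) = A.rr (d (n + 1)) * z"
        "A.rr (Idn A (obj X (n + 1))) * (A.rr (f (n + 1)) * z) = A.rr (f (n + 1)) * z"
        "A.rr (Idn A (obj X (n + 1))) * (A.rr (diff X n) * z) = A.rr (diff X n) * z" for z
        using tt(5,6)[of "n + 1"] tt(7)[of n] by (simp_all flip: mult.assoc)
      have "A.rr (p (n + 1)) * (A.rr (diff Z n) * A.rr x) = - (A.rr (d (n + 1)) * (A.rr (p n) * A.rr x))"
        unfolding rdZ
        by (simp only: distrib_left distrib_right left_diff_distrib right_diff_distrib mult.assoc pi w) simp
      then have 1: "A.rr (d (n + 1)) * (A.rr (p n) * A.rr x) = 0" using x(2) by simp
      have "A.rr (q (n + 1)) * (A.rr (diff Z n) * A.rr x) =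
          A.rr (f (n + 1)) * (A.rr (p n) * A.rr x) + A.rr (diff X n) * (A.rr (q n) * A.rr x)"
        unfolding rdZ
        by (simp only: distrib_left distrib_right left_diff_distrib right_diff_distrib mult.assoc pi w) simp
      then have 2: "A.rr (f (n + 1)) * (A.rr (p n) * A.rr x) = - (A.rr (diff X n) * (A.rr (q n) * A.rr x))"
        using x(2) by (simp only: eq_neg_iff_add_eq_0 mult_zero_right)
      \<comment> \<open>Conversely a cycle \<open>x\<close> of the cone gives the pair
        \<open>(-p x, q x)\<close>; the negative is formed by subtracting from zero.\<close>
      let ?x = "A.minus (Zero A T (P (n + 1))) (p n \<cdot>\<^bsub>A\<^esub> x)" and ?y = "q n \<cdot>\<^bsub>A\<^esub> x"
      have rx: "A.typed ?x T (P (n + 1))" "A.rr ?x = - (A.rr (p n) * A.rr x)"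
        "A.typed ?y T (obj X n)" "A.rr ?y = A.rr (q n) * A.rr x"
        using xt bt[of n] T o by (simp_all add: A.typed_iff)
      have "\<exists>u. A.typed u T (E n) \<and> A.rr (a n) * A.rr u = A.rr ?x \<and> A.rr (b n) * A.rr u = A.rr ?y"
        by (rule univ[OF rx(1,3)]) (simp_all only: rx(2,4) mult_minus_right 1 2 minus_minus minus_zero)
      then obtain u where u: "A.typed u T (E n)" "A.rr (a n) * A.rr u = - (A.rr (p n) * A.rr x)"
        "A.rr (b n) * A.rr u = A.rr (q n) * A.rr x" using rx by auto
      have "A.rr (k n) * A.rr u = A.rr x"
        using sum[OF x(1)] by (simp add: k(2) left_diff_distrib mult.assoc u(2,3) add.commute)
      then show "\<exists>u. A.typed u T (E n) \<and> A.rr (k n) * A.rr u = A.rr x" using u by blast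
    next
      fix T u u' assume u: "A.typed u T (E n)" "A.typed u' T (E n)" "A.rr (k n) * A.rr u = A.rr (k n) * A.rr u'"
      have "A.rr (p n) * (A.rr (k n) * A.rr u) = A.rr (p n) * (A.rr (k n) * A.rr u')"
        "A.rr (q n) * (A.rr (k n) * A.rr u) = A.rr (q n) * (A.rr (k n) * A.rr u')" using u(3) by simp_all
      then have "A.rr (a n) * A.rr u = A.rr (a n) * A.rr u'" "A.rr (b n) * A.rr u = A.rr (b n) * A.rr u'"
        by (simp_all add: pk[THEN times_ext])
      then show "u = u'" using uniq u by blast
    qed
    note kr = A.is_kernel_rr[OF ker dZ]
    have ddZ: "A.rr (diff Z (n + 1)) * A.rr (diff Z n) = 0" for n
    proof -
      have "diff Z (n + 1) \<cdot>\<^bsub>A\<^esub> diff Z n = Zero A (obj Z n) (obj Z (n + 2))" using cZ by (simp add: is_complex_def)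
      from arg_cong[OF this, of A.rr] show ?thesis using dZt[of n] dZt[of "n + 1"] oZ by simp
    qed
    \<comment> \<open>\<open>\<pi> n\<close> is the differential with its target restricted to the
      cycles.\<close>
    have "\<exists>u. A.typed u (obj Z n) (E (n + 1)) \<and> A.rr (k (n + 1)) * A.rr u = A.rr (diff Z n)" for n
      by (rule kr(3)[OF dZ ddZ])
    then obtain \<pi> where \<pi>: "\<And>n. A.typed (\<pi> n) (obj Z n) (E (n + 1))"
      "\<And>n. A.rr (k (n + 1)) * A.rr (\<pi> n) = A.rr (diff Z n)" by metis
    note kt = k(1)[unfolded A.typed_iff] \<pi>(1)[unfolded A.typed_iff]
    have im: "A.typed (i (n - 1)) (P n) (obj Z (n - 1))" "A.typed (\<pi> (n - 1)) (obj Z (n - 1)) (E n)" for n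
      using b(1)[of "n - 1"] \<pi>(1)[of "n - 1"] by auto
    note imt = im[unfolded A.typed_iff]
    \<comment> \<open>The term \<open>P n\<close> is a summand of the cone in degree
      \<open>n - 1\<close>. On it the differential is \<open>j f - i d\<close>, which equals
      \<open>k e\<close>, so its restriction to the cycles is the covering map
      \<open>e n\<close>.\<close>
    have \<pi>i: "\<pi> (n - 1) \<cdot>\<^bsub>A\<^esub> i (n - 1) = e n" for n
    proof (rule kr(4))
      show "A.typed (\<pi> (n - 1) \<cdot>\<^bsub>A\<^esub> i (n - 1)) (P n) (E n)" using im A.Comp_typed by blast
      show "A.typed (e n) (P n) (E n)" by (rule t)
      have "A.rr (k n) * (A.rr (\<pi> (n - 1)) * A.rr (i (n - 1))) = A.rr (diff Z (n - 1)) * A.rr (i (n - 1))"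
        using \<pi>(2)[of "n - 1"] by (simp flip: mult.assoc)
      also have "\<dots> = A.rr (j n) * (A.rr (f n) * A.rr (Idn A (P n))) - A.rr (i n) * (A.rr (d n) * A.rr (Idn A (P n)))"
        using b(5,7)[of "n - 1"]
        by (simp add: rdZ[of "n - 1"] distrib_right left_diff_distrib mult.assoc)
      also have "\<dots> = A.rr (k n) * A.rr (e n)"
        using tt(3)[of n] by (simp add: k(2) r(1,2) left_diff_distrib mult.assoc)
      finally show "A.rr (k n) * A.rr (\<pi> (n - 1) \<cdot>\<^bsub>A\<^esub> i (n - 1)) = A.rr (k n) * A.rr (e n)"
        using imt[of n] by simp
    qed
    have FZ: "obj (map_complex F Z) = (\<lambda>n. Fo (obj Z n))" "diff (map_complex F Z) = (\<lambda>n. Fa (diff Z n))"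
      by (simp_all add: map_complex_def)
    note kF = B.is_kernel_rr[OF F_kernel[OF ker dZ] F_typed[OF dZ]]
    \<comment> \<open>The splitting of \<open>F \<pi>\<close> is \<open>F i\<close> after
      \<open>s\<close>: the composite of \<open>\<pi>\<close> and \<open>i\<close> is
      \<open>e\<close>, and \<open>s\<close> splits \<open>F e\<close>.\<close>
    show "contractible B (map_complex F Z)"
    proof (rule B.contractibleI[of _ "\<lambda>n. Fa (k n)" "\<lambda>n. Fo (E n)" "\<lambda>n. Fa (\<pi> n)" "\<lambda>n. Fa (i (n - 1)) \<cdot>\<^bsub>B\<^esub> s n"];
        (unfold FZ)?)
      show "is_complex B (map_complex F Z)"
        unfolding is_complex_def FZ
      proof (intro allI conjI)
        fix n
        show "Fo (obj Z n) \<in> Ob B" using oZ by simp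
        show "Fa (diff Z n) \<in> Hom B (Fo (obj Z n)) (Fo (obj Z (n + 1)))" using F_typed[OF dZ] by (simp add: B.typed_def)
        have "diff Z (n + 1) \<cdot>\<^bsub>A\<^esub> diff Z n = Zero A (obj Z n) (obj Z (n + 2))" using cZ by (simp add: is_complex_def)
        then show "Fa (diff Z (n + 1)) \<cdot>\<^bsub>B\<^esub> Fa (diff Z n) = Zero B (Fo (obj Z n)) (Fo (obj Z (n + 2)))"
          using F_Comp[of "diff Z n" "diff Z (n + 1)"] dZt[of n] dZt[of "n + 1"] oZ by (simp add: F_Zero)
      qed
    next
      fix n
      show "B.typed (Fa (k n)) (Fo (E n)) (Fo (obj Z n))" by (rule F_typed[OF k(1)])
      show "B.typed (Fa (\<pi> n)) (Fo (obj Z n)) (Fo (E (n + 1)))" by (rule F_typed[OF \<pi>(1)])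
      show "B.typed (Fa (i (n - 1)) \<cdot>\<^bsub>B\<^esub> s n) (Fo (E n)) (Fo (obj Z (n - 1)))"
        by (rule B.Comp_typed[OF t(4) F_typed[OF im(1)]])
      have "k (n + 1) \<cdot>\<^bsub>A\<^esub> \<pi> n = diff Z n"
        using kt(1)[of "n + 1"] kt(2)[of n] dZt[of n] \<pi>(2)[of n] by (intro A.rr_inject) auto
      then show "B.rr (Fa (diff Z n)) = B.rr (Fa (k (n + 1))) * B.rr (Fa (\<pi> n))"
        using F_rr[of "\<pi> n" "k (n + 1)"] kt(1)[of "n + 1"] kt(2)[of n] by simp
      have "B.rr (Fa (\<pi> (n - 1))) * B.rr (Fa (i (n - 1))) = B.rr (Fa (e n))"
        using F_rr[of "i (n - 1)" "\<pi> (n - 1)"] imt[of n] \<pi>i[of n] by simp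
      then show "B.rr (Fa (\<pi> (n - 1))) * B.rr (Fa (i (n - 1)) \<cdot>\<^bsub>B\<^esub> s n) = B.rr (Idn B (Fo (E n)))"
        using imt[of n] tt(4)[of n] r(3)[of n] by (simp flip: mult.assoc)
      show "B.rr (Fa (diff Z n)) * B.rr (Fa (k n)) = 0" by (rule kF(2))
    next
      show "t = t'" if "B.typed t T (Fo (E n))" "B.typed t' T (Fo (E n))"
        "B.rr (Fa (k n)) * B.rr t = B.rr (Fa (k n)) * B.rr t'" for n T t t'
        using kF(4) that .
      show "\<exists>u. B.typed u T (Fo (E n)) \<and> B.rr (Fa (k n)) * B.rr u = B.rr t"
        if "B.typed t T (Fo (obj Z n))" "B.rr (Fa (diff Z n)) * B.rr t = 0" for n T t
        using kF(3) that .
    qed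
  qed
qed

subsection \<open>The comparison\<close>

definition "bounded = {X. bounded_above A X}"
definition "projectives = {X. is_complex A X \<and> bounded_above A X \<and> (\<forall>n. proj (obj X n))}"

lemma bounded_above_shift: "bounded_above A X \<Longrightarrow> bounded_above A (shift_complex A X)"
  unfolding bounded_above_def
proof (erule exE)
  fix N assume "\<forall>n>N. is_zero_object A (obj X n)"
  then show "\<exists>N. \<forall>n>N. is_zero_object A (obj (shift_complex A X) n)"
    by (intro exI[of _ N]) (simp add: A.obj_sh)
qed

text \<open>The differential is negated here too, so that the shift negates it a second time and
  gives back \<open>X\<close> itself, not only an isomorphic complex.\<close>

definition unshift :: "('a, 'm) cochain_complex \<Rightarrow> ('a, 'm) cochain_complex" where
  "unshift X = \<lparr>obj = (\<lambda>n. obj X (n - 1)),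
     diff = (\<lambda>n. neg A (obj X (n - 1)) (obj X n) (diff X (n - 1)))\<rparr>"

lemma unshift:
  assumes X: "is_complex A X" shows "is_complex A (unshift X)" "shift_complex A (unshift X) = X"
proof -
  have o: "obj X n \<in> Ob A" for n using X by (simp add: is_complex_def)
  have d: "A.typed (diff X n) (obj X n) (obj X (n + 1))" for n using X by (auto simp: is_complex_def A.typed_def)
  note n = A.typed_neg A.rr_neg
  have d1: "A.typed (diff X (m - 1)) (obj X (m - 1)) (obj X m)" for m using d[of "m - 1"] by simp
  show "is_complex A (unshift X)"
    unfolding is_complex_def unshift_def cochain_complex.simps
  proof (intro allI conjI)
    fix m
    show "obj X (m - 1) \<in> Ob A" by (rule o)
    show "neg A (obj X (m - 1)) (obj X m) (diff X (m - 1)) \<in> Hom A (obj X (m - 1)) (obj X (m + 1 - 1))"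
      using n(1)[OF d1[of m]] by (simp add: A.typed_def)
    have "diff X (m - 1 + 1) \<cdot>\<^bsub>A\<^esub> diff X (m - 1) = Zero A (obj X (m - 1)) (obj X (m - 1 + 2))"
      using X unfolding is_complex_def by blast
    from arg_cong[OF this, of A.rr] have "A.rr (diff X m) * A.rr (diff X (m - 1)) = 0"
      using d1[of m] d[of m] o by (simp add: A.typed_iff)
    then show "neg A (obj X (m + 1 - 1)) (obj X (m + 1)) (diff X (m + 1 - 1)) \<cdot>\<^bsub>A\<^esub>
       neg A (obj X (m - 1)) (obj X m) (diff X (m - 1)) = Zero A (obj X (m - 1)) (obj X (m + 2 - 1))"
      using n[OF d1[of m]] n[OF d[of m]] o by (intro A.rr_inject) (auto simp: A.typed_iff add.commute)
  qed
  have "neg A (obj X m) (obj X (m + 1)) (neg A (obj X m) (obj X (m + 1)) (diff X m)) = diff X m" for m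
    by (rule A.eqI_rr[OF n(1)[OF n(1)[OF d]] d]) (simp add: n(2)[OF n(1)[OF d]] n(2)[OF d])
  then show "shift_complex A (unshift X) = X"
    by (simp add: shift_complex_def unshift_def add.commute)
qed

lemma obj_unshift: "obj (unshift X) n = obj X (n - 1)"
  by (simp add: unshift_def)

text \<open>The \<open>is_cone\<close> data are returned along with the triangle: the terms of the
  cone are needed to see that they are relatively projective, and the cone itself to see that it is
  split acyclic.\<close>

lemma cone_triangle:
  assumes c: "is_complex A X" "is_complex A Y" "f \<in> chain_maps A X Y"
    and b: "bounded_above A X" "bounded_above A Y"
  obtains Z v w i j p q where "is_cone A X Y f Z i j p q" "is_complex A Z" "bounded_above A Z"
    "(X, Y, Z, htpy_arrow A X Y f, v, w) \<in> Tri A.K"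
proof -
  obtain Z i j p q where Z: "is_cone A X Y f Z i j p q"
    using A.is_cone_exists[OF A.ex_biproduct c(1,2)] by blast
  note k = A.cone_cmaps[OF A.cone_of_is_cone(1)[OF c Z]]
  obtain M M' where M: "\<And>n. n > M \<Longrightarrow> is_zero_object A (obj X n)" "\<And>n. n > M' \<Longrightarrow> is_zero_object A (obj Y n)"
    using b by (auto simp: bounded_above_def)
  have "is_zero_object A (obj Z n)" if "n > max M M'" for n
  proof (rule A.biproduct_zero_object)
    show "biproduct A (obj X (n + 1)) (obj Y n) (obj Z n) (i n) (j n) (p n) (q n)"
      using Z by (simp add: is_cone_def)
  qed (use M that in auto)
  then have "bounded_above A Z" unfolding bounded_above_def by (intro exI[of _ "max M M'"]) simp
  then show thesis using that[OF Z k(4)] A.Tri_K_of_is_cone[OF c Z] by blast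
qed

lemma colocalization_K_minus:
  "colocalization (homotopy_category_minus A) (F_split_acyclic A B F \<inter> Ob (homotopy_category_minus A)) projectives"
proof -
  let ?T = "homotopy_category_minus A" and ?N = "F_split_acyclic A B F \<inter> Ob (homotopy_category_minus A)"
  have T: "?T = full_subcat A.K bounded" by (simp add: homotopy_category_minus_def bounded_def)
  note fs = full_subcat_simps[of A.K bounded, folded T]
  have ObT: "Ob ?T = {X. is_complex A X \<and> bounded_above A X}"
    by (auto simp: fs A.K_simps(1) bounded_def)
  have pre: "pretriangulated ?T"
    unfolding T using A.pretriangulated_K
    by (rule pretriangulated.pretriangulated_full_subcat)
       (simp add: bounded_def A.K_simps(7) bounded_above_shift)
  show ?thesis
  proof (intro colocalization.intro pre colocalization_axioms.intro)
    show "projectives \<subseteq> Ob ?T" by (auto simp: projectives_def ObT)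
  next
    fix Q S g assume Q: "Q \<in> projectives" and S: "S \<in> ?N" and g: "g \<in> Hom ?T Q S"
    have c: "is_complex A Q" "is_complex A S" using Q S by (auto simp: projectives_def ObT)
    obtain x where x: "A.cmap Q S x" "g = A.karr Q S x" using g A.Hom_K[OF c] by (auto simp: fs)
    let ?h = "A.components 0 (obj Q) (obj S) x"
    have h: "?h \<in> A.graded_hom 0 (obj Q) (obj S)" "A.emb 0 (obj Q) (obj S) ?h = x"
      using A.components_in A.emb_components A.cmap_gmap[OF x(1)] by auto
    have "?h \<in> chain_maps A Q S" using h x A.chain_maps_iff[OF c] by simp
    then have "homotopic A Q S ?h (\<lambda>n. Zero A (obj Q n) (obj S n))"
      using Q S by (intro homotopic_zero) (auto simp: projectives_def F_split_acyclic_def)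
    moreover have o: "\<And>n. obj Q n \<in> Ob A" "\<And>n. obj S n \<in> Ob A" using c A.complex_obj by auto
    ultimately have "A.null Q S x"
      using A.homotopic_iff[OF c h(1) A.graded_hom_Zero[of "obj Q" "obj S" 0, OF o, simplified]] A.emb_Zero[of "obj Q" "obj S" 0, OF o] h(2)
      by simp
    then show "g = Zero ?T Q S" using x A.null_iff_Zero by (simp add: fs)
  next
    fix Q assume Q: "Q \<in> projectives"
    then show "ShOb ?T Q \<in> projectives"
      by (simp add: projectives_def fs A.K_simps(7) A.complex_sh bounded_above_shift A.obj_sh)
    have "unshift Q \<in> projectives"
      using Q unfolding projectives_def
    proof (clarsimp simp: unshift(1) obj_unshift)
      assume "bounded_above A Q"
      then obtain M where "\<And>n. n > M \<Longrightarrow> is_zero_object A (obj Q n)" by (auto simp: bounded_above_def)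
      then show "bounded_above A (unshift Q)"
        unfolding bounded_above_def by (intro exI[of _ "M + 1"]) (simp add: obj_unshift)
    qed
    then show "\<exists>Q'\<in>projectives. ShOb ?T Q' = Q"
      using Q unshift(2) by (intro bexI[of _ "unshift Q"]) (auto simp: projectives_def fs A.K_simps(7))
  next
    fix Q Q' u assume Q: "Q \<in> projectives" and Q': "Q' \<in> projectives" and u: "u \<in> Hom ?T Q Q'"
    have c: "is_complex A Q" "is_complex A Q'" and ba: "bounded_above A Q" "bounded_above A Q'"
      using Q Q' by (auto simp: projectives_def)
    have "u \<in> htpy_arrow A Q Q' ` chain_maps A Q Q'"
      using u by (simp add: fs A.K_simps) (simp add: htpy_shift_cat_def)
    then obtain f where f: "f \<in> chain_maps A Q Q'" "u = htpy_arrow A Q Q' f" by blast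
    obtain Z v w i j p q where Z: "is_cone A Q Q' f Z i j p q" "is_complex A Z" "bounded_above A Z"
      "(Q, Q', Z, htpy_arrow A Q Q' f, v, w) \<in> Tri A.K"
      by (rule cone_triangle[OF c f(1) ba]) (rule that, assumption+)
    have "proj (obj Z n)" for n
    proof (rule proj_biproduct)
      show "biproduct A (obj Q (n + 1)) (obj Q' n) (obj Z n) (i n) (j n) (p n) (q n)"
        using Z by (simp add: is_cone_def)
    qed (use Q Q' in \<open>auto simp: projectives_def\<close>)
    then show "\<exists>Z\<in>projectives. \<exists>v w. (Q, Q', Z, u, v, w) \<in> Tri ?T"
    proof -
      have "Z \<in> projectives" using Z \<open>\<And>n. proj (obj Z n)\<close> by (simp add: projectives_def)
      moreover have "(Q, Q', Z, u, v, w) \<in> Tri ?T"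
        using Z(3,4) ba by (simp add: fs bounded_def f(2))
      ultimately show ?thesis by blast
    qed
  next
    fix X assume "X \<in> Ob ?T"
    then have X: "is_complex A X" "bounded_above A X" by (auto simp: ObT)
    obtain Q g where Q: "is_complex A Q" "bounded_above A Q" "\<And>n. proj (obj Q n)" "g \<in> chain_maps A Q X"
      "\<And>Z i j p q. is_cone A Q X g Z i j p q \<Longrightarrow> is_complex A Z \<Longrightarrow> contractible B (map_complex F Z)"
      by (rule resolution[OF X]) (rule that, assumption+)
    obtain Z v w i j p q where Z: "is_cone A Q X g Z i j p q" "is_complex A Z" "bounded_above A Z"
      "(Q, X, Z, htpy_arrow A Q X g, v, w) \<in> Tri A.K"
      by (rule cone_triangle[OF Q(1) X(1) Q(4) Q(2) X(2)]) (rule that, assumption+)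
    have "htpy_arrow A Q X g \<in> Hom ?T Q X"
      using Q(4) by (simp add: fs A.K_simps) (simp add: htpy_shift_cat_def)
    moreover have "Z \<in> ?N" using Z Q(5)[OF Z(1,2)] by (simp add: F_split_acyclic_def ObT)
    moreover have "(Q, X, Z, htpy_arrow A Q X g, v, w) \<in> Tri ?T"
      using Z Q X by (simp add: fs bounded_def)
    ultimately have "htpy_arrow A Q X g \<in> cone_in ?T ?N Q X" unfolding cone_in_def by blast
    moreover have "Q \<in> projectives" using Q(1-3) by (simp add: projectives_def)
    ultimately show "\<exists>Q\<in>projectives. \<exists>s. s \<in> cone_in ?T ?N Q X" by blast
  qed
qed

text \<open>The two sets of objects differ by the condition of being a complex. This holds for all
  objects of the homotopy category and, by the typing of distinguished triangles, for all their
  vertices.\<close>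

lemma full_subcat_projectives:
  "full_subcat (homotopy_category_minus A) projectives = homotopy_category_minus_proj A B L"
proof -
  have "full_subcat A.K projectives = full_subcat A.K {X. bounded_above A X \<and> (\<forall>n. proj (obj X n))}"
  proof (rule tri_cat.equality)
    have "X \<in> Ob A.K \<and> Y \<in> Ob A.K \<and> Z \<in> Ob A.K" if "(X, Y, Z, u, v, w) \<in> Tri A.K" for X Y Z u v w
      using pretriangulated.Tri_exact[OF A.pretriangulated_K that]
      unfolding shifted_category.exact_triangle_def[OF A.shifted_category_K]
        shifted_category.tri_typed_def[OF A.shifted_category_K]
      by (auto simp: category.typed_def[OF A.category_K])
    then show "Tri (full_subcat A.K projectives) = Tri (full_subcat A.K {X. bounded_above A X \<and> (\<forall>n. proj (obj X n))})"
      by (auto simp: full_subcat_simps projectives_def A.K_simps(1))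
    show "Ob (full_subcat A.K projectives) = Ob (full_subcat A.K {X. bounded_above A X \<and> (\<forall>n. proj (obj X n))})"
      by (auto simp: full_subcat_simps projectives_def A.K_simps(1))
  qed (simp_all add: full_subcat_simps)
  moreover have "full_subcat (homotopy_category_minus A) projectives = full_subcat A.K projectives"
    unfolding homotopy_category_minus_def
    by (rule full_subcat_full_subcat) (auto simp: projectives_def)
  ultimately show ?thesis by (simp add: homotopy_category_minus_proj_def)
qed

lemma derived_equivalent_projectives:
  "triangle_equivalent (derived_F_minus A B F) (homotopy_category_minus_proj A B L)"
  using colocalization.triangle_equivalent_colocal[OF colocalization_K_minus]
  by (simp add: derived_F_minus_def full_subcat_projectives)

end

theorem theorem5p8:
  fixes A :: "('a, 'm) ab_cat" and B :: "('b, 'n) ab_cat"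
    and F :: "('a, 'm, 'b, 'n) func"
    and L :: "('b, 'n, 'a, 'm) func" and R :: "('b, 'n, 'a, 'm) func"
  assumes "abelian_category A" and "abelian_category B"
    and "additive_functor A B F" and "faithful_functor A B F"
    and "adjunction B A L F" and "adjunction A B F R"
    and "{X. F_projective A B L X} = {X. F_injective A B R X}"
  shows "triangle_equivalent (derived_F_minus A B F) (homotopy_category_minus_proj A B L)"
  using assms by (intro relative_setting.derived_equivalent_projectives relative_setting.intro relative_setting_axioms.intro)

end
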